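(* Let $M$ be a Hadamard manifold, $f:M\to(-\infty,+\infty]$ a convex function, $Q\subseteq\mathrm{int}\,\mathcal D(f)$ a nonempty closed convex set, and $V:Q\to TM$ a continuous (single-valued) vector field on $Q$. Then: (i) $\mathrm{MVIP}(V,f,Q)\neq\emptyset$ provided that $Q$ is compact, or that there exists a compact subset $L\subseteq M$ such that for every $x\in Q\setminus L$ and every $v\in\partial f(x)$ there exists $y\in Q\cap L$ with $\langle V(x)+v,\dot\gamma_{xy}(0)\rangle<0$, where $\gamma_{xy}$ is the geodesic from $x$ to $y$. (ii) If $V+\partial f$ is monotone on $Q$ and $\mathrm{MVIP}(V,f,Q)\neq\emptyset$, then $\mathrm{MVIP}(V,f,Q)$ is convex.
   Context: A Hadamard manifold is a complete simply connected finite-dimensional Riemannian manifold with nonpositive sectional curvatures; any two points $x,y$ are joined by a unique geodesic $\gamma_{xy}:[0,1]\to M$, $\gamma_{xy}(0)=x$, $\gamma_{xy}(1)=y$, and it is minimal. A set is convex if it contains the geodesic joining any two of its points. For $f:M\to(-\infty,+\infty]$, $\mathcal D(f):=\{x:f(x)\ne+\infty\}$. A proper $f$ with convex domain is convex if $f(\gamma_{xy}(t))\le(1-t)f(x)+tf(y)$ for all $x,y\in\mathcal D(f)$, $t\in(0,1)$. For such $f$ and $x\in\mathcal D(f)$, $f'(x;u):=\lim_{t\to0^+}\frac{f(\exp_x tu)-f(x)}{t}$ and $\partial f(x):=\{v\in T_xM:\langle v,u\rangle\le f'(x;u)\ \forall u\in T_xM\}$. $\mathrm{MVIP}(V,f,Q)$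 is the set of $\bar x\in Q$ such that $\langle V(\bar x),\dot\gamma_{\bar xy}(0)\rangle+f(y)-f(\bar x)\ge0$ for all $y\in Q$. $V+\partial f$ is the set-valued vector field $x\mapsto V(x)+\partial f(x)$ on $Q$; a set-valued vector field $A$ is monotone on $Q$ if $\langle v_x,\dot\gamma_{xy}(0)\rangle-\langle v_y,\dot\gamma_{xy}(1)\rangle\le0$ for all $x,y\in Q$, $v_x\in A(x)$, $v_y\in A(y)$. *)

theory Defs
  imports "HOL-Analysis.Analysis"
begin

section \<open>Smooth maps between open subsets of Euclidean spaces\<close>

primrec Ck_on :: "nat \<Rightarrow> 'a::euclidean_space set \<Rightarrow> ('a \<Rightarrow> 'b::real_normed_vector) \<Rightarrow> bool" where
  "Ck_on 0 S F \<longleftrightarrow> continuous_on S F"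
| "Ck_on (Suc k) S F \<longleftrightarrow> (\<forall>p\<in>S. F differentiable (at p)) \<and>
     (\<forall>v. Ck_on k S (\<lambda>p. frechet_derivative F (at p) v))"

definition smooth_on :: "'a::euclidean_space set \<Rightarrow> ('a \<Rightarrow> 'b::real_normed_vector) \<Rightarrow> bool" where
  "smooth_on S F \<longleftrightarrow> (\<forall>k. Ck_on k S F)"


section \<open>Smooth manifolds and tangent vectors\<close>

text \<open>
  The underlying set of a manifold is the universe of a Hausdorff, second countable type \<open>'m\<close>;
  charts take values in the Euclidean space \<open>'e\<close>, so the dimension is \<open>DIM('e)\<close>.
  A chart is a pair of its domain and its coordinate map; the values of the coordinate map
  outside the domain are irrelevant.

  The tangent space at \<open>x\<close> is represented by \<open>'e\<close> itself: a vector of type \<open>'e\<close>, regarded as a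
  tangent vector at \<open>x\<close>, is the tuple of components of that tangent vector in the chart
  \<open>chart_at M x\<close>, a chart around \<open>x\<close> chosen once and for all. The components of the same
  tangent vector in any other chart \<open>c\<close> around \<open>x\<close> are given by \<open>to_chart M c x\<close>. The choice of
  \<open>chart_at M x\<close> need not depend continuously on \<open>x\<close>, so that continuity and smoothness of
  fields have to be expressed in charts. In the record below, \<open>metric M x\<close> is accordingly
  the inner product on the tangent space at \<open>x\<close>.
\<close>

type_synonym ('m, 'e) chart = "'m set \<times> ('m \<Rightarrow> 'e)"

record ('m, 'e) riemannian =
  atlas :: "('m, 'e) chart set"
  metric :: "'m \<Rightarrow> 'e \<Rightarrow> 'e \<Rightarrow> real"

definition chart_inv :: "('m, 'e) chart \<Rightarrow> 'e \<Rightarrow> 'm" where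
  "chart_inv c = inv_into (fst c) (snd c)"

definition is_chart :: "('m::topological_space, 'e::euclidean_space) chart \<Rightarrow> bool" where
  "is_chart c \<longleftrightarrow> open (fst c) \<and> open (snd c ` fst c) \<and>
     homeomorphism (fst c) (snd c ` fst c) (snd c) (chart_inv c)"

definition smooth_atlas ::
  "('m::topological_space, 'e::euclidean_space) chart set \<Rightarrow> bool" where
  "smooth_atlas A \<longleftrightarrow> (\<forall>c\<in>A. is_chart c) \<and> (\<Union>c\<in>A. fst c) = UNIV \<and>
     (\<forall>c\<in>A. \<forall>d\<in>A. smooth_on (snd c ` (fst c \<inter> fst d)) (snd d \<circ> chart_inv c))"

definition chart_at :: "('m, 'e) riemannian \<Rightarrow> 'm \<Rightarrow> ('m, 'e) chart" where
  "chart_at M x = (SOME c. c \<in> atlas M \<and> x \<in> fst c)"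

definition to_chart ::
  "('m, 'e::euclidean_space) riemannian \<Rightarrow> ('m, 'e) chart \<Rightarrow> 'm \<Rightarrow> 'e \<Rightarrow> 'e" where
  "to_chart M c x =
     frechet_derivative (snd c \<circ> chart_inv (chart_at M x)) (at (snd (chart_at M x) x))"

definition from_chart ::
  "('m, 'e::euclidean_space) riemannian \<Rightarrow> ('m, 'e) chart \<Rightarrow> 'm \<Rightarrow> 'e \<Rightarrow> 'e" where
  "from_chart M c x =
     frechet_derivative (snd (chart_at M x) \<circ> chart_inv c) (at (snd c x))"

definition continuous_vector_field_on ::
  "('m::topological_space, 'e::euclidean_space) riemannian \<Rightarrow> 'm set \<Rightarrow> ('m \<Rightarrow> 'e) \<Rightarrow> bool" where
  "continuous_vector_field_on M Q V \<longleftrightarrow>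
     (\<forall>c\<in>atlas M. continuous_on (Q \<inter> fst c) (\<lambda>x. to_chart M c x (V x)))"


section \<open>Riemannian metrics, geodesics and curvature\<close>

definition local_metric ::
  "('m, 'e::euclidean_space) riemannian \<Rightarrow> ('m, 'e) chart \<Rightarrow> 'e \<Rightarrow> 'e \<Rightarrow> 'e \<Rightarrow> real" where
  "local_metric M c p u v =
     metric M (chart_inv c p) (from_chart M c (chart_inv c p) u) (from_chart M c (chart_inv c p) v)"

definition riemannian_manifold ::
  "('m::{t2_space,second_countable_topology}, 'e::euclidean_space) riemannian \<Rightarrow> bool" where
  "riemannian_manifold M \<longleftrightarrow> smooth_atlas (atlas M) \<and>
     (\<forall>x. bilinear (metric M x) \<and> (\<forall>u v. metric M x u v = metric M x v u) \<and>
          (\<forall>u. u \<noteq> 0 \<longrightarrow> metric M x u u > 0)) \<and>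
     (\<forall>c\<in>atlas M. \<forall>u v. smooth_on (snd c ` fst c) (\<lambda>p. local_metric M c p u v))"

text \<open>
  \<open>christoffel M c p u v\<close> is the vector with components \<open>\<Gamma>\<^sup>k\<^sub>i\<^sub>j u\<^sup>i v\<^sup>j\<close>, i.e. the
  covariant derivative along \<open>u\<close> of the field with constant components \<open>v\<close> in the chart \<open>c\<close>,
  as determined by the Koszul formula.
\<close>

definition christoffel ::
  "('m, 'e::euclidean_space) riemannian \<Rightarrow> ('m, 'e) chart \<Rightarrow> 'e \<Rightarrow> 'e \<Rightarrow> 'e \<Rightarrow> 'e" where
  "christoffel M c p u v = (THE w. \<forall>z. 2 * local_metric M c p w z =
       frechet_derivative (\<lambda>q. local_metric M c q v z) (at p) u
     + frechet_derivative (\<lambda>q. local_metric M c q u z) (at p) v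
     - frechet_derivative (\<lambda>q. local_metric M c q u v) (at p) z)"

text \<open>
  In each chart \<open>c\<close>, with \<open>s'\<close> denoting the derivative of the local expression of the curve,
  the geodesic equation is required in the form \<open>s'' + \<Gamma>(s', s') = 0\<close>. Derivatives at end points
  of the interval \<open>I\<close> are one-sided.
\<close>

definition geodesic_on ::
  "('m::topological_space, 'e::euclidean_space) riemannian \<Rightarrow> real set \<Rightarrow> (real \<Rightarrow> 'm) \<Rightarrow> bool" where
  "geodesic_on M I \<gamma> \<longleftrightarrow> continuous_on I \<gamma> \<and>
     (\<forall>c\<in>atlas M. \<exists>s'. \<forall>t\<in>I. \<gamma> t \<in> fst c \<longrightarrow>
        ((\<lambda>r. snd c (\<gamma> r)) has_vector_derivative s' t) (at t within I) \<and>
        (s' has_vector_derivative - christoffel M c (snd c (\<gamma> t)) (s' t) (s' t)) (at t within I))"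

definition velocity ::
  "('m, 'e::euclidean_space) riemannian \<Rightarrow> real set \<Rightarrow> (real \<Rightarrow> 'm) \<Rightarrow> real \<Rightarrow> 'e" where
  "velocity M I \<gamma> t = vector_derivative (\<lambda>r. snd (chart_at M (\<gamma> t)) (\<gamma> r)) (at t within I)"

text \<open>The curvature tensor is \<open>R(u,v)w = \<nabla>\<^sub>u\<nabla>\<^sub>v w - \<nabla>\<^sub>v\<nabla>\<^sub>u w\<close>
  for fields with constant components in the chart \<open>c\<close>.\<close>

definition local_curvature ::
  "('m, 'e::euclidean_space) riemannian \<Rightarrow> ('m, 'e) chart \<Rightarrow> 'e \<Rightarrow> 'e \<Rightarrow> 'e \<Rightarrow> 'e \<Rightarrow> 'e" where
  "local_curvature M c p u v w =
       frechet_derivative (\<lambda>q. christoffel M c q v w) (at p) u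
     - frechet_derivative (\<lambda>q. christoffel M c q u w) (at p) v
     + christoffel M c p u (christoffel M c p v w)
     - christoffel M c p v (christoffel M c p u w)"

definition sectional_curvature ::
  "('m, 'e::euclidean_space) riemannian \<Rightarrow> 'm \<Rightarrow> 'e \<Rightarrow> 'e \<Rightarrow> real" where
  "sectional_curvature M x u v =
     metric M x (local_curvature M (chart_at M x) (snd (chart_at M x) x) u v v) u
       / (metric M x u u * metric M x v v - (metric M x u v)\<^sup>2)"

definition complete_riemannian ::
  "('m::topological_space, 'e::euclidean_space) riemannian \<Rightarrow> bool" where
  "complete_riemannian M \<longleftrightarrow>
     (\<forall>x u. \<exists>\<gamma>. geodesic_on M UNIV \<gamma> \<and> \<gamma> 0 = x \<and> velocity M UNIV \<gamma> 0 = u)"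

text \<open>Two vectors span a plane iff they are distinct and form an independent set.
  The library's \<open>simply_connected\<close> includes path-connectedness.\<close>

definition hadamard_manifold ::
  "('m::{t2_space,second_countable_topology}, 'e::euclidean_space) riemannian \<Rightarrow> bool" where
  "hadamard_manifold M \<longleftrightarrow> riemannian_manifold M \<and> complete_riemannian M \<and>
     simply_connected (UNIV :: 'm set) \<and>
     (\<forall>x u v. u \<noteq> v \<and> independent {u, v} \<longrightarrow> sectional_curvature M x u v \<le> 0)"

definition riem_exp ::
  "('m::topological_space, 'e::euclidean_space) riemannian \<Rightarrow> 'm \<Rightarrow> 'e \<Rightarrow> 'm" where
  "riem_exp M x u =
     (THE \<gamma>. geodesic_on M UNIV \<gamma> \<and> \<gamma> 0 = x \<and> velocity M UNIV \<gamma> 0 = u) 1"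

text \<open>The geodesic \<open>[0,1] \<rightarrow> M\<close> from \<open>x\<close> to \<open>y\<close>; membership in \<open>extensional {0..1}\<close>
  makes it unique as a function on all of \<open>real\<close>.\<close>

definition geod ::
  "('m::topological_space, 'e::euclidean_space) riemannian \<Rightarrow> 'm \<Rightarrow> 'm \<Rightarrow> real \<Rightarrow> 'm" where
  "geod M x y =
     (THE \<gamma>. \<gamma> \<in> extensional {0..1} \<and> geodesic_on M {0..1} \<gamma> \<and> \<gamma> 0 = x \<and> \<gamma> 1 = y)"

definition geod_velocity ::
  "('m::topological_space, 'e::euclidean_space) riemannian \<Rightarrow> 'm \<Rightarrow> 'm \<Rightarrow> real \<Rightarrow> 'e" where
  "geod_velocity M x y = velocity M {0..1} (geod M x y)"


section \<open>Convex analysis on a Hadamard manifold\<close>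

definition geod_convex ::
  "('m::topological_space, 'e::euclidean_space) riemannian \<Rightarrow> 'm set \<Rightarrow> bool" where
  "geod_convex M S \<longleftrightarrow> (\<forall>x\<in>S. \<forall>y\<in>S. geod M x y ` {0..1} \<subseteq> S)"

definition eff_dom :: "('m \<Rightarrow> ereal) \<Rightarrow> 'm set" where
  "eff_dom f = {x. f x \<noteq> \<infinity>}"

definition geod_convex_fun ::
  "('m::topological_space, 'e::euclidean_space) riemannian \<Rightarrow> ('m \<Rightarrow> ereal) \<Rightarrow> bool" where
  "geod_convex_fun M f \<longleftrightarrow>
     (\<forall>x. f x \<noteq> - \<infinity>) \<and> eff_dom f \<noteq> {} \<and> geod_convex M (eff_dom f) \<and>
     (\<forall>x\<in>eff_dom f. \<forall>y\<in>eff_dom f. \<forall>t\<in>{0<..<1}.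
        f (geod M x y t) \<le> ereal (1 - t) * f x + ereal t * f y)"

definition dir_deriv ::
  "('m::topological_space, 'e::euclidean_space) riemannian \<Rightarrow> ('m \<Rightarrow> ereal) \<Rightarrow> 'm \<Rightarrow> 'e \<Rightarrow> ereal" where
  "dir_deriv M f x u =
     Lim (at_right 0) (\<lambda>t. (f (riem_exp M x (t *\<^sub>R u)) - f x) / ereal t)"

text \<open>Meaningful for \<open>x \<in> eff_dom f\<close> only, like \<open>dir_deriv\<close>.\<close>

definition subdiff ::
  "('m::topological_space, 'e::euclidean_space) riemannian \<Rightarrow> ('m \<Rightarrow> ereal) \<Rightarrow> 'm \<Rightarrow> 'e set" where
  "subdiff M f x = {v. \<forall>u. ereal (metric M x v u) \<le> dir_deriv M f x u}"

definition MVIP ::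
  "('m::topological_space, 'e::euclidean_space) riemannian \<Rightarrow> ('m \<Rightarrow> 'e) \<Rightarrow> ('m \<Rightarrow> ereal) \<Rightarrow>
     'm set \<Rightarrow> 'm set" where
  "MVIP M V f Q =
     {x\<in>Q. \<forall>y\<in>Q. ereal (metric M x (V x) (geod_velocity M x y 0)) + f y - f x \<ge> 0}"

definition monotone_field_on ::
  "('m::topological_space, 'e::euclidean_space) riemannian \<Rightarrow> 'm set \<Rightarrow> ('m \<Rightarrow> 'e set) \<Rightarrow> bool" where
  "monotone_field_on M Q A \<longleftrightarrow>
     (\<forall>x\<in>Q. \<forall>y\<in>Q. \<forall>v\<in>A x. \<forall>w\<in>A y.
        metric M x v (geod_velocity M x y 0) - metric M y w (geod_velocity M x y 1) \<le> 0)"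

end

theory Submission
  imports Defs
begin

text \<open>
  By Cartan--Hadamard, \<open>riem_exp M x\<close> is a homeomorphism. Jacobi fields are obtained here as
  limits of difference quotients of geodesics; nonpositive curvature makes the exponential map
  expanding, so by invariance of domain it is a local homeomorphism through which Lipschitz curves
  lift, hence a covering, which is injective since the manifold is simply connected. The expansion
  property is also the law of cosines, from which the CN inequality and the contraction property of
  nearest points follow for the distance \<^emph>\<open>defined\<close> as the length of the geodesic between two points.

  For compact \<open>Q\<close> the map taking \<open>w\<close> to the minimizer over \<open>Q\<close> of \<open>f\<close> plus
  half the squared distance to \<open>exp\<^sub>w(- V w)\<close> is continuous and, by Brouwer, has a fixed point;
  the first variation of the distance shows that fixed points are solutions. In the coercive case
  one solves the inequality on \<open>Q\<close> intersected with a large ball. Separating two convex cones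
  in the tangent space at the solution gives a subgradient to which coercivity applies, so the
  solution is interior to the ball, and convexity of \<open>f\<close> makes it a solution on \<open>Q\<close>.

  For (ii), let \<open>z\<close> lie on the geodesic between two solutions and let \<open>w\<close> solve the
  inequality for the field \<open>V(w) - exp\<^sub>w\<^sup>-\<^sup>1 z\<close>. Monotonicity makes the angles at \<open>w\<close> between
  \<open>z\<close> and the two solutions obtuse, and the CN inequality forces \<open>w = z\<close>.
\<close>

section \<open>Ordinary differential equations\<close>

text \<open>For a fixed tangent vector u at x, the pairing of u with \<open>lg x y\<close> is in
  general not convex in y along geodesics. So the sets that a KKM argument would use for existence,
  or a Minty argument for (ii), need not be convex; this is why a fixed point and a regularized
  inequality appear instead. Brouwer's theorem in turn wants a convex subset of a vector space,
  while Q is convex only along geodesics; the nearest point map extends a self-map of Q to a ball of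
  a tangent space. The differential of the exponential map is never formed. Difference quotients are
  taken along sequences of pairs of velocities that tend to one vector, which yields the two-point
  estimate behind local injectivity and the Lipschitz bound for lifts. Components of tangent vectors
  refer to charts that may jump from point to point, so every limit of vectors is read in one fixed
  chart. Q may have empty interior and f need not be differentiable. Tangent directions of Q are
  therefore given by sequences inside Q, and limits along them are controlled by the Lipschitz
  continuity of f near interior points of its domain.\<close>

text \<open>The supremum of the times up to which \<open>P\<close> holds is itself reached by
  \<open>left\<close> and, unless it is \<open>b\<close>, passed by \<open>right\<close>. This takes
  the place of cutting a curve into finitely many pieces inside charts.\<close>

lemma real_induction [consumes 1, case_names start left right]:
  fixes a b t :: real
  assumes "t \<in> {a..b}" and start: "P a"
    and left: "\<And>t. a < t \<Longrightarrow> t \<le> b \<Longrightarrow> (\<And>s. a \<le> s \<Longrightarrow> s < t \<Longrightarrow> P s) \<Longrightarrow> P t"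
    and right: "\<And>t. a \<le> t \<Longrightarrow> t < b \<Longrightarrow> (\<And>s. a \<le> s \<Longrightarrow> s \<le> t \<Longrightarrow> P s) \<Longrightarrow>
      \<exists>\<epsilon>>0. \<forall>s. t < s \<and> s < t + \<epsilon> \<and> s \<le> b \<longrightarrow> P s"
  shows "P t"
proof -
  define S where "S = {\<tau>. a \<le> \<tau> \<and> \<tau> \<le> b \<and> (\<forall>s. a \<le> s \<and> s \<le> \<tau> \<longrightarrow> P s)}"
  define m where "m = Sup S"
  have "P s" if "a \<le> s" "s \<le> a" for s using that start by (simp add: antisym)
  moreover have "a \<le> b" using assms(1) by simp
  ultimately have aS: "a \<in> S" unfolding S_def by blast
  have bdd: "bdd_above S" unfolding S_def bdd_above_def by auto
  have am: "a \<le> m" using cSup_upper[OF aS bdd] by (simp add: m_def)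
  have mb: "m \<le> b" unfolding m_def by (rule cSup_least) (use aS in blast, simp add: S_def)
  have below: "P s" if "a \<le> s" "s < m" for s
  proof -
    obtain \<tau> where "\<tau> \<in> S" "s < \<tau>" using less_cSup_iff[of S s] aS bdd \<open>s < m\<close> by (auto simp: m_def)
    then show ?thesis using that by (auto simp: S_def)
  qed
  have Pm: "P m"
    using left[of m] below am mb start by (cases "a = m") auto
  have all: "P s" if "a \<le> s" "s \<le> m" for s using below Pm that by (cases "s = m") auto
  have "m = b"
  proof (rule ccontr)
    assume "m \<noteq> b"
    then have "m < b" using mb by simp
    obtain \<epsilon> where e: "\<epsilon> > 0" "\<forall>s. m < s \<and> s < m + \<epsilon> \<and> s \<le> b \<longrightarrow> P s"
      using right[OF am \<open>m < b\<close>] all by blast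
    define \<tau> where "\<tau> = min b (m + \<epsilon> / 2)"
    have t: "m < \<tau>" "\<tau> < m + \<epsilon>" "\<tau> \<le> b" using e \<open>m < b\<close> by (auto simp: \<tau>_def)
    have "\<tau> \<in> S" unfolding S_def
    proof (intro CollectI conjI allI impI)
      fix s assume "a \<le> s \<and> s \<le> \<tau>"
      then show "P s" using all[of s] e(2) t by (cases "s \<le> m") auto
    qed (use t am in auto)
    then have "\<tau> \<le> m" using cSup_upper bdd by (simp add: m_def)
    then show False using t by simp
  qed
  then show ?thesis using all assms(1) by auto
qed

lemma deriv_nonneg_mono:
  fixes f :: "real \<Rightarrow> real"
  assumes "a \<le> b" "\<And>t. t \<in> {a..b} \<Longrightarrow> (f has_real_derivative f' t) (at t within {a..b})"
    and "\<And>t. a < t \<Longrightarrow> t < b \<Longrightarrow> 0 \<le> f' t"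
  shows "f a \<le> f b"
proof (rule DERIV_nonneg_imp_increasing_open[OF assms(1)])
  show "continuous_on {a..b} f"
    using assms(2) by (meson DERIV_continuous continuous_on_eq_continuous_within)
  fix x assume "a < x" "x < b"
  then show "\<exists>y. DERIV f x :> y \<and> 0 \<le> y"
    using assms(2)[of x] assms(3)[of x] by (auto simp: at_within_Icc_at)
qed

text \<open>The squared norm is differentiated because the norm is not differentiable at 0. Its
  derivative is at most \<open>2 * L * |e|^2 + 2 * \<epsilon> * |e|\<close>, and splitting the last
  product as a sum of two squares gives the rate \<open>2 * L + 1\<close>.\<close>

lemma gronwall_sq:
  fixes e :: "real \<Rightarrow> 'a::real_inner"
  assumes e: "\<And>t. t \<in> {a..b} \<Longrightarrow> (e has_vector_derivative e' t) (at t within {a..b})"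
    and bnd: "\<And>t. t \<in> {a..b} \<Longrightarrow> norm (e' t) \<le> L * norm (e t) + \<epsilon>"
    and L: "0 \<le> L" and \<epsilon>: "0 \<le> \<epsilon>" and t: "t \<in> {a..b}"
  shows "(norm (e t))\<^sup>2 \<le> ((norm (e a))\<^sup>2 + \<epsilon>\<^sup>2 * (t - a)) * exp ((2 * L + 1) * (t - a))"
proof -
  define k where "k = 2 * L + 1"
  define \<phi> where "\<phi> = (\<lambda>s. \<epsilon>\<^sup>2 * (s - a) - (e s \<bullet> e s) * exp (- k * (s - a)))"
  have "\<phi> a \<le> \<phi> t"
  proof (rule deriv_nonneg_mono[of a t \<phi> "\<lambda>s. \<epsilon>\<^sup>2 - ((2 * (e s \<bullet> e' s)) * exp (- k * (s - a)) + (e s \<bullet> e s) *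
    (exp (- k * (s - a)) * (- k)))"])
    show "a \<le> t" using t by simp
    fix s assume s: "s \<in> {a..t}"
    have "(e has_vector_derivative e' s) (at s within {a..t})"
      using e[of s] s t by (auto intro: has_vector_derivative_within_subset)
    note d = this[unfolded has_vector_derivative_def]
    have "((\<lambda>s. e s \<bullet> e s) has_derivative (\<lambda>h. h * (2 * (e s \<bullet> e' s)))) (at s within {a..t})"
      by (rule has_derivative_eq_rhs[OF has_derivative_inner[OF d d]])
        (auto simp: inner_commute algebra_simps fun_eq_iff)
    then have *: "((\<lambda>s. e s \<bullet> e s) has_real_derivative (2 * (e s \<bullet> e' s))) (at s within {a..t})"
      by (simp add: has_field_derivative_def mult.commute[of _ "2 * _"])
    show "(\<phi> has_real_derivative \<epsilon>\<^sup>2 - ((2 * (e s \<bullet> e' s)) * exp (- k * (s - a)) + (e s \<bullet> e s) * (exp (- k *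
      (s - a)) * (- k)))) (at s within {a..t})"
      unfolding \<phi>_def by (auto intro!: derivative_eq_intros *)
  next
    fix s assume s: "a < s" "s < t"
    have "2 * (e s \<bullet> e' s) \<le> 2 * (norm (e s) * norm (e' s))"
      using Cauchy_Schwarz_ineq2[of "e s" "e' s"] by linarith
    also have "\<dots> \<le> 2 * (norm (e s) * (L * norm (e s) + \<epsilon>))"
      using bnd[of s] s t by (intro mult_left_mono) auto
    also have "\<dots> \<le> k * (norm (e s))\<^sup>2 + \<epsilon>\<^sup>2"
      using sum_squares_bound[of "norm (e s)" \<epsilon>] by (simp add: k_def algebra_simps power2_eq_square)
    finally have 1: "2 * (e s \<bullet> e' s) - k * (e s \<bullet> e s) \<le> \<epsilon>\<^sup>2" by (simp add: power2_norm_eq_inner)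
    have ex: "exp (- k * (s - a)) \<le> 1" using s L by (simp add: k_def mult_nonpos_nonneg)
    have "(2 * (e s \<bullet> e' s) - k * (e s \<bullet> e s)) * exp (- k * (s - a)) \<le> \<epsilon>\<^sup>2 * exp (- k * (s - a))"
      using 1 by (intro mult_right_mono) auto
    also have "\<dots> \<le> \<epsilon>\<^sup>2" using ex by (simp add: mult_left_le)
    finally show "0 \<le> \<epsilon>\<^sup>2 - ((2 * (e s \<bullet> e' s)) * exp (- k * (s - a)) + (e s \<bullet> e s) * (exp (- k * (s - a)) *
      (- k)))"
      by (simp add: algebra_simps)
  qed
  then have "(e t \<bullet> e t) * exp (- k * (t - a)) \<le> (norm (e a))\<^sup>2 + \<epsilon>\<^sup>2 * (t - a)"
    by (simp add: \<phi>_def power2_norm_eq_inner)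
  then have "(e t \<bullet> e t) * exp (- k * (t - a)) * exp (k * (t - a)) \<le>
    ((norm (e a))\<^sup>2 + \<epsilon>\<^sup>2 * (t - a)) * exp (k * (t - a))"
    by (intro mult_right_mono) auto
  moreover have "(e t \<bullet> e t) * exp (- k * (t - a)) * exp (k * (t - a)) = (norm (e t))\<^sup>2"
    by (simp add: power2_norm_eq_inner mult.assoc flip: exp_add)
  ultimately show ?thesis by (simp only: k_def)
qed

lemma gronwall:
  fixes e :: "real \<Rightarrow> 'a::real_inner"
  assumes e: "\<And>t. t \<in> {a..b} \<Longrightarrow> (e has_vector_derivative e' t) (at t within {a..b})"
    and bnd: "\<And>t. t \<in> {a..b} \<Longrightarrow> norm (e' t) \<le> L * norm (e t)"
    and L: "0 \<le> L" and t: "t \<in> {a..b}"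
  shows "norm (e t) \<le> exp ((L + 1) * (t - a)) * norm (e a)"
proof -
  have "(norm (e t))\<^sup>2 \<le> (norm (e a))\<^sup>2 * exp ((2 * L + 1) * (t - a))"
    using gronwall_sq[OF e _ L order_refl t] bnd by simp
  \<comment> \<open>The rate is rounded up to an even multiple so that the square root can be
    taken.\<close>
  also have "\<dots> \<le> (norm (e a))\<^sup>2 * exp (2 * ((L + 1) * (t - a)))"
    using t by (intro mult_left_mono) (auto simp: algebra_simps)
  also have "\<dots> = (exp ((L + 1) * (t - a)) * norm (e a))\<^sup>2"
    by (simp add: power_mult_distrib exp_double)
  finally show ?thesis by (rule power2_le_imp_le) auto
qed

definition C1_on :: "'a::euclidean_space set \<Rightarrow> ('a \<Rightarrow> 'b::euclidean_space) \<Rightarrow> ('a \<Rightarrow> 'a \<Rightarrow>\<^sub>L 'b) \<Rightarrow> bool" where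
  "C1_on S F F' \<longleftrightarrow> open S \<and> (\<forall>x\<in>S. (F has_derivative blinfun_apply (F' x)) (at x)) \<and> continuous_on S F'"

text \<open>Strict differentiability, uniform over \<open>K\<close>: both points vary while the
  derivative is frozen at the centre. It comes from uniform continuity of the derivative on a
  compact neighbourhood of \<open>K\<close>.\<close>

lemma C1_on_uniform:
  assumes F: "C1_on S F F'" and K: "compact K" "K \<subseteq> S" and \<eta>: "0 < \<eta>"
  shows "\<exists>\<delta>>0. \<forall>y\<in>K. cball y \<delta> \<subseteq> S \<and> (\<forall>p\<in>cball y \<delta>. \<forall>q\<in>cball y \<delta>.
    norm (F p - F q - F' y (p - q)) \<le> \<eta> * norm (p - q))"
proof (cases "K = {}")
  case False
  have "open S" using F by (simp add: C1_on_def)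
  then obtain e where e: "e > 0" "(\<Union>x\<in>K. cball x e) \<subseteq> S"
    using compact_subset_open_imp_cball_epsilon_subset[OF K(1) _ K(2)] by blast
  define K' where "K' = (\<Union>x\<in>K. cball x e)"
  have "K' = {x + y | x y. x \<in> K \<and> y \<in> cball 0 e}"
  proof -
    have "z \<in> K'" if "z = x + y" "x \<in> K" "y \<in> cball 0 e" for x y z
      using that by (auto simp: K'_def dist_norm intro!: bexI[of _ x])
    moreover have "\<exists>x y. z = x + y \<and> x \<in> K \<and> y \<in> cball 0 e" if z: "z \<in> K'" for z
    proof -
      obtain x where "x \<in> K" "dist x z \<le> e" using z by (auto simp: K'_def)
      then show ?thesis by (intro exI[of _ x] exI[of _ "z - x"]) (auto simp: dist_norm norm_minus_commute)
    qed
    ultimately show ?thesis by blast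
  qed
  then have "compact K'" using compact_sums[OF K(1) compact_cball[of 0 e]] by simp
  moreover have "continuous_on K' F'"
    using F e(2) continuous_on_subset by (auto simp: C1_on_def K'_def)
  ultimately have "uniformly_continuous_on K' F'" by (rule compact_uniformly_continuous[rotated])
  then obtain d where d: "d > 0" "\<And>x x'. x \<in> K' \<Longrightarrow> x' \<in> K' \<Longrightarrow> dist x' x < d \<Longrightarrow> dist (F' x') (F' x) < \<eta>"
    using \<eta> unfolding uniformly_continuous_on_def by meson
  define \<delta> where "\<delta> = min e (d / 2)"
  have dd: "\<delta> > 0" "\<delta> \<le> e" "\<delta> < d" using e d by (auto simp: \<delta>_def)
  show ?thesis
  proof (intro exI[of _ \<delta>] conjI ballI)
    fix y assume y: "y \<in> K"
    have "cball y \<delta> \<subseteq> cball y e" using dd by (simp add: subset_cball)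
    then show sub: "cball y \<delta> \<subseteq> S" using e(2) y by blast
    fix p q assume p: "p \<in> cball y \<delta>" and q: "q \<in> cball y \<delta>"
    have "norm (F p - F q - F' y (p - q)) \<le> norm (p - q) * \<eta>"
    proof (rule differentiable_bound_linearization[where S = "cball y \<delta>" and f' = "\<lambda>x. blinfun_apply (F' x)"])
      fix t :: real assume t: "t \<in> {0..1}"
      have "q + t *\<^sub>R (p - q) = (1 - t) *\<^sub>R q + t *\<^sub>R p" by (simp add: algebra_simps)
      then show "q + t *\<^sub>R (p - q) \<in> cball y \<delta>"
        using t p q convex_cball[of y \<delta>] unfolding convex_alt by auto
    next
      fix x assume "x \<in> cball y \<delta>"
      then show "(F has_derivative blinfun_apply (F' x)) (at x within cball y \<delta>)"
        using F sub unfolding C1_on_def by (meson has_derivative_at_withinI subsetD)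
    next
      fix x assume x: "x \<in> cball y \<delta>"
      have "x \<in> K'" "y \<in> K'" using x y dd e unfolding K'_def by (auto intro!: bexI[of _ y])
      then have "norm (F' x - F' y) < \<eta>" using d(2)[of y x] x dd by (auto simp: dist_norm norm_minus_commute)
      then show "onorm (blinfun_apply (F' x) - blinfun_apply (F' y)) \<le> \<eta>"
        by (simp add: norm_blinfun.rep_eq minus_blinfun.rep_eq fun_diff_def)
    qed (use dd in auto)
    then show "norm (F p - F q - F' y (p - q)) \<le> \<eta> * norm (p - q)" by (simp add: mult.commute)
  qed (use dd in auto)
qed (auto intro: exI[of _ 1])

lemma norm_scaleR_inverse: "0 < r \<Longrightarrow> norm (x /\<^sub>R r) = norm x / r"
  by (simp add: divide_inverse mult.commute)

text \<open>Neither end of the difference has to be \<open>y\<close>; this is where strict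
  differentiability gives more than differentiability at \<open>y\<close>.\<close>

lemma C1_on_quotient_tendsto:
  assumes F: "C1_on S F F'" and y: "y \<in> S"
    and z: "z \<longlonglongrightarrow> y" and z': "z' \<longlonglongrightarrow> y" and r: "\<And>n. 0 < r n"
    and j: "(\<lambda>n. (z' n - z n) /\<^sub>R r n) \<longlonglongrightarrow> j"
  shows "(\<lambda>n. (F (z' n) - F (z n)) /\<^sub>R r n) \<longlonglongrightarrow> F' y j"
proof -
  obtain B where B: "\<And>n. norm ((z' n - z n) /\<^sub>R r n) \<le> B" "B > 0"
    using convergent_imp_Bseq[of "\<lambda>n. (z' n - z n) /\<^sub>R r n"] j by (auto simp: convergent_def Bseq_def)
  have "(\<lambda>n. (F (z' n) - F (z n)) /\<^sub>R r n - F' y ((z' n - z n) /\<^sub>R r n)) \<longlonglongrightarrow> 0"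
  proof (rule metric_LIMSEQ_I)
    fix e :: real assume e: "e > 0"
    obtain \<delta> where \<delta>: "\<delta> > 0" "\<forall>p\<in>cball y \<delta>. \<forall>q\<in>cball y \<delta>. norm (F p - F q - F' y (p - q)) \<le>
      e / (2 * B) * norm (p - q)"
      using C1_on_uniform[OF F, of "{y}" "e / (2 * B)"] y e B by auto
    have "\<forall>\<^sub>F n in sequentially. dist (z n) y < \<delta> \<and> dist (z' n) y < \<delta>"
      using tendstoD[OF z \<delta>(1)] tendstoD[OF z' \<delta>(1)] by (rule eventually_conj)
    then obtain N where N: "\<And>n. n \<ge> N \<Longrightarrow> dist (z n) y < \<delta> \<and> dist (z' n) y < \<delta>"
      by (auto simp: eventually_sequentially)
    show "\<exists>N. \<forall>n\<ge>N. dist ((F (z' n) - F (z n)) /\<^sub>R r n - F' y ((z' n - z n) /\<^sub>R r n)) 0 < e"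
    proof (intro exI[of _ N] allI impI)
      fix n assume "N \<le> n"
      have "(F (z' n) - F (z n)) /\<^sub>R r n - F' y ((z' n - z n) /\<^sub>R r n) =
        (F (z' n) - F (z n) - F' y (z' n - z n)) /\<^sub>R r n"
        by (simp add: blinfun.scaleR_right scaleR_diff_right blinfun.diff_right)
      then have "norm ((F (z' n) - F (z n)) /\<^sub>R r n - F' y ((z' n - z n) /\<^sub>R r n)) =
        norm (F (z' n) - F (z n) - F' y (z' n - z n)) / r n"
        using r[of n] by (simp only: norm_scaleR) (simp add: divide_inverse mult.commute)
      also have "\<dots> \<le> e / (2 * B) * norm (z' n - z n) / r n"
        using \<delta>(2) N[OF \<open>N \<le> n\<close>] r[of n] by (intro divide_right_mono) (auto simp: dist_commute)
      also have "\<dots> = e / (2 * B) * norm ((z' n - z n) /\<^sub>R r n)"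
        by (simp only: norm_scaleR_inverse[OF r] times_divide_eq_right)
      also have "\<dots> \<le> e / (2 * B) * B" using B e by (intro mult_left_mono) auto
      also have "\<dots> < e" using B e by simp
      finally show "dist ((F (z' n) - F (z n)) /\<^sub>R r n - F' y ((z' n - z n) /\<^sub>R r n)) 0 < e" by simp
    qed
  qed
  moreover have "(\<lambda>n. F' y ((z' n - z n) /\<^sub>R r n)) \<longlonglongrightarrow> F' y j"
    by (intro tendsto_intros j)
  ultimately show ?thesis using tendsto_add by fastforce
qed

lemma C1_on_lipschitz_near_curve:
  fixes y :: "real \<Rightarrow> 'a::euclidean_space"
  assumes X: "C1_on \<Omega> X X'" and y: "continuous_on {a..b} y" "y ` {a..b} \<subseteq> \<Omega>"
  obtains \<rho> L where "\<rho> > 0" "L \<ge> 0" "\<And>t. t \<in> {a..b} \<Longrightarrow> cball (y t) \<rho> \<subseteq> \<Omega>"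
    "\<And>t p q. t \<in> {a..b} \<Longrightarrow> p \<in> cball (y t) \<rho> \<Longrightarrow> q \<in> cball (y t) \<rho> \<Longrightarrow> norm (X p - X q) \<le> L * norm (p - q)"
    "\<And>t. t \<in> {a..b} \<Longrightarrow> norm (X' (y t)) \<le> L"
proof -
  define K where "K = y ` {a..b}"
  have K: "compact K" "K \<subseteq> \<Omega>" using y by (auto simp: K_def intro: compact_continuous_image)
  have "compact (X' ` K)"
    using X K by (intro compact_continuous_image) (auto simp: C1_on_def intro: continuous_on_subset)
  then obtain B where B: "\<And>x. x \<in> K \<Longrightarrow> norm (X' x) \<le> B" "B > 0"
    using compact_imp_bounded bounded_pos by (metis imageI)
  obtain \<rho> where \<rho>: "\<rho> > 0" "\<forall>y\<in>K. cball y \<rho> \<subseteq> \<Omega> \<and> (\<forall>p\<in>cball y \<rho>. \<forall>q\<in>cball y \<rho>.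
    norm (X p - X q - X' y (p - q)) \<le> 1 * norm (p - q))" using C1_on_uniform[OF X K, of 1] by auto
  show ?thesis
  proof (rule that[of \<rho> "B + 1"])
    fix t p q assume t: "t \<in> {a..b}" and p: "p \<in> cball (y t) \<rho>" and q: "q \<in> cball (y t) \<rho>"
    have yK: "y t \<in> K" using t by (auto simp: K_def)
    have "norm (X p - X q) \<le> norm (X p - X q - X' (y t) (p - q)) + norm (X' (y t) (p - q))"
      using norm_triangle_ineq[of "X p - X q - X' (y t) (p - q)" "X' (y t) (p - q)"] by simp
    also have "norm (X p - X q - X' (y t) (p - q)) \<le> norm (p - q)" using \<rho>(2) yK p q by auto
    also have "norm (X' (y t) (p - q)) \<le> B * norm (p - q)"
      using norm_blinfun[of "X' (y t)" "p - q"] B(1)[OF yK]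
          by (meson mult_right_mono norm_ge_zero order_trans)
    finally show "norm (X p - X q) \<le> (B + 1) * norm (p - q)" by (simp add: algebra_simps)
  next
    fix t assume "t \<in> {a..b}"
    then show "norm (X' (y t)) \<le> B + 1" using B(1)[of "y t"] by (simp add: K_def)
  qed (use \<rho> B K_def in auto)
qed

text \<open>The predicate \<open>D\<close> is the domain of validity of the coordinate expression \<open>z\<close> of a curve, which
  the comparison curve might leave a priori.\<close>

lemma ode_stability:
  fixes y :: "real \<Rightarrow> 'a::euclidean_space"
  assumes X: "C1_on \<Omega> X X'"
    and y: "\<And>t. t \<in> {a..b} \<Longrightarrow> (y has_vector_derivative X (y t)) (at t within {a..b})"
    and y\<Omega>: "y ` {a..b} \<subseteq> \<Omega>"
  obtains \<rho> C where "\<rho> > 0" "C > 0" "\<And>t. t \<in> {a..b} \<Longrightarrow> cball (y t) (2 * \<rho>) \<subseteq> \<Omega>"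
    "\<And>z D t. \<lbrakk>t \<in> {a..b}; C * norm (z a - y a) < \<rho>; D a;
      \<And>t. t \<in> {a..b} \<Longrightarrow> D t \<Longrightarrow> (z has_vector_derivative X (z t)) (at t within {a..b});
      \<And>t. \<lbrakk>a < t; t \<le> b; \<And>s. a \<le> s \<Longrightarrow> s < t \<Longrightarrow> D s \<and> norm (z s - y s) \<le> \<rho>\<rbrakk> \<Longrightarrow> D t;
      \<And>t. \<lbrakk>a \<le> t; t < b; D t\<rbrakk> \<Longrightarrow> \<forall>\<^sub>F s in at t within {a..b}. D s\<rbrakk>
     \<Longrightarrow> D t \<and> norm (z t - y t) \<le> C * norm (z a - y a)"
proof -
  have cy: "continuous_on {a..b} y"
    using y by (meson continuous_on_eq_continuous_within has_vector_derivative_continuous)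
  obtain r L where r: "r > 0" "L \<ge> 0" "\<And>t. t \<in> {a..b} \<Longrightarrow> cball (y t) r \<subseteq> \<Omega>"
    "\<And>t p q. t \<in> {a..b} \<Longrightarrow> p \<in> cball (y t) r \<Longrightarrow> q \<in> cball (y t) r \<Longrightarrow> norm (X p - X q) \<le> L * norm (p - q)"
    using C1_on_lipschitz_near_curve[OF X cy y\<Omega>] by metis
  \<comment> \<open>Half of the available radius, so that closed balls of radius
    \<open>2 * \<rho>\<close> still lie in \<Omega>. \<open>geodesic_stability\<close> uses this as
    a compact margin about the curve.\<close>
  define \<rho> where "\<rho> = r / 2"
  have \<rho>: "\<rho> > 0" "L \<ge> 0" "\<And>t. t \<in> {a..b} \<Longrightarrow> cball (y t) (2 * \<rho>) \<subseteq> \<Omega>"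
    "\<And>t p q. t \<in> {a..b} \<Longrightarrow> p \<in> cball (y t) \<rho> \<Longrightarrow> q \<in> cball (y t) \<rho> \<Longrightarrow> norm (X p - X q) \<le> L * norm (p - q)"
    using r by (auto simp: \<rho>_def)
  define C where "C = exp ((L + 1) * (b - a))"
  show ?thesis
  proof (rule that[of \<rho> C])
    fix z :: "real \<Rightarrow> 'a" and D t
    assume t: "t \<in> {a..b}" and small: "C * norm (z a - y a) < \<rho>" and Da: "D a"
      and z: "\<And>t. t \<in> {a..b} \<Longrightarrow> D t \<Longrightarrow> (z has_vector_derivative X (z t)) (at t within {a..b})"
      and left: "\<And>t. \<lbrakk>a < t; t \<le> b; \<And>s. a \<le> s \<Longrightarrow> s < t \<Longrightarrow> D s \<and> norm (z s - y s) \<le> \<rho>\<rbrakk> \<Longrightarrow> D t"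
      and right: "\<And>t. \<lbrakk>a \<le> t; t < b; D t\<rbrakk> \<Longrightarrow> \<forall>\<^sub>F s in at t within {a..b}. D s"
    \<comment> \<open>Gronwall applies as long as the deviation stays below \<rho>. The smallness
      assumption is strict, so the deviation never reaches \<rho> and the argument can be continued
      in time.\<close>
    have key: "norm (z s - y s) \<le> C * norm (z a - y a)"
      if s: "s \<in> {a..b}" and Ds: "\<And>\<tau>. \<tau> \<in> {a..s} \<Longrightarrow> D \<tau> \<and> norm (z \<tau> - y \<tau>) \<le> \<rho>" for s
    proof -
      have "norm (z s - y s) \<le> exp ((L + 1) * (s - a)) * norm (z a - y a)"
      proof (rule gronwall[of a s "\<lambda>\<tau>. z \<tau> - y \<tau>" "\<lambda>\<tau>. X (z \<tau>) - X (y \<tau>)" L])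
        fix \<tau> assume \<tau>: "\<tau> \<in> {a..s}"
        have "(z has_vector_derivative X (z \<tau>)) (at \<tau> within {a..s})"
          "(y has_vector_derivative X (y \<tau>)) (at \<tau> within {a..s})"
          using z[of \<tau>] y[of \<tau>] Ds[OF \<tau>] \<tau> s by (auto intro: has_vector_derivative_within_subset)
        then show "((\<lambda>\<tau>. z \<tau> - y \<tau>) has_vector_derivative X (z \<tau>) - X (y \<tau>)) (at \<tau> within {a..s})"
          by (rule has_vector_derivative_diff)
        show "norm (X (z \<tau>) - X (y \<tau>)) \<le> L * norm (z \<tau> - y \<tau>)"
          using \<rho>(1) Ds[OF \<tau>] \<tau> s by (intro \<rho>(4)[of \<tau>]) (auto simp: dist_norm norm_minus_commute)
      qed (use \<rho> s in auto)
      also have "\<dots> \<le> C * norm (z a - y a)" using s \<rho>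
        by (auto simp: C_def intro!: mult_right_mono mult_left_mono)
      finally show ?thesis .
    qed
    have cont: "((\<lambda>\<tau>. norm (z \<tau> - y \<tau>)) \<longlongrightarrow> norm (z s - y s)) (at s within {a..b})" if "s \<in> {a..b}" "D s" for s
    proof -
      have "continuous (at s within {a..b}) (\<lambda>\<tau>. norm (z \<tau> - y \<tau>))"
        using z[OF that] y[OF that(1)] by (intro continuous_intros) (auto dest:
            has_vector_derivative_continuous)
      then show ?thesis by (simp add: continuous_within)
    qed
    show "D t \<and> norm (z t - y t) \<le> C * norm (z a - y a)"
      using t
    proof (induction rule: real_induction)
      case start
      have "1 \<le> C" using t \<rho> by (simp add: C_def)
      then have "1 * norm (z a - y a) \<le> C * norm (z a - y a)" by (intro mult_right_mono) auto
      then show ?case using Da by simp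
    next
      case (left t)
      have 1: "D s \<and> norm (z s - y s) \<le> \<rho>" if "a \<le> s" "s < t" for s
        using left(3)[OF that] small by auto
      have Dt: "D t" using assms left(1,2) 1 by (intro \<open>\<And>t. _ \<Longrightarrow> _ \<Longrightarrow> (\<And>s. _ \<Longrightarrow> _ \<Longrightarrow> D s \<and> _) \<Longrightarrow> D t\<close>) auto
      have tab: "t \<in> {a..b}" using left by auto
      have "((\<lambda>\<tau>. norm (z \<tau> - y \<tau>)) \<longlongrightarrow> norm (z t - y t)) (at t within {a..<t})"
        using cont[OF tab Dt] by (rule tendsto_within_subset) (use left in auto)
      moreover have "\<forall>\<^sub>F s in at t within {a..<t}. norm (z s - y s) \<le> C * norm (z a - y a)"
        using left(3) by (auto simp: eventually_at_filter)
      moreover have "at t within {a..<t} \<noteq> bot"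
        using left(1) by (simp add: at_within_eq_bot_iff closure_greaterThanLessThan islimpt_in_closure)
      ultimately have "norm (z t - y t) \<le> C * norm (z a - y a)" by (intro tendsto_upperbound)
      then show ?case using Dt by simp
    next
      case (right t)
      have tab: "t \<in> {a..b}" and Dt: "D t" using right by auto
      have "\<forall>\<^sub>F s in at t within {a..b}. norm (z s - y s) < \<rho>"
        using right(3)[of t] right(1) small by (intro order_tendstoD(2)[OF cont[OF tab Dt]]) auto
      moreover have "\<forall>\<^sub>F s in at t within {a..b}. D s"
        using \<open>\<And>t. \<lbrakk>a \<le> t; t < b; D t\<rbrakk> \<Longrightarrow> \<forall>\<^sub>F s in at t within {a..b}. D s\<close> right Dt by auto
      ultimately have "\<forall>\<^sub>F s in at t within {a..b}. norm (z s - y s) < \<rho> \<and> D s" by (rule eventually_conj)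
      then obtain \<epsilon> where \<epsilon>: "\<epsilon> > 0" "\<And>s. s \<in> {a..b} \<Longrightarrow> s \<noteq> t \<Longrightarrow> dist s t < \<epsilon> \<Longrightarrow> norm (z s - y s) < \<rho> \<and> D s"
        unfolding eventually_at by auto
      show ?case
      proof (intro exI[of _ \<epsilon>] conjI allI impI)
        fix s assume s: "t < s \<and> s < t + \<epsilon> \<and> s \<le> b"
        have *: "D \<tau> \<and> norm (z \<tau> - y \<tau>) \<le> \<rho>" if "\<tau> \<in> {a..s}" for \<tau>
        proof (cases "\<tau> \<le> t")
          case True
          then show ?thesis using right(3)[of \<tau>] that small by auto
        next
          case False
          then show ?thesis using \<epsilon>(2)[of \<tau>] that s right(1) by (auto simp: dist_real_def)
        qed
        show "D s" using *[of s] s right(1) by auto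
        show "norm (z s - y s) \<le> C * norm (z a - y a)" using key[of s] * s right(1) by auto
      qed (rule \<epsilon>(1))
    qed
  qed (use \<rho> in \<open>auto simp: C_def\<close>)
qed

text \<open>The quotients solve the linearized equation up to an error that tends to 0 uniformly, so
  Gronwall makes them uniformly Cauchy. Two varying solutions are compared, not one solution with
  \<open>y\<close>, because the exponential map has to be shown expanding between arbitrary
  neighbouring vectors.\<close>

lemma ode_linearization:
  fixes y :: "real \<Rightarrow> 'a::euclidean_space" and z z' :: "nat \<Rightarrow> real \<Rightarrow> 'a"
  assumes X: "C1_on \<Omega> X X'" and "a \<le> b"
    and y: "\<And>t. t \<in> {a..b} \<Longrightarrow> (y has_vector_derivative X (y t)) (at t within {a..b})"
    and y\<Omega>: "y ` {a..b} \<subseteq> \<Omega>"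
    and z: "\<forall>\<^sub>F n in sequentially. \<forall>t\<in>{a..b}. (z n has_vector_derivative X (z n t)) (at t within {a..b})"
    and z': "\<forall>\<^sub>F n in sequentially. \<forall>t\<in>{a..b}. (z' n has_vector_derivative X (z' n t)) (at t within {a..b})"
    and lim: "uniform_limit {a..b} z y sequentially"
    and lim': "uniform_limit {a..b} z' y sequentially"
    and r: "\<And>n. 0 < r n"
    and j0: "(\<lambda>n. (z' n a - z n a) /\<^sub>R r n) \<longlonglongrightarrow> j0"
  shows "\<exists>j. \<forall>t\<in>{a..b}. (\<lambda>n. (z' n t - z n t) /\<^sub>R r n) \<longlonglongrightarrow> j t \<and>
    (j has_vector_derivative X' (y t) (j t)) (at t within {a..b})"
proof -
  have cy: "continuous_on {a..b} y"
    using y by (meson continuous_on_eq_continuous_within has_vector_derivative_continuous)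
  obtain \<rho> L where \<rho>: "\<rho> > 0" "L \<ge> 0" "\<And>t. t \<in> {a..b} \<Longrightarrow> cball (y t) \<rho> \<subseteq> \<Omega>"
    "\<And>t p q. t \<in> {a..b} \<Longrightarrow> p \<in> cball (y t) \<rho> \<Longrightarrow> q \<in> cball (y t) \<rho> \<Longrightarrow> norm (X p - X q) \<le> L * norm (p - q)"
    "\<And>t. t \<in> {a..b} \<Longrightarrow> norm (X' (y t)) \<le> L"
    using C1_on_lipschitz_near_curve[OF X cy y\<Omega>] by metis
  define D where "D = (\<lambda>n t. (z' n t - z n t) /\<^sub>R r n)"
  define D' where "D' = (\<lambda>n t. (X (z' n t) - X (z n t)) /\<^sub>R r n)"
  have "\<forall>\<^sub>F n in sequentially. (\<forall>t\<in>{a..b}. (z n has_vector_derivative X (z n t)) (at t within {a..b})) \<and>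
     (\<forall>t\<in>{a..b}. (z' n has_vector_derivative X (z' n t)) (at t within {a..b})) \<and>
     (\<forall>t\<in>{a..b}. dist (z n t) (y t) < \<rho>) \<and> (\<forall>t\<in>{a..b}. dist (z' n t) (y t) < \<rho>)"
    by (intro eventually_conj z z' uniform_limitD[OF lim \<rho>(1)] uniform_limitD[OF lim' \<rho>(1)])
  then obtain N where N: "\<And>n t. n \<ge> N \<Longrightarrow> t \<in> {a..b} \<Longrightarrow> (z n has_vector_derivative X (z n t)) (at t within
    {a..b})"
    "\<And>n t. n \<ge> N \<Longrightarrow> t \<in> {a..b} \<Longrightarrow> (z' n has_vector_derivative X (z' n t)) (at t within {a..b})"
    "\<And>n t. n \<ge> N \<Longrightarrow> t \<in> {a..b} \<Longrightarrow> dist (z n t) (y t) < \<rho> \<and> dist (z' n t) (y t) < \<rho>"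
    unfolding eventually_sequentially by blast
  have dD: "(D n has_vector_derivative D' n t) (at t within {a..b})" if "n \<ge> N" "t \<in> {a..b}" for n t
    unfolding D_def D'_def
    using bounded_linear.has_vector_derivative[OF bounded_linear_scaleR_right has_vector_derivative_diff[OF
        N(2)[OF that] N(1)[OF that]], of "inverse (r n)"]
    by simp
  define C where "C = exp ((L + 1) * (b - a))"
  obtain B0 where B0: "\<And>n. norm (D n a) \<le> B0" "B0 > 0"
    using convergent_imp_Bseq[of "\<lambda>n. D n a"] j0 by (auto simp: convergent_def Bseq_def D_def)
  define B where "B = C * B0"
  have "B > 0" using B0 by (simp add: B_def C_def)
  have DB: "norm (D n t) \<le> B" if n: "n \<ge> N" and t: "t \<in> {a..b}" for n t
  proof -
    have "norm (D n t) \<le> exp ((L + 1) * (t - a)) * norm (D n a)"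
    proof (rule gronwall[OF dD[OF n] _ \<rho>(2) t])
      fix t assume t: "t \<in> {a..b}"
      have "norm (X (z' n t) - X (z n t)) \<le> L * norm (z' n t - z n t)"
        using N(3)[OF n t] by (intro \<rho>(4)[OF t]) (auto simp: dist_commute)
      then have "norm (X (z' n t) - X (z n t)) / r n \<le> L * norm (z' n t - z n t) / r n"
        using r[of n] by (intro divide_right_mono) auto
      then show "norm (D' n t) \<le> L * norm (D n t)"
        using r[of n] by (simp add: D'_def D_def divide_inverse mult_ac)
    qed auto
    also have "\<dots> \<le> C * B0"
      unfolding C_def using t \<rho>(2) B0 by (intro mult_mono) (auto intro!: mult_left_mono)
    finally show ?thesis by (simp add: B_def)
  qed
  have err: "\<exists>M\<ge>N. \<forall>n\<ge>M. \<forall>t\<in>{a..b}. norm (D' n t - X' (y t) (D n t)) \<le> e * B" if e: "e > 0" for e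
  proof -
    have K: "compact (y ` {a..b})" using cy compact_Icc by (rule compact_continuous_image)
    obtain \<delta> where \<delta>: "\<delta> > 0" "\<forall>y\<in>y ` {a..b}. cball y \<delta> \<subseteq> \<Omega> \<and> (\<forall>p\<in>cball y \<delta>. \<forall>q\<in>cball y \<delta>.
      norm (X p - X q - X' y (p - q)) \<le> e * norm (p - q))" using C1_on_uniform[OF X K y\<Omega> e] by auto
    have "\<forall>\<^sub>F n in sequentially. n \<ge> N \<and> (\<forall>t\<in>{a..b}. dist (z n t) (y t) < \<delta>) \<and>
      (\<forall>t\<in>{a..b}. dist (z' n t) (y t) < \<delta>)"
      by (intro eventually_conj uniform_limitD[OF lim \<delta>(1)] uniform_limitD[OF lim' \<delta>(1)] eventually_ge_at_top)
    then obtain M where M: "M \<ge> N" "\<And>n t. n \<ge> M \<Longrightarrow> t \<in> {a..b} \<Longrightarrow> dist (z n t) (y t) < \<delta> \<and> dist (z' n t) (y t) <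
      \<delta>"
      unfolding eventually_sequentially by (metis order_refl)
    show ?thesis
    proof (intro exI[of _ M] conjI allI impI ballI M(1))
      fix n t assume n: "n \<ge> M" and t: "t \<in> {a..b}"
      have "norm (X (z' n t) - X (z n t) - X' (y t) (z' n t - z n t)) \<le> e * norm (z' n t - z n t)"
        using \<delta>(2) t M(2)[OF n t] by (auto simp: dist_commute)
      then have "norm (X (z' n t) - X (z n t) - X' (y t) (z' n t - z n t)) / r n \<le>
        e * norm (z' n t - z n t) / r n"
        using r[of n] by (intro divide_right_mono) auto
      moreover have "D' n t - X' (y t) (D n t) = (X (z' n t) - X (z n t) - X' (y t) (z' n t - z n t)) /\<^sub>R r n"
        by (simp add: D'_def D_def blinfun.scaleR_right blinfun.diff_right scaleR_diff_right)
      ultimately have "norm (D' n t - X' (y t) (D n t)) \<le> e * norm (D n t)"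
        using r[of n] by (simp add: D_def divide_inverse mult_ac)
      also have "\<dots> \<le> e * B" using DB[of n t] n t M(1) e by (intro mult_left_mono) auto
      finally show "norm (D' n t - X' (y t) (D n t)) \<le> e * B" .
    qed
  qed
  have "\<exists>j. \<forall>e>0. \<exists>M. \<forall>n t. M \<le> n \<and> t \<in> {a..b} \<longrightarrow> dist (D n t) (j t) < e"
    unfolding uniformly_convergent_eq_cauchy
  proof (intro allI impI)
    fix e :: real assume e: "e > 0"
    \<comment> \<open>Chosen so that Gronwall ends with exactly e / 2; the length of the interval
      enters through \<open>1 + (b - a) \<le> (1 + sqrt (b - a))\<^sup>2\<close>.\<close>
    define \<eta> where "\<eta> = e / (2 * C * (1 + sqrt (b - a)) )"
    have C: "C > 0" by (simp add: C_def)
    have sq: "sqrt (b - a) \<ge> 0" using \<open>a \<le> b\<close> by simp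
    have \<eta>: "\<eta> > 0" using e C sq by (auto simp: \<eta>_def intro!: divide_pos_pos mult_pos_pos add_pos_nonneg)
    obtain M where M: "M \<ge> N" "\<And>n t. n \<ge> M \<Longrightarrow> t \<in> {a..b} \<Longrightarrow> norm (D' n t - X' (y t) (D n t)) \<le> \<eta> / (2 * B) * B"
      using err[of "\<eta> / (2 * B)"] \<eta> \<open>B > 0\<close> by auto
    have "Cauchy (\<lambda>n. D n a)" using j0 by (simp add: D_def LIMSEQ_imp_Cauchy)
    then obtain M' where M': "\<And>m n. m \<ge> M' \<Longrightarrow> n \<ge> M' \<Longrightarrow> norm (D m a - D n a) < \<eta>"
      using CauchyD[OF _ \<eta>] by blast
    show "\<exists>M. \<forall>m n t. M \<le> m \<and> M \<le> n \<and> t \<in> {a..b} \<longrightarrow> dist (D m t) (D n t) < e"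
    proof (intro exI[of _ "max M M'"] allI impI)
      fix m n t assume h: "max M M' \<le> m \<and> max M M' \<le> n \<and> t \<in> {a..b}"
      then have t: "t \<in> {a..b}" and mn: "m \<ge> M" "n \<ge> M" "m \<ge> M'" "n \<ge> M'" "m \<ge> N" "n \<ge> N" using M(1) by auto
      have "(norm (D m t - D n t))\<^sup>2 \<le> ((norm (D m a - D n a))\<^sup>2 + \<eta>\<^sup>2 * (t - a)) * exp ((2 * L + 1) * (t -
        a))"
      proof (rule gronwall_sq[of a b "\<lambda>t. D m t - D n t" "\<lambda>t. D' m t - D' n t"])
        fix t assume t: "t \<in> {a..b}"
        show "((\<lambda>t. D m t - D n t) has_vector_derivative D' m t - D' n t) (at t within {a..b})"
          by (intro has_vector_derivative_diff dD mn t)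
        have "D' m t - D' n t = X' (y t) (D m t - D n t) + (D' m t - X' (y t) (D m t)) - (D' n t - X' (y t)
          (D n t))"
          by (simp add: blinfun.diff_right)
        also have "norm \<dots> \<le> norm (X' (y t) (D m t - D n t)) + norm (D' m t - X' (y t) (D m t)) + norm (D' n t
          - X' (y t) (D n t))"
          by (meson add_mono norm_triangle_ineq norm_triangle_ineq4 order_refl order_trans)
        also have "norm (X' (y t) (D m t - D n t)) \<le> L * norm (D m t - D n t)"
          using norm_blinfun[of "X' (y t)" "D m t - D n t"] \<rho>(5)[OF t]
              by (meson mult_right_mono norm_ge_zero order_trans)
        finally show "norm (D' m t - D' n t) \<le> L * norm (D m t - D n t) + \<eta>"
          using M(2)[OF mn(1) t] M(2)[OF mn(2) t] \<open>B > 0\<close> by simp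
      qed (use \<rho> \<eta> t in auto)
      also have "\<dots> \<le> (\<eta>\<^sup>2 + \<eta>\<^sup>2 * (b - a)) * exp (2 * ((L + 1) * (b - a)))"
      proof (intro mult_mono add_mono power_mono)
        have "(2 * L + 1) * (t - a) \<le> (2 * L + 2) * (b - a)" using t \<rho>(2) by (intro mult_mono) auto
        then show "exp ((2 * L + 1) * (t - a)) \<le> exp (2 * ((L + 1) * (b - a)))" by (simp add: algebra_simps)
      qed (use M'[OF mn(3,4)] t \<eta> in auto)
      also have "\<dots> = (\<eta> * C)\<^sup>2 * (1 + (b - a))"
        unfolding C_def exp_double by (simp add: power_mult_distrib ring_distribs)
      also have "\<dots> \<le> (\<eta> * C)\<^sup>2 * (1 + sqrt (b - a))\<^sup>2"
        using sq \<open>a \<le> b\<close> by (intro mult_left_mono) (auto simp: power2_sum)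
      also have "\<dots> = (\<eta> * C * (1 + sqrt (b - a)))\<^sup>2" by (simp add: power_mult_distrib)
      also have "\<eta> * C * (1 + sqrt (b - a)) = e / 2"
        using C sq add_pos_nonneg[of 1 "sqrt (b - a)"] unfolding \<eta>_def by (simp add: divide_simps)
      finally have "norm (D m t - D n t) \<le> e / 2" by (rule power2_le_imp_le) (use e in simp)
      then show "dist (D m t) (D n t) < e" using e by (simp add: dist_norm)
    qed
  qed
  then obtain j where j: "\<And>e. e > 0 \<Longrightarrow> \<exists>M. \<forall>n t. M \<le> n \<and> t \<in> {a..b} \<longrightarrow> dist (D n t) (j t) < e" by blast
  have jt: "(\<lambda>n. D n t) \<longlonglongrightarrow> j t" if "t \<in> {a..b}" for t
    using j that unfolding lim_sequentially by meson
  \<comment> \<open>Interchange of limit and derivative. The shift by \<open>N\<close> drops the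
    indices for which the curves are not yet known to be solutions inside the tube.\<close>
  have "\<exists>g. \<forall>t\<in>{a..b}. (\<lambda>n. D (n + N) t) \<longlonglongrightarrow> g t \<and> (g has_derivative (\<lambda>h. h *\<^sub>R X' (y t) (j t))) (at t within
    {a..b})"
  proof (rule has_derivative_sequence[where f' = "\<lambda>n t h. h *\<^sub>R D' (n + N) t"])
    fix n t assume "t \<in> {a..b}"
    then show "(D (n + N) has_derivative (\<lambda>h. h *\<^sub>R D' (n + N) t)) (at t within {a..b})"
      using dD[of "n + N" t] by (simp add: has_vector_derivative_def)
  next
    fix e :: real assume e: "e > 0"
    obtain M1 where M1: "\<And>n t. n \<ge> M1 \<Longrightarrow> t \<in> {a..b} \<Longrightarrow> norm (D' n t - X' (y t) (D n t)) \<le> e / (2 * B) * B"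
      using err[of "e / (2 * B)"] divide_pos_pos[of e "2 * B"] e \<open>B > 0\<close> by fastforce
    obtain M2 where M2: "\<And>n t. n \<ge> M2 \<Longrightarrow> t \<in> {a..b} \<Longrightarrow> dist (D n t) (j t) < e / (2 * (L + 1))"
      using j[of "e / (2 * (L + 1))"] e \<rho>(2) by auto
    have "norm (h *\<^sub>R D' (n + N) t - h *\<^sub>R X' (y t) (j t)) \<le> e * norm h"
      if n: "n \<ge> max M1 M2" and t: "t \<in> {a..b}" for n t h
    proof -
      have "D' (n + N) t - X' (y t) (j t) = (D' (n + N) t - X' (y t) (D (n + N) t)) + X' (y t) (D (n + N) t -
        j t)"
        by (simp add: blinfun.diff_right)
      also have "norm \<dots> \<le> norm (D' (n + N) t - X' (y t) (D (n + N) t)) + norm (X' (y t) (D (n + N) t - j t))"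
        by (rule norm_triangle_ineq)
      also have "norm (X' (y t) (D (n + N) t - j t)) \<le> L * norm (D (n + N) t - j t)"
        using norm_blinfun[of "X' (y t)"] \<rho>(5)[OF t] by (meson mult_right_mono norm_ge_zero order_trans)
      also have "\<dots> \<le> L * (e / (2 * (L + 1)))"
        using M2[of "n + N" t] n t \<rho>(2) by (intro mult_left_mono) (auto simp: dist_norm)
      also have "\<dots> \<le> e / 2" using \<rho>(2) e by (simp add: field_simps)
      also have "norm (D' (n + N) t - X' (y t) (D (n + N) t)) \<le> e / 2"
        using M1[of "n + N" t] n t \<open>B > 0\<close> by simp
      finally have *: "norm (D' (n + N) t - X' (y t) (j t)) \<le> e" by simp
      have "norm (h *\<^sub>R D' (n + N) t - h *\<^sub>R X' (y t) (j t)) = norm h * norm (D' (n + N) t - X' (y t) (j t))"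
        by (simp flip: scaleR_diff_right)
      also have "\<dots> \<le> norm h * e" using * by (intro mult_left_mono) auto
      finally show ?thesis by (simp add: mult.commute)
    qed
    then show "\<forall>\<^sub>F n in sequentially. \<forall>t\<in>{a..b}. \<forall>h. norm (h *\<^sub>R D' (n + N) t - h *\<^sub>R X' (y t) (j t)) \<le>
      e * norm h"
      unfolding eventually_sequentially by blast
  next
    show "(\<lambda>n. D (n + N) a) \<longlonglongrightarrow> j0" using LIMSEQ_ignore_initial_segment[OF j0, of N] by (simp add: D_def)
  qed (use \<open>a \<le> b\<close> in auto)
  then obtain g where g: "\<And>t. t \<in> {a..b} \<Longrightarrow> (\<lambda>n. D (n + N) t) \<longlonglongrightarrow> g t"
    "\<And>t. t \<in> {a..b} \<Longrightarrow> (g has_vector_derivative X' (y t) (j t)) (at t within {a..b})"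
    unfolding has_vector_derivative_def by blast
  have gj: "g t = j t" if "t \<in> {a..b}" for t
    using g(1)[OF that] LIMSEQ_ignore_initial_segment[OF jt[OF that], of N] by (rule LIMSEQ_unique)
  have "(\<lambda>n. D n t) \<longlonglongrightarrow> g t \<and> (g has_vector_derivative X' (y t) (g t)) (at t within {a..b})"
    if "t \<in> {a..b}" for t
    using jt[OF that] g(2)[OF that] gj[OF that] by simp
  then show ?thesis unfolding D_def by blast
qed

section \<open>Maps of class C1\<close>

text \<open>The derivative is a plain function, continuous for each fixed direction, which is the
  form that \<open>Ck_on\<close> provides. In finite dimension this amounts to continuity in
  operator norm, as \<open>C1f_imp_C1_on\<close> records.\<close>

definition C1f :: "'a::euclidean_space set \<Rightarrow> ('a \<Rightarrow> 'b::euclidean_space) \<Rightarrow> ('a \<Rightarrow> 'a \<Rightarrow> 'b) \<Rightarrow> bool" where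
  "C1f S F F' \<longleftrightarrow> open S \<and> (\<forall>x\<in>S. (F has_derivative F' x) (at x)) \<and> (\<forall>v. continuous_on S (\<lambda>x. F' x v))"

lemma C1f_bounded_linear: "C1f S F F' \<Longrightarrow> x \<in> S \<Longrightarrow> bounded_linear (F' x)"
  by (auto simp: C1f_def has_derivative_bounded_linear)

lemma C1f_imp_C1_on: "C1f S F F' \<Longrightarrow> C1_on S F (\<lambda>x. Blinfun (F' x))"
  unfolding C1_on_def
  by (auto simp: C1f_def C1f_bounded_linear bounded_linear_Blinfun_apply has_derivative_bounded_linear
      intro!: continuous_on_blinfun_componentwise cong: continuous_on_cong_simp)

lemma C1f_frechet: "C1f S F F' \<Longrightarrow> x \<in> S \<Longrightarrow> frechet_derivative F (at x) = F' x"
  by (metis C1f_def frechet_derivative_at)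

lemma C1f_cong:
  assumes "C1f S F F'" "\<And>x. x \<in> S \<Longrightarrow> F' x = F'' x"
  shows "C1f S F F''"
  unfolding C1f_def
proof (intro conjI ballI allI)
  show "continuous_on S (\<lambda>x. F'' x v)" for v
    by (rule continuous_on_eq[of S "\<lambda>x. F' x v"]) (use assms in \<open>auto simp: C1f_def\<close>)
qed (use assms in \<open>auto simp: C1f_def\<close>)

lemma C1f_continuous_on: "C1f S F F' \<Longrightarrow> continuous_on S F"
  unfolding C1f_def by (meson continuous_at_imp_continuous_on has_derivative_continuous)

lemma smooth_on_C1f:
  assumes "open S" "smooth_on S F"
  shows "C1f S F (\<lambda>x. frechet_derivative F (at x))"
  unfolding C1f_def
proof (intro conjI ballI allI)
  have "Ck_on (Suc 0) S F" using assms(2) by (auto simp: smooth_on_def)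
  then show "x \<in> S \<Longrightarrow> (F has_derivative frechet_derivative F (at x)) (at x)"
    and "continuous_on S (\<lambda>x. frechet_derivative F (at x) v)" for x v
    by (auto simp: frechet_derivative_works)
qed (rule assms(1))

lemma smooth_on_frechet: "smooth_on S F \<Longrightarrow> smooth_on S (\<lambda>x. frechet_derivative F (at x) v)"
  unfolding smooth_on_def by (metis Ck_on.simps(2))

lemma C1f_compose:
  assumes F: "C1f S F F'" and G: "C1f T G G'" and sub: "F ` S \<subseteq> T"
  shows "C1f S (\<lambda>x. G (F x)) (\<lambda>x v. G' (F x) (F' x v))"
  unfolding C1f_def
proof (intro conjI ballI allI)
  show "open S" using F by (simp add: C1f_def)
  show "((\<lambda>x. G (F x)) has_derivative (\<lambda>v. G' (F x) (F' x v))) (at x)" if "x \<in> S" for x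
    by (rule has_derivative_compose[of F "F' x"]) (use F G sub that in \<open>auto simp: C1f_def\<close>)
  fix v
  have lin: "bounded_linear (G' (F x))" if "x \<in> S" for x using C1f_bounded_linear[OF G] sub that by auto
  have "continuous_on S (\<lambda>x. \<Sum>i\<in>Basis. (F' x v \<bullet> i) *\<^sub>R G' (F x) i)"
  proof (intro continuous_intros)
    show "continuous_on S (\<lambda>x. F' x v)" using F by (simp add: C1f_def)
    fix i
    have "continuous_on T (\<lambda>y. G' y i)" using G by (simp add: C1f_def)
    then show "continuous_on S (\<lambda>x. G' (F x) i)"
      by (rule continuous_on_compose2[OF _ C1f_continuous_on[OF F] sub])
  qed
  moreover have "(\<Sum>i\<in>Basis. (F' x v \<bullet> i) *\<^sub>R G' (F x) i) = G' (F x) (F' x v)" if "x \<in> S" for x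
  proof -
    interpret bounded_linear "G' (F x)" by (rule lin[OF that])
    have "G' (F x) (F' x v) = G' (F x) (\<Sum>i\<in>Basis. (F' x v \<bullet> i) *\<^sub>R i)" by (simp add: euclidean_representation)
    then show ?thesis by (simp add: sum scaleR)
  qed
  ultimately show "continuous_on S (\<lambda>x. G' (F x) (F' x v))" by (simp cong: continuous_on_cong_simp)
qed

lemma linear_basis_expand: "linear f \<Longrightarrow> f w = (\<Sum>i\<in>Basis. (w \<bullet> i) *\<^sub>R f i)"
  for f :: "'a::euclidean_space \<Rightarrow> 'b::real_vector"
  by (metis (no_types, lifting) euclidean_representation linear_sum linear_scale sum.cong)

text \<open>Expanding \<open>w\<close> in the basis reduces joint differentiability in
  \<open>(p, w)\<close> to differentiability in \<open>p\<close> for each fixed \<open>w\<close>.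
  Smoothness of the metric is given only for fixed vectors, whereas along curves the vectors vary as
  well.\<close>

lemma C1f_linear_param:
  fixes E :: "'a::euclidean_space \<Rightarrow> 'b::euclidean_space \<Rightarrow> 'c::euclidean_space"
  assumes E: "\<And>w. C1f S (\<lambda>p. E p w) (\<lambda>p. E' p w)" and lin: "\<And>p. p \<in> S \<Longrightarrow> linear (E p)"
  shows "C1f (S \<times> UNIV) (\<lambda>z. E (fst z) (snd z)) (\<lambda>z d. E' (fst z) (snd z) (fst d) + E (fst z) (snd d))"
    and "\<And>p h. p \<in> S \<Longrightarrow> linear (\<lambda>w. E' p w h)"
proof -
  have oS: "open S" using E by (auto simp: C1f_def)
  have dE: "((\<lambda>p. E p w) has_derivative E' p w) (at p)" if "p \<in> S" for p w
    using E[of w] that by (simp add: C1f_def)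
  have expE: "E p w = (\<Sum>i\<in>Basis. (w \<bullet> i) *\<^sub>R E p i)" if "p \<in> S" for p w
    by (rule linear_basis_expand[OF lin[OF that]])
  have expE': "E' p w h = (\<Sum>i\<in>Basis. (w \<bullet> i) *\<^sub>R E' p i h)" if p: "p \<in> S" for p w h
  proof -
    have "((\<lambda>p. \<Sum>i\<in>Basis. (w \<bullet> i) *\<^sub>R E p i) has_derivative (\<lambda>h. \<Sum>i\<in>Basis. (w \<bullet> i) *\<^sub>R E' p i h)) (at p)"
      by (intro has_derivative_sum has_derivative_scaleR_right dE[OF p])
    then have "((\<lambda>p. E p w) has_derivative (\<lambda>h. \<Sum>i\<in>Basis. (w \<bullet> i) *\<^sub>R E' p i h)) (at p)"
      by (rule has_derivative_transform_within_open[OF _ oS p]) (simp add: expE[symmetric])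
    then show ?thesis using has_derivative_unique[OF dE[OF p, of w]] by metis
  qed
  show "linear (\<lambda>w. E' p w h)" if p: "p \<in> S" for p h
  proof -
    have "linear (\<lambda>w. \<Sum>i\<in>Basis. (w \<bullet> i) *\<^sub>R E' p i h)"
      by (rule linearI) (simp_all add: inner_left_distrib scaleR_left_distrib sum.distrib scaleR_sum_right)
    then show ?thesis by (simp flip: expE'[OF p])
  qed
  show "C1f (S \<times> UNIV) (\<lambda>z. E (fst z) (snd z)) (\<lambda>z d. E' (fst z) (snd z) (fst d) + E (fst z) (snd d))"
    unfolding C1f_def
  proof (intro conjI ballI allI)
    show op: "open (S \<times> (UNIV :: 'b set))" using oS by (simp add: open_Times)
    show "((\<lambda>z. E (fst z) (snd z)) has_derivative (\<lambda>d. E' (fst z) (snd z) (fst d) + E (fst z) (snd d))) (at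
      z)"
      if z: "z \<in> S \<times> UNIV" for z :: "'a \<times> 'b"
    proof -
      have p: "fst z \<in> S" using z by auto
      have "((\<lambda>z. \<Sum>i\<in>Basis. (snd z \<bullet> i) *\<^sub>R E (fst z) i) has_derivative
        (\<lambda>d. \<Sum>i\<in>Basis. (snd z \<bullet> i) *\<^sub>R E' (fst z) i (fst d) + (snd d \<bullet> i) *\<^sub>R E (fst z) i)) (at z)"
        by (intro has_derivative_sum has_derivative_scaleR has_derivative_inner_left has_derivative_snd
            has_derivative_ident has_derivative_compose[of fst, OF has_derivative_fst[OF
              has_derivative_ident] dE[OF p]])
      moreover have "(\<lambda>d. \<Sum>i\<in>Basis. (snd z \<bullet> i) *\<^sub>R E' (fst z) i (fst d) + (snd d \<bullet> i) *\<^sub>R E (fst z) i) =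
        (\<lambda>d. E' (fst z) (snd z) (fst d) + E (fst z) (snd d))"
        by (simp add: fun_eq_iff sum.distrib expE[OF p, of "snd _"] expE'[OF p, of "snd z"])
      ultimately have "((\<lambda>z. \<Sum>i\<in>Basis. (snd z \<bullet> i) *\<^sub>R E (fst z) i) has_derivative
        (\<lambda>d. E' (fst z) (snd z) (fst d) + E (fst z) (snd d))) (at z)" by simp
      then show ?thesis
        by (rule has_derivative_transform_within_open[OF _ op z]) (auto simp: expE[symmetric])
    qed
    fix d :: "'a \<times> 'b"
    have cE': "continuous_on S (\<lambda>p. E' p w h)" for w h using E[of w] by (simp add: C1f_def)
    have c1: "continuous_on (S \<times> UNIV) (\<lambda>z::'a \<times> 'b. E' (fst z) w h)" for w h
      by (rule continuous_on_compose2[OF cE']) (auto intro: continuous_intros)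
    have c2: "continuous_on (S \<times> UNIV) (\<lambda>z::'a \<times> 'b. E (fst z) w)" for w
      by (rule continuous_on_compose2[OF C1f_continuous_on[OF E]]) (auto intro: continuous_intros)
    have "continuous_on (S \<times> UNIV) (\<lambda>z. (\<Sum>i\<in>Basis. (snd z \<bullet> i) *\<^sub>R E' (fst z) i (fst d)) + E (fst z) (snd d))"
      by (intro continuous_intros c1 c2)
    then show "continuous_on (S \<times> UNIV) (\<lambda>z. E' (fst z) (snd z) (fst d) + E (fst z) (snd d))"
      by (rule continuous_on_eq) (auto simp: expE'[symmetric])
  qed
qed

lemma C1f_pair:
  assumes "C1f S F F'" "C1f S G G'"
  shows "C1f S (\<lambda>x. (F x, G x)) (\<lambda>x v. (F' x v, G' x v))"
  using assms unfolding C1f_def by (auto intro!: has_derivative_Pair continuous_on_Pair)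

lemma C1f_bounded_linear_fun: "bounded_linear L \<Longrightarrow> open S \<Longrightarrow> C1f S L (\<lambda>_. L)"
  unfolding C1f_def by (auto intro: bounded_linear_imp_has_derivative)

lemma C1f_uminus: "C1f S F F' \<Longrightarrow> C1f S (\<lambda>x. - F x) (\<lambda>x v. - F' x v)"
  unfolding C1f_def by (auto intro!: has_derivative_minus continuous_on_minus)

lemma C1f_fst: "C1f S F F' \<Longrightarrow> C1f (S \<times> UNIV) (\<lambda>z. F (fst z)) (\<lambda>z d. F' (fst z) (fst d))"
  by (rule C1f_compose[OF C1f_bounded_linear_fun[OF bounded_linear_fst]])
    (auto simp: C1f_def open_Times)

section \<open>Linear systems depending on a parameter\<close>

lemma linear_system_lower_bound:
  fixes \<A> :: "'p::metric_space \<Rightarrow> 'e::euclidean_space \<Rightarrow>\<^sub>L 'e"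
  assumes cont: "continuous_on S \<A>" and inj: "\<And>p u. p \<in> S \<Longrightarrow> \<A> p u = 0 \<Longrightarrow> u = 0" and p: "p \<in> S"
  shows "\<exists>c d. c > 0 \<and> d > 0 \<and> (\<forall>q u. q \<in> S \<longrightarrow> dist q p < d \<longrightarrow> c * norm u \<le> norm (\<A> q u))"
proof -
  have "inj (blinfun_apply (\<A> p))"
    using inj[OF p] by (simp add: linear_injective_0 blinfun.bounded_linear_right bounded_linear.linear)
  then obtain B where B: "B > 0" "\<And>u. B * norm u \<le> norm (\<A> p u)"
    using linear_inj_bounded_below_pos[of "blinfun_apply (\<A> p)"]
        by (auto simp: blinfun.bounded_linear_right bounded_linear.linear)
  obtain d where d: "d > 0" "\<And>q. q \<in> S \<Longrightarrow> dist q p < d \<Longrightarrow> dist (\<A> q) (\<A> p) < B / 2"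
    using cont p B(1) unfolding continuous_on_iff by (meson half_gt_zero)
  show ?thesis
  proof (rule exI[of _ "B / 2"], rule exI[of _ d], intro conjI allI impI)
    fix q u assume "q \<in> S" "dist q p < d"
    then have "norm (\<A> q - \<A> p) < B / 2" using d by (simp add: dist_norm)
    then have "norm (\<A> q u - \<A> p u) \<le> B / 2 * norm u"
      using norm_blinfun[of "\<A> q - \<A> p" u] mult_right_mono[of "norm (\<A> q - \<A> p)" "B / 2" "norm u"]
      by (simp add: blinfun.diff_left)
    moreover have "norm (\<A> p u) \<le> norm (\<A> q u) + norm (\<A> q u - \<A> p u)"
      using norm_triangle_sub[of "\<A> p u" "\<A> q u"] by (simp add: norm_minus_commute)
    ultimately show "B / 2 * norm u \<le> norm (\<A> q u)" using B(2)[of u] by simp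
  qed (use B d in auto)
qed

lemma linear_system_continuous:
  fixes \<A> :: "'p::metric_space \<Rightarrow> 'e::euclidean_space \<Rightarrow>\<^sub>L 'e"
  assumes cont: "continuous_on S \<A>" and inj: "\<And>p u. p \<in> S \<Longrightarrow> \<A> p u = 0 \<Longrightarrow> u = 0"
    and k: "continuous_on S \<kappa>" and F: "\<And>p. p \<in> S \<Longrightarrow> \<A> p (F p) = \<kappa> p"
  shows "continuous_on S F"
  unfolding continuous_on_def
proof
  fix p assume p: "p \<in> S"
  obtain c d where cd: "c > 0" "d > 0" "\<And>q u. q \<in> S \<Longrightarrow> dist q p < d \<Longrightarrow> c * norm u \<le> norm (\<A> q u)"
    using linear_system_lower_bound[OF cont _ p] inj by blast
  have "((\<lambda>q. (\<kappa> q - \<A> q (F p)) /\<^sub>R c) \<longlongrightarrow> (\<kappa> p - \<A> p (F p)) /\<^sub>R c) (at p within S)"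
    using cont k p unfolding continuous_on_def by (intro tendsto_intros) auto
  then have lim: "((\<lambda>q. (\<kappa> q - \<A> q (F p)) /\<^sub>R c) \<longlongrightarrow> 0) (at p within S)" using F[OF p] by simp
  have "((\<lambda>q. F q - F p) \<longlongrightarrow> 0) (at p within S)"
  proof (rule Lim_null_comparison[OF _ tendsto_norm_zero[OF lim]])
    show "\<forall>\<^sub>F q in at p within S. norm (F q - F p) \<le> norm ((\<kappa> q - \<A> q (F p)) /\<^sub>R c)"
      unfolding eventually_at
    proof (intro exI[of _ d] conjI ballI impI)
      fix q assume q: "q \<in> S" "q \<noteq> p \<and> dist q p < d"
      have "c * norm (F q - F p) \<le> norm (\<kappa> q - \<A> q (F p))"
        using cd(3)[of q "F q - F p"] q F[of q] by (simp add: blinfun.diff_right)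
      then show "norm (F q - F p) \<le> norm ((\<kappa> q - \<A> q (F p)) /\<^sub>R c)"
        by (simp only: norm_scaleR_inverse[OF cd(1)] pos_le_divide_eq[OF cd(1)] mult.commute)
    qed (rule cd(2))
  qed
  then show "(F \<longlongrightarrow> F p) (at p within S)" by (simp add: LIM_zero_iff)
qed

text \<open>Serves for the Christoffel symbols, which are defined only implicitly by the Koszul
  formula. The derivative is found by differentiating the equation itself, with the lower bound for
  the system in place of a formula for the inverse.\<close>

lemma linear_system_C1f:
  fixes \<A> :: "'p::euclidean_space \<Rightarrow> 'e::euclidean_space \<Rightarrow> 'e"
  assumes A: "\<And>u. C1f S (\<lambda>p. \<A> p u) (\<lambda>p. \<A>' p u)" and lin: "\<And>p. p \<in> S \<Longrightarrow> linear (\<A> p)"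
    and inj: "\<And>p u. p \<in> S \<Longrightarrow> \<A> p u = 0 \<Longrightarrow> u = 0"
    and k: "C1f S \<kappa> \<kappa>'" and F: "\<And>p. p \<in> S \<Longrightarrow> \<A> p (F p) = \<kappa> p"
  shows "\<exists>F'. C1f S F F'"
proof -
  have oS: "open S" using k by (simp add: C1f_def)
  define \<A>b where "\<A>b = (\<lambda>p. Blinfun (\<A> p))"
  have Ab: "blinfun_apply (\<A>b p) = \<A> p" if "p \<in> S" for p
    unfolding \<A>b_def by (rule bounded_linear_Blinfun_apply) (simp add: lin[OF that]
        linear_conv_bounded_linear[symmetric])
  have cA: "continuous_on S (\<lambda>p. \<A> p u)" for u by (rule C1f_continuous_on[OF A])
  have cAb: "continuous_on S \<A>b"
    by (intro continuous_on_blinfun_componentwise) (use cA in \<open>simp add: Ab cong: continuous_on_cong_simp\<close>)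
  have injb: "\<And>p u. p \<in> S \<Longrightarrow> \<A>b p u = 0 \<Longrightarrow> u = 0" using inj Ab by simp
  have cF: "continuous_on S F"
    by (rule linear_system_continuous[OF cAb injb C1f_continuous_on[OF k]]) (use F Ab in auto)
  have surj: "\<exists>v. \<A> p v = w" if "p \<in> S" for p w
  proof -
    have "inj (\<A> p)" using inj[OF that] by (simp add: linear_injective_0[OF lin[OF that]])
    then show ?thesis using linear_injective_imp_surjective[OF lin[OF that] _ refl] by (metis surjD)
  qed
  \<comment> \<open>The solution of the differentiated equation. It is picked separately for every
    \<open>h\<close>; linearity in \<open>h\<close> then follows from injectivity of the
    system.\<close>
  define F' where "F' = (\<lambda>p h. SOME v. \<A> p v = \<kappa>' p h - \<A>' p (F p) h)"
  have F': "\<A> p (F' p h) = \<kappa>' p h - \<A>' p (F p) h" if "p \<in> S" for p h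
    unfolding F'_def by (rule someI_ex) (rule surj[OF that])
  have lin': "linear (\<lambda>w. \<A>' p w h)" if "p \<in> S" for p h
    by (rule C1f_linear_param(2)[OF A lin that])
  have "continuous_on S (\<lambda>p. F' p h)" for h
  proof (rule linear_system_continuous[OF cAb injb])
    have "continuous_on S (\<lambda>p. \<kappa>' p h - (\<Sum>i\<in>Basis. (F p \<bullet> i) *\<^sub>R \<A>' p i h))"
      using k A unfolding C1f_def by (intro continuous_intros cF) auto
    then show "continuous_on S (\<lambda>p. \<kappa>' p h - \<A>' p (F p) h)"
      by (rule continuous_on_eq) (simp add: linear_basis_expand[OF lin', symmetric])
  qed (auto simp: Ab F')
  moreover have "(F has_derivative F' p) (at p)" if p: "p \<in> S" for p
  proof -
    have dk: "(\<kappa> has_derivative \<kappa>' p) (at p)" using k p by (simp add: C1f_def)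
    have dA: "((\<lambda>q. \<A> q (F p)) has_derivative \<A>' p (F p)) (at p)" using A[of "F p"] p by (simp add: C1f_def)
    \<comment> \<open>The residual when the solution is frozen at \<open>p\<close>: it equals the
      system at \<open>q\<close> applied to \<open>F q - F p\<close>, vanishes at \<open>p\<close>,
      and its derivative is the right side that defines \<open>F'\<close>.\<close>
    define \<psi> where "\<psi> = (\<lambda>q. \<kappa> q - \<A> q (F p))"
    have d\<psi>: "(\<psi> has_derivative (\<lambda>h. \<kappa>' p h - \<A>' p (F p) h)) (at p)"
      unfolding \<psi>_def by (intro has_derivative_diff dk dA)
    have linF': "linear (F' p)"
    proof (rule linearI)
      have lk: "linear (\<lambda>h. \<kappa>' p h - \<A>' p (F p) h)"
        using has_derivative_linear[OF d\<psi>] .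
      have inj': "v = w" if "\<A> p v = \<A> p w" for v w
        using inj[OF p, of "v - w"] that linear_diff[OF lin[OF p]] by simp
      show "F' p (b1 + b2) = F' p b1 + F' p b2" for b1 b2
        by (rule inj') (simp add: F'[OF p] linear_add[OF lin[OF p]] linear_add[OF lk])
      show "F' p (r *\<^sub>R b) = r *\<^sub>R F' p b" for r b
        by (rule inj') (simp add: F'[OF p] linear_scale[OF lin[OF p]] linear_scale[OF lk])
    qed
    obtain c d where cd: "c > 0" "d > 0" "\<And>q u. q \<in> S \<Longrightarrow> dist q p < d \<Longrightarrow> c * norm u \<le> norm (\<A>b q u)"
      using linear_system_lower_bound[OF cAb _ p] injb by blast
    have "((\<lambda>q. norm (\<psi> q - \<psi> p - (\<kappa>' p (q - p) - \<A>' p (F p) (q - p))) / norm (q - p) / c +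
         norm (\<A>b q - \<A>b p) * (norm (F' p (q - p)) / norm (q - p)) / c) \<longlongrightarrow> 0 / c + 0) (at p)"
    proof (intro tendsto_add tendsto_divide tendsto_const)
      show "((\<lambda>q. norm (\<psi> q - \<psi> p - (\<kappa>' p (q - p) - \<A>' p (F p) (q - p))) / norm (q - p)) \<longlongrightarrow> 0) (at p)"
        using d\<psi> unfolding has_derivative_iff_norm by simp
      obtain K where K: "\<And>v. norm (F' p v) \<le> K * norm v"
        using linear_bounded[OF linF'] by blast
      have "((\<lambda>q. norm (\<A>b q - \<A>b p) * K) \<longlongrightarrow> norm (\<A>b p - \<A>b p) * K) (at p)"
        using cAb p oS by (intro tendsto_intros) (simp add: continuous_on_eq_continuous_at isCont_def)
      then have lim: "((\<lambda>q. norm (\<A>b q - \<A>b p) * K / c) \<longlongrightarrow> 0) (at p)"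
        using tendsto_divide_zero by fastforce
      show "((\<lambda>q. norm (\<A>b q - \<A>b p) * (norm (F' p (q - p)) / norm (q - p)) / c) \<longlongrightarrow> 0) (at p)"
      proof (rule Lim_null_comparison[OF _ lim])
        have "norm (norm (\<A>b q - \<A>b p) * (norm (F' p (q - p)) / norm (q - p)) / c) \<le>
          norm (\<A>b q - \<A>b p) * K / c"
          if "q \<noteq> p" for q
        proof -
          have "norm (F' p (q - p)) / norm (q - p) \<le> K"
            using K[of "q - p"] that by (simp add: pos_divide_le_eq)
          then have "norm (\<A>b q - \<A>b p) * (norm (F' p (q - p)) / norm (q - p)) / c \<le>
            norm (\<A>b q - \<A>b p) * K / c"
            using cd(1) by (intro divide_right_mono mult_left_mono) auto
          then show ?thesis using cd(1) by simp
        qed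
        then show "\<forall>\<^sub>F q in at p. norm (norm (\<A>b q - \<A>b p) * (norm (F' p (q - p)) / norm (q - p)) / c) \<le>
          norm (\<A>b q - \<A>b p) * K / c"
          unfolding eventually_at_filter by (intro always_eventually) blast
      qed
    qed (use cd in auto)
    then have lim: "((\<lambda>q. norm (\<psi> q - \<psi> p - (\<kappa>' p (q - p) - \<A>' p (F p) (q - p))) / norm (q - p) / c +
         norm (\<A>b q - \<A>b p) * (norm (F' p (q - p)) / norm (q - p)) / c) \<longlongrightarrow> 0) (at p)" by simp
    have "\<forall>\<^sub>F q in at p. norm ((F q - F p - F' p (q - p)) /\<^sub>R norm (q - p)) \<le>
       norm (\<psi> q - \<psi> p - (\<kappa>' p (q - p) - \<A>' p (F p) (q - p))) / norm (q - p) / c +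
         norm (\<A>b q - \<A>b p) * (norm (F' p (q - p)) / norm (q - p)) / c"
    proof -
      obtain d' where d': "d' > 0" "ball p d' \<subseteq> S" using oS p by (meson openE)
      show ?thesis unfolding eventually_at
      proof (intro exI[of _ "min d d'"] conjI ballI impI)
        fix q assume "q \<noteq> p \<and> dist q p < min d d'"
        then have q: "q \<noteq> p" "dist q p < d" "q \<in> S" using d' by (auto simp: dist_commute)
        define E where "E = F q - F p - F' p (q - p)"
        have "\<A>b q E = \<A> q (F q) - \<A> q (F p) - \<A> q (F' p (q - p))"
          by (simp add: E_def Ab q linear_diff[OF lin])
        also have "\<dots> = (\<psi> q - \<psi> p - (\<kappa>' p (q - p) - \<A>' p (F p) (q - p))) - (\<A>b q - \<A>b p) (F' p (q - p))"
          using F[OF q(3)] F[OF p] F'[OF p, of "q - p"] by (simp add: \<psi>_def blinfun.diff_left Ab q p)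
        finally have "norm (\<A>b q E) \<le> norm (\<psi> q - \<psi> p - (\<kappa>' p (q - p) - \<A>' p (F p) (q - p))) + norm ((\<A>b q -
          \<A>b p) (F' p (q - p)))"
          by (simp add: norm_triangle_ineq4)
        also have "norm ((\<A>b q - \<A>b p) (F' p (q - p))) \<le> norm (\<A>b q - \<A>b p) * norm (F' p (q - p))"
          by (rule norm_blinfun)
        finally have "c * norm E \<le> norm (\<psi> q - \<psi> p - (\<kappa>' p (q - p) - \<A>' p (F p) (q - p))) + norm (\<A>b q - \<A>b
          p) * norm (F' p (q - p))"
          using cd(3)[OF q(3,2), of E] by simp
        then have "norm E \<le> (norm (\<psi> q - \<psi> p - (\<kappa>' p (q - p) - \<A>' p (F p) (q - p))) + norm (\<A>b q - \<A>b p) *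
          norm (F' p (q - p))) / c"
          using cd(1) by (simp add: pos_le_divide_eq mult.commute)
        then have *: "norm E / norm (q - p) \<le> (norm (\<psi> q - \<psi> p - (\<kappa>' p (q - p) - \<A>' p (F p) (q - p))) + norm
          (\<A>b q - \<A>b p) * norm (F' p (q - p))) / c / norm (q - p)"
          by (intro divide_right_mono) auto
        show "norm ((F q - F p - F' p (q - p)) /\<^sub>R norm (q - p)) \<le>
          norm (\<psi> q - \<psi> p - (\<kappa>' p (q - p) - \<A>' p (F p) (q - p))) / norm (q - p) / c +
          norm (\<A>b q - \<A>b p) * (norm (F' p (q - p)) / norm (q - p)) / c"
        proof -
          have nq: "0 < norm (q - p)" using q(1) by simp
          show ?thesis using * unfolding E_def norm_scaleR_inverse[OF nq]
            by (simp add: add_divide_distrib mult.commute[of c])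
        qed
      qed (use cd d' in auto)
    qed
    then have "((\<lambda>q. (F q - F p - F' p (q - p)) /\<^sub>R norm (q - p)) \<longlongrightarrow> 0) (at p)"
      by (rule Lim_null_comparison[OF _ lim])
    then show ?thesis
      unfolding has_derivative_def using linF' by (simp add: linear_conv_bounded_linear divide_inverse)
  qed
  ultimately have "C1f S F F'" using oS by (simp add: C1f_def)
  then show ?thesis by blast
qed

text \<open>Raising an index. It yields the Christoffel symbols and later turns the separating
  functional of \<open>subgradient_exists\<close> into a tangent vector.\<close>

lemma posdef_bilinear_riesz:
  fixes B :: "'e::euclidean_space \<Rightarrow> 'e \<Rightarrow> real"
  assumes B: "bilinear B" and pos: "\<And>u. u \<noteq> 0 \<Longrightarrow> B u u > 0" and l: "linear l"
  shows "\<exists>!w. \<forall>z. B w z = l z"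
proof (rule ex_ex1I)
  define A where "A = (\<lambda>w. \<Sum>b\<in>Basis. B w b *\<^sub>R b)"
  have linA: "linear A" unfolding A_def
    by (rule linearI) (simp_all add: bilinear_ladd[OF B] bilinear_lmul[OF B] scaleR_left_distrib sum.distrib
        scaleR_sum_right)
  have lB: "linear (B w)" for w using B by (simp add: bilinear_def)
  have Az: "B w z = A w \<bullet> z" for w z
    by (subst linear_basis_expand[OF lB]) (simp add: A_def inner_sum_left inner_sum_right inner_commute
        mult.commute)
  have "inj A"
  proof (subst linear_injective_0[OF linA], intro allI impI)
    fix u assume "A u = 0"
    then have "B u u = 0" by (simp add: Az)
    then show "u = 0" using pos[of u] by fastforce
  qed
  then have "surj A" by (rule linear_injective_imp_surjective[OF linA _ refl])
  then obtain w where w: "(\<Sum>b\<in>Basis. l b *\<^sub>R b) = A w" by (metis surjD)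
  have "B w z = l z" for z
  proof -
    have "(\<Sum>b\<in>Basis. l b *\<^sub>R b) \<bullet> z = (\<Sum>b\<in>Basis. (z \<bullet> b) *\<^sub>R l b)"
      by (simp add: inner_sum_left inner_commute[of z] mult.commute)
    then show ?thesis using linear_basis_expand[OF l, of z] by (simp only: Az flip: w)
  qed
  then show "\<exists>w. \<forall>z. B w z = l z" by blast
  fix w w' assume "\<forall>z. B w z = l z" "\<forall>z. B w' z = l z"
  then have "B (w - w') (w - w') = 0" by (simp add: bilinear_lsub[OF B])
  then show "w = w'" using pos[of "w - w'"] by fastforce
qed


section \<open>Local Riemannian calculus\<close>

text \<open>One notation for \<open>to_chart\<close> and \<open>from_chart\<close>, which are the
  cases where one of the charts is \<open>chart_at M x\<close>; the chain rule then has the single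
  form \<open>trd_chain\<close>.\<close>

definition trd :: "('m, 'e::euclidean_space) chart \<Rightarrow> ('m, 'e) chart \<Rightarrow> 'm \<Rightarrow> 'e \<Rightarrow> 'e" where
  "trd c d x = frechet_derivative (snd d \<circ> chart_inv c) (at (snd c x))"

lemma to_chart_trd: "to_chart M c x = trd (chart_at M x) c x"
  by (simp add: to_chart_def trd_def)

lemma from_chart_trd: "from_chart M c x = trd c (chart_at M x) x"
  by (simp add: from_chart_def trd_def)

locale riemannian_space =
  fixes M :: "('m::{t2_space,second_countable_topology}, 'e::euclidean_space) riemannian"
  assumes riemannian: "riemannian_manifold M"
begin

lemma
  assumes "c \<in> atlas M"
  shows open_chart: "open (fst c)" and open_chart_image: "open (snd c ` fst c)"
    and continuous_on_chart: "continuous_on (fst c) (snd c)"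
    and continuous_on_chart_inv: "continuous_on (snd c ` fst c) (chart_inv c)"
    and chart_inv_chart [simp]: "x \<in> fst c \<Longrightarrow> chart_inv c (snd c x) = x"
    and chart_chart_inv [simp]: "p \<in> snd c ` fst c \<Longrightarrow> snd c (chart_inv c p) = p"
    and chart_inv_in: "p \<in> snd c ` fst c \<Longrightarrow> chart_inv c p \<in> fst c"
proof -
  have "is_chart c" using riemannian assms by (auto simp: riemannian_manifold_def smooth_atlas_def)
  then show "open (fst c)" "open (snd c ` fst c)" "continuous_on (fst c) (snd c)"
    "continuous_on (snd c ` fst c) (chart_inv c)" "x \<in> fst c \<Longrightarrow> chart_inv c (snd c x) = x"
    "p \<in> snd c ` fst c \<Longrightarrow> snd c (chart_inv c p) = p" "p \<in> snd c ` fst c \<Longrightarrow> chart_inv c p \<in> fst c"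
    by (auto simp: is_chart_def homeomorphism_def)
qed

lemma chart_at: "chart_at M x \<in> atlas M" "x \<in> fst (chart_at M x)"
proof -
  have "\<exists>c. c \<in> atlas M \<and> x \<in> fst c"
    using riemannian unfolding riemannian_manifold_def smooth_atlas_def by blast
  from someI_ex[OF this] show "chart_at M x \<in> atlas M" "x \<in> fst (chart_at M x)"
    by (auto simp: chart_at_def)
qed

lemma open_chart_subset:
  assumes "c \<in> atlas M" "open U"
  shows "open (snd c ` (fst c \<inter> U))"
proof -
  have "snd c ` (fst c \<inter> U) = (snd c ` fst c) \<inter> chart_inv c -` U"
    using assms by (auto simp: image_iff)
  then show ?thesis
    using continuous_open_preimage[OF continuous_on_chart_inv[OF assms(1)] open_chart_image[OF assms(1)]
        assms(2)] by simp
qed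

lemma C1f_transition:
  assumes "c \<in> atlas M" "d \<in> atlas M"
  shows "C1f (snd c ` (fst c \<inter> fst d)) (snd d \<circ> chart_inv c)
      (\<lambda>p. frechet_derivative (snd d \<circ> chart_inv c) (at p))"
    and "C1f (snd c ` (fst c \<inter> fst d)) (\<lambda>p. frechet_derivative (snd d \<circ> chart_inv c) (at p) v)
      (\<lambda>p. frechet_derivative (\<lambda>p. frechet_derivative (snd d \<circ> chart_inv c) (at p) v) (at p))"
proof -
  have s: "smooth_on (snd c ` (fst c \<inter> fst d)) (snd d \<circ> chart_inv c)"
    using riemannian assms unfolding riemannian_manifold_def smooth_atlas_def by blast
  have o: "open (snd c ` (fst c \<inter> fst d))"
    by (intro open_chart_subset assms open_chart)
  show "C1f (snd c ` (fst c \<inter> fst d)) (snd d \<circ> chart_inv c)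
      (\<lambda>p. frechet_derivative (snd d \<circ> chart_inv c) (at p))"
    by (rule smooth_on_C1f[OF o s])
  show "C1f (snd c ` (fst c \<inter> fst d)) (\<lambda>p. frechet_derivative (snd d \<circ> chart_inv c) (at p) v)
      (\<lambda>p. frechet_derivative (\<lambda>p. frechet_derivative (snd d \<circ> chart_inv c) (at p) v) (at p))"
    by (rule smooth_on_C1f[OF o smooth_on_frechet[OF s]])
qed

lemma trd_derivative:
  assumes "c \<in> atlas M" "d \<in> atlas M" "x \<in> fst c" "x \<in> fst d"
  shows "(snd d \<circ> chart_inv c has_derivative trd c d x) (at (snd c x))"
  using C1f_transition(1)[OF assms(1,2)] assms(3,4) unfolding C1f_def trd_def by blast

lemma linear_trd:
  assumes "c \<in> atlas M" "d \<in> atlas M" "x \<in> fst c" "x \<in> fst d"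
  shows "linear (trd c d x)"
  using trd_derivative[OF assms] by (rule has_derivative_linear)

lemma trd_chain:
  assumes c: "c \<in> atlas M" "d \<in> atlas M" "e \<in> atlas M" and x: "x \<in> fst c" "x \<in> fst d" "x \<in> fst e"
  shows "trd d e x (trd c d x v) = trd c e x v"
proof -
  have inv: "(snd d \<circ> chart_inv c) (snd c x) = snd d x" using c x by simp
  have "((snd e \<circ> chart_inv d) \<circ> (snd d \<circ> chart_inv c) has_derivative trd d e x \<circ> trd c d x) (at (snd c x))"
    by (rule diff_chain_at[OF trd_derivative]) (use c x inv trd_derivative in simp_all)
  then have "(snd e \<circ> chart_inv c has_derivative trd d e x \<circ> trd c d x) (at (snd c x))"
    by (rule has_derivative_transform_within_open[OF _ open_chart_subset[OF c(1) open_chart[OF c(2)]]])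
      (use c x in auto)
  then have "trd d e x \<circ> trd c d x = trd c e x"
    using trd_derivative[OF c(1,3) x(1,3)] by (rule has_derivative_unique)
  then show ?thesis by (metis comp_apply)
qed

lemma trd_same:
  assumes "c \<in> atlas M" "x \<in> fst c"
  shows "trd c c x v = v"
proof -
  have "((\<lambda>p. p) has_derivative (\<lambda>v. v)) (at (snd c x))" by (rule has_derivative_ident)
  then have "(snd c \<circ> chart_inv c has_derivative (\<lambda>v. v)) (at (snd c x))"
    by (rule has_derivative_transform_within_open[OF _ open_chart_image[OF assms(1)]]) (use assms in auto)
  from has_derivative_unique[OF trd_derivative[OF assms(1,1,2,2)] this] show ?thesis by simp
qed

abbreviation g :: "('m, 'e) chart \<Rightarrow> 'e \<Rightarrow> 'e \<Rightarrow> 'e \<Rightarrow> real" where "g \<equiv> local_metric M"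

abbreviation \<Gamma> :: "('m, 'e) chart \<Rightarrow> 'e \<Rightarrow> 'e \<Rightarrow> 'e \<Rightarrow> 'e" where "\<Gamma> \<equiv> christoffel M"

lemma metric_bilinear: "bilinear (metric M x)"
  and metric_sym: "metric M x u v = metric M x v u"
  and metric_pos: "u \<noteq> 0 \<Longrightarrow> metric M x u u > 0"
  using riemannian unfolding riemannian_manifold_def by blast+

lemma metric_nonneg: "metric M x u u \<ge> 0"
  using metric_pos[of u x] bilinear_lzero[OF metric_bilinear] by (cases "u = 0") (auto simp: less_imp_le)

lemma g_eq: "c \<in> atlas M \<Longrightarrow> x \<in> fst c \<Longrightarrow> g c (snd c x) u v =
  metric M x (trd c (chart_at M x) x u) (trd c (chart_at M x) x v)"
  by (simp add: local_metric_def from_chart_trd)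

lemma g_trd:
  assumes "c \<in> atlas M" "d \<in> atlas M" "x \<in> fst c" "x \<in> fst d"
  shows "g d (snd d x) (trd c d x u) (trd c d x v) = g c (snd c x) u v"
  using assms chart_at by (simp add: g_eq trd_chain)

lemma g_chart_at: "g (chart_at M x) (snd (chart_at M x) x) u v = metric M x u v"
  using chart_at by (simp add: g_eq trd_same)

lemma metric_to_chart:
  assumes "c \<in> atlas M" "x \<in> fst c"
  shows "metric M x u v = g c (snd c x) (to_chart M c x u) (to_chart M c x v)"
  using assms chart_at by (simp add: g_eq to_chart_trd trd_chain trd_same)

lemma
  assumes "c \<in> atlas M" "p \<in> snd c ` fst c"
  shows g_bilinear: "bilinear (g c p)" and g_sym: "g c p u v = g c p v u"
    and g_pos: "u \<noteq> 0 \<Longrightarrow> g c p u u > 0"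
proof -
  obtain x where x: "x \<in> fst c" "p = snd c x" using assms by auto
  note gx = g_eq[OF assms(1) x(1)]
  have l: "linear (trd c (chart_at M x) x)" by (intro linear_trd assms x chart_at)
  show "bilinear (g c p)"
    unfolding bilinear_def x(2) gx
    by (auto intro!: linearI simp: linear_add[OF l] linear_scale[OF l] bilinear_ladd[OF metric_bilinear]
        bilinear_radd[OF metric_bilinear] bilinear_lmul[OF metric_bilinear] bilinear_rmul[OF metric_bilinear])
  show "g c p u v = g c p v u" by (simp add: x gx metric_sym)
  assume u: "u \<noteq> 0"
  have "trd (chart_at M x) c x (trd c (chart_at M x) x u) = u"
    using assms x chart_at by (simp add: trd_chain trd_same)
  moreover have "trd (chart_at M x) c x 0 = 0"
    by (intro linear_0 linear_trd assms x chart_at)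
  ultimately have "trd c (chart_at M x) x u \<noteq> 0" using u by metis
  then show "g c p u u > 0" by (simp add: x gx metric_pos)
qed

lemma g_nonneg: "c \<in> atlas M \<Longrightarrow> p \<in> snd c ` fst c \<Longrightarrow> g c p u u \<ge> 0"
  using g_pos[of c p u] bilinear_lzero[OF g_bilinear, of c p] by (cases "u = 0") (auto simp: less_imp_le)

definition dg :: "('m, 'e) chart \<Rightarrow> 'e \<Rightarrow> 'e \<Rightarrow> 'e \<Rightarrow> 'e \<Rightarrow> real" where
  "dg c p u v = frechet_derivative (\<lambda>q. g c q u v) (at p)"

lemma smooth_g: "c \<in> atlas M \<Longrightarrow> smooth_on (snd c ` fst c) (\<lambda>p. g c p u v)"
  using riemannian unfolding riemannian_manifold_def by blast

lemma C1f_g: "c \<in> atlas M \<Longrightarrow> C1f (snd c ` fst c) (\<lambda>p. g c p u v) (\<lambda>p. dg c p u v)"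
  unfolding dg_def by (intro smooth_on_C1f open_chart_image smooth_g)

lemma C1f_dg: "c \<in> atlas M \<Longrightarrow> \<exists>D. C1f (snd c ` fst c) (\<lambda>p. dg c p u v h) D"
  unfolding dg_def using smooth_on_C1f[OF open_chart_image smooth_on_frechet[OF smooth_g]] by blast

lemma linear_dg:
  assumes "c \<in> atlas M" "p \<in> snd c ` fst c"
  shows "linear (dg c p u v)" "linear (\<lambda>u. dg c p u v h)" "linear (\<lambda>v. dg c p u v h)"
proof -
  show "linear (dg c p u v)" using C1f_bounded_linear[OF C1f_g[OF assms(1)] assms(2)] bounded_linear.linear
    by blast
  have lin: "linear (\<lambda>u. g c p u v)" "linear (g c p u)" if "p \<in> snd c ` fst c" for p u v
    using g_bilinear[OF assms(1) that] by (auto simp: bilinear_def)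
  show "linear (\<lambda>u. dg c p u v h)"
    by (rule C1f_linear_param(2)[OF C1f_g[OF assms(1), where v = v] _ assms(2)]) (rule lin)
  show "linear (\<lambda>v. dg c p u v h)"
    by (rule C1f_linear_param(2)[OF C1f_g[OF assms(1), where u = u] _ assms(2)]) (rule lin)
qed

lemma dg_sym:
  assumes "c \<in> atlas M" "p \<in> snd c ` fst c"
  shows "dg c p u v h = dg c p v u h"
proof -
  have "((\<lambda>p. g c p u v) has_derivative dg c p u v) (at p)" using C1f_g[OF assms(1)] assms(2)
    by (auto simp: C1f_def)
  then have "((\<lambda>p. g c p v u) has_derivative dg c p u v) (at p)"
    by (rule has_derivative_transform_within_open[OF _ open_chart_image[OF assms(1)] assms(2)]) (simp add:
        g_sym assms)
  then show ?thesis using frechet_derivative_at[of "\<lambda>p. g c p v u"] by (simp add: dg_def)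
qed

text \<open>Gives meaning to the definite description in \<open>christoffel\<close>: the right side
  of the Koszul formula is linear in \<open>z\<close>.\<close>

lemma christoffel_ex1:
  assumes "c \<in> atlas M" "p \<in> snd c ` fst c"
  shows "\<exists>!w. \<forall>z. 2 * g c p w z = dg c p v z u + dg c p u z v - dg c p u v z"
proof -
  have "linear (\<lambda>z. (dg c p v z u + dg c p u z v - dg c p u v z) / 2)"
    unfolding linear_iff linear_add[OF linear_dg(1)[OF assms]] linear_add[OF linear_dg(2)[OF assms]]
        linear_add[OF linear_dg(3)[OF assms]]
      linear_scale[OF linear_dg(1)[OF assms]] linear_scale[OF linear_dg(2)[OF assms]] linear_scale[OF
        linear_dg(3)[OF assms]]
    by (simp add: real_scaleR_def field_simps)
  from posdef_bilinear_riesz[OF g_bilinear[OF assms] g_pos[OF assms] this]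
  have "\<exists>!w. \<forall>z. g c p w z = (dg c p v z u + dg c p u z v - dg c p u v z) / 2" by blast
  moreover have "(g c p w z = (dg c p v z u + dg c p u z v - dg c p u v z) / 2) \<longleftrightarrow>
     (2 * g c p w z = dg c p v z u + dg c p u z v - dg c p u v z)" for w z by auto
  ultimately show ?thesis by simp
qed

lemma christoffel:
  assumes "c \<in> atlas M" "p \<in> snd c ` fst c"
  shows "2 * g c p (\<Gamma> c p u v) z = dg c p v z u + dg c p u z v - dg c p u v z"
  using theI'[OF christoffel_ex1[OF assms, of v u]] unfolding christoffel_def dg_def by blast

lemma g_nondegenerate:
  assumes "c \<in> atlas M" "p \<in> snd c ` fst c" "\<And>z. g c p w z = g c p w' z"
  shows "w = w'"
proof -
  have "g c p (w - w') (w - w') = 0" using assms(3) by (simp add: bilinear_lsub[OF g_bilinear[OF assms(1,2)]])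
  then show ?thesis using g_pos[OF assms(1,2), of "w - w'"] by fastforce
qed

lemma christoffel_sym:
  assumes "c \<in> atlas M" "p \<in> snd c ` fst c"
  shows "\<Gamma> c p u v = \<Gamma> c p v u"
proof (rule g_nondegenerate[OF assms])
  show "g c p (\<Gamma> c p u v) z = g c p (\<Gamma> c p v u) z" for z
    using christoffel[OF assms, of u v z] christoffel[OF assms, of v u z] dg_sym[OF assms, of u v z] by simp
qed

lemma christoffel_linear:
  assumes "c \<in> atlas M" "p \<in> snd c ` fst c"
  shows "linear (\<Gamma> c p u)" "linear (\<lambda>u. \<Gamma> c p u v)"
proof -
  note b = g_bilinear[OF assms] and l = linear_dg[OF assms]
  have 1: "linear (\<Gamma> c p u)" for u
  proof (rule linearI)
    show "\<Gamma> c p u (v + v') = \<Gamma> c p u v + \<Gamma> c p u v'" for v v'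
    proof (rule g_nondegenerate[OF assms])
      fix z
      have "2 * g c p (\<Gamma> c p u (v + v')) z = 2 * g c p (\<Gamma> c p u v + \<Gamma> c p u v') z"
        unfolding bilinear_ladd[OF b] ring_distribs christoffel[OF assms] linear_add[OF l(1)] linear_add[OF
            l(2)] linear_add[OF l(3)] by simp
      then show "g c p (\<Gamma> c p u (v + v')) z = g c p (\<Gamma> c p u v + \<Gamma> c p u v') z" by simp
    qed
    show "\<Gamma> c p u (r *\<^sub>R v) = r *\<^sub>R \<Gamma> c p u v" for r v
    proof (rule g_nondegenerate[OF assms])
      fix z
      have "2 * g c p (\<Gamma> c p u (r *\<^sub>R v)) z = r * (2 * g c p (\<Gamma> c p u v) z)"
        unfolding christoffel[OF assms] linear_scale[OF l(1)] linear_scale[OF l(2)] linear_scale[OF l(3)]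
            by (simp add: real_scaleR_def algebra_simps)
      then show "g c p (\<Gamma> c p u (r *\<^sub>R v)) z = g c p (r *\<^sub>R \<Gamma> c p u v) z" by (simp add: bilinear_lmul[OF b])
    qed
  qed
  then show "linear (\<Gamma> c p u)" .
  have "(\<lambda>u. \<Gamma> c p u v) = \<Gamma> c p v" using christoffel_sym[OF assms] by auto
  then show "linear (\<lambda>u. \<Gamma> c p u v)" using 1[of v] by simp
qed

text \<open>Compatibility of the connection with the metric. In the sum of the Koszul formulas for
  \<open>(w, u, v)\<close> and \<open>(w, v, u)\<close> the derivatives in the directions u and v
  cancel.\<close>

lemma dg_christoffel:
  assumes "c \<in> atlas M" "p \<in> snd c ` fst c"
  shows "dg c p u v w = g c p (\<Gamma> c p w u) v + g c p u (\<Gamma> c p w v)"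
  using christoffel[OF assms, of w u v] christoffel[OF assms, of w v u]
    g_sym[OF assms, of u "\<Gamma> c p w v"] dg_sym[OF assms, of v u w] by linarith

definition d\<Gamma> :: "('m, 'e) chart \<Rightarrow> 'e \<Rightarrow> 'e \<Rightarrow> 'e \<Rightarrow> 'e \<Rightarrow> 'e" where
  "d\<Gamma> c p u v = frechet_derivative (\<lambda>q. \<Gamma> c q u v) (at p)"

lemma C1f_christoffel:
  assumes c: "c \<in> atlas M"
  shows "C1f (snd c ` fst c) (\<lambda>p. \<Gamma> c p u v) (\<lambda>p. d\<Gamma> c p u v)"
proof -
  let ?S = "snd c ` fst c"
  \<comment> \<open>The Koszul formula tested on basis vectors: \<A> lowers the index, \<kappa>
    collects the right sides, and the Christoffel symbol solves the resulting linear system.\<close>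
  define \<A> where "\<A> = (\<lambda>p w. \<Sum>b\<in>Basis. g c p w b *\<^sub>R b)"
  define \<kappa> where "\<kappa> = (\<lambda>p. \<Sum>b\<in>Basis. ((dg c p v b u + dg c p u b v - dg c p u v b) / 2) *\<^sub>R b)"
  have sumC1: "\<exists>D. C1f ?S (\<lambda>p. \<Sum>b\<in>Basis. F p b *\<^sub>R b) D" if ex: "\<And>b. b \<in> Basis \<Longrightarrow> \<exists>D. C1f ?S (\<lambda>p. F p b) D"
    for F :: "'e \<Rightarrow> 'e \<Rightarrow> real"
  proof -
    define D where "D = (\<lambda>b. SOME D. C1f ?S (\<lambda>p. F p b) D)"
    have D: "C1f ?S (\<lambda>p. F p b) (D b)" if "b \<in> Basis" for b
      unfolding D_def by (rule someI_ex[of "C1f ?S (\<lambda>p. F p b)"]) (rule ex[OF that])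
    have "C1f ?S (\<lambda>p. \<Sum>b\<in>Basis. F p b *\<^sub>R b) (\<lambda>p h. \<Sum>b\<in>Basis. D b p h *\<^sub>R b)"
      unfolding C1f_def
    proof (intro conjI ballI allI)
      show "((\<lambda>p. \<Sum>b\<in>Basis. F p b *\<^sub>R b) has_derivative (\<lambda>h. \<Sum>b\<in>Basis. D b p h *\<^sub>R b)) (at p)"
        if "p \<in> ?S" for p
        using D that by (intro has_derivative_sum has_derivative_scaleR_left) (auto simp: C1f_def)
      show "continuous_on ?S (\<lambda>p. \<Sum>b\<in>Basis. D b p h *\<^sub>R b)" for h
        using D by (intro continuous_intros) (auto simp: C1f_def)
    qed (rule open_chart_image[OF c])
    then show ?thesis by blast
  qed
  have "\<exists>D. C1f ?S (\<lambda>p. \<A> p w) D" for w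
    unfolding \<A>_def by (rule sumC1) (use C1f_g[OF c] in blast)
  then have ex: "\<forall>w. \<exists>D. C1f ?S (\<lambda>p. \<A> p w) D" by blast
  obtain D where "\<And>w. C1f ?S (\<lambda>p. \<A> p w) (D w)" using choice[OF ex] by blast
  moreover define \<A>' where "\<A>' = (\<lambda>p w. D w p)"
  ultimately have A': "\<And>w. C1f ?S (\<lambda>p. \<A> p w) (\<lambda>p. \<A>' p w)" by simp
  have "\<exists>D. C1f ?S \<kappa> D" unfolding \<kappa>_def
  proof (rule sumC1)
    fix b
    obtain D1 D2 D3 where D: "C1f ?S (\<lambda>p. dg c p v b u) D1" "C1f ?S (\<lambda>p. dg c p u b v) D2" "C1f ?S (\<lambda>p. dg c
      p u v b) D3"
      using C1f_dg[OF c] by metis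
    have "C1f ?S (\<lambda>p. (dg c p v b u + dg c p u b v - dg c p u v b) / 2) (\<lambda>p h. (D1 p h + D2 p h - D3 p h) /
      2)"
      using D unfolding C1f_def
      by (auto intro!: bounded_linear.has_derivative[OF bounded_linear_divide] derivative_intros
          continuous_intros)
    then show "\<exists>D. C1f ?S (\<lambda>p. (dg c p v b u + dg c p u b v - dg c p u v b) / 2) D" by blast
  qed
  then obtain \<kappa>' where k: "C1f ?S \<kappa> \<kappa>'" by blast
  have lin: "linear (\<A> p)" if "p \<in> ?S" for p
    unfolding \<A>_def using g_bilinear[OF c that]
    by (intro linearI) (simp_all add: bilinear_ladd bilinear_lmul scaleR_left_distrib sum.distrib
        scaleR_sum_right)
  have "\<exists>F'. C1f ?S (\<lambda>p. \<Gamma> c p u v) F'"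
  proof (rule linear_system_C1f[OF A' lin _ k])
    fix p assume p: "p \<in> ?S"
    have l: "linear (g c p w)" for w using g_bilinear[OF c p] by (simp add: bilinear_def)
    show "w = 0" if "\<A> p w = 0" for w
    proof -
      have "g c p w w = \<A> p w \<bullet> w"
        by (subst linear_basis_expand[OF l], simp add: \<A>_def inner_sum_left) (simp add: inner_commute
            mult.commute)
      then show ?thesis using g_pos[OF c p, of w] that by fastforce
    qed
    have "g c p (\<Gamma> c p u v) b = (dg c p v b u + dg c p u b v - dg c p u v b) / 2" for b
      using christoffel[OF c p, of u v b] by simp
    then show "\<A> p (\<Gamma> c p u v) = \<kappa> p" by (simp only: \<A>_def \<kappa>_def)
  qed
  then obtain F' where F': "C1f ?S (\<lambda>p. \<Gamma> c p u v) F'" by blast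
  have "F' p = d\<Gamma> c p u v" if "p \<in> ?S" for p
    unfolding d\<Gamma>_def by (rule C1f_frechet[OF F' that, symmetric])
  with F' show ?thesis by (rule C1f_cong)
qed

lemma christoffel_linear_d\<Gamma>:
  assumes "c \<in> atlas M" "p \<in> snd c ` fst c"
  shows "linear (d\<Gamma> c p u v)" "linear (\<lambda>u. d\<Gamma> c p u v h)" "linear (\<lambda>v. d\<Gamma> c p u v h)"
  using C1f_bounded_linear[OF C1f_christoffel[OF assms(1)] assms(2)] bounded_linear.linear
    C1f_linear_param(2)[OF C1f_christoffel[OF assms(1),
      where u = u] christoffel_linear(1)[OF assms(1)] assms(2)]
    C1f_linear_param(2)[OF C1f_christoffel[OF assms(1),
      where v = v] christoffel_linear(2)[OF assms(1)] assms(2)]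
  by blast+

lemma d\<Gamma>_sym:
  assumes "c \<in> atlas M" "p \<in> snd c ` fst c"
  shows "d\<Gamma> c p u v h = d\<Gamma> c p v u h"
proof -
  have "((\<lambda>p. \<Gamma> c p u v) has_derivative d\<Gamma> c p u v) (at p)" using C1f_christoffel[OF assms(1)] assms(2)
    by (auto simp: C1f_def)
  then have "((\<lambda>p. \<Gamma> c p v u) has_derivative d\<Gamma> c p u v) (at p)"
    by (rule has_derivative_transform_within_open[OF _ open_chart_image[OF assms(1)] assms(2)]) (simp add:
        christoffel_sym assms)
  then show ?thesis using frechet_derivative_at[of "\<lambda>p. \<Gamma> c p v u"] by (simp add: d\<Gamma>_def)
qed

lemma C1f_christoffel2:
  assumes "c \<in> atlas M"
  shows "C1f ((snd c ` fst c) \<times> UNIV) (\<lambda>z. \<Gamma> c (fst z) u (snd z)) (\<lambda>z d. d\<Gamma> c (fst z) u (snd z) (fst d) + \<Gamma> c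
      (fst z) u (snd d))"
  by (rule C1f_linear_param(1)[OF C1f_christoffel[OF assms] christoffel_linear(1)[OF assms]])

text \<open>The point \<open>((p, v), u)\<close> stands for \<open>\<Gamma> c p u v\<close>. The
  nesting arises because \<open>C1f_linear_param\<close> is applied twice, first in v and then in
  u.\<close>

lemma C1f_christoffel3:
  assumes c: "c \<in> atlas M"
  shows "C1f (((snd c ` fst c) \<times> UNIV) \<times> UNIV) (\<lambda>z. \<Gamma> c (fst (fst z)) (snd z) (snd (fst z)))
    (\<lambda>z d. d\<Gamma> c (fst (fst z)) (snd z) (snd (fst z)) (fst (fst d)) + \<Gamma> c (fst (fst z)) (snd z) (snd (fst d))
      + \<Gamma> c (fst (fst z)) (snd d) (snd (fst z)))"
  by (rule C1f_linear_param(1)[OF C1f_christoffel2[OF c]]) (use christoffel_linear(2)[OF c] in auto)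

lemma C1f_g3:
  assumes c: "c \<in> atlas M"
  shows "C1f (((snd c ` fst c) \<times> UNIV) \<times> UNIV) (\<lambda>z. g c (fst (fst z)) (snd z) (snd (fst z)))
    (\<lambda>z d. dg c (fst (fst z)) (snd z) (snd (fst z)) (fst (fst d)) + g c (fst (fst z)) (snd z) (snd (fst d))
      + g c (fst (fst z)) (snd d) (snd (fst z)))"
proof -
  have b: "linear (g c p u)" "linear (\<lambda>u. g c p u v)" if "p \<in> snd c ` fst c" for p u v
    using g_bilinear[OF c that] by (auto simp: bilinear_def)
  show ?thesis
    by (rule C1f_linear_param(1)[OF C1f_linear_param(1)[OF C1f_g[OF c] b(1)]]) (use b(2) in auto)
qed

section \<open>The geodesic equation as a first order system\<close>

definition spray :: "('m, 'e) chart \<Rightarrow> 'e \<times> 'e \<Rightarrow> 'e \<times> 'e" where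
  "spray c z = (snd z, - \<Gamma> c (fst z) (snd z) (snd z))"

text \<open>The linearized geodesic equation. Its solutions are pairs of a Jacobi field and the
  derivative of its coordinates; the factor 2 merges two Christoffel terms by symmetry.\<close>

definition spray' :: "('m, 'e) chart \<Rightarrow> 'e \<times> 'e \<Rightarrow> 'e \<times> 'e \<Rightarrow> 'e \<times> 'e" where
  "spray' c z d = (snd d, - (d\<Gamma> c (fst z) (snd z) (snd z) (fst d) + 2 *\<^sub>R \<Gamma> c (fst z) (snd z) (snd d)))"

lemma C1f_spray:
  assumes c: "c \<in> atlas M"
  shows "C1f ((snd c ` fst c) \<times> UNIV) (spray c) (spray' c)"
proof -
  let ?S = "(snd c ` fst c) \<times> (UNIV :: 'e set)"
  have oS: "open ?S" by (simp add: open_Times open_chart_image[OF c])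
  have dup: "C1f ?S (\<lambda>z. (z, snd z)) (\<lambda>_ d. (d, snd d))"
    by (rule C1f_bounded_linear_fun[OF _ oS]) (intro bounded_linear_Pair bounded_linear_ident
        bounded_linear_snd)
  have "C1f ?S (\<lambda>z. (snd z, - \<Gamma> c (fst z) (snd z) (snd z)))
    (\<lambda>z d. (snd d, - (d\<Gamma> c (fst z) (snd z) (snd z) (fst d) + \<Gamma> c (fst z) (snd z) (snd d) + \<Gamma> c (fst z) (snd
      d) (snd z))))"
    by (rule C1f_pair[OF C1f_bounded_linear_fun[OF bounded_linear_snd oS] C1f_uminus])
      (rule C1f_compose[OF dup C1f_christoffel3[OF c], simplified], auto)
  moreover have "(\<lambda>z. (snd z, - \<Gamma> c (fst z) (snd z) (snd z))) = spray c" by (simp add: spray_def fun_eq_iff)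
  ultimately have H: "C1f ?S (spray c)
    (\<lambda>z d. (snd d, - (d\<Gamma> c (fst z) (snd z) (snd z) (fst d) + \<Gamma> c (fst z) (snd z) (snd d) + \<Gamma> c (fst z) (snd
      d) (snd z))))"
    by metis
  have "(snd d, - (d\<Gamma> c (fst z) (snd z) (snd z) (fst d) + \<Gamma> c (fst z) (snd z) (snd d) + \<Gamma> c (fst z) (snd d)
    (snd z))) = spray' c z d"
    if "z \<in> ?S" for z d
  proof -
    have "fst z \<in> snd c ` fst c" using that by auto
    then show ?thesis using christoffel_sym[OF c, of "fst z" "snd d" "snd z"]
      by (simp add: spray'_def scaleR_2 add.assoc)
  qed
  then show ?thesis by (intro C1f_cong[OF H]) blast
qed

definition trT :: "('m, 'e) chart \<Rightarrow> ('m, 'e) chart \<Rightarrow> 'e \<times> 'e \<Rightarrow> 'e \<times> 'e" where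
  "trT c d z = (snd d (chart_inv c (fst z)), trd c d (chart_inv c (fst z)) (snd z))"

text \<open>The second component contains a first derivative of the coordinate change, so two
  derivatives of it enter here. The extra clause on the first component of \<open>D\<close> says
  that positions vary by tangent vectors, whence the chart independence of Jacobi fields.\<close>

lemma C1f_trT:
  assumes c: "c \<in> atlas M" "d \<in> atlas M"
  shows "\<exists>D. C1f ((snd c ` (fst c \<inter> fst d)) \<times> UNIV) (trT c d) D \<and>
    (\<forall>z h. fst (D z h) = trd c d (chart_inv c (fst z)) (fst h))"
proof -
  let ?W = "snd c ` (fst c \<inter> fst d)"
  let ?D = "\<lambda>p. frechet_derivative (snd d \<circ> chart_inv c) (at p)"
  let ?D2 = "\<lambda>p v. frechet_derivative (\<lambda>p. frechet_derivative (snd d \<circ> chart_inv c) (at p) v) (at p)"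
  have lin: "linear (?D p)" if "p \<in> ?W" for p
    using C1f_bounded_linear[OF C1f_transition(1)[OF c] that] bounded_linear.linear by blast
  have C: "C1f (?W \<times> UNIV) (\<lambda>z. ((snd d \<circ> chart_inv c) (fst z), ?D (fst z) (snd z)))
     (\<lambda>z h. (?D (fst z) (fst h), ?D2 (fst z) (snd z) (fst h) + ?D (fst z) (snd h)))"
    by (rule C1f_pair[OF C1f_fst[OF C1f_transition(1)[OF c]] C1f_linear_param(1)[OF C1f_transition(2)[OF c]
        lin]])
  have "C1f (?W \<times> UNIV) (trT c d)
     (\<lambda>z h. (trd c d (chart_inv c (fst z)) (fst h), ?D2 (fst z) (snd z) (fst h) + ?D (fst z) (snd h)))"
  proof -
    have tr: "trd c d (chart_inv c p) = ?D p" if "p \<in> ?W" for p using that c by (auto simp: trd_def)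
    have trT: "trT c d z = ((snd d \<circ> chart_inv c) (fst z), ?D (fst z) (snd z))" if "z \<in> ?W \<times> UNIV" for z
      using that by (auto simp: trT_def tr)
    show ?thesis unfolding C1f_def
    proof (intro conjI ballI allI)
      show op: "open (?W \<times> (UNIV :: 'e set))" using C by (simp add: C1f_def)
      fix z assume z: "z \<in> ?W \<times> (UNIV :: 'e set)"
      then have "fst z \<in> ?W" by auto
      show "(trT c d has_derivative (\<lambda>h. (trd c d (chart_inv c (fst z)) (fst h), ?D2 (fst z) (snd z) (fst h)
        + ?D (fst z) (snd h)))) (at z)"
        unfolding tr[OF \<open>fst z \<in> ?W\<close>]
        by (rule has_derivative_transform_within_open[OF _ op z, of "\<lambda>z. ((snd d \<circ> chart_inv c) (fst z), ?D
            (fst z) (snd z))"])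
          (use C z trT in \<open>auto simp: C1f_def\<close>)
    next
      fix h
      have "continuous_on (?W \<times> UNIV) (\<lambda>z. (?D (fst z) (fst h), ?D2 (fst z) (snd z) (fst h) + ?D (fst z) (snd
        h)))"
        using C by (simp add: C1f_def)
      then show "continuous_on (?W \<times> UNIV) (\<lambda>z. (trd c d (chart_inv c (fst z)) (fst h), ?D2 (fst z) (snd z)
        (fst h) + ?D (fst z) (snd h)))"
        by (rule continuous_on_eq) (use tr in auto)
    qed
  qed
  then show ?thesis by (intro exI[of _ "\<lambda>z h. (trd c d (chart_inv c (fst z)) (fst h), ?D2 (fst z) (snd z)
    (fst h) + ?D (fst z) (snd h))"]) simp
qed

end

text \<open>It is enough to carry \<open>P\<close> forward inside a neighbourhood of each time,
  typically one during which a curve stays in a single chart. The neighbourhood must work for every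
  start \<open>s\<close> in it, so that nothing has to be known at \<open>t\<close> itself.\<close>

lemma interval_propagate:
  fixes a b t :: real
  assumes t: "t \<in> {a..b}" and "P a"
    and step: "\<And>t. t \<in> {a..b} \<Longrightarrow> \<exists>\<epsilon>>0. \<forall>s r. s \<in> {a..b} \<and> r \<in> {a..b} \<and> s \<le> r \<and> t - \<epsilon> < s \<and> r < t + \<epsilon> \<and> P s \<longrightarrow>
        P r"
  shows "P t"
  using t
proof (induction rule: real_induction)
  case start
  show ?case by fact
next
  case (left t)
  then obtain \<epsilon> where \<epsilon>: "\<epsilon> > 0" "\<forall>s r. s \<in> {a..b} \<and> r \<in> {a..b} \<and> s \<le> r \<and> t - \<epsilon> < s \<and> r < t + \<epsilon> \<and> P s \<longrightarrow> P r"
    using step[of t] by auto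
  define s where "s = max a (t - \<epsilon> / 2)"
  have s: "a \<le> s" "s < t" "t - \<epsilon> < s" using left(1) \<epsilon>(1) by (auto simp: s_def)
  show ?case using \<epsilon>(2)[rule_format, of s t] left(3)[OF s(1,2)] s \<epsilon>(1) left(1,2) by auto
next
  case (right t)
  then obtain \<epsilon> where \<epsilon>: "\<epsilon> > 0" "\<forall>s r. s \<in> {a..b} \<and> r \<in> {a..b} \<and> s \<le> r \<and> t - \<epsilon> < s \<and> r < t + \<epsilon> \<and> P s \<longrightarrow> P r"
    using step[of t] by auto
  have "P t" using right(3)[of t] right(1) by simp
  then have "P s" if "t < s \<and> s < t + \<epsilon> \<and> s \<le> b" for s
    using \<epsilon>(2)[rule_format, of t s] \<epsilon>(1) right(1,2) that by auto
  then show ?case using \<epsilon>(1) by blast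
qed

section \<open>Geodesics in charts\<close>

text \<open>The point of phase space on which \<open>spray\<close> acts. The derivative is relative
  to \<open>I\<close>, so end points of an interval are included.\<close>

definition ph :: "('m, 'e::euclidean_space) chart \<Rightarrow> real set \<Rightarrow> (real \<Rightarrow> 'm) \<Rightarrow> real \<Rightarrow> 'e \<times> 'e" where
  "ph c I \<gamma> t = (snd c (\<gamma> t), vector_derivative (\<lambda>r. snd c (\<gamma> r)) (at t within I))"

lemma fst_ph [simp]: "fst (ph c I \<gamma> t) = snd c (\<gamma> t)"
  by (simp add: ph_def)

lemma velocity_ph: "velocity M I \<gamma> t = snd (ph (chart_at M (\<gamma> t)) I \<gamma> t)"
  by (simp add: velocity_def ph_def)

lemma geodesic_on_subset: "geodesic_on M I \<gamma> \<Longrightarrow> J \<subseteq> I \<Longrightarrow> geodesic_on M J \<gamma>"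
  unfolding geodesic_on_def
  by (meson continuous_on_subset has_vector_derivative_within_subset subset_iff)

lemma at_within_Icc_nontrivial: "a < b \<Longrightarrow> t \<in> {a..b} \<Longrightarrow> at t within {a..b} \<noteq> bot" for a b t :: real
proof -
  assume "a < b" "t \<in> {a..b}"
  then have "\<nexists>x. {a..b} = {x}" by (metis atLeastAtMost_singleton_iff less_irrefl)
  then have "t islimpt {a..b}" using \<open>t \<in> {a..b}\<close> by (intro connected_imp_perfect) auto
  then show ?thesis by (simp add: trivial_limit_within)
qed

context riemannian_space
begin

lemma eventually_in_chart:
  assumes "geodesic_on M I \<gamma>" "c \<in> atlas M" "t \<in> I" "\<gamma> t \<in> fst c"
  shows "\<exists>\<epsilon>>0. \<forall>s\<in>I. \<bar>s - t\<bar> < \<epsilon> \<longrightarrow> \<gamma> s \<in> fst c"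
proof -
  have "continuous_on I \<gamma>" using assms by (simp add: geodesic_on_def)
  then have "(\<gamma> \<longlongrightarrow> \<gamma> t) (at t within I)" using assms(3) by (simp add: continuous_on_def)
  then have "\<forall>\<^sub>F s in at t within I. \<gamma> s \<in> fst c"
    using open_chart[OF assms(2)] assms(4) by (rule topological_tendstoD)
  then obtain \<epsilon> where "\<epsilon> > 0" "\<forall>s\<in>I. s \<noteq> t \<and> dist s t < \<epsilon> \<longrightarrow> \<gamma> s \<in> fst c"
    unfolding eventually_at by auto
  then show ?thesis using assms(4) by (intro exI[of _ \<epsilon>]) (metis dist_real_def)
qed

lemma geodesic_ph:
  assumes \<gamma>: "geodesic_on M I \<gamma>" and c: "c \<in> atlas M" and t: "t \<in> I" "\<gamma> t \<in> fst c"
    and I: "\<And>t. t \<in> I \<Longrightarrow> at t within I \<noteq> bot"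
  shows "(ph c I \<gamma> has_vector_derivative spray c (ph c I \<gamma> t)) (at t within I)"
proof -
  obtain s' where s': "\<And>t. t \<in> I \<Longrightarrow> \<gamma> t \<in> fst c \<Longrightarrow>
        ((\<lambda>r. snd c (\<gamma> r)) has_vector_derivative s' t) (at t within I) \<and>
        (s' has_vector_derivative - christoffel M c (snd c (\<gamma> t)) (s' t) (s' t)) (at t within I)"
    using \<gamma> c unfolding geodesic_on_def by metis
  have ph: "ph c I \<gamma> t = (snd c (\<gamma> t), s' t)" if "t \<in> I" "\<gamma> t \<in> fst c" for t
    using vector_derivative_within[OF I[OF that(1)]] s'[OF that] unfolding ph_def by blast
  obtain \<epsilon> where \<epsilon>: "\<epsilon> > 0" "\<forall>s\<in>I. \<bar>s - t\<bar> < \<epsilon> \<longrightarrow> \<gamma> s \<in> fst c"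
    using eventually_in_chart[OF \<gamma> c t] by blast
  have "((\<lambda>t. (snd c (\<gamma> t), s' t)) has_vector_derivative spray c (ph c I \<gamma> t)) (at t within I)"
    unfolding ph[OF t] spray_def using s'[OF t] by (auto intro: has_vector_derivative_Pair)
  then show ?thesis
    by (rule has_vector_derivative_transform_within[OF _ \<epsilon>(1) t(1)])
      (use \<epsilon>(2) ph in \<open>auto simp: dist_real_def\<close>)
qed

lemma has_vector_derivative_chart:
  assumes \<gamma>: "geodesic_on M I \<gamma>" and c: "c \<in> atlas M" and t: "t \<in> I" "\<gamma> t \<in> fst c"
    and I: "\<And>t. t \<in> I \<Longrightarrow> at t within I \<noteq> bot"
  shows "((\<lambda>r. snd c (\<gamma> r)) has_vector_derivative snd (ph c I \<gamma> t)) (at t within I)"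
    and "((\<lambda>r. snd (ph c I \<gamma> r)) has_vector_derivative - \<Gamma> c (snd c (\<gamma> t)) (snd (ph c I \<gamma> t)) (snd (ph c I \<gamma>
        t))) (at t within I)"
proof -
  note d = geodesic_ph[OF assms]
  show "((\<lambda>r. snd c (\<gamma> r)) has_vector_derivative snd (ph c I \<gamma> t)) (at t within I)"
    using bounded_linear.has_vector_derivative[OF bounded_linear_fst d] by (simp add: spray_def)
  show "((\<lambda>r. snd (ph c I \<gamma> r)) has_vector_derivative - \<Gamma> c (snd c (\<gamma> t)) (snd (ph c I \<gamma> t)) (snd (ph c I \<gamma>
    t))) (at t within I)"
    using bounded_linear.has_vector_derivative[OF bounded_linear_snd d] by (simp add: spray_def)
qed

lemma ph_trT:
  assumes \<gamma>: "geodesic_on M I \<gamma>" and c: "c \<in> atlas M" "d \<in> atlas M" and t: "t \<in> I" "\<gamma> t \<in> fst c" "\<gamma> t \<in> fst d"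
    and I: "\<And>t. t \<in> I \<Longrightarrow> at t within I \<noteq> bot"
  shows "ph d I \<gamma> t = trT c d (ph c I \<gamma> t)"
proof -
  obtain \<epsilon> where \<epsilon>: "\<epsilon> > 0" "\<forall>s\<in>I. \<bar>s - t\<bar> < \<epsilon> \<longrightarrow> \<gamma> s \<in> fst c"
    using eventually_in_chart[OF \<gamma> c(1) t(1,2)] by blast
  have D: "((snd d \<circ> chart_inv c) has_derivative trd c d (\<gamma> t)) (at ((snd c (\<gamma> t))))"
    by (rule trd_derivative[OF c t(2,3)])
  have "((snd d \<circ> chart_inv c) \<circ> (\<lambda>r. snd c (\<gamma> r)) has_vector_derivative trd c d (\<gamma> t) (snd (ph c I \<gamma> t)))
    (at t within I)"
    by (rule vector_derivative_diff_chain_within[OF has_vector_derivative_chart(1)[OF \<gamma> c(1) t(1,2) I]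
        has_derivative_at_withinI[OF D]])
  then have "((\<lambda>r. snd d (\<gamma> r)) has_vector_derivative trd c d (\<gamma> t) (snd (ph c I \<gamma> t))) (at t within I)"
    by (rule has_vector_derivative_transform_within[OF _ \<epsilon>(1) t(1)])
      (use \<epsilon>(2) c in \<open>auto simp: dist_real_def\<close>)
  then have "vector_derivative (\<lambda>r. snd d (\<gamma> r)) (at t within I) = trd c d (\<gamma> t) (snd (ph c I \<gamma> t))"
    by (rule vector_derivative_within[OF I[OF t(1)]])
  then show ?thesis using c t by (simp add: trT_def ph_def[of d])
qed

lemma ph_velocity:
  assumes \<gamma>: "geodesic_on M I \<gamma>" and c: "c \<in> atlas M" and t: "t \<in> I" "\<gamma> t \<in> fst c"
    and I: "\<And>t. t \<in> I \<Longrightarrow> at t within I \<noteq> bot"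
  shows "snd (ph c I \<gamma> t) = to_chart M c (\<gamma> t) (velocity M I \<gamma> t)"
proof -
  have "ph c I \<gamma> t = trT (chart_at M (\<gamma> t)) c (ph (chart_at M (\<gamma> t)) I \<gamma> t)"
    by (rule ph_trT[OF \<gamma> _ c t(1) _ t(2) I]) (simp_all add: chart_at)
  then show ?thesis by (simp add: trT_def velocity_ph to_chart_trd chart_at)
qed

lemma ph_subset:
  assumes \<gamma>: "geodesic_on M I \<gamma>" and c: "c \<in> atlas M" and t: "t \<in> J" "\<gamma> t \<in> fst c" and J: "J \<subseteq> I"
    and I: "\<And>t. t \<in> I \<Longrightarrow> at t within I \<noteq> bot" "at t within J \<noteq> bot"
  shows "ph c J \<gamma> t = ph c I \<gamma> t"
proof -
  have tI: "t \<in> I" using t(1) J by blast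
  have "((\<lambda>r. snd c (\<gamma> r)) has_vector_derivative snd (ph c I \<gamma> t)) (at t within J)"
    using has_vector_derivative_chart(1)[OF \<gamma> c tI t(2) I(1)] J by (rule has_vector_derivative_within_subset)
  from vector_derivative_within[OF I(2) this] show ?thesis by (simp add: ph_def)
qed

text \<open>Coordinates say nothing about points outside the chart, so staying in the chart belongs
  to the conclusion and is obtained together with the estimate; it is the predicate \<open>D\<close>
  of \<open>ode_stability\<close>.\<close>

lemma geodesic_stability:
  assumes \<gamma>: "geodesic_on M I \<gamma>" and c: "c \<in> atlas M" and ab: "{a..b} \<subseteq> I" "\<gamma> ` {a..b} \<subseteq> fst c"
    and I: "\<And>t. t \<in> I \<Longrightarrow> at t within I \<noteq> bot"
  obtains \<rho> C where "\<rho> > 0" "C > 0"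
    "\<And>\<sigma> t. \<lbrakk>t \<in> {a..b}; geodesic_on M I \<sigma>; \<sigma> a \<in> fst c; C * norm (ph c I \<sigma> a - ph c I \<gamma> a) < \<rho>\<rbrakk>
      \<Longrightarrow> \<sigma> t \<in> fst c \<and> norm (ph c I \<sigma> t - ph c I \<gamma> t) \<le> C * norm (ph c I \<sigma> a - ph c I \<gamma> a)"
proof -
  let ?\<Omega> = "(snd c ` fst c) \<times> (UNIV :: 'e set)"
  have der: "(ph c I \<sigma> has_vector_derivative spray c (ph c I \<sigma> t)) (at t within {a..b})"
    if "geodesic_on M I \<sigma>" "t \<in> {a..b}" "\<sigma> t \<in> fst c" for \<sigma> t
    using geodesic_ph[OF that(1) c _ that(3) I] that(2) ab(1) has_vector_derivative_within_subset by blast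
  have y\<Omega>: "ph c I \<gamma> ` {a..b} \<subseteq> ?\<Omega>" using ab(2) by (auto simp: ph_def)
  show ?thesis
  proof (rule ode_stability[OF C1f_imp_C1_on[OF C1f_spray[OF c]], of a b "ph c I \<gamma>"])
    show "t \<in> {a..b} \<Longrightarrow> (ph c I \<gamma> has_vector_derivative spray c (ph c I \<gamma> t)) (at t within {a..b})" for t
      using der[OF \<gamma>, of t] ab(2) by blast
    show "ph c I \<gamma> ` {a..b} \<subseteq> ?\<Omega>" by (rule y\<Omega>)
  next
  fix \<rho> C :: real
  assume \<rho>: "\<rho> > 0" "C > 0" "\<And>t. t \<in> {a..b} \<Longrightarrow> cball (ph c I \<gamma> t) (2 * \<rho>) \<subseteq> ?\<Omega>"
    and st: "\<And>z D t. \<lbrakk>t \<in> {a..b}; C * norm (z a - ph c I \<gamma> a) < \<rho>; D a;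
      \<And>t. t \<in> {a..b} \<Longrightarrow> D t \<Longrightarrow> (z has_vector_derivative spray c (z t)) (at t within {a..b});
      \<And>t. \<lbrakk>a < t; t \<le> b; \<And>s. a \<le> s \<Longrightarrow> s < t \<Longrightarrow> D s \<and> norm (z s - ph c I \<gamma> s) \<le> \<rho>\<rbrakk> \<Longrightarrow> D t;
      \<And>t. \<lbrakk>a \<le> t; t < b; D t\<rbrakk> \<Longrightarrow> \<forall>\<^sub>F s in at t within {a..b}. D s\<rbrakk>
     \<Longrightarrow> D t \<and> norm (z t - ph c I \<gamma> t) \<le> C * norm (z a - ph c I \<gamma> a)"
  show ?thesis
  proof (rule that[OF \<rho>(1,2)])
    fix \<sigma> t
    assume t: "t \<in> {a..b}" and \<sigma>: "geodesic_on M I \<sigma>" and \<sigma>a: "\<sigma> a \<in> fst c"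
      and small: "C * norm (ph c I \<sigma> a - ph c I \<gamma> a) < \<rho>"
    have c\<sigma>: "continuous_on {a..b} \<sigma>" using \<sigma> ab(1)
      by (auto simp: geodesic_on_def intro: continuous_on_subset)
    show "\<sigma> t \<in> fst c \<and> norm (ph c I \<sigma> t - ph c I \<gamma> t) \<le> C * norm (ph c I \<sigma> a - ph c I \<gamma> a)"
    proof (rule st[where D = "\<lambda>t. \<sigma> t \<in> fst c", OF t small \<sigma>a der[OF \<sigma>]])
      fix t assume t: "a < t" "t \<le> b" and s: "\<And>s. a \<le> s \<Longrightarrow> s < t \<Longrightarrow> \<sigma> s \<in> fst c \<and>
        norm (ph c I \<sigma> s - ph c I \<gamma> s) \<le> \<rho>"
      \<comment> \<open>A compact piece of the chart domain that contains \<sigma> shortly before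
        \<open>t\<close>. It is closed because the manifold is Hausdorff, so the limit point
        \<sigma> t cannot have left the chart.\<close>
      define K where "K = chart_inv c ` (fst ` cball (ph c I \<gamma> t) (2 * \<rho>))"
      have sub: "fst ` cball (ph c I \<gamma> t) (2 * \<rho>) \<subseteq> snd c ` fst c" using \<rho>(3)[of t] t by auto
      have "compact K" unfolding K_def
        by (intro compact_continuous_image continuous_on_subset[OF continuous_on_chart_inv[OF c] sub]
            continuous_on_fst continuous_on_id compact_cball)
      then have K: "closed K" by (rule compact_imp_closed)
      have KU: "K \<subseteq> fst c" using sub chart_inv_in[OF c] by (auto simp: K_def)
      have tab: "t \<in> {a..b}" using t by auto
      have "continuous (at t within {a..b}) (ph c I \<gamma>)"
        using has_vector_derivative_continuous[OF der[OF \<gamma> tab]] ab(2) tab by blast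
      then have "\<forall>\<^sub>F s in at t within {a..b}. dist (ph c I \<gamma> s) (ph c I \<gamma> t) < \<rho>"
        unfolding continuous_within using \<rho>(1) by (rule tendstoD)
      then have ev: "\<forall>\<^sub>F s in at t within {a..<t}. dist (ph c I \<gamma> s) (ph c I \<gamma> t) < \<rho>"
        by (rule filter_leD[rotated]) (use t in \<open>auto intro: at_le\<close>)
      have "\<forall>\<^sub>F s in at t within {a..<t}. s \<in> {a..<t}" by (simp add: eventually_at_filter)
      then have "\<forall>\<^sub>F s in at t within {a..<t}. \<sigma> s \<in> K"
        using ev
      proof eventually_elim
        case (elim r)
        have r: "\<sigma> r \<in> fst c" "dist (ph c I \<gamma> r) (ph c I \<sigma> r) \<le> \<rho>"
          using s[of r] elim by (auto simp: dist_norm norm_minus_commute)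
        then have "dist (ph c I \<gamma> t) (ph c I \<sigma> r) \<le> 2 * \<rho>"
          using dist_triangle[of "ph c I \<gamma> t" "ph c I \<sigma> r" "ph c I \<gamma> r"] elim by (simp add: dist_commute)
        then have "snd c (\<sigma> r) \<in> fst ` cball (ph c I \<gamma> t) (2 * \<rho>)"
          by (intro image_eqI[of _ _ "ph c I \<sigma> r"]) auto
        then show ?case unfolding K_def using chart_inv_chart[OF c r(1)] by (metis image_eqI)
      qed
      moreover have "(\<sigma> \<longlongrightarrow> \<sigma> t) (at t within {a..<t})"
        using c\<sigma> tab t unfolding continuous_on_def
            by (meson tendsto_within_subset atLeastLessThan_subseteq_atLeastAtMost_iff order_refl)
      moreover have "at t within {a..<t} \<noteq> bot"
        using t(1) by (simp add: at_within_eq_bot_iff closure_greaterThanLessThan islimpt_in_closure)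
      ultimately have "\<sigma> t \<in> K" using K Lim_in_closed_set by blast
      then show "\<sigma> t \<in> fst c" using KU by blast
    next
      fix t assume "a \<le> t" "t < b" "\<sigma> t \<in> fst c"
      then have "(\<sigma> \<longlongrightarrow> \<sigma> t) (at t within {a..b})" using c\<sigma> by (simp add: continuous_on_def)
      then show "\<forall>\<^sub>F s in at t within {a..b}. \<sigma> s \<in> fst c"
        using open_chart[OF c] \<open>\<sigma> t \<in> fst c\<close> by (rule topological_tendstoD)
    qed
  qed
  qed
qed

text \<open>The case of zero initial difference in \<open>geodesic_stability\<close>, carried from
  chart to chart. Velocities are part of the induction because they are the initial data in the next
  chart.\<close>

lemma geodesic_unique_forward:
  assumes \<gamma>: "geodesic_on M {a..b} \<gamma>" and \<sigma>: "geodesic_on M {a..b} \<sigma>" and "a < b"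
    and init: "\<gamma> a = \<sigma> a" "velocity M {a..b} \<gamma> a = velocity M {a..b} \<sigma> a" and t: "t \<in> {a..b}"
  shows "\<gamma> t = \<sigma> t"
proof -
  let ?I = "{a..b}"
  have I: "\<And>t. t \<in> ?I \<Longrightarrow> at t within ?I \<noteq> bot" using \<open>a < b\<close> by (rule at_within_Icc_nontrivial)
  define P where "P = (\<lambda>t. \<gamma> t = \<sigma> t \<and> velocity M ?I \<gamma> t = velocity M ?I \<sigma> t)"
  have "P t"
  proof (rule interval_propagate[OF t])
    show "P a" using init by (simp add: P_def)
    fix t assume t: "t \<in> ?I"
    obtain c where c: "c \<in> atlas M" "\<gamma> t \<in> fst c" using chart_at by blast
    obtain \<epsilon> where \<epsilon>: "\<epsilon> > 0" "\<forall>s\<in>?I. \<bar>s - t\<bar> < \<epsilon> \<longrightarrow> \<gamma> s \<in> fst c"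
      using eventually_in_chart[OF \<gamma> c(1) t c(2)] by blast
    show "\<exists>\<epsilon>>0. \<forall>s r. s \<in> ?I \<and> r \<in> ?I \<and> s \<le> r \<and> t - \<epsilon> < s \<and> r < t + \<epsilon> \<and> P s \<longrightarrow> P r"
    proof (intro exI[of _ \<epsilon>] conjI allI impI)
      fix s r assume h: "s \<in> ?I \<and> r \<in> ?I \<and> s \<le> r \<and> t - \<epsilon> < s \<and> r < t + \<epsilon> \<and> P s"
      have sub: "{s..r} \<subseteq> ?I" "\<gamma> ` {s..r} \<subseteq> fst c" using h \<epsilon> by auto
      have sr: "\<gamma> s \<in> fst c" "\<gamma> r \<in> fst c" using sub h by auto
      obtain \<rho> C where \<rho>: "\<rho> > 0" "C > 0"
        "\<And>\<tau> t. \<lbrakk>t \<in> {s..r}; geodesic_on M ?I \<tau>; \<tau> s \<in> fst c; C * norm (ph c ?I \<tau> s - ph c ?I \<gamma> s) < \<rho>\<rbrakk>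
        \<Longrightarrow> \<tau> t \<in> fst c \<and> norm (ph c ?I \<tau> t - ph c ?I \<gamma> t) \<le> C * norm (ph c ?I \<tau> s - ph c ?I \<gamma> s)"
        using geodesic_stability[OF \<gamma> c(1) sub I] by metis
      have "ph c ?I \<sigma> s = ph c ?I \<gamma> s"
        using h sr ph_velocity[OF \<gamma> c(1) _ _ I, of s] ph_velocity[OF \<sigma> c(1) _ _ I, of s]
        by (auto simp: P_def intro: prod_eqI)
      then have *: "\<sigma> r \<in> fst c \<and> ph c ?I \<sigma> r = ph c ?I \<gamma> r"
        using \<rho>(3)[OF _ \<sigma>, of r] \<rho>(1) h sr by (auto simp: P_def)
      then have "snd c (\<sigma> r) = snd c (\<gamma> r)" by (metis fst_ph)
      then have eq: "\<sigma> r = \<gamma> r" using * sr c(1) by (metis chart_inv_chart)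
      have "ph (chart_at M (\<gamma> r)) ?I \<sigma> r = ph (chart_at M (\<gamma> r)) ?I \<gamma> r"
        using ph_trT[OF \<gamma> c(1) chart_at(1) _ sr(2) chart_at(2) I] ph_trT[OF \<sigma> c(1) chart_at(1)[of "\<gamma> r"] _ _
            _ I, of r]
          * h sr chart_at eq by auto
      then show "P r" using eq by (simp add: P_def velocity_ph)
    qed (rule \<epsilon>(1))
  qed
  then show ?thesis by (simp add: P_def)
qed

text \<open>Both sides of the geodesic equation scale by the square of \<open>k\<close>. The case
  \<open>k = -1\<close> gives reversed geodesics.\<close>

lemma geodesic_affine:
  assumes \<gamma>: "geodesic_on M UNIV \<gamma>"
  shows "geodesic_on M UNIV (\<lambda>t. \<gamma> (k * t + \<tau>))"
    and "c \<in> atlas M \<Longrightarrow> \<gamma> (k * t + \<tau>) \<in> fst c \<Longrightarrow>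
      ph c UNIV (\<lambda>t. \<gamma> (k * t + \<tau>)) t = (snd c (\<gamma> (k * t + \<tau>)), k *\<^sub>R snd (ph c UNIV \<gamma> (k * t + \<tau>)))"
proof -
  have aff: "((\<lambda>t. k * t + \<tau>) has_vector_derivative k) (at t)" for t
    by (auto intro!: derivative_eq_intros simp flip: has_real_derivative_iff_has_vector_derivative)
  have d1: "((\<lambda>r. snd c (\<gamma> (k * r + \<tau>))) has_vector_derivative k *\<^sub>R snd (ph c UNIV \<gamma> (k * t + \<tau>))) (at t)"
    if c: "c \<in> atlas M" and t: "\<gamma> (k * t + \<tau>) \<in> fst c" for c t
    using vector_diff_chain_at[OF aff has_vector_derivative_chart(1)[OF \<gamma> c UNIV_I t]] by (simp add: o_def)
  have d2: "((\<lambda>r. k *\<^sub>R snd (ph c UNIV \<gamma> (k * r + \<tau>))) has_vector_derivative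
      - \<Gamma> c (snd c (\<gamma> (k * t + \<tau>))) (k *\<^sub>R snd (ph c UNIV \<gamma> (k * t + \<tau>))) (k *\<^sub>R snd (ph c UNIV \<gamma> (k * t +
        \<tau>)))) (at t)"
    if c: "c \<in> atlas M" and t: "\<gamma> (k * t + \<tau>) \<in> fst c" for c t
  proof -
    have "((\<lambda>r. snd (ph c UNIV \<gamma> (k * r + \<tau>))) has_vector_derivative
      k *\<^sub>R - \<Gamma> c (snd c (\<gamma> (k * t + \<tau>))) (snd (ph c UNIV \<gamma> (k * t + \<tau>))) (snd (ph c UNIV \<gamma> (k * t + \<tau>))))
        (at t)"
      using vector_diff_chain_at[OF aff has_vector_derivative_chart(2)[OF \<gamma> c UNIV_I t]] by (simp add: o_def)
    from bounded_linear.has_vector_derivative[OF bounded_linear_scaleR_right this, of k]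
    have "((\<lambda>r. k *\<^sub>R snd (ph c UNIV \<gamma> (k * r + \<tau>))) has_vector_derivative
      k *\<^sub>R k *\<^sub>R - \<Gamma> c (snd c (\<gamma> (k * t + \<tau>))) (snd (ph c UNIV \<gamma> (k * t + \<tau>))) (snd (ph c UNIV \<gamma> (k * t +
        \<tau>)))) (at t)" .
    moreover have p: "snd c (\<gamma> (k * t + \<tau>)) \<in> snd c ` fst c" using t by simp
    ultimately show ?thesis
      by (simp add: linear_scale[OF christoffel_linear(1)[OF c p]] linear_scale[OF christoffel_linear(2)[OF c
          p]])
  qed
  have "continuous_on UNIV \<gamma>" using \<gamma> by (simp add: geodesic_on_def)
  then have "continuous_on UNIV (\<lambda>t. \<gamma> (k * t + \<tau>))"
    by (rule continuous_on_compose2) (auto intro!: continuous_intros)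
  moreover have "\<exists>s'. \<forall>t\<in>UNIV. \<gamma> (k * t + \<tau>) \<in> fst c \<longrightarrow>
      ((\<lambda>r. snd c (\<gamma> (k * r + \<tau>))) has_vector_derivative s' t) (at t) \<and>
      (s' has_vector_derivative - \<Gamma> c (snd c (\<gamma> (k * t + \<tau>))) (s' t) (s' t)) (at t)" if "c \<in> atlas M" for c
    using d1[OF that] d2[OF that] by (intro exI[of _ "\<lambda>t. k *\<^sub>R snd (ph c UNIV \<gamma> (k * t + \<tau>))"]) blast
  ultimately show "geodesic_on M UNIV (\<lambda>t. \<gamma> (k * t + \<tau>))"
    unfolding geodesic_on_def by blast
  show "c \<in> atlas M \<Longrightarrow> \<gamma> (k * t + \<tau>) \<in> fst c \<Longrightarrow>
      ph c UNIV (\<lambda>t. \<gamma> (k * t + \<tau>)) t = (snd c (\<gamma> (k * t + \<tau>)), k *\<^sub>R snd (ph c UNIV \<gamma> (k * t + \<tau>)))"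
    unfolding ph_def[of c UNIV "\<lambda>t. \<gamma> (k * t + \<tau>)"] using vector_derivative_at[OF d1] by simp
qed

lemma velocity_affine:
  assumes \<gamma>: "geodesic_on M UNIV \<gamma>"
  shows "velocity M UNIV (\<lambda>t. \<gamma> (k * t + \<tau>)) t = k *\<^sub>R velocity M UNIV \<gamma> (k * t + \<tau>)"
  unfolding velocity_ph by (simp add: geodesic_affine(2)[OF \<gamma>] chart_at)

lemma velocity_subset:
  assumes "geodesic_on M UNIV \<gamma>" "t \<in> {a..b}" "a < b"
  shows "velocity M {a..b} \<gamma> t = velocity M UNIV \<gamma> t"
  unfolding velocity_ph using assms chart_at at_within_Icc_nontrivial
  by (subst ph_subset[OF assms(1)]) auto

lemma geodesic_unique:
  assumes \<gamma>: "geodesic_on M UNIV \<gamma>" and \<sigma>: "geodesic_on M UNIV \<sigma>"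
    and init: "\<gamma> 0 = \<sigma> 0" "velocity M UNIV \<gamma> 0 = velocity M UNIV \<sigma> 0"
  shows "\<gamma> = \<sigma>"
proof
  have fw: "\<gamma> t = \<sigma> t" if "t \<ge> 0" "geodesic_on M UNIV \<gamma>" "geodesic_on M UNIV \<sigma>"
     "\<gamma> 0 = \<sigma> 0" "velocity M UNIV \<gamma> 0 = velocity M UNIV \<sigma> 0" for \<gamma> \<sigma> t
    using geodesic_unique_forward[of 0 "t + 1" \<gamma> \<sigma> t] that
    by (auto simp: velocity_subset intro: geodesic_on_subset)
  fix t
  show "\<gamma> t = \<sigma> t"
  proof (cases "t \<ge> 0")
    case True
    then show ?thesis using fw[of t \<gamma> \<sigma>] assms by auto
  next
    case False
    then show ?thesis
      using fw[of "- t" "\<lambda>t. \<gamma> (- 1 * t + 0)" "\<lambda>t. \<sigma> (- 1 * t + 0)"] geodesic_affine(1)[OF \<gamma>, of "-1" 0]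
          geodesic_affine(1)[OF \<sigma>, of "-1" 0]
        velocity_affine[OF \<gamma>, of "-1" 0 0] velocity_affine[OF \<sigma>, of "-1" 0 0] init by simp
  qed
qed

section \<open>Convergence of geodesics\<close>

text \<open>Convergence in the tangent bundle, expressed in every chart about the limit. The
  eventual membership has to be demanded separately, since a coordinate map takes arbitrary values
  outside its domain.\<close>

definition conv :: "(nat \<Rightarrow> real \<Rightarrow> 'm) \<Rightarrow> (real \<Rightarrow> 'm) \<Rightarrow> real \<Rightarrow> bool" where
  "conv \<sigma> \<gamma> t \<longleftrightarrow> (\<forall>c\<in>atlas M. \<gamma> t \<in> fst c \<longrightarrow>
     (\<lambda>n. ph c UNIV (\<sigma> n) t) \<longlonglongrightarrow> ph c UNIV \<gamma> t \<and> (\<forall>\<^sub>F n in sequentially. \<sigma> n t \<in> fst c))"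

lemma conv_imp_tendsto:
  assumes "conv \<sigma> \<gamma> t"
  shows "(\<lambda>n. \<sigma> n t) \<longlonglongrightarrow> \<gamma> t"
proof -
  obtain c where c: "c \<in> atlas M" "\<gamma> t \<in> fst c" using chart_at by blast
  have "(\<lambda>n. ph c UNIV (\<sigma> n) t) \<longlonglongrightarrow> ph c UNIV \<gamma> t" and ev: "\<forall>\<^sub>F n in sequentially. \<sigma> n t \<in> fst c"
    using assms c by (auto simp: conv_def)
  then have "(\<lambda>n. snd c (\<sigma> n t)) \<longlonglongrightarrow> snd c (\<gamma> t)" using tendsto_fst by fastforce
  moreover have "isCont (chart_inv c) (snd c (\<gamma> t))"
    using continuous_on_chart_inv[OF c(1)] open_chart_image[OF c(1)] c(2)
        by (auto simp: continuous_on_eq_continuous_at)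
  ultimately have "(\<lambda>n. chart_inv c (snd c (\<sigma> n t))) \<longlonglongrightarrow> chart_inv c (snd c (\<gamma> t))"
    using isCont_tendsto_compose by blast
  then have "(\<lambda>n. chart_inv c (snd c (\<sigma> n t))) \<longlonglongrightarrow> \<gamma> t" using c by simp
  then show ?thesis
    by (rule Lim_transform_eventually) (use ev c in \<open>auto elim: eventually_mono\<close>)
qed

text \<open>One chart about the limit is enough, because the coordinate change \<open>trT\<close> of
  phase space is continuous.\<close>

lemma convI:
  assumes \<gamma>: "geodesic_on M UNIV \<gamma>" and \<sigma>: "\<And>n. geodesic_on M UNIV (\<sigma> n)"
    and c: "c \<in> atlas M" "\<gamma> t \<in> fst c"
    and lim: "(\<lambda>n. ph c UNIV (\<sigma> n) t) \<longlonglongrightarrow> ph c UNIV \<gamma> t" and ev: "\<forall>\<^sub>F n in sequentially. \<sigma> n t \<in> fst c"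
  shows "conv \<sigma> \<gamma> t"
  unfolding conv_def
proof (intro ballI impI)
  fix d assume d: "d \<in> atlas M" "\<gamma> t \<in> fst d"
  have "(\<lambda>n. snd c (\<sigma> n t)) \<longlonglongrightarrow> snd c (\<gamma> t)" using lim tendsto_fst by fastforce
  moreover have "snd c (\<gamma> t) \<in> snd c ` (fst c \<inter> fst d)" using c d by simp
  ultimately have "\<forall>\<^sub>F n in sequentially. snd c (\<sigma> n t) \<in> snd c ` (fst c \<inter> fst d)"
    using open_chart_subset[OF c(1) open_chart[OF d(1)]] topological_tendstoD by blast
  then have ev': "\<forall>\<^sub>F n in sequentially. \<sigma> n t \<in> fst c \<and> \<sigma> n t \<in> fst d"
    using ev
  proof eventually_elim
    case (elim n)
    then obtain x where "x \<in> fst c" "x \<in> fst d" "snd c (\<sigma> n t) = snd c x" by auto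
    then have "\<sigma> n t = x" using elim c(1) by (metis chart_inv_chart)
    then show ?case using \<open>x \<in> fst d\<close> elim by simp
  qed
  obtain D where "C1f ((snd c ` (fst c \<inter> fst d)) \<times> UNIV) (trT c d) D" using C1f_trT[OF c(1) d(1)] by blast
  then have "continuous_on ((snd c ` (fst c \<inter> fst d)) \<times> UNIV) (trT c d)" "open ((snd c ` (fst c \<inter> fst d)) \<times>
    (UNIV :: 'e set))"
    by (auto simp: C1f_continuous_on) (simp add: C1f_def)
  then have "isCont (trT c d) (ph c UNIV \<gamma> t)"
    using c d by (auto simp: continuous_on_eq_continuous_at ph_def)
  then have "(\<lambda>n. trT c d (ph c UNIV (\<sigma> n) t)) \<longlonglongrightarrow> trT c d (ph c UNIV \<gamma> t)"
    using lim isCont_tendsto_compose by blast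
  then have "(\<lambda>n. trT c d (ph c UNIV (\<sigma> n) t)) \<longlonglongrightarrow> ph d UNIV \<gamma> t"
    using ph_trT[OF \<gamma> c(1) d(1) _ c(2) d(2)] by simp
  moreover have "\<forall>\<^sub>F n in sequentially. trT c d (ph c UNIV (\<sigma> n) t) = ph d UNIV (\<sigma> n) t"
    using ev' by eventually_elim (simp add: ph_trT[OF \<sigma> c(1) d(1)])
  ultimately show "(\<lambda>n. ph d UNIV (\<sigma> n) t) \<longlonglongrightarrow> ph d UNIV \<gamma> t \<and> (\<forall>\<^sub>F n in sequentially. \<sigma> n t \<in> fst d)"
    using ev' by (auto intro: Lim_transform_eventually elim: eventually_mono)
qed

lemma conv_uniform:
  assumes \<gamma>: "geodesic_on M UNIV \<gamma>" and \<sigma>: "\<And>n. geodesic_on M UNIV (\<sigma> n)"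
    and c: "c \<in> atlas M" "\<gamma> ` {a..b} \<subseteq> fst c" and "a \<le> b" and conv: "conv \<sigma> \<gamma> a"
  shows "uniform_limit {a..b} (\<lambda>n. ph c UNIV (\<sigma> n)) (ph c UNIV \<gamma>) sequentially"
    and "\<forall>\<^sub>F n in sequentially. \<forall>t\<in>{a..b}. \<sigma> n t \<in> fst c"
proof -
  obtain \<rho> C where \<rho>: "\<rho> > 0" "C > 0"
    "\<And>\<sigma> t. \<lbrakk>t \<in> {a..b}; geodesic_on M UNIV \<sigma>; \<sigma> a \<in> fst c; C * norm (ph c UNIV \<sigma> a - ph c UNIV \<gamma> a) < \<rho>\<rbrakk>
      \<Longrightarrow> \<sigma> t \<in> fst c \<and> norm (ph c UNIV \<sigma> t - ph c UNIV \<gamma> t) \<le> C * norm (ph c UNIV \<sigma> a - ph c UNIV \<gamma> a)"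
    using geodesic_stability[OF \<gamma> c(1) _ c(2)] by (metis subset_UNIV trivial_limit_at)
  have \<gamma>a: "\<gamma> a \<in> fst c" using c(2) \<open>a \<le> b\<close> by auto
  have lim: "(\<lambda>n. ph c UNIV (\<sigma> n) a) \<longlonglongrightarrow> ph c UNIV \<gamma> a" and ev: "\<forall>\<^sub>F n in sequentially. \<sigma> n a \<in> fst c"
    using conv c(1) \<gamma>a by (auto simp: conv_def)
  have "\<forall>\<^sub>F n in sequentially. \<forall>t\<in>{a..b}. \<sigma> n t \<in> fst c \<and> dist (ph c UNIV (\<sigma> n) t) (ph c UNIV \<gamma> t) < e"
    if e: "e > 0" for e
  proof -
    have "\<forall>\<^sub>F n in sequentially. dist (ph c UNIV (\<sigma> n) a) (ph c UNIV \<gamma> a) < min \<rho> e / C"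
      using lim by (rule tendstoD) (use \<rho> e in auto)
    then show ?thesis using ev
    proof eventually_elim
      case (elim n)
      then have "C * norm (ph c UNIV (\<sigma> n) a - ph c UNIV \<gamma> a) < min \<rho> e"
        using \<rho>(2) by (simp add: pos_less_divide_eq dist_norm mult.commute)
      then show ?case using \<rho>(3)[OF _ \<sigma>, of _ n] elim by (fastforce simp: dist_norm)
    qed
  qed
  note * = this
  show "uniform_limit {a..b} (\<lambda>n. ph c UNIV (\<sigma> n)) (ph c UNIV \<gamma>) sequentially"
    by (intro uniform_limitI) (rule eventually_mono[OF *], auto)
  show "\<forall>\<^sub>F n in sequentially. \<forall>t\<in>{a..b}. \<sigma> n t \<in> fst c"
    using *[of 1] by (auto elim: eventually_mono)
qed

text \<open>Continuous dependence on initial data for all later times: inside one chart it is the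
  stability estimate, and \<open>convI\<close> changes the chart.\<close>

lemma conv_propagate:
  assumes \<gamma>: "geodesic_on M UNIV \<gamma>" and \<sigma>: "\<And>n. geodesic_on M UNIV (\<sigma> n)"
    and conv: "conv \<sigma> \<gamma> a" and t: "a \<le> t"
  shows "conv \<sigma> \<gamma> t"
proof -
  have "t \<in> {a..t}" using t by simp
  then show ?thesis
  proof (rule interval_propagate[where P = "conv \<sigma> \<gamma>"])
    fix t' assume t': "t' \<in> {a..t}"
    obtain c where c: "c \<in> atlas M" "\<gamma> t' \<in> fst c" using chart_at by blast
    obtain \<epsilon> where \<epsilon>: "\<epsilon> > 0" "\<forall>s\<in>UNIV. \<bar>s - t'\<bar> < \<epsilon> \<longrightarrow> \<gamma> s \<in> fst c"
      using eventually_in_chart[OF \<gamma> c(1) UNIV_I c(2)] by blast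
    show "\<exists>\<epsilon>>0. \<forall>s r. s \<in> {a..t} \<and> r \<in> {a..t} \<and> s \<le> r \<and> t' - \<epsilon> < s \<and> r < t' + \<epsilon> \<and> conv \<sigma> \<gamma> s \<longrightarrow> conv \<sigma> \<gamma> r"
    proof (intro exI[of _ \<epsilon>] conjI allI impI)
      fix s r assume h: "s \<in> {a..t} \<and> r \<in> {a..t} \<and> s \<le> r \<and> t' - \<epsilon> < s \<and> r < t' + \<epsilon> \<and> conv \<sigma> \<gamma> s"
      have sub: "\<gamma> ` {s..r} \<subseteq> fst c" using h \<epsilon> by auto
      have "uniform_limit {s..r} (\<lambda>n. ph c UNIV (\<sigma> n)) (ph c UNIV \<gamma>) sequentially"
        "\<forall>\<^sub>F n in sequentially. \<forall>t\<in>{s..r}. \<sigma> n t \<in> fst c"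
        using conv_uniform[OF \<gamma> \<sigma> c(1) sub] h by auto
      then show "conv \<sigma> \<gamma> r"
        using h sub by (intro convI[OF \<gamma> \<sigma> c(1)]) (auto intro: tendsto_uniform_limitI elim: eventually_mono)
    qed (rule \<epsilon>(1))
  qed (rule conv)
qed

text \<open>The limits of these difference quotients are the coordinate expressions of Jacobi fields.\<close>

definition dquot :: "('m, 'e) chart \<Rightarrow> (nat \<Rightarrow> real \<Rightarrow> 'm) \<Rightarrow> (nat \<Rightarrow> real \<Rightarrow> 'm) \<Rightarrow> (nat \<Rightarrow> real) \<Rightarrow> real \<Rightarrow> nat \<Rightarrow> 'e
  \<times> 'e" where
  "dquot c \<sigma> \<sigma>' r t n = (ph c UNIV (\<sigma>' n) t - ph c UNIV (\<sigma> n) t) /\<^sub>R r n"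

text \<open>The new limit is the image of the old one under the derivative of \<open>trT\<close>.
  Its second component involves second derivatives of the coordinate change; only the first
  component transforms as a tangent vector, and only that is recorded.\<close>

lemma dquot_transition:
  assumes \<gamma>: "geodesic_on M UNIV \<gamma>" and \<sigma>: "\<And>n. geodesic_on M UNIV (\<sigma> n)" "\<And>n. geodesic_on M UNIV (\<sigma>' n)"
    and c: "c \<in> atlas M" "d \<in> atlas M" "\<gamma> t \<in> fst c" "\<gamma> t \<in> fst d"
    and conv: "conv \<sigma> \<gamma> t" "conv \<sigma>' \<gamma> t" and r: "\<And>n. 0 < r n"
    and j: "dquot c \<sigma> \<sigma>' r t \<longlonglongrightarrow> j"
  shows "\<exists>k. dquot d \<sigma> \<sigma>' r t \<longlonglongrightarrow> k \<and> fst k = trd c d (\<gamma> t) (fst j)"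
proof -
  obtain D where D: "C1f ((snd c ` (fst c \<inter> fst d)) \<times> UNIV) (trT c d) D"
    "\<And>z h. fst (D z h) = trd c d (chart_inv c (fst z)) (fst h)" using C1f_trT[OF c(1,2)] by blast
  have mem: "ph c UNIV \<gamma> t \<in> (snd c ` (fst c \<inter> fst d)) \<times> UNIV" using c by (simp add: ph_def)
  have "(\<lambda>n. (trT c d (ph c UNIV (\<sigma>' n) t) - trT c d (ph c UNIV (\<sigma> n) t)) /\<^sub>R r n) \<longlonglongrightarrow>
    Blinfun (D (ph c UNIV \<gamma> t)) j"
    by (rule C1_on_quotient_tendsto[OF C1f_imp_C1_on[OF D(1)] mem _ _ r j[unfolded dquot_def]])
      (use conv c in \<open>auto simp: conv_def\<close>)
  moreover have "Blinfun (D (ph c UNIV \<gamma> t)) j = D (ph c UNIV \<gamma> t) j"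
    by (simp add: bounded_linear_Blinfun_apply C1f_bounded_linear[OF D(1) mem])
  moreover have "\<forall>\<^sub>F n in sequentially. (trT c d (ph c UNIV (\<sigma>' n) t) - trT c d (ph c UNIV (\<sigma> n) t)) /\<^sub>R r n
    = dquot d \<sigma> \<sigma>' r t n"
  proof -
    have "\<forall>\<^sub>F n in sequentially. \<sigma> n t \<in> fst c \<and> \<sigma> n t \<in> fst d \<and> \<sigma>' n t \<in> fst c \<and> \<sigma>' n t \<in> fst d"
      using conv c by (auto simp: conv_def intro!: eventually_conj)
    then show ?thesis
      by eventually_elim (simp add: dquot_def ph_trT[OF \<sigma>(1) c(1,2)] ph_trT[OF \<sigma>(2) c(1,2)])
  qed
  ultimately have "dquot d \<sigma> \<sigma>' r t \<longlonglongrightarrow> D (ph c UNIV \<gamma> t) j" by (auto intro: Lim_transform_eventually)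
  then show ?thesis using D(2)[of "ph c UNIV \<gamma> t" j] c by (intro exI[of _ "D (ph c UNIV \<gamma> t) j"]) simp
qed

lemma dquot_linearization:
  assumes \<gamma>: "geodesic_on M UNIV \<gamma>" and \<sigma>: "\<And>n. geodesic_on M UNIV (\<sigma> n)" "\<And>n. geodesic_on M UNIV (\<sigma>' n)"
    and c: "c \<in> atlas M" "\<gamma> ` {a..b} \<subseteq> fst c" and "a \<le> b"
    and conv: "conv \<sigma> \<gamma> a" "conv \<sigma>' \<gamma> a" and r: "\<And>n. 0 < r n"
    and j: "convergent (dquot c \<sigma> \<sigma>' r a)"
  shows "\<exists>j. \<forall>t\<in>{a..b}. dquot c \<sigma> \<sigma>' r t \<longlonglongrightarrow> j t \<and>
    (j has_vector_derivative spray' c (ph c UNIV \<gamma> t) (j t)) (at t within {a..b})"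
proof -
  let ?S = "(snd c ` fst c) \<times> (UNIV :: 'e set)"
  obtain j0 where j0: "dquot c \<sigma> \<sigma>' r a \<longlonglongrightarrow> j0" using j by (auto simp: convergent_def)
  have der: "(ph c UNIV \<tau> has_vector_derivative spray c (ph c UNIV \<tau> t)) (at t within {a..b})"
    if "geodesic_on M UNIV \<tau>" "\<tau> t \<in> fst c" for \<tau> t
    using geodesic_ph[OF that(1) c(1) UNIV_I that(2)] has_vector_derivative_at_within by auto
  have mem: "ph c UNIV \<gamma> ` {a..b} \<subseteq> ?S" using c(2) by (auto simp: ph_def)
  have "\<exists>j. \<forall>t\<in>{a..b}. (\<lambda>n. (ph c UNIV (\<sigma>' n) t - ph c UNIV (\<sigma> n) t) /\<^sub>R r n) \<longlonglongrightarrow> j t \<and>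
    (j has_vector_derivative Blinfun (spray' c (ph c UNIV \<gamma> t)) (j t)) (at t within {a..b})"
  proof (rule ode_linearization[OF C1f_imp_C1_on[OF C1f_spray[OF c(1)]] \<open>a \<le> b\<close> _ mem])
    show "t \<in> {a..b} \<Longrightarrow> (ph c UNIV \<gamma> has_vector_derivative spray c (ph c UNIV \<gamma> t)) (at t within {a..b})" for t
      using der[OF \<gamma>, of t] c(2) by blast
    show "\<forall>\<^sub>F n in sequentially. \<forall>t\<in>{a..b}. (ph c UNIV (\<sigma> n) has_vector_derivative spray c (ph c UNIV (\<sigma> n)
      t)) (at t within {a..b})"
      using conv_uniform(2)[OF \<gamma> \<sigma>(1) c \<open>a \<le> b\<close> conv(1)] by eventually_elim (use der[OF \<sigma>(1)] in blast)
    show "\<forall>\<^sub>F n in sequentially. \<forall>t\<in>{a..b}. (ph c UNIV (\<sigma>' n) has_vector_derivative spray c (ph c UNIV (\<sigma>' n)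
      t)) (at t within {a..b})"
      using conv_uniform(2)[OF \<gamma> \<sigma>(2) c \<open>a \<le> b\<close> conv(2)] by eventually_elim (use der[OF \<sigma>(2)] in blast)
    show "(\<lambda>n. (ph c UNIV (\<sigma>' n) a - ph c UNIV (\<sigma> n) a) /\<^sub>R r n) \<longlonglongrightarrow> j0"
      using j0 by (simp add: dquot_def[abs_def])
  qed (use conv_uniform(1)[OF \<gamma> \<sigma>(1) c \<open>a \<le> b\<close> conv(1)] conv_uniform(1)[OF \<gamma> \<sigma>(2) c \<open>a \<le>
    b\<close> conv(2)] r in auto)
  moreover have "Blinfun (spray' c (ph c UNIV \<gamma> t)) v = spray' c (ph c UNIV \<gamma> t) v" if "t \<in> {a..b}" for t v
  proof -
    have "ph c UNIV \<gamma> t \<in> ?S" using mem that by blast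
    then show ?thesis by (simp add: bounded_linear_Blinfun_apply C1f_bounded_linear[OF C1f_spray[OF c(1)]])
  qed
  ultimately show ?thesis by (simp add: dquot_def[abs_def])
qed

text \<open>Only the existence of the limits is propagated, since their values depend on the chart.
  Once they exist, \<open>lim\<close> names them in every chart along the geodesic.\<close>

lemma dquot_convergent:
  assumes \<gamma>: "geodesic_on M UNIV \<gamma>" and \<sigma>: "\<And>n. geodesic_on M UNIV (\<sigma> n)" "\<And>n. geodesic_on M UNIV (\<sigma>' n)"
    and conv: "conv \<sigma> \<gamma> a" "conv \<sigma>' \<gamma> a" and r: "\<And>n. 0 < r n"
    and c0: "c0 \<in> atlas M" "\<gamma> a \<in> fst c0" and j: "convergent (dquot c0 \<sigma> \<sigma>' r a)"
    and t: "a \<le> t" and c: "c \<in> atlas M" "\<gamma> t \<in> fst c"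
  shows "convergent (dquot c \<sigma> \<sigma>' r t)"
proof -
  define P where "P = (\<lambda>t. \<forall>c\<in>atlas M. \<gamma> t \<in> fst c \<longrightarrow> convergent (dquot c \<sigma> \<sigma>' r t))"
  have PI: "P t" if h: "a \<le> t" "c \<in> atlas M" "\<gamma> t \<in> fst c" "convergent (dquot c \<sigma> \<sigma>' r t)" for c t
    unfolding P_def
  proof (intro ballI impI)
    fix d assume d: "d \<in> atlas M" "\<gamma> t \<in> fst d"
    obtain j where "dquot c \<sigma> \<sigma>' r t \<longlonglongrightarrow> j" using h(4) unfolding convergent_def by blast
    from dquot_transition[OF \<gamma> \<sigma> h(2) d(1) h(3) d(2) conv_propagate[OF \<gamma> \<sigma>(1) conv(1) h(1)]
      conv_propagate[OF \<gamma> \<sigma>(2) conv(2) h(1)] r this]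
    show "convergent (dquot d \<sigma> \<sigma>' r t)" by (auto simp: convergent_def)
  qed
  have "t \<in> {a..t}" using t by simp
  then have "P t"
  proof (rule interval_propagate[where P = P])
    show "P a" by (rule PI[OF order_refl c0 j])
    fix t' assume t': "t' \<in> {a..t}"
    obtain c where c: "c \<in> atlas M" "\<gamma> t' \<in> fst c" using chart_at by blast
    obtain \<epsilon> where \<epsilon>: "\<epsilon> > 0" "\<forall>s\<in>UNIV. \<bar>s - t'\<bar> < \<epsilon> \<longrightarrow> \<gamma> s \<in> fst c"
      using eventually_in_chart[OF \<gamma> c(1) UNIV_I c(2)] by blast
    show "\<exists>\<epsilon>>0. \<forall>s r. s \<in> {a..t} \<and> r \<in> {a..t} \<and> s \<le> r \<and> t' - \<epsilon> < s \<and> r < t' + \<epsilon> \<and> P s \<longrightarrow> P r"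
    proof (intro exI[of _ \<epsilon>] conjI allI impI)
      fix s u assume h: "s \<in> {a..t} \<and> u \<in> {a..t} \<and> s \<le> u \<and> t' - \<epsilon> < s \<and> u < t' + \<epsilon> \<and> P s"
      have sub: "\<gamma> ` {s..u} \<subseteq> fst c" using h \<epsilon> by auto
      then have "\<gamma> s \<in> fst c" using h by auto
      then have "convergent (dquot c \<sigma> \<sigma>' r s)" using h c(1) unfolding P_def by blast
      moreover have as: "a \<le> s" using h by auto
      moreover have su: "s \<le> u" "u \<in> {s..u}" using h by auto
      ultimately obtain j where "\<forall>t\<in>{s..u}. dquot c \<sigma> \<sigma>' r t \<longlonglongrightarrow> j t \<and>
          (j has_vector_derivative spray' c (ph c UNIV \<gamma> t) (j t)) (at t within {s..u})"
        using dquot_linearization[where r = r, OF \<gamma> \<sigma> c(1) sub su(1) conv_propagate[OF \<gamma> \<sigma>(1) conv(1) as]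
            conv_propagate[OF \<gamma> \<sigma>(2) conv(2) as] r] by blast
      then have "convergent (dquot c \<sigma> \<sigma>' r u)" using su(2) convergentI by blast
      moreover have "\<gamma> u \<in> fst c" using sub su(2) by blast
      ultimately show "P u" using PI[of u c] c(1) h by auto
    qed (rule \<epsilon>(1))
  qed
  then show ?thesis using c by (simp add: P_def)
qed

lemma jacobi_derivative:
  assumes \<gamma>: "geodesic_on M UNIV \<gamma>" and \<sigma>: "\<And>n. geodesic_on M UNIV (\<sigma> n)" "\<And>n. geodesic_on M UNIV (\<sigma>' n)"
    and conv: "conv \<sigma> \<gamma> a" "conv \<sigma>' \<gamma> a" and r: "\<And>n. 0 < r n"
    and c0: "c0 \<in> atlas M" "\<gamma> a \<in> fst c0" and j: "convergent (dquot c0 \<sigma> \<sigma>' r a)"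
    and t: "t \<in> {a..b}" and c: "c \<in> atlas M" "\<gamma> t \<in> fst c" and "a < b"
  shows "((\<lambda>t. lim (dquot c \<sigma> \<sigma>' r t)) has_vector_derivative
     spray' c (ph c UNIV \<gamma> t) (lim (dquot c \<sigma> \<sigma>' r t))) (at t within {a..b})"
proof -
  obtain \<epsilon> where \<epsilon>: "\<epsilon> > 0" "\<forall>s\<in>UNIV. \<bar>s - t\<bar> < \<epsilon> \<longrightarrow> \<gamma> s \<in> fst c"
    using eventually_in_chart[OF \<gamma> c(1) UNIV_I c(2)] by blast
  define s u where "s = max a (t - \<epsilon> / 2)" and "u = min b (t + \<epsilon> / 2)"
  have su: "a \<le> s" "s \<le> t" "t \<le> u" "u \<le> b" using t \<epsilon>(1) by (auto simp: s_def u_def)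
  have sub: "\<gamma> ` {s..u} \<subseteq> fst c" using \<epsilon> by (auto simp: s_def u_def)
  have \<gamma>s: "\<gamma> s \<in> fst c" using sub su by auto
  have cs: "convergent (dquot c \<sigma> \<sigma>' r s)"
    by (rule dquot_convergent[OF \<gamma> \<sigma> conv r c0 j su(1) c(1) \<gamma>s])
  have "s \<le> u" using su by simp
  obtain j where j: "\<And>t. t \<in> {s..u} \<Longrightarrow> dquot c \<sigma> \<sigma>' r t \<longlonglongrightarrow> j t"
    "\<And>t. t \<in> {s..u} \<Longrightarrow> (j has_vector_derivative spray' c (ph c UNIV \<gamma> t) (j t)) (at t within {s..u})"
    using dquot_linearization[OF \<gamma> \<sigma> c(1) sub \<open>s \<le> u\<close> conv_propagate[OF \<gamma> \<sigma>(1) conv(1) su(1)]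
        conv_propagate[OF \<gamma> \<sigma>(2) conv(2) su(1)] r cs] by blast
  have jl: "lim (dquot c \<sigma> \<sigma>' r t) = j t" if "t \<in> {s..u}" for t using j(1)[OF that] by (rule limI)
  have tsu: "t \<in> {s..u}" using su by auto
  have "((\<lambda>t. lim (dquot c \<sigma> \<sigma>' r t)) has_vector_derivative spray' c (ph c UNIV \<gamma> t) (lim (dquot c \<sigma> \<sigma>' r
    t))) (at t within {s..u})"
    unfolding jl[OF tsu] by (rule has_vector_derivative_transform[OF tsu _ j(2)[OF tsu]]) (simp add: jl)
  \<comment> \<open>Within \<open>{a..b}\<close>, a whole neighbourhood of \<open>t\<close> lies in
    the interval between \<open>s\<close> and \<open>u\<close>, also when \<open>t\<close> is an end
    point.\<close>
  moreover have "at t within {s..u} = at t within {a..b}"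
    by (rule at_within_nhd[of t "{t - \<epsilon> / 2<..<t + \<epsilon> / 2}"]) (use \<epsilon>(1) in \<open>auto simp: s_def u_def\<close>)
  ultimately show ?thesis by simp
qed

section \<open>The metric along curves\<close>

text \<open>The sums of a derivative and a Christoffel term are covariant derivatives along the
  curve, and the product rule for them is \<open>dg_christoffel\<close>.\<close>

lemma has_real_derivative_g:
  assumes c: "c \<in> atlas M" and p: "p t \<in> snd c ` fst c"
    and d: "(p has_vector_derivative p') (at t within I)" "(u has_vector_derivative u') (at t within I)" "(v
        has_vector_derivative v') (at t within I)"
  shows "((\<lambda>t. g c (p t) (u t) (v t)) has_real_derivative
    g c (p t) (u' + \<Gamma> c (p t) p' (u t)) (v t) + g c (p t) (u t) (v' + \<Gamma> c (p t) p' (v t))) (at t within I)"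
proof -
  note C = C1f_g3[OF c]
  let ?F = "\<lambda>z. g c (fst (fst z)) (snd z) (snd (fst z))"
  have "((p t, v t), u t) \<in> ((snd c ` fst c) \<times> UNIV) \<times> UNIV" using p by simp
  then have D: "(?F has_derivative (\<lambda>d. dg c (p t) (u t) (v t) (fst (fst d)) + g c (p t) (u t) (snd (fst d))
    + g c (p t) (snd d) (v t)))
    (at ((p t, v t), u t))" using C unfolding C1f_def by fastforce
  have "((\<lambda>t. ((p t, v t), u t)) has_vector_derivative ((p', v'), u')) (at t within I)"
    by (intro has_vector_derivative_Pair d)
  from vector_derivative_diff_chain_within[OF this has_derivative_at_withinI[OF D]]
  have "((\<lambda>t. g c (p t) (u t) (v t)) has_vector_derivative dg c (p t) (u t) (v t) p' + g c (p t) (u t) v' + g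
    c (p t) u' (v t)) (at t within I)"
    by (simp add: o_def)
  moreover have "dg c (p t) (u t) (v t) p' + g c (p t) (u t) v' + g c (p t) u' (v t) =
    g c (p t) (u' + \<Gamma> c (p t) p' (u t)) (v t) + g c (p t) (u t) (v' + \<Gamma> c (p t) p' (v t))"
    by (simp add: dg_christoffel[OF c p] bilinear_ladd[OF g_bilinear[OF c p]] bilinear_radd[OF g_bilinear[OF
        c p]])
  ultimately show ?thesis by (simp add: has_real_derivative_iff_has_vector_derivative)
qed

text \<open>The geodesic equation says that the covariant derivative of the velocity vanishes, so
  both terms of \<open>has_real_derivative_g\<close> do.\<close>

lemma geodesic_speed_constant:
  assumes \<gamma>: "geodesic_on M UNIV \<gamma>"
  shows "metric M (\<gamma> t) (velocity M UNIV \<gamma> t) (velocity M UNIV \<gamma> t) =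
      metric M (\<gamma> 0) (velocity M UNIV \<gamma> 0) (velocity M UNIV \<gamma> 0)"
proof -
  have "((\<lambda>t. metric M (\<gamma> t) (velocity M UNIV \<gamma> t) (velocity M UNIV \<gamma> t)) has_real_derivative 0) (at t)" for t
  proof -
    obtain c where c: "c \<in> atlas M" "\<gamma> t \<in> fst c" using chart_at by blast
    obtain \<epsilon> where \<epsilon>: "\<epsilon> > 0" "\<forall>s\<in>UNIV. \<bar>s - t\<bar> < \<epsilon> \<longrightarrow> \<gamma> s \<in> fst c"
      using eventually_in_chart[OF \<gamma> c(1) UNIV_I c(2)] by blast
    have p: "snd c (\<gamma> t) \<in> snd c ` fst c" using c by simp
    note d = has_vector_derivative_chart[OF \<gamma> c(1) UNIV_I c(2)]
    have "((\<lambda>t. g c (snd c (\<gamma> t)) (snd (ph c UNIV \<gamma> t)) (snd (ph c UNIV \<gamma> t))) has_real_derivative 0) (at t)"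
      using has_real_derivative_g[OF c(1) p d(1) d(2) d(2)] 
      by (simp add: bilinear_lzero[OF g_bilinear[OF c(1) p]] bilinear_rzero[OF g_bilinear[OF c(1) p]])
    then show ?thesis
    proof (rule has_field_derivative_transform_within[OF _ \<epsilon>(1) UNIV_I])
      fix s assume "dist s t < \<epsilon>"
      then have s: "\<gamma> s \<in> fst c" using \<epsilon> by (simp add: dist_real_def)
      show "g c (snd c (\<gamma> s)) (snd (ph c UNIV \<gamma> s)) (snd (ph c UNIV \<gamma> s)) =
        metric M (\<gamma> s) (velocity M UNIV \<gamma> s) (velocity M UNIV \<gamma> s)"
        using ph_velocity[OF \<gamma> c(1) UNIV_I s] metric_to_chart[OF c(1) s] by simp
    qed
  qed
  then show ?thesis using DERIV_isconst_all[of "\<lambda>t. metric M (\<gamma> t) (velocity M UNIV \<gamma> t) (velocity M UNIV \<gamma>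
    t)" t 0] by blast
qed

end

section \<open>Jacobi fields in nonpositive curvature\<close>

text \<open>Applied to a Jacobi field \<open>J\<close> with \<open>h = |J|\<^sup>2\<close> and \<open>q = J' \<bullet> J\<close>: the last assumption
  is \<open>|t J' - J|\<^sup>2 \<ge> 0\<close> up to a curvature term of the right sign.\<close>

lemma radial_comparison:
  fixes h q q' :: "real \<Rightarrow> real"
  assumes h: "\<And>t. t \<in> {0..1} \<Longrightarrow> (h has_real_derivative 2 * q t) (at t within {0..1})"
    and q: "\<And>t. t \<in> {0..1} \<Longrightarrow> (q has_real_derivative q' t) (at t within {0..1})"
    and init: "h 0 = 0" "q 0 = 0"
    and conv: "\<And>t. t \<in> {0..1} \<Longrightarrow> 0 \<le> t\<^sup>2 * q' t - 2 * t * q t + h t"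
  shows "q' 0 \<le> h 1"
proof -
  have sub: "(f has_real_derivative f') (at t within {a..b})"
    if "(f has_real_derivative f') (at t within {0..1})" "0 \<le> a" "b \<le> 1" for f f' and t a b :: real
    using that by (auto intro: has_field_derivative_subset)
  \<comment> \<open>The last assumption is the sign of the derivative of \<open>q - h / t\<close>.
    This function tends to 0 at 0, so \<open>h / t \<le> q\<close>.\<close>
  have A: "q s - h s / s \<le> q t - h t / t" if st: "0 < s" "s \<le> t" "t \<le> 1" for s t
  proof (rule deriv_nonneg_mono[OF st(2), where f' = "\<lambda>r. q' r - (2 * q r * r - h r) / r\<^sup>2"])
    fix r assume r: "r \<in> {s..t}"
    have r': "r \<noteq> 0" "r \<in> {0..1}" using r st by auto
    show "((\<lambda>r. q r - h r / r) has_real_derivative q' r - (2 * q r * r - h r) / r\<^sup>2) (at r within {s..t})"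
      using r' st
      by (auto intro!: derivative_eq_intros sub[OF h] sub[OF q] simp: power2_eq_square)
  next
    fix r assume r: "s < r" "r < t"
    then have "0 \<le> (r\<^sup>2 * q' r - 2 * r * q r + h r) / r\<^sup>2" using conv[of r] st by simp
    also have "\<dots> = q' r - (2 * q r * r - h r) / r\<^sup>2" using r st by (simp add: field_simps)
    finally show "0 \<le> q' r - (2 * q r * r - h r) / r\<^sup>2" .
  qed
  have qh: "h t / t \<le> q t" if t: "0 < t" "t \<le> 1" for t
  proof -
    have z: "0 \<in> {0..1::real}" by simp
    have "(h has_real_derivative 0) (at_right 0)"
      using h[OF z] init by (simp add: at_within_Icc_at_right)
    then have "((\<lambda>s. h s / s) \<longlongrightarrow> 0) (at_right 0)" by (simp add: has_field_derivative_iff init)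
    moreover have "(q \<longlongrightarrow> 0) (at_right 0)"
      using DERIV_continuous[OF q[OF z]] init by (simp add: continuous_within at_within_Icc_at_right)
    ultimately have lim: "((\<lambda>s. q s - h s / s) \<longlongrightarrow> 0 - 0) (at_right 0)" by (intro tendsto_diff)
    have "\<forall>\<^sub>F s in at_right 0. q s - h s / s \<le> q t - h t / t"
      using A[OF _ _ t(2)] t by (auto simp: eventually_at_right intro!: exI[of _ t])
    from tendsto_upperbound[OF lim this] show ?thesis by simp
  qed
  \<comment> \<open>Since \<open>2 * q\<close> is the derivative of \<open>h\<close>, the previous
    bound says that \<open>h / t\<^sup>2\<close> is nondecreasing. It remains to bound it below near
    0 by values close to \<open>q' 0\<close>.\<close>
  have H: "h t / t\<^sup>2 \<le> h 1" if t: "0 < t" "t \<le> 1" for t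
  proof -
    have "h t / t\<^sup>2 \<le> h 1 / 1\<^sup>2"
    proof (rule deriv_nonneg_mono[OF t(2), where f' = "\<lambda>r. (2 * q r * r\<^sup>2 - h r * (2 * r)) / (r\<^sup>2)\<^sup>2"])
      fix r assume r: "r \<in> {t..1}"
      have r': "r \<noteq> 0" "r \<in> {0..1}" using r t by auto
      show "((\<lambda>r. h r / r\<^sup>2) has_real_derivative (2 * q r * r\<^sup>2 - h r * (2 * r)) / (r\<^sup>2)\<^sup>2) (at r within
        {t..1})"
        using r' t by (auto intro!: derivative_eq_intros sub[OF h] simp: power2_eq_square)
    next
      fix r assume r: "t < r" "r < 1"
      then have "h r \<le> q r * r" using qh[of r] t by (simp add: pos_divide_le_eq)
      then have "0 \<le> 2 * r * (q r * r - h r)" using r t by simp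
      moreover have "2 * q r * r\<^sup>2 - h r * (2 * r) = 2 * r * (q r * r - h r)"
        by (simp add: algebra_simps power2_eq_square)
      ultimately show "0 \<le> (2 * q r * r\<^sup>2 - h r * (2 * r)) / (r\<^sup>2)\<^sup>2" by simp
    qed
    then show ?thesis by simp
  qed
  show ?thesis
  proof (rule field_le_epsilon)
    fix e :: real assume e: "0 < e"
    have z: "0 \<in> {0..1::real}" by simp
    have "((\<lambda>s. q s / s) \<longlongrightarrow> q' 0) (at_right 0)"
      using q[OF z] init by (simp add: has_field_derivative_iff at_within_Icc_at_right)
    then have "\<forall>\<^sub>F s in at_right 0. q' 0 - e < q s / s" by (rule order_tendstoD(1)) (use e in simp)
    then obtain d where d: "d > 0" "\<And>s. 0 < s \<Longrightarrow> s < d \<Longrightarrow> q' 0 - e < q s / s"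
      unfolding eventually_at_right_field by blast
    define t where "t = min (d / 2) 1"
    have t: "0 < t" "t < d" "t \<le> 1" using d by (auto simp: t_def)
    \<comment> \<open>Integrates \<open>(q' 0 - e) * r < q r\<close> over small r, which stands in
      for the limit of \<open>h / t\<^sup>2\<close> at 0.\<close>
    have "h 0 - (q' 0 - e) * 0\<^sup>2 \<le> h t - (q' 0 - e) * t\<^sup>2"
    proof (rule deriv_nonneg_mono[where f = "\<lambda>r. h r - (q' 0 - e) * r\<^sup>2"
      and f' = "\<lambda>r. 2 * q r - (q' 0 - e) * (2 * r)"])
      fix r assume r: "r \<in> {0..t}"
      then show "((\<lambda>r. h r - (q' 0 - e) * r\<^sup>2) has_real_derivative 2 * q r - (q' 0 - e) * (2 * r)) (at r
        within {0..t})"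
        using t by (auto intro!: derivative_eq_intros sub[OF h])
    next
      fix r assume r: "0 < r" "r < t"
      then have "(q' 0 - e) * r < q r" using d(2)[of r] t by (simp add: pos_less_divide_eq)
      then show "0 \<le> 2 * q r - (q' 0 - e) * (2 * r)" by (simp add: algebra_simps)
    qed (use t in simp)
    then have "q' 0 - e \<le> h t / t\<^sup>2" using t init by (simp add: pos_le_divide_eq)
    then show "q' 0 \<le> h 1 + e" using H[of t] t by simp
  qed
qed

locale hadamard_space =
  fixes M :: "('m::{t2_space,second_countable_topology}, 'e::euclidean_space) riemannian"
  assumes hadamard: "hadamard_manifold M"
begin

sublocale riemannian_space
  using hadamard by unfold_locales (simp add: hadamard_manifold_def)

section \<open>Geodesics from a point and the exponential map\<close>

definition geo :: "'m \<Rightarrow> 'e \<Rightarrow> real \<Rightarrow> 'm" where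
  "geo x u = (THE \<gamma>. geodesic_on M UNIV \<gamma> \<and> \<gamma> 0 = x \<and> velocity M UNIV \<gamma> 0 = u)"

lemma geo: "geodesic_on M UNIV (geo x u)" "geo x u 0 = x" "velocity M UNIV (geo x u) 0 = u"
proof -
  obtain \<gamma> where \<gamma>: "geodesic_on M UNIV \<gamma> \<and> \<gamma> 0 = x \<and> velocity M UNIV \<gamma> 0 = u"
    using hadamard unfolding hadamard_manifold_def complete_riemannian_def by blast
  have "\<exists>!\<gamma>. geodesic_on M UNIV \<gamma> \<and> \<gamma> 0 = x \<and> velocity M UNIV \<gamma> 0 = u"
    by (rule ex1I[of _ \<gamma>]) (use \<gamma> geodesic_unique in auto)
  from theI'[OF this] show "geodesic_on M UNIV (geo x u)" "geo x u 0 = x" "velocity M UNIV (geo x u) 0 = u"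
    by (auto simp: geo_def)
qed

lemma geo_eqI: "geodesic_on M UNIV \<gamma> \<Longrightarrow> \<gamma> 0 = x \<Longrightarrow> velocity M UNIV \<gamma> 0 = u \<Longrightarrow> geo x u = \<gamma>"
  by (rule geodesic_unique[OF geo(1)]) (simp_all add: geo)

abbreviation ex :: "'m \<Rightarrow> 'e \<Rightarrow> 'm" where "ex \<equiv> riem_exp M"

lemma ex_geo: "ex x u = geo x u 1"
  by (simp add: riem_exp_def geo_def)

lemma geo_scale: "geo x (k *\<^sub>R u) t = geo x u (k * t)"
proof -
  have "geo x (k *\<^sub>R u) = (\<lambda>t. geo x u (k * t + 0))"
    by (rule geo_eqI) (simp_all add: geodesic_affine[OF geo(1)] velocity_affine[OF geo(1)] geo del:
        add_0_right)
  then show ?thesis by simp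
qed

lemma ex_scale: "ex x (t *\<^sub>R u) = geo x u t"
  by (simp add: ex_geo geo_scale)

lemma ex_0 [simp]: "ex x 0 = x"
  using ex_scale[of x 0 0] by (simp add: geo)

lemma geo_shift: "geo (geo x u s) (k *\<^sub>R velocity M UNIV (geo x u) s) t = geo x u (s + k * t)"
proof -
  have "geo (geo x u s) (k *\<^sub>R velocity M UNIV (geo x u) s) = (\<lambda>t. geo x u (k * t + s))"
    by (rule geo_eqI) (simp_all add: geodesic_affine[OF geo(1)] velocity_affine[OF geo(1)])
  then show ?thesis by (simp add: add.commute)
qed

lemma ex_reverse: "ex (ex x u) (- velocity M UNIV (geo x u) 1) = x"
  using geo_shift[of x u 1 "-1" 1] by (simp add: ex_geo geo)

lemma ph_geo_0:
  assumes "c \<in> atlas M" "x \<in> fst c"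
  shows "ph c UNIV (geo x u) 0 = (snd c x, to_chart M c x u)"
  using ph_velocity[OF geo(1) assms(1) UNIV_I, of x u 0] assms
  by (intro prod_eqI) (simp_all add: geo)

text \<open>The base point varies too. Convergence of the initial vectors is read in one fixed chart
  about the limit point, because their own components refer to charts that may jump.\<close>

lemma conv_geo:
  assumes c: "c \<in> atlas M" "x \<in> fst c" and x: "xs \<longlonglongrightarrow> x"
    and u: "(\<lambda>n. to_chart M c (xs n) (us n)) \<longlonglongrightarrow> to_chart M c x u" and t: "0 \<le> t"
  shows "conv (\<lambda>n. geo (xs n) (us n)) (geo x u) t"
proof (rule conv_propagate[OF geo(1) geo(1) convI[OF geo(1) geo(1) c(1)] t])
  show ev: "\<forall>\<^sub>F n in sequentially. geo (xs n) (us n) 0 \<in> fst c"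
    using topological_tendstoD[OF x open_chart[OF c(1)] c(2)] by (simp add: geo)
  have "isCont (snd c) x"
    using continuous_on_chart[OF c(1)] open_chart[OF c(1)] c(2) by (auto simp: continuous_on_eq_continuous_at)
  then have "(\<lambda>n. (snd c (xs n), to_chart M c (xs n) (us n))) \<longlonglongrightarrow> (snd c x, to_chart M c x u)"
    using x u by (intro tendsto_Pair) (auto intro: isCont_tendsto_compose)
  then have "(\<lambda>n. (snd c (xs n), to_chart M c (xs n) (us n))) \<longlonglongrightarrow> ph c UNIV (geo x u) 0"
    by (simp add: ph_geo_0 c)
  then show "(\<lambda>n. ph c UNIV (geo (xs n) (us n)) 0) \<longlonglongrightarrow> ph c UNIV (geo x u) 0"
    by (rule Lim_transform_eventually) (use ev c in \<open>auto elim!: eventually_mono simp: geo ph_geo_0\<close>)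
qed (use c geo in auto)

lemma to_chart_chart_at [simp]: "to_chart M (chart_at M x) x u = u"
  by (simp add: to_chart_trd trd_same chart_at)

lemma conv_geo_fixed:
  assumes "us \<longlonglongrightarrow> u" "0 \<le> t"
  shows "conv (\<lambda>n. geo x (us n)) (geo x u) t"
  by (rule conv_geo[OF chart_at, of _ x]) (use assms in auto)

lemma ex_tendsto: "us \<longlonglongrightarrow> u \<Longrightarrow> (\<lambda>n. ex x (us n)) \<longlonglongrightarrow> ex x u"
  unfolding ex_geo by (rule conv_imp_tendsto[OF conv_geo_fixed]) auto

lemma continuous_on_ex: "continuous_on S (ex x)"
  by (simp add: continuous_on_sequentially o_def ex_tendsto)

text \<open>The curvature assumption concerns linearly independent pairs and a quotient. For such
  pairs the denominator is positive by the strict Cauchy-Schwarz inequality; for dependent pairs the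
  curvature term vanishes by multilinearity and antisymmetry.\<close>

lemma curvature_nonpos:
  fixes x J s
  defines "c \<equiv> chart_at M x"
  defines "p \<equiv> snd c x"
  shows "metric M x (local_curvature M c p J s s) J \<le> 0"
proof -
  have c: "c \<in> atlas M" and p: "p \<in> snd c ` fst c" using chart_at by (auto simp: c_def p_def)
  note l = christoffel_linear[OF c p] christoffel_linear_d\<Gamma>[OF c p]
  have lc: "local_curvature M c p u v w = d\<Gamma> c p v w u - d\<Gamma> c p u w v + \<Gamma> c p u (\<Gamma> c p v w) - \<Gamma> c p v (\<Gamma> c p
    u w)" for u v w
    by (simp add: local_curvature_def d\<Gamma>_def)
  note b = metric_bilinear[of x]
  show ?thesis
  proof (cases "J \<noteq> s \<and> independent {J, s}")
    case True
    have s0: "s \<noteq> 0" using True dependent_zero[of "{J, s}"] by auto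
    have "sectional_curvature M x J s \<le> 0"
      using hadamard True unfolding hadamard_manifold_def by blast
    then have 1: "metric M x (local_curvature M c p J s s) J / (metric M x J J * metric M x s s - (metric M x
      J s)\<^sup>2) \<le> 0"
      by (simp add: sectional_curvature_def c_def p_def)
    have ss: "metric M x s s > 0" by (rule metric_pos[OF s0])
    define a where "a = metric M x J s / metric M x s s"
    have "J - a *\<^sub>R s \<noteq> 0"
    proof
      assume "J - a *\<^sub>R s = 0"
      then have "J \<in> span {s}" by (auto simp: span_singleton)
      then show False using True by (auto simp: independent_insert)
    qed
    then have "0 < metric M x (J - a *\<^sub>R s) (J - a *\<^sub>R s)" by (rule metric_pos)
    also have "\<dots> = metric M x J J - 2 * a * metric M x J s + a * a * metric M x s s"
      by (simp add: bilinear_lsub[OF b] bilinear_rsub[OF b] bilinear_lmul[OF b] bilinear_rmul[OF b]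
          metric_sym[of x s J] algebra_simps)
    also have "\<dots> = (metric M x J J * metric M x s s - (metric M x J s)\<^sup>2) / metric M x s s"
      using ss by (simp add: a_def field_simps power2_eq_square)
    finally have "metric M x J J * metric M x s s - (metric M x J s)\<^sup>2 > 0" using ss
      by (simp add: zero_less_divide_iff)
    then show ?thesis using 1 by (simp add: divide_le_0_iff)
  next
    case False
    have "\<exists>a. J = a *\<^sub>R s" if "s \<noteq> 0"
    proof (cases "J = s")
      case True
      then show ?thesis by (intro exI[of _ 1]) simp
    next
      case neq: False
      have "independent {s}" using that by simp
      then have "J \<in> span {s}" using False neq by (simp add: independent_insert)
      then show ?thesis by (auto simp: span_singleton)
    qed
    then consider "s = 0" | a where "J = a *\<^sub>R s" by blast
    then have "local_curvature M c p J s s = 0"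
    proof cases
      case 1
      then show ?thesis by (simp add: lc linear_0[OF l(1)] linear_0[OF l(2)] linear_0[OF l(3)] linear_0[OF
        l(4)] linear_0[OF l(5)])
    next
      case 2
      then show ?thesis by (simp add: lc linear_scale[OF l(1)] linear_scale[OF l(2)] linear_scale[OF l(3)]
        linear_scale[OF l(4)] linear_scale[OF l(5)])
    qed
    then show ?thesis by (simp add: bilinear_lzero[OF b])
  qed
qed

section \<open>The exponential map expands\<close>

text \<open>\<open>J\<close> is the value at time 1 of the Jacobi field with initial value 0 and
  initial covariant derivative \<open>w\<close>; nonpositive curvature makes it at least as long as
  \<open>w\<close>. The field arises from the geodesics with initial velocities \<open>v n\<close>
  and \<open>v' n\<close>.\<close>

lemma jacobi_expanding:
  assumes v: "v \<longlonglongrightarrow> u" "v' \<longlonglongrightarrow> u" and r: "\<And>n. 0 < r n" and w: "(\<lambda>n. (v' n - v n) /\<^sub>R r n) \<longlonglongrightarrow> w"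
    and c: "c \<in> atlas M" "ex x u \<in> fst c"
  shows "\<exists>J. (\<lambda>n. (snd c (ex x (v' n)) - snd c (ex x (v n))) /\<^sub>R r n) \<longlonglongrightarrow> J \<and>
    metric M x w w \<le> g c (snd c (ex x u)) J J"
proof -
  define \<gamma> where "\<gamma> = geo x u"
  define \<sigma> where "\<sigma> = (\<lambda>n. geo x (v n))"
  define \<sigma>' where "\<sigma>' = (\<lambda>n. geo x (v' n))"
  have \<gamma>: "geodesic_on M UNIV \<gamma>" and \<sigma>: "\<And>n. geodesic_on M UNIV (\<sigma> n)" "\<And>n. geodesic_on M UNIV (\<sigma>' n)"
    by (auto simp: \<gamma>_def \<sigma>_def \<sigma>'_def geo)
  have conv: "conv \<sigma> \<gamma> t" "conv \<sigma>' \<gamma> t" if "0 \<le> t" for t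
    unfolding \<gamma>_def \<sigma>_def \<sigma>'_def using v that by (auto intro: conv_geo_fixed)
  define c0 where "c0 = chart_at M x"
  have \<gamma>0: "\<gamma> 0 = x" by (simp add: \<gamma>_def geo)
  have c0: "c0 \<in> atlas M" "\<gamma> 0 \<in> fst c0" by (simp_all add: c0_def chart_at \<gamma>0)
  have D0: "dquot c0 \<sigma> \<sigma>' r 0 \<longlonglongrightarrow> (0, w)"
  proof -
    have "dquot c0 \<sigma> \<sigma>' r 0 = (\<lambda>n. (0, (v' n - v n) /\<^sub>R r n))"
      by (rule ext) (simp add: dquot_def \<sigma>_def \<sigma>'_def c0_def chart_at ph_geo_0)
    then show ?thesis using w by (simp add: tendsto_Pair)
  qed
  then have conv0: "convergent (dquot c0 \<sigma> \<sigma>' r 0)" by (rule convergentI)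
  note conv00 = conv[OF order_refl]
  define J where "J = (\<lambda>c t. fst (lim (dquot c \<sigma> \<sigma>' r t)))"
  define K where "K = (\<lambda>c t. snd (lim (dquot c \<sigma> \<sigma>' r t)))"
  let ?p = "\<lambda>c t. snd c (\<gamma> t)"
  let ?s = "\<lambda>c t. snd (ph c UNIV \<gamma> t)"
  have lim: "dquot c \<sigma> \<sigma>' r t \<longlonglongrightarrow> lim (dquot c \<sigma> \<sigma>' r t)" if "0 \<le> t" "c \<in> atlas M" "\<gamma> t \<in> fst c" for c t
    using dquot_convergent[OF \<gamma> \<sigma> conv00 r c0 conv0 that] by (simp add: convergent_LIMSEQ_iff)
  have dJK: "((\<lambda>t. lim (dquot c \<sigma> \<sigma>' r t)) has_vector_derivative
     spray' c (ph c UNIV \<gamma> t) (lim (dquot c \<sigma> \<sigma>' r t))) (at t within {0..1})"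
    if "t \<in> {0..1}" "c \<in> atlas M" "\<gamma> t \<in> fst c" for c t
    by (rule jacobi_derivative[OF \<gamma> \<sigma> conv00 r c0 conv0 that]) simp
  have dJ: "(J c has_vector_derivative K c t) (at t within {0..1})"
    if "t \<in> {0..1}" "c \<in> atlas M" "\<gamma> t \<in> fst c" for c t
    using bounded_linear.has_vector_derivative[OF bounded_linear_fst dJK[OF that]]
        by (simp add: spray'_def J_def K_def)
  have dK: "(K c has_vector_derivative - (d\<Gamma> c (?p c t) (?s c t) (?s c t) (J c t) + 2 *\<^sub>R \<Gamma> c (?p c t) (?s c
    t) (K c t))) (at t within {0..1})"
    if "t \<in> {0..1}" "c \<in> atlas M" "\<gamma> t \<in> fst c" for c t
    using bounded_linear.has_vector_derivative[OF bounded_linear_snd dJK[OF that]]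
        by (simp add: spray'_def J_def K_def)
  have dp: "((\<lambda>t. ?p c t) has_vector_derivative ?s c t) (at t within {0..1})"
    and ds: "((\<lambda>t. ?s c t) has_vector_derivative - \<Gamma> c (?p c t) (?s c t) (?s c t)) (at t within {0..1})"
    if "c \<in> atlas M" "\<gamma> t \<in> fst c" for c t
    using has_vector_derivative_chart[OF \<gamma> that(1) UNIV_I that(2)]
        by (auto intro: has_vector_derivative_at_within)
  have Jtrd: "J d t = trd c d (\<gamma> t) (J c t)"
    if "0 \<le> t" "c \<in> atlas M" "d \<in> atlas M" "\<gamma> t \<in> fst c" "\<gamma> t \<in> fst d" for c d t
    using dquot_transition[OF \<gamma> \<sigma> that(2-5) conv[OF that(1)] r lim[OF that(1,2,4)]] lim[OF that(1,3,5)]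
        LIMSEQ_unique
    unfolding J_def by metis
  \<comment> \<open>The squared length of the field, read at each time in the chart chosen there. By
    the next fact any chart gives the same value, since the field transforms as a tangent
    vector.\<close>
  define h where "h = (\<lambda>t. g (chart_at M (\<gamma> t)) (?p (chart_at M (\<gamma> t)) t) (J (chart_at M (\<gamma> t)) t) (J
    (chart_at M (\<gamma> t)) t))"
  have h: "h t = g c (?p c t) (J c t) (J c t)" if "0 \<le> t" "c \<in> atlas M" "\<gamma> t \<in> fst c" for c t
    unfolding h_def using Jtrd[OF that(1,2) chart_at(1) that(3) chart_at(2)] g_trd[OF that(2) chart_at(1)
        that(3) chart_at(2)] by simp
  \<comment> \<open>The covariant derivative of the field in the coordinates of
    \<open>c\<close>.\<close>
  define DJ where "DJ = (\<lambda>c t. K c t + \<Gamma> c (?p c t) (?s c t) (J c t))"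
  have dh: "(h has_real_derivative 2 * g c (?p c t) (DJ c t) (J c t)) (at t within {0..1})"
    if t: "t \<in> {0..1}" "c \<in> atlas M" "\<gamma> t \<in> fst c" for c t
  proof -
    obtain \<epsilon> where \<epsilon>: "\<epsilon> > 0" "\<forall>s\<in>UNIV. \<bar>s - t\<bar> < \<epsilon> \<longrightarrow> \<gamma> s \<in> fst c"
      using eventually_in_chart[OF \<gamma> t(2) UNIV_I t(3)] by blast
    have p: "?p c t \<in> snd c ` fst c" using t by simp
    have "((\<lambda>t. g c (?p c t) (J c t) (J c t)) has_real_derivative 2 * g c (?p c t) (DJ c t) (J c t)) (at t
      within {0..1})"
      using has_real_derivative_g[OF t(2) p dp[OF t(2,3)] dJ[OF t] dJ[OF t]] g_sym[OF t(2) p, of "J c t"]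
          by (simp add: DJ_def)
    then show ?thesis
      by (rule has_field_derivative_transform_within[OF _ \<epsilon>(1) t(1)])
        (use \<epsilon>(2) h t in \<open>auto simp: dist_real_def\<close>)
  qed
  \<comment> \<open>That this value is independent of the chart is read off from \<open>dh\<close>:
    in every chart twice the expression is the derivative of the same function \<open>h\<close>. A
    transformation law for \<open>DJ\<close> is thereby avoided.\<close>
  define q where "q = (\<lambda>t. g (chart_at M (\<gamma> t)) (?p (chart_at M (\<gamma> t)) t) (DJ (chart_at M (\<gamma> t)) t) (J
    (chart_at M (\<gamma> t)) t))"
  have q: "q t = g c (?p c t) (DJ c t) (J c t)" if "t \<in> {0..1}" "c \<in> atlas M" "\<gamma> t \<in> fst c" for c t
  proof -
    have "2 * q t = 2 * g c (?p c t) (DJ c t) (J c t)"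
      unfolding q_def
      by (rule vector_derivative_unique_within[OF at_within_Icc_nontrivial[OF zero_less_one that(1)]
        dh[OF that(1) chart_at, unfolded has_real_derivative_iff_has_vector_derivative]
        dh[OF that, unfolded has_real_derivative_iff_has_vector_derivative]])
    then show ?thesis by simp
  qed
  \<comment> \<open>The second covariant derivative, as the Jacobi equation prescribes it.\<close>
  define DDJ where "DDJ = (\<lambda>c t. - local_curvature M c (?p c t) (J c t) (?s c t) (?s c t))"
  define q' where "q' = (\<lambda>t. metric M (\<gamma> t) (DDJ (chart_at M (\<gamma> t)) t) (J (chart_at M (\<gamma> t)) t)
      + metric M (\<gamma> t) (DJ (chart_at M (\<gamma> t)) t) (DJ (chart_at M (\<gamma> t)) t))"
  have dq: "(q has_real_derivative q' t) (at t within {0..1})" if t: "t \<in> {0..1}" for t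
  proof -
    define c where "c = chart_at M (\<gamma> t)"
    have c: "c \<in> atlas M" "\<gamma> t \<in> fst c" by (simp_all add: c_def chart_at)
    obtain \<epsilon> where \<epsilon>: "\<epsilon> > 0" "\<forall>s\<in>UNIV. \<bar>s - t\<bar> < \<epsilon> \<longrightarrow> \<gamma> s \<in> fst c"
      using eventually_in_chart[OF \<gamma> c(1) UNIV_I c(2)] by blast
    have p: "?p c t \<in> snd c ` fst c" using c by simp
    note l = christoffel_linear[OF c(1) p] christoffel_linear_d\<Gamma>[OF c(1) p]
    let ?F = "\<lambda>z. \<Gamma> c (fst (fst z)) (snd z) (snd (fst z))"
    have "((?p c t, J c t), ?s c t) \<in> ((snd c ` fst c) \<times> UNIV) \<times> UNIV" using p by simp
    then have D: "(?F has_derivative (\<lambda>d. d\<Gamma> c (?p c t) (?s c t) (J c t) (fst (fst d)) + \<Gamma> c (?p c t) (?s c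
      t) (snd (fst d)) + \<Gamma> c (?p c t) (snd d) (J c t)))
      (at ((?p c t, J c t), ?s c t))" using C1f_christoffel3[OF c(1)] unfolding C1f_def by fastforce
    have "((\<lambda>t. ((?p c t, J c t), ?s c t)) has_vector_derivative ((?s c t, K c t), - \<Gamma> c (?p c t) (?s c t)
      (?s c t))) (at t within {0..1})"
      by (intro has_vector_derivative_Pair dp ds dJ c t)
    from vector_derivative_diff_chain_within[OF this has_derivative_at_withinI[OF D]]
    have "((\<lambda>t. \<Gamma> c (?p c t) (?s c t) (J c t)) has_vector_derivative
      d\<Gamma> c (?p c t) (?s c t) (J c t) (?s c t) + \<Gamma> c (?p c t) (?s c t) (K c t) - \<Gamma> c (?p c t) (\<Gamma> c (?p c t)
        (?s c t) (?s c t)) (J c t)) (at t within {0..1})"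
      by (simp add: o_def linear_neg[OF l(2)])
    from has_vector_derivative_add[OF dK[OF t c] this]
    have "(DJ c has_vector_derivative - (d\<Gamma> c (?p c t) (?s c t) (?s c t) (J c t) + 2 *\<^sub>R \<Gamma> c (?p c t) (?s c
      t) (K c t)) +
      (d\<Gamma> c (?p c t) (?s c t) (J c t) (?s c t) + \<Gamma> c (?p c t) (?s c t) (K c t) - \<Gamma> c (?p c t) (\<Gamma> c (?p c t)
        (?s c t) (?s c t)) (J c t))) (at t within {0..1})"
      by (simp add: DJ_def[abs_def])
    from has_real_derivative_g[OF c(1) p dp[OF c] this dJ[OF t c]]
    have "((\<lambda>t. g c (?p c t) (DJ c t) (J c t)) has_real_derivative
       g c (?p c t) (- (d\<Gamma> c (?p c t) (?s c t) (?s c t) (J c t) + 2 *\<^sub>R \<Gamma> c (?p c t) (?s c t) (K c t)) +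
      (d\<Gamma> c (?p c t) (?s c t) (J c t) (?s c t) + \<Gamma> c (?p c t) (?s c t) (K c t) - \<Gamma> c (?p c t) (\<Gamma> c (?p c t)
        (?s c t) (?s c t)) (J c t))
       + \<Gamma> c (?p c t) (?s c t) (DJ c t)) (J c t) + g c (?p c t) (DJ c t) (DJ c t)) (at t within {0..1})"
      by (simp add: DJ_def)
    \<comment> \<open>The Jacobi equation in coordinates: the terms that come from differentiating
      the covariant derivative combine to the curvature tensor.\<close>
    moreover have "- (d\<Gamma> c (?p c t) (?s c t) (?s c t) (J c t) + 2 *\<^sub>R \<Gamma> c (?p c t) (?s c t) (K c t)) +
      (d\<Gamma> c (?p c t) (?s c t) (J c t) (?s c t) + \<Gamma> c (?p c t) (?s c t) (K c t) - \<Gamma> c (?p c t) (\<Gamma> c (?p c t)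
        (?s c t) (?s c t)) (J c t))
       + \<Gamma> c (?p c t) (?s c t) (DJ c t) = DDJ c t"
      unfolding DDJ_def DJ_def local_curvature_def linear_add[OF l(1)] d\<Gamma>_def[symmetric]
      using d\<Gamma>_sym[OF c(1) p, of "?s c t" "J c t"] christoffel_sym[OF c(1) p, of "J c t"]
      by (simp add: scaleR_2 algebra_simps)
    ultimately have "((\<lambda>t. g c (?p c t) (DJ c t) (J c t)) has_real_derivative q' t) (at t within {0..1})"
      by (simp add: q'_def c_def g_chart_at)
    then show ?thesis
      by (rule has_field_derivative_transform_within[OF _ \<epsilon>(1) t])
        (use \<epsilon>(2) q c in \<open>auto simp: dist_real_def\<close>)
  qed
  have J0: "J c0 0 = 0" "K c0 0 = w" using limI[OF D0] by (simp_all add: J_def K_def)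
  have "q' 0 \<le> h 1"
  proof (rule radial_comparison[where q = q])
    fix t :: real assume t: "t \<in> {0..1}"
    show "(h has_real_derivative 2 * q t) (at t within {0..1})"
      unfolding q_def by (rule dh[OF t chart_at])
    show "(q has_real_derivative q' t) (at t within {0..1})" by (rule dq[OF t])
    define c where "c = chart_at M (\<gamma> t)"
    note b = metric_bilinear[of "\<gamma> t"]
    have 1: "0 \<le> metric M (\<gamma> t) (t *\<^sub>R DJ c t - J c t) (t *\<^sub>R DJ c t - J c t)" by (rule metric_nonneg)
    have 2: "0 \<le> metric M (\<gamma> t) (DDJ c t) (J c t)"
      using curvature_nonpos[of "\<gamma> t" "J c t" "?s c t"] by (simp add: DDJ_def c_def bilinear_lneg[OF b])
    \<comment> \<open>Expanding this square produces the last hypothesis of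
      \<open>radial_comparison\<close>, up to the curvature term in \<open>q'\<close>, whose sign is
      the right one.\<close>
    have "metric M (\<gamma> t) (t *\<^sub>R DJ c t - J c t) (t *\<^sub>R DJ c t - J c t) =
      t\<^sup>2 * metric M (\<gamma> t) (DJ c t) (DJ c t) - 2 * t * q t + h t"
    proof -
      have qh: "q t = metric M (\<gamma> t) (DJ c t) (J c t)" "h t = metric M (\<gamma> t) (J c t) (J c t)"
        by (simp_all only: q_def h_def c_def g_chart_at)
      show ?thesis unfolding qh bilinear_lsub[OF b] bilinear_rsub[OF b] bilinear_lmul[OF b] bilinear_rmul[OF
        b]
        metric_sym[of "\<gamma> t" "J c t" "DJ c t"] by (simp add: power2_eq_square algebra_simps)
    qed
    moreover have "t\<^sup>2 * metric M (\<gamma> t) (DJ c t) (DJ c t) \<le> t\<^sup>2 * q' t"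
      using 2 by (intro mult_left_mono) (auto simp: q'_def c_def)
    ultimately show "0 \<le> t\<^sup>2 * q' t - 2 * t * q t + h t" using 1 by linarith
  next
    have p0: "?p c0 0 \<in> snd c0 ` fst c0" using c0 by simp
    show "h 0 = 0" using h[OF _ c0] J0 by (simp add: bilinear_lzero[OF g_bilinear[OF c0(1) p0]])
    show "q 0 = 0" using q[OF _ c0] J0 by (simp add: bilinear_rzero[OF g_bilinear[OF c0(1) p0]])
  qed
  moreover have "q' 0 = metric M x w w"
  proof -
    have p0: "?p c0 0 \<in> snd c0 ` fst c0" using c0 by simp
    have cc: "chart_at M (\<gamma> 0) = c0" by (simp add: \<gamma>0 c0_def)
    show ?thesis unfolding q'_def cc DJ_def J0
      by (simp add: linear_0[OF christoffel_linear(1)[OF c0(1) p0[unfolded \<gamma>0]]] bilinear_rzero[OF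
          metric_bilinear] \<gamma>0)
  qed
  moreover have \<gamma>1: "\<gamma> 1 = ex x u" by (simp add: \<gamma>_def ex_geo)
  ultimately have "metric M x w w \<le> g c (snd c (ex x u)) (J c 1) (J c 1)" using h[of 1 c] c by simp
  moreover have "(\<lambda>n. (snd c (ex x (v' n)) - snd c (ex x (v n))) /\<^sub>R r n) \<longlonglongrightarrow> J c 1"
  proof -
    have "(\<lambda>n. fst (dquot c \<sigma> \<sigma>' r 1 n)) \<longlonglongrightarrow> J c 1"
      unfolding J_def by (intro tendsto_fst lim) (use c \<gamma>1 in auto)
    then show ?thesis by (simp add: dquot_def \<sigma>_def \<sigma>'_def ex_geo)
  qed
  ultimately show ?thesis by blast
qed

lemma tendsto_bilinear:
  fixes B :: "'e \<Rightarrow> 'e \<Rightarrow> real"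
  assumes "bilinear B" "(a \<longlongrightarrow> a0) F" "(b \<longlongrightarrow> b0) F"
  shows "((\<lambda>n. B (a n) (b n)) \<longlongrightarrow> B a0 b0) F"
  using assms by (simp add: bilinear_conv_bounded_bilinear bounded_bilinear.tendsto)

text \<open>If it failed for vectors arbitrarily near \<open>u\<close>, their normalized differences
  would accumulate at a unit vector, and \<open>jacobi_expanding\<close> would contradict the limit;
  \<open>\<eta> < 1\<close> leaves the gap for this. The metric on the right is frozen at the
  centre, so the estimate compares two fixed quadratic forms.\<close>

lemma ex_expanding:
  assumes c: "c \<in> atlas M" "ex x u \<in> fst c" and \<eta>: "\<eta> < 1"
  shows "\<exists>\<epsilon>>0. \<forall>v\<in>ball u \<epsilon>. \<forall>v'\<in>ball u \<epsilon>. ex x v \<in> fst c \<and>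
    \<eta> * metric M x (v' - v) (v' - v) \<le> g c (snd c (ex x u)) (snd c (ex x v') - snd c (ex x v)) (snd c (ex x
      v') - snd c (ex x v))"
proof (rule ccontr)
  assume neg: "\<not> ?thesis"
  let ?p = "snd c (ex x u)"
  have p: "?p \<in> snd c ` fst c" using c by simp
  let ?bad = "\<lambda>v v'. \<not> \<eta> * metric M x (v' - v) (v' - v) \<le>
    g c ?p (snd c (ex x v') - snd c (ex x v)) (snd c (ex x v') - snd c (ex x v))"
  have "open (ex x -` fst c)"
    using continuous_on_ex[of UNIV x] open_chart[OF c(1)] by (simp add: continuous_on_open_vimage)
  then obtain \<epsilon>0 where \<epsilon>0: "\<epsilon>0 > 0" "ball u \<epsilon>0 \<subseteq> ex x -` fst c" using c(2) by (meson openE vimageI)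
  have "\<exists>v v'. v \<in> ball u (\<epsilon>0 / (real n + 1)) \<and> v' \<in> ball u (\<epsilon>0 / (real n + 1)) \<and> ?bad v v'" for n
  proof -
    have e: "\<epsilon>0 / (real n + 1) > 0" using \<epsilon>0(1) by simp
    have "ball u (\<epsilon>0 / (real n + 1)) \<subseteq> ball u \<epsilon>0" using \<epsilon>0(1) by (intro subset_ball) (simp add: field_simps)
    then show ?thesis using neg e \<epsilon>0(2) by blast
  qed
  then obtain v v' where vv: "\<And>n. v n \<in> ball u (\<epsilon>0 / (real n + 1))" "\<And>n. v' n \<in> ball u (\<epsilon>0 / (real n + 1))"
    "\<And>n. ?bad (v n) (v' n)"
    by metis
  have lim0: "(\<lambda>n. \<epsilon>0 / (real n + 1)) \<longlonglongrightarrow> 0"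
    using tendsto_mult_right_zero[OF LIMSEQ_inverse_real_of_nat, of \<epsilon>0]
        by (simp add: divide_inverse add.commute)
  have v: "v \<longlonglongrightarrow> u" "v' \<longlonglongrightarrow> u"
  proof -
    have "dist (v n) u \<le> dist (\<epsilon>0 / (real n + 1)) 0" "dist (v' n) u \<le> dist (\<epsilon>0 / (real n + 1)) 0" for n
      using vv(1,2)[of n] \<epsilon>0(1) by (simp_all add: dist_commute less_imp_le)
    then show "v \<longlonglongrightarrow> u" "v' \<longlonglongrightarrow> u"
      by (auto intro!: metric_tendsto_imp_tendsto[OF lim0] always_eventually)
  qed
  have ne: "v' n \<noteq> v n" for n
    using vv(3)[of n] bilinear_lzero[OF g_bilinear[OF c(1) p]] bilinear_lzero[OF metric_bilinear] by auto
  define r where "r = (\<lambda>n. norm (v' n - v n))"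
  have r: "r n > 0" for n using ne by (simp add: r_def)
  define w where "w = (\<lambda>n. (v' n - v n) /\<^sub>R r n)"
  have "w n \<in> sphere 0 1" for n using r[of n] by (simp add: w_def r_def)
  then obtain w0 k where k: "w0 \<in> sphere 0 1" "strict_mono k" "(w \<circ> k) \<longlonglongrightarrow> w0"
    using compact_sphere[of "0::'e" 1] unfolding compact_def by metis
  have vk: "(v \<circ> k) \<longlonglongrightarrow> u" "(v' \<circ> k) \<longlonglongrightarrow> u" using v k(2) by (auto intro: LIMSEQ_subseq_LIMSEQ)
  have "(\<lambda>n. ((v' \<circ> k) n - (v \<circ> k) n) /\<^sub>R (r \<circ> k) n) \<longlonglongrightarrow> w0" using k(3) by (simp add: w_def o_def)
  from jacobi_expanding[OF vk _ this c] r obtain J where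
    J: "(\<lambda>n. (snd c (ex x ((v' \<circ> k) n)) - snd c (ex x ((v \<circ> k) n))) /\<^sub>R (r \<circ> k) n) \<longlonglongrightarrow> J"
      "metric M x w0 w0 \<le> g c ?p J J" by auto
  have "g c ?p J J \<le> \<eta> * metric M x w0 w0"
  proof (rule tendsto_le[OF sequentially_bot])
    show "(\<lambda>n. \<eta> * metric M x ((w \<circ> k) n) ((w \<circ> k) n)) \<longlonglongrightarrow> \<eta> * metric M x w0 w0"
      by (intro tendsto_intros tendsto_bilinear[OF metric_bilinear] k(3))
    show "(\<lambda>n. g c ?p ((snd c (ex x ((v' \<circ> k) n)) - snd c (ex x ((v \<circ> k) n))) /\<^sub>R (r \<circ> k) n)
      ((snd c (ex x ((v' \<circ> k) n)) - snd c (ex x ((v \<circ> k) n))) /\<^sub>R (r \<circ> k) n)) \<longlonglongrightarrow> g c ?p J J"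
      by (intro tendsto_bilinear[OF g_bilinear[OF c(1) p]] J(1))
    have "g c ?p ((snd c (ex x (v' n)) - snd c (ex x (v n))) /\<^sub>R r n) ((snd c (ex x (v' n)) - snd c (ex x (v
      n))) /\<^sub>R r n)
      \<le> \<eta> * metric M x (w n) (w n)" for n
    proof -
      have "g c ?p (snd c (ex x (v' n)) - snd c (ex x (v n))) (snd c (ex x (v' n)) - snd c (ex x (v n))) / (r
        n * r n)
        \<le> \<eta> * metric M x (v' n - v n) (v' n - v n) / (r n * r n)"
        using vv(3)[of n] r[of n] by (intro divide_right_mono) auto
      then show ?thesis unfolding w_def bilinear_lmul[OF g_bilinear[OF c(1) p]] bilinear_rmul[OF
        g_bilinear[OF c(1) p]]
        bilinear_lmul[OF metric_bilinear] bilinear_rmul[OF metric_bilinear]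
        by (simp add: divide_inverse mult_ac)
    qed
    then show "\<forall>\<^sub>F n in sequentially. g c ?p ((snd c (ex x ((v' \<circ> k) n)) - snd c (ex x ((v \<circ> k) n))) /\<^sub>R (r \<circ>
      k) n)
      ((snd c (ex x ((v' \<circ> k) n)) - snd c (ex x ((v \<circ> k) n))) /\<^sub>R (r \<circ> k) n) \<le>
        \<eta> * metric M x ((w \<circ> k) n) ((w \<circ> k) n)"
      by (simp add: always_eventually)
  qed
  moreover have "metric M x w0 w0 > 0" using k(1) by (intro metric_pos) auto
  ultimately have "metric M x w0 w0 \<le> \<eta> * metric M x w0 w0" using J(2) by linarith
  then show False using \<eta> \<open>metric M x w0 w0 > 0\<close> by simp
qed

text \<open>Any positive factor in \<open>ex_expanding\<close> gives injectivity; 1/2 is taken.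
  Invariance of domain does the work of the inverse function theorem, as the coordinate space has
  the dimension of the tangent space.\<close>

lemma ex_local_homeomorphism:
  obtains \<epsilon> where "\<epsilon> > 0" "inj_on (ex x) (ball u \<epsilon>)" "\<And>U. U \<subseteq> ball u \<epsilon> \<Longrightarrow> open U \<Longrightarrow> open (ex x ` U)"
proof -
  define c where "c = chart_at M (ex x u)"
  have c: "c \<in> atlas M" "ex x u \<in> fst c" by (simp_all add: c_def chart_at)
  have p: "snd c (ex x u) \<in> snd c ` fst c" using c by simp
  obtain \<epsilon> where \<epsilon>: "\<epsilon> > 0" "\<And>v v'. v \<in> ball u \<epsilon> \<Longrightarrow> v' \<in> ball u \<epsilon> \<Longrightarrow> ex x v \<in> fst c \<and>
    1/2 * metric M x (v' - v) (v' - v) \<le> g c (snd c (ex x u)) (snd c (ex x v') - snd c (ex x v)) (snd c (ex x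
      v') - snd c (ex x v))"
    using ex_expanding[OF c, of "1/2"] by auto
  have inj: "inj_on (snd c \<circ> ex x) (ball u \<epsilon>)"
  proof (rule inj_onI)
    fix v v' assume v: "v \<in> ball u \<epsilon>" "v' \<in> ball u \<epsilon>" and eq: "(snd c \<circ> ex x) v = (snd c \<circ> ex x) v'"
    then have "metric M x (v' - v) (v' - v) \<le> 0"
      using \<epsilon>(2)[OF v] bilinear_lzero[OF g_bilinear[OF c(1) p]] by simp
    then show "v = v'" using metric_pos[of "v' - v" x] by fastforce
  qed
  show ?thesis
  proof (rule that[OF \<epsilon>(1)])
    show "inj_on (ex x) (ball u \<epsilon>)" using inj by (rule inj_on_imageI2)
    fix U assume U: "U \<subseteq> ball u \<epsilon>" "open U"
    have img: "ex x ` U \<subseteq> fst c" using U(1) \<epsilon> by blast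
    have "continuous_on U (snd c \<circ> ex x)"
      by (intro continuous_on_compose continuous_on_ex continuous_on_subset[OF continuous_on_chart[OF c(1)]
          img])
    then have "open ((snd c \<circ> ex x) ` U)"
      using U(2) inj_on_subset[OF inj U(1)] by (rule invariance_of_domain)
    then have "open (fst c \<inter> snd c -` ((snd c \<circ> ex x) ` U))"
      by (intro continuous_open_preimage continuous_on_chart open_chart c)
    moreover have "fst c \<inter> snd c -` ((snd c \<circ> ex x) ` U) = ex x ` U"
    proof (intro equalityI subsetI)
      fix y assume "y \<in> fst c \<inter> snd c -` ((snd c \<circ> ex x) ` U)"
      then obtain v where v: "v \<in> U" "y \<in> fst c" "snd c y = snd c (ex x v)" by auto
      then have "y = ex x v" using img c(1) by (metis chart_inv_chart image_subset_iff)
      then show "y \<in> ex x ` U" using v by simp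
    qed (use img in auto)
    ultimately show "open (ex x ` U)" by simp
  qed
qed

lemma open_map_ex:
  assumes "open U"
  shows "open (ex x ` U)"
  unfolding open_subopen[of "ex x ` U"]
proof safe
  fix u assume u: "u \<in> U"
  obtain \<epsilon> where \<epsilon>: "\<epsilon> > 0" "inj_on (ex x) (ball u \<epsilon>)" "\<And>U. U \<subseteq> ball u \<epsilon> \<Longrightarrow> open U \<Longrightarrow> open (ex x ` U)"
    using ex_local_homeomorphism by metis
  have "open (ex x ` (U \<inter> ball u \<epsilon>))" using assms by (intro \<epsilon>(3)) auto
  then show "\<exists>T. open T \<and> ex x u \<in> T \<and> T \<subseteq> ex x ` U" using u \<epsilon>(1)
    by (intro exI[of _ "ex x ` (U \<inter> ball u \<epsilon>)"]) auto
qed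

end

section \<open>The Cartan--Hadamard theorem\<close>

context riemannian_space
begin

section \<open>The norm of a tangent space\<close>

definition nrm :: "'m \<Rightarrow> 'e \<Rightarrow> real" where "nrm x v = sqrt (metric M x v v)"

lemma nrm_power2: "(nrm x v)\<^sup>2 = metric M x v v"
  by (simp add: nrm_def metric_nonneg)

lemma nrm_nonneg [simp]: "0 \<le> nrm x v"
  by (simp add: nrm_def metric_nonneg)

lemma nrm_scale: "nrm x (k *\<^sub>R v) = \<bar>k\<bar> * nrm x v"
  by (simp add: nrm_def bilinear_lmul[OF metric_bilinear] bilinear_rmul[OF metric_bilinear] real_sqrt_mult
      flip: mult.assoc)

lemma nrm_0 [simp]: "nrm x 0 = 0"
  using nrm_scale[of x 0 0] by simp

lemma nrm_minus: "nrm x (- v) = nrm x v"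
  using nrm_scale[of x "-1" v] by simp

lemma nrm_eq_0: "nrm x v = 0 \<longleftrightarrow> v = 0"
  using metric_pos[of v x] by (cases "v = 0") (auto simp: nrm_def bilinear_lzero[OF metric_bilinear])

lemma metric_le_nrm: "metric M x u v \<le> nrm x u * nrm x v"
proof (cases "v = 0")
  case False
  note b = metric_bilinear[of x]
  have vv: "metric M x v v > 0" by (rule metric_pos[OF False])
  define a where "a = metric M x u v / metric M x v v"
  have "0 \<le> metric M x (u - a *\<^sub>R v) (u - a *\<^sub>R v)" by (rule metric_nonneg)
  also have "\<dots> = metric M x u u - 2 * a * metric M x u v + a * a * metric M x v v"
    by (simp add: bilinear_lsub[OF b] bilinear_rsub[OF b] bilinear_lmul[OF b] bilinear_rmul[OF b]
        metric_sym[of x v u] algebra_simps)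
  also have "\<dots> = metric M x u u - (metric M x u v)\<^sup>2 / metric M x v v"
    using vv by (simp add: a_def field_simps power2_eq_square)
  finally have "(metric M x u v)\<^sup>2 \<le> (nrm x u * nrm x v)\<^sup>2"
    using vv by (simp add: pos_divide_le_eq power_mult_distrib nrm_power2)
  then show ?thesis by (rule power2_le_imp_le) simp
qed (simp add: bilinear_rzero[OF metric_bilinear])

lemma nrm_triangle: "nrm x (u + v) \<le> nrm x u + nrm x v"
proof -
  note b = metric_bilinear[of x]
  have "(nrm x (u + v))\<^sup>2 = (nrm x u)\<^sup>2 + 2 * metric M x u v + (nrm x v)\<^sup>2"
    unfolding nrm_power2 bilinear_ladd[OF b] bilinear_radd[OF b] metric_sym[of x v u] by simp
  also have "\<dots> \<le> (nrm x u + nrm x v)\<^sup>2"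
    using metric_le_nrm[of x u v] by (simp add: power2_sum)
  finally show ?thesis by (rule power2_le_imp_le) simp
qed

lemma nrm_equiv: "\<exists>C>0. \<forall>v. norm v \<le> C * nrm x v \<and> nrm x v \<le> C * norm v"
proof -
  have cont: "continuous_on (sphere 0 1) (nrm x)"
    using metric_bilinear[of x] unfolding nrm_def
    by (intro continuous_on_real_sqrt bounded_bilinear.continuous_on[of "metric M x"] continuous_on_id)
      (simp add: bilinear_conv_bounded_bilinear)
  have ne: "sphere (0::'e) 1 \<noteq> {}" by simp
  obtain a where a: "a \<in> sphere 0 1" "\<And>v. v \<in> sphere 0 1 \<Longrightarrow> nrm x a \<le> nrm x v"
    using continuous_attains_inf[OF compact_sphere ne cont] by blast
  obtain b where b: "\<And>v. v \<in> sphere 0 1 \<Longrightarrow> nrm x v \<le> nrm x b"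
    using continuous_attains_sup[OF compact_sphere ne cont] by blast
  have "a \<noteq> 0" using a(1) by auto
  then have pos: "nrm x a > 0" using nrm_eq_0[of x a] nrm_nonneg[of x a] by linarith
  define C where "C = max (1 / nrm x a) (nrm x b + 1)"
  have C: "C > 0" "1 \<le> C * nrm x a" "nrm x b \<le> C"
    using pos by (auto simp: C_def less_max_iff_disj le_max_iff_disj add_nonneg_pos pos_divide_le_eq
        intro: order_trans[OF _ mult_right_mono[OF max.cobounded1]])
  show ?thesis
  proof (intro exI[of _ C] conjI allI)
    fix v
    show "norm v \<le> C * nrm x v"
    proof (cases "v = 0")
      case False
      have "nrm x a \<le> nrm x (v /\<^sub>R norm v)" using False by (intro a(2)) simp
      also have "\<dots> = nrm x v / norm v" by (simp add: nrm_scale divide_inverse)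
      finally have "nrm x a * norm v \<le> nrm x v" using False by (simp add: pos_le_divide_eq)
      then have "C * (nrm x a * norm v) \<le> C * nrm x v" using C(1) by (intro mult_left_mono) auto
      moreover have "1 * norm v \<le> C * nrm x a * norm v" using C(2) by (intro mult_right_mono) auto
      ultimately show ?thesis by (simp add: mult.assoc)
    qed simp
    show "nrm x v \<le> C * norm v"
    proof (cases "v = 0")
      case False
      have "nrm x (v /\<^sub>R norm v) \<le> nrm x b" using False by (intro b) simp
      then have "nrm x v / norm v \<le> C" using C(3) by (simp add: nrm_scale divide_inverse mult.commute)
      then show ?thesis using False by (simp add: pos_divide_le_eq)
    qed simp
  qed (rule C(1))
qed

text \<open>Curves whose Riemannian speed is at most \<open>K\<close>, without assuming differentiability.\<close>

definition speed_le :: "(real \<Rightarrow> 'm) \<Rightarrow> real \<Rightarrow> bool" where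
  "speed_le \<sigma> K \<longleftrightarrow> continuous_on {0..1} \<sigma> \<and> (\<forall>s\<in>{0..1}. \<exists>c\<in>atlas M. \<sigma> s \<in> fst c \<and>
    (\<forall>e>0. \<exists>\<epsilon>>0. \<forall>r\<in>{0..1}. \<forall>r'\<in>{0..1}. \<bar>r - s\<bar> < \<epsilon> \<longrightarrow> \<bar>r' - s\<bar> < \<epsilon> \<longrightarrow>
      g c (snd c (\<sigma> s)) (snd c (\<sigma> r') - snd c (\<sigma> r)) (snd c (\<sigma> r') - snd c (\<sigma> r)) \<le> (K\<^sup>2 + e) * (r' - r)\<^sup>2))"

lemma speed_le_mono:
  assumes "speed_le \<sigma> K" "K\<^sup>2 \<le> K'\<^sup>2"
  shows "speed_le \<sigma> K'"
  unfolding speed_le_def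
proof (intro conjI ballI)
  show "continuous_on {0..1} \<sigma>" using assms(1) by (simp add: speed_le_def)
  fix s :: real assume s: "s \<in> {0..1}"
  obtain c where c: "c \<in> atlas M" "\<sigma> s \<in> fst c" and sp: "\<forall>e>0. \<exists>\<epsilon>>0. \<forall>r\<in>{0..1}. \<forall>r'\<in>{0..1}. \<bar>r - s\<bar> < \<epsilon> \<longrightarrow>
    \<bar>r' - s\<bar> < \<epsilon> \<longrightarrow>
      g c (snd c (\<sigma> s)) (snd c (\<sigma> r') - snd c (\<sigma> r)) (snd c (\<sigma> r') - snd c (\<sigma> r)) \<le> (K\<^sup>2 + e) * (r' - r)\<^sup>2"
    using assms(1)[unfolded speed_le_def, THEN conjunct2, THEN bspec, OF s] by (elim bexE conjE) (rule that)
  show "\<exists>c\<in>atlas M. \<sigma> s \<in> fst c \<and> (\<forall>e>0. \<exists>\<epsilon>>0. \<forall>r\<in>{0..1}. \<forall>r'\<in>{0..1}. \<bar>r - s\<bar> < \<epsilon> \<longrightarrow> \<bar>r' - s\<bar> < \<epsilon> \<longrightarrow>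
      g c (snd c (\<sigma> s)) (snd c (\<sigma> r') - snd c (\<sigma> r)) (snd c (\<sigma> r') - snd c (\<sigma> r)) \<le> (K'\<^sup>2 + e) * (r' - r)\<^sup>2)"
  proof (rule bexI[OF _ c(1)], intro conjI c(2) allI impI)
    fix e :: real assume e: "0 < e"
    obtain \<epsilon> where "\<epsilon> > 0" and e1: "\<forall>r\<in>{0..1}. \<forall>r'\<in>{0..1}. \<bar>r - s\<bar> < \<epsilon> \<longrightarrow> \<bar>r' - s\<bar> < \<epsilon> \<longrightarrow>
      g c (snd c (\<sigma> s)) (snd c (\<sigma> r') - snd c (\<sigma> r)) (snd c (\<sigma> r') - snd c (\<sigma> r)) \<le> (K\<^sup>2 + e) * (r' - r)\<^sup>2"
      using sp[THEN spec, THEN mp, OF e] by (elim exE conjE) (rule that)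
    show "\<exists>\<epsilon>>0. \<forall>r\<in>{0..1}. \<forall>r'\<in>{0..1}. \<bar>r - s\<bar> < \<epsilon> \<longrightarrow> \<bar>r' - s\<bar> < \<epsilon> \<longrightarrow>
      g c (snd c (\<sigma> s)) (snd c (\<sigma> r') - snd c (\<sigma> r)) (snd c (\<sigma> r') - snd c (\<sigma> r)) \<le> (K'\<^sup>2 + e) * (r' - r)\<^sup>2"
    proof (rule exI[of _ \<epsilon>], intro conjI ballI impI)
      fix r r' assume r: "r \<in> {0..1}" "r' \<in> {0..1}" "\<bar>r - s\<bar> < \<epsilon>" "\<bar>r' - s\<bar> < \<epsilon>"
      note e1[rule_format, OF r]
      also have "(K\<^sup>2 + e) * (r' - r)\<^sup>2 \<le> (K'\<^sup>2 + e) * (r' - r)\<^sup>2"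
        by (rule mult_right_mono) (use assms(2) in simp_all)
      finally show "g c (snd c (\<sigma> s)) (snd c (\<sigma> r') - snd c (\<sigma> r)) (snd c (\<sigma> r') - snd c (\<sigma> r)) \<le>
        (K'\<^sup>2 + e) * (r' - r)\<^sup>2" .
    qed (rule \<open>\<epsilon> > 0\<close>)
  qed
qed

text \<open>Near \<open>s\<close> the derivative is close to \<open>p' s\<close>, so by the mean
  value inequality every difference quotient nearby is close to \<open>p' s\<close> as well, and so
  is its value under the fixed form \<open>B\<close>.\<close>

lemma speed_le_C1:
  fixes p p' :: "real \<Rightarrow> 'e" and B :: "'e \<Rightarrow> 'e \<Rightarrow> real"
  assumes "0 < \<epsilon>0" and s: "s \<in> {0..1}"
    and p: "\<And>r. r \<in> {0..1} \<Longrightarrow> \<bar>r - s\<bar> < \<epsilon>0 \<Longrightarrow> (p has_vector_derivative p' r) (at r within {0..1})"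
    and cont: "continuous (at s within {0..1}) p'" and B: "bilinear B" and K: "B (p' s) (p' s) \<le> K\<^sup>2"
        and e: "0 < e"
  shows "\<exists>\<epsilon>>0. \<forall>r\<in>{0..1}. \<forall>r'\<in>{0..1}. \<bar>r - s\<bar> < \<epsilon> \<longrightarrow> \<bar>r' - s\<bar> < \<epsilon> \<longrightarrow> B (p r' - p r) (p r' - p r) \<le>
      (K\<^sup>2 + e) * (r' - r)\<^sup>2"
proof -
  have "isCont (\<lambda>v. B v v) (p' s)"
    unfolding isCont_def by (intro bounded_bilinear.tendsto[of B] tendsto_ident_at) (use B in \<open>simp add:
        bilinear_conv_bounded_bilinear\<close>)
  then obtain \<delta> where \<delta>: "\<delta> > 0" "\<And>v. dist v (p' s) < \<delta> \<Longrightarrow> dist (B v v) (B (p' s) (p' s)) < e"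
    using e unfolding continuous_at_eps_delta by metis
  obtain \<epsilon>1 where \<epsilon>1: "\<epsilon>1 > 0" "\<And>r. r \<in> {0..1} \<Longrightarrow> dist r s < \<epsilon>1 \<Longrightarrow> dist (p' r) (p' s) < \<delta> / 2"
    using cont \<delta>(1) unfolding continuous_within_eps_delta by (metis half_gt_zero)
  define \<epsilon> where "\<epsilon> = min \<epsilon>0 \<epsilon>1"
  have \<epsilon>: "\<epsilon> > 0" using assms(1) \<epsilon>1 by (simp add: \<epsilon>_def)
  show ?thesis
  proof (intro exI[of _ \<epsilon>] conjI ballI impI)
    fix r r' assume r: "r \<in> {0..1}" "r' \<in> {0..1}" "\<bar>r - s\<bar> < \<epsilon>" "\<bar>r' - s\<bar> < \<epsilon>"
    show "B (p r' - p r) (p r' - p r) \<le> (K\<^sup>2 + e) * (r' - r)\<^sup>2"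
    proof (cases "r' = r")
      case False
      let ?S = "{0..1} \<inter> {s - \<epsilon> <..< s + \<epsilon>}"
      have mv: "norm (p r' - p r - (r' - r) *\<^sub>R p' s) \<le> norm (r' - r) * (\<delta> / 2)"
      proof (rule vector_differentiable_bound_linearization[where S = ?S])
        show "closed_segment r r' \<subseteq> ?S"
          using r by (intro closed_segment_subset convex_Int convex_real_interval) (auto simp: abs_less_iff)
        fix q assume q: "q \<in> ?S"
        then have "\<bar>q - s\<bar> < \<epsilon>" by (auto simp: abs_less_iff)
        then show "(p has_vector_derivative p' q) (at q within ?S)" "norm (p' q - p' s) \<le> \<delta> / 2"
          using p[of q] q \<epsilon>1(2)[of q] by (auto simp: \<epsilon>_def dist_norm intro:
              has_vector_derivative_within_subset)
      qed (use s \<epsilon> in auto)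
      define v where "v = (p r' - p r) /\<^sub>R (r' - r)"
      have pv: "p r' - p r = (r' - r) *\<^sub>R v" using False by (simp add: v_def)
      have "norm ((r' - r) *\<^sub>R (v - p' s)) \<le> norm (r' - r) * (\<delta> / 2)"
        using mv by (simp only: pv scaleR_diff_right)
      then have "norm (v - p' s) \<le> \<delta> / 2" using False by simp
      then have "dist (B v v) (B (p' s) (p' s)) < e" using \<delta> by (intro \<delta>(2)) (simp add: dist_norm)
      then have "B v v \<le> K\<^sup>2 + e" using K by (simp add: dist_real_def abs_less_iff)
      then have "(r' - r)\<^sup>2 * B v v \<le> (r' - r)\<^sup>2 * (K\<^sup>2 + e)" by (intro mult_left_mono) auto
      then show ?thesis unfolding pv bilinear_lmul[OF B] bilinear_rmul[OF B]
        by (simp add: power2_eq_square mult_ac)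
    qed (simp add: bilinear_lzero[OF B])
  qed (rule \<epsilon>)
qed

lemma speed_le_geodesic:
  assumes \<gamma>: "geodesic_on M UNIV \<gamma>"
  shows "speed_le \<gamma> (nrm (\<gamma> 0) (velocity M UNIV \<gamma> 0))"
  unfolding speed_le_def
proof (intro conjI ballI)
  show "continuous_on {0..1} \<gamma>" using \<gamma> by (auto simp: geodesic_on_def intro: continuous_on_subset)
  fix s :: real assume s: "s \<in> {0..1}"
  obtain c where c: "c \<in> atlas M" "\<gamma> s \<in> fst c" using chart_at by blast
  have p: "snd c (\<gamma> s) \<in> snd c ` fst c" using c by simp
  obtain \<epsilon> where \<epsilon>: "\<epsilon> > 0" "\<forall>r\<in>UNIV. \<bar>r - s\<bar> < \<epsilon> \<longrightarrow> \<gamma> r \<in> fst c"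
    using eventually_in_chart[OF \<gamma> c(1) UNIV_I c(2)] by blast
  have "g c (snd c (\<gamma> s)) (snd (ph c UNIV \<gamma> s)) (snd (ph c UNIV \<gamma> s)) \<le> (nrm (\<gamma> 0) (velocity M UNIV \<gamma> 0))\<^sup>2"
    using ph_velocity[OF \<gamma> c(1) UNIV_I c(2)] metric_to_chart[OF c] geodesic_speed_constant[OF \<gamma>, of s]
        by (simp add: nrm_power2)
  moreover have "continuous (at s within {0..1}) (\<lambda>r. snd (ph c UNIV \<gamma> r))"
    by (rule has_vector_derivative_continuous[OF has_vector_derivative_at_within[OF
        has_vector_derivative_chart(2)[OF \<gamma> c(1) UNIV_I c(2)]]]) simp
  moreover have "((\<lambda>r. snd c (\<gamma> r)) has_vector_derivative snd (ph c UNIV \<gamma> r)) (at r within {0..1})"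
    if "\<bar>r - s\<bar> < \<epsilon>" for r
    using has_vector_derivative_chart(1)[OF \<gamma> c(1) UNIV_I] \<epsilon> that
        by (auto intro: has_vector_derivative_at_within)
  ultimately show "\<exists>c\<in>atlas M. \<gamma> s \<in> fst c \<and>
    (\<forall>e>0. \<exists>\<epsilon>>0. \<forall>r\<in>{0..1}. \<forall>r'\<in>{0..1}. \<bar>r - s\<bar> < \<epsilon> \<longrightarrow> \<bar>r' - s\<bar> < \<epsilon> \<longrightarrow>
      g c (snd c (\<gamma> s)) (snd c (\<gamma> r') - snd c (\<gamma> r)) (snd c (\<gamma> r') - snd c (\<gamma> r)) \<le>
        ((nrm (\<gamma> 0) (velocity M UNIV \<gamma> 0))\<^sup>2 + e) * (r' - r)\<^sup>2)"
    using speed_le_C1[OF \<epsilon>(1) s, of "\<lambda>r. snd c (\<gamma> r)" "\<lambda>r. snd (ph c UNIV \<gamma> r)", OF _ _ g_bilinear[OF c(1)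
        p]] c by blast
qed

end

context hadamard_space
begin

section \<open>Lifting curves through the exponential map\<close>

lemma ex_local_inverse:
  obtains \<epsilon> \<psi> where "\<epsilon> > 0" "open (ex x ` ball u \<epsilon>)" "continuous_on (ex x ` ball u \<epsilon>) \<psi>" "\<And>v. v \<in> ball u \<epsilon> \<Longrightarrow>
    \<psi> (ex x v) = v"
proof -
  obtain \<epsilon> where \<epsilon>: "\<epsilon> > 0" "inj_on (ex x) (ball u \<epsilon>)" "\<And>U. U \<subseteq> ball u \<epsilon> \<Longrightarrow> open U \<Longrightarrow> open (ex x ` U)"
    using ex_local_homeomorphism by metis
  have o: "open (ex x ` ball u \<epsilon>)" by (rule \<epsilon>(3)) auto
  have inv: "\<And>v. v \<in> ball u \<epsilon> \<Longrightarrow> inv_into (ball u \<epsilon>) (ex x) (ex x v) = v" using \<epsilon>(2) by (rule inv_into_f_f)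
  have "continuous_on (ex x ` ball u \<epsilon>) (inv_into (ball u \<epsilon>) (ex x))"
  proof (rule continuous_on_inverse_open_map[OF continuous_on_ex refl inv])
    fix U assume "openin (top_of_set (ball u \<epsilon>)) U"
    then have "open U" "U \<subseteq> ball u \<epsilon>" by (auto simp: openin_open_eq)
    then show "openin (top_of_set (ex x ` ball u \<epsilon>)) (ex x ` U)" using \<epsilon>(3)[of U] o
      by (auto simp: openin_open_eq)
  qed
  then show ?thesis using that[OF \<epsilon>(1) o _ inv] by blast
qed

text \<open>The coincidence set of two lifts is closed by continuity and open because
  \<open>ex x\<close> is locally injective.\<close>

lemma lift_unique:
  fixes T :: "'t::topological_space set"
  assumes "connected T" and c: "continuous_on T a" "continuous_on T b"
    and eq: "\<And>t. t \<in> T \<Longrightarrow> ex x (a t) = ex x (b t)" and t0: "t0 \<in> T" "a t0 = b t0" and t: "t \<in> T"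
  shows "a t = b t"
proof -
  let ?E = "{t \<in> T. a t = b t}"
  have "{t \<in> T. a t - b t = 0} = ?E" by auto
  moreover have "closedin (top_of_set T) {t \<in> T. a t - b t = 0}"
    by (intro continuous_closedin_preimage_constant continuous_intros c)
  ultimately have cl: "closedin (top_of_set T) ?E" by simp
  have op: "openin (top_of_set T) ?E"
  proof (subst openin_subopen, intro ballI)
    fix t assume t: "t \<in> ?E"
    obtain \<epsilon> where \<epsilon>: "\<epsilon> > 0" "inj_on (ex x) (ball (a t) \<epsilon>)" "\<And>U. U \<subseteq> ball (a t) \<epsilon> \<Longrightarrow> open U \<Longrightarrow> open (ex x ` U)"
      using ex_local_homeomorphism by metis
    let ?N = "(T \<inter> a -` ball (a t) \<epsilon>) \<inter> (T \<inter> b -` ball (a t) \<epsilon>)"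
    have "openin (top_of_set T) ?N" by (intro openin_Int continuous_openin_preimage_gen c open_ball)
    moreover have "t \<in> ?N" using t \<epsilon>(1) by auto
    moreover have "?N \<subseteq> ?E" using \<epsilon>(2) eq by (auto dest: inj_onD)
    ultimately show "\<exists>N. openin (top_of_set T) N \<and> t \<in> N \<and> N \<subseteq> ?E" by blast
  qed
  have "?E = {} \<or> ?E = T" using assms(1) cl op unfolding connected_clopen by blast
  then show ?thesis using t0 t by blast
qed

text \<open>Expansion of \<open>ex x\<close> bounds the increments of a lift by those of the curve
  below, locally up to a factor near 1; the local bounds add up by the triangle inequality. An
  arbitrary \<open>L > K\<close> absorbs the losses and is finally lowered to
  \<open>K\<close>.\<close>

lemma lift_Lipschitz:
  assumes \<sigma>: "speed_le \<sigma> K" and K: "0 \<le> K" and ab: "{a..b} \<subseteq> {0..1}" "a \<le> b"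
    and u: "continuous_on {a..b} \<omega>" and lift: "\<And>s. s \<in> {a..b} \<Longrightarrow> ex x (\<omega> s) = \<sigma> s"
  shows "nrm x (\<omega> b - \<omega> a) \<le> K * (b - a)"
proof -
  have L: "nrm x (\<omega> b - \<omega> a) \<le> L * (b - a)" if L: "L > K" for L
  proof -
    have "b \<in> {a..b}" using ab by simp
    then show ?thesis
    proof (rule interval_propagate[where P = "\<lambda>t. nrm x (\<omega> t - \<omega> a) \<le> L * (t - a)"])
      fix t assume t: "t \<in> {a..b}"
      have t01: "t \<in> {0..1}" using t ab by blast
      \<comment> \<open>\<eta> and \<open>e\<close> are fixed by
        \<open>K\<^sup>2 + e = \<eta> * L\<^sup>2\<close>, both sides being the mean of the squares
        of \<open>K\<close> and \<open>L\<close>, so the loss \<eta> of the expansion and the excess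
        \<open>e\<close> of the speed together cost exactly the step from \<open>K\<close> to
        \<open>L\<close>.\<close>
      define \<eta> where "\<eta> = (K\<^sup>2 + L\<^sup>2) / (2 * L\<^sup>2)"
      define e where "e = (L\<^sup>2 - K\<^sup>2) / 2"
      have KL: "K\<^sup>2 < L\<^sup>2" using L K by (intro power_strict_mono) auto
      have "L > 0" using L K by simp
      then have \<eta>: "0 < \<eta>" "\<eta> < 1" "e > 0" "K\<^sup>2 + e = \<eta> * L\<^sup>2"
        using KL by (auto simp: \<eta>_def e_def field_simps add_nonneg_pos)
      obtain c where c: "c \<in> atlas M" "\<sigma> t \<in> fst c"
        and sp: "\<forall>e>0. \<exists>\<epsilon>>0. \<forall>r\<in>{0..1}. \<forall>r'\<in>{0..1}. \<bar>r - t\<bar> < \<epsilon> \<longrightarrow> \<bar>r' - t\<bar> < \<epsilon> \<longrightarrow>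
          g c (snd c (\<sigma> t)) (snd c (\<sigma> r') - snd c (\<sigma> r)) (snd c (\<sigma> r') - snd c (\<sigma> r)) \<le>
            (K\<^sup>2 + e) * (r' - r)\<^sup>2"
        using \<sigma> t01 unfolding speed_le_def by blast
      obtain \<epsilon>1 where "\<epsilon>1 > 0" and e1: "\<forall>r\<in>{0..1}. \<forall>r'\<in>{0..1}. \<bar>r - t\<bar> < \<epsilon>1 \<longrightarrow> \<bar>r' - t\<bar> < \<epsilon>1 \<longrightarrow>
          g c (snd c (\<sigma> t)) (snd c (\<sigma> r') - snd c (\<sigma> r)) (snd c (\<sigma> r') - snd c (\<sigma> r)) \<le>
            (K\<^sup>2 + e) * (r' - r)\<^sup>2"
        using sp[THEN spec, THEN mp, OF \<eta>(3)] by (elim exE conjE) (rule that)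
      note \<epsilon>1 = \<open>\<epsilon>1 > 0\<close> e1[rule_format]
      have \<sigma>t: "\<sigma> t = ex x (\<omega> t)" using lift[OF t] by simp
      obtain \<epsilon>2 where "\<epsilon>2 > 0" and e2: "\<forall>v\<in>ball (\<omega> t) \<epsilon>2. \<forall>v'\<in>ball (\<omega> t) \<epsilon>2. ex x v \<in> fst c \<and>
        \<eta> * metric M x (v' - v) (v' - v) \<le> g c (snd c (ex x (\<omega> t))) (snd c (ex x v') - snd c (ex x v)) (snd c
          (ex x v') - snd c (ex x v))"
        using ex_expanding[OF c(1) c(2)[unfolded \<sigma>t] \<eta>(2)] by (elim exE conjE) (rule that)
      have \<epsilon>2: "\<epsilon>2 > 0" "\<And>v v'. v \<in> ball (\<omega> t) \<epsilon>2 \<Longrightarrow> v' \<in> ball (\<omega> t) \<epsilon>2 \<Longrightarrow>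
        \<eta> * metric M x (v' - v) (v' - v) \<le> g c (snd c (\<sigma> t)) (snd c (ex x v') - snd c (ex x v)) (snd c (ex x
          v') - snd c (ex x v))"
        using \<open>\<epsilon>2 > 0\<close> e2 unfolding \<sigma>t by simp_all
      obtain \<epsilon>3 where \<epsilon>3: "\<epsilon>3 > 0" "\<And>r. r \<in> {a..b} \<Longrightarrow> dist r t < \<epsilon>3 \<Longrightarrow> dist (\<omega> r) (\<omega> t) < \<epsilon>2"
        using u t \<epsilon>2(1) unfolding continuous_on_iff by metis
      show "\<exists>\<epsilon>>0. \<forall>s r. s \<in> {a..b} \<and> r \<in> {a..b} \<and> s \<le> r \<and> t - \<epsilon> < s \<and> r < t + \<epsilon> \<and> nrm x (\<omega> s - \<omega> a) \<le>
        L * (s - a) \<longrightarrow>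
        nrm x (\<omega> r - \<omega> a) \<le> L * (r - a)"
      proof (intro exI[of _ "min \<epsilon>1 \<epsilon>3"] conjI allI impI)
        fix s r assume h: "s \<in> {a..b} \<and> r \<in> {a..b} \<and> s \<le> r \<and> t - min \<epsilon>1 \<epsilon>3 < s \<and> r < t + min \<epsilon>1 \<epsilon>3 \<and>
          nrm x (\<omega> s - \<omega> a) \<le> L * (s - a)"
        then have near: "\<bar>s - t\<bar> < min \<epsilon>1 \<epsilon>3" "\<bar>r - t\<bar> < min \<epsilon>1 \<epsilon>3" by auto
        have "dist (\<omega> s) (\<omega> t) < \<epsilon>2" "dist (\<omega> r) (\<omega> t) < \<epsilon>2"
          using \<epsilon>3(2) h near by (auto simp: dist_real_def)
        then have mem: "\<omega> s \<in> ball (\<omega> t) \<epsilon>2" "\<omega> r \<in> ball (\<omega> t) \<epsilon>2" by (auto simp: dist_commute)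
        have sr: "s \<in> {0..1}" "r \<in> {0..1}" using h ab by auto
        have "\<eta> * metric M x (\<omega> r - \<omega> s) (\<omega> r - \<omega> s) \<le> g c (snd c (\<sigma> t)) (snd c (\<sigma> r) - snd c (\<sigma> s)) (snd c
          (\<sigma> r) - snd c (\<sigma> s))"
          using \<epsilon>2(2)[OF mem] lift h by auto
        also have "\<dots> \<le> (K\<^sup>2 + e) * (r - s)\<^sup>2" using \<epsilon>1(2)[OF sr] near by auto
        finally have "\<eta> * (nrm x (\<omega> r - \<omega> s))\<^sup>2 \<le> \<eta> * (L * (r - s))\<^sup>2"
          by (simp add: nrm_power2 \<eta>(4) power_mult_distrib)
        then have "(nrm x (\<omega> r - \<omega> s))\<^sup>2 \<le> (L * (r - s))\<^sup>2" using \<eta>(1) by simp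
        then have 1: "nrm x (\<omega> r - \<omega> s) \<le> L * (r - s)" by (rule power2_le_imp_le) (use \<open>L > 0\<close> h in auto)
        have "nrm x (\<omega> r - \<omega> a) \<le> nrm x (\<omega> s - \<omega> a) + nrm x (\<omega> r - \<omega> s)"
          using nrm_triangle[of x "\<omega> s - \<omega> a" "\<omega> r - \<omega> s"] by simp
        also have "\<dots> \<le> L * (s - a) + L * (r - s)" using 1 h by simp
        finally show "nrm x (\<omega> r - \<omega> a) \<le> L * (r - a)" by (simp add: algebra_simps)
      qed (use \<epsilon>1 \<epsilon>3 in auto)
    qed simp
  qed
  show ?thesis
  proof (rule field_le_epsilon)
    fix e :: real assume e: "e > 0"
    have "nrm x (\<omega> b - \<omega> a) \<le> (K + e / (b - a + 1)) * (b - a)"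
      using e ab by (intro L) (auto intro!: divide_pos_pos)
    also have "\<dots> = K * (b - a) + e * ((b - a) / (b - a + 1))" by (simp add: algebra_simps)
    also have "\<dots> \<le> K * (b - a) + e * 1" using e ab by (intro add_left_mono mult_left_mono) auto
    finally show "nrm x (\<omega> b - \<omega> a) \<le> K * (b - a) + e" by simp
  qed
qed

lemma lift_norm_Lipschitz:
  assumes \<sigma>: "speed_le \<sigma> K" and K: "0 \<le> K" and I: "{a..b} \<subseteq> {0..1}"
    and u: "continuous_on {a..b} \<omega>" and lift: "\<And>s. s \<in> {a..b} \<Longrightarrow> ex x (\<omega> s) = \<sigma> s"
    and C: "\<And>v. norm v \<le> C * nrm x v" "C > 0" and s: "s \<in> {a..b}" "r \<in> {a..b}"
  shows "norm (\<omega> r - \<omega> s) \<le> C * K * \<bar>r - s\<bar>"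
proof -
  have *: "norm (\<omega> r - \<omega> s) \<le> C * K * \<bar>r - s\<bar>" if sr: "s \<le> r" "s \<in> {a..b}" "r \<in> {a..b}" for s r
  proof -
    have "nrm x (\<omega> r - \<omega> s) \<le> K * (r - s)"
      using that I by (intro lift_Lipschitz[OF \<sigma> K _ sr(1)] continuous_on_subset[OF u] lift) auto
    then have "C * nrm x (\<omega> r - \<omega> s) \<le> C * (K * (r - s))" using C(2) by (intro mult_left_mono) auto
    then show ?thesis using C(1)[of "\<omega> r - \<omega> s"] sr(1) by (simp add: mult.assoc)
  qed
  show ?thesis
    using *[of s r] *[of r s] s by (cases "s \<le> r") (auto simp: norm_minus_commute abs_minus_commute)
qed

text \<open>For a mere local homeomorphism a lift could run off to infinity in finite time. The
  Lipschitz bound excludes this: the lift is uniformly continuous up to the critical time and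
  extends by completeness of the tangent space.\<close>

lemma lift_exists:
  assumes \<sigma>: "speed_le \<sigma> K" and K: "0 \<le> K" and u0: "ex x u0 = \<sigma> 0"
  shows "\<exists>\<omega>. continuous_on {0..1} \<omega> \<and> \<omega> 0 = u0 \<and> (\<forall>s\<in>{0..1}. ex x (\<omega> s) = \<sigma> s)"
proof -
  obtain C where C: "C > 0" "\<And>v. norm v \<le> C * nrm x v" using nrm_equiv[of x] by blast
  define isl where "isl = (\<lambda>t \<omega>. continuous_on {0..t} \<omega> \<and> \<omega> 0 = u0 \<and> (\<forall>s\<in>{0..t}. ex x (\<omega> s) = \<sigma> s))"
  have islsub: "isl s \<omega>" if "isl t \<omega>" "s \<le> t" for s t \<omega>
    using that by (auto simp: isl_def intro: continuous_on_subset)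
  have uniq: "\<omega> s = v s" if "isl t \<omega>" "isl t v" "s \<in> {0..t}" for t \<omega> v s
    by (rule lift_unique[of "{0..t}" \<omega> v x 0]) (use that in \<open>auto simp: isl_def\<close>)
  have c\<sigma>: "continuous_on {0..1} \<sigma>" using \<sigma> by (simp add: speed_le_def)
  have "1 \<in> {0..1::real}" by simp
  then have "\<exists>\<omega>. isl 1 \<omega>"
  proof (induction rule: real_induction)
    case start
    show ?case using u0 by (intro exI[of _ "\<lambda>_. u0"]) (simp add: isl_def)
  next
    case (left t)
    \<comment> \<open>A lift is chosen separately for every earlier end time. By uniqueness the
      choices agree, and their diagonal is one continuous lift on the half open interval.\<close>
    define F where "F = (\<lambda>s. SOME \<omega>. isl s \<omega>)"
    have F: "isl s (F s)" if "0 \<le> s" "s < t" for s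
      unfolding F_def by (rule someI_ex[of "isl s"]) (rule left(3)[OF that])
    define \<omega> where "\<omega> = (\<lambda>s. F s s)"
    have \<omega>F: "\<omega> s = F r s" if "0 \<le> s" "s \<le> r" "r < t" for s r
      using uniq[OF F[of s] islsub[OF F[of r]], of s] that by (simp add: \<omega>_def)
    have Fr: "continuous_on {0..r} \<omega>" if "r < t" for r
    proof (cases "0 \<le> r")
      case True
      show ?thesis by (rule continuous_on_eq[of _ "F r"]) (use F[OF True that] \<omega>F that in \<open>auto simp:
        isl_def\<close>)
    qed simp
    have lift: "ex x (\<omega> s) = \<sigma> s" if "s \<in> {0..<t}" for s
      using F[of s] that by (auto simp: \<omega>_def isl_def)
    have lip: "norm (\<omega> r - \<omega> s) \<le> C * K * \<bar>r - s\<bar>" if "s \<in> {0..<t}" "r \<in> {0..<t}" for r s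
      by (rule lift_norm_Lipschitz[OF \<sigma> K _ Fr[of "max s r"] _ C(2,1)]) (use that left lift in auto)
    have "uniformly_continuous_on {0..<t} \<omega>"
      unfolding uniformly_continuous_on_def
    proof (intro allI impI)
      fix e :: real assume e: "e > 0"
      have "dist (\<omega> r) (\<omega> s) < e" if "s \<in> {0..<t}" "r \<in> {0..<t}" "dist r s < e / (C * K + 1)" for s r
      proof -
        have "dist (\<omega> r) (\<omega> s) \<le> C * K * \<bar>r - s\<bar>" using lip[OF that(1,2)] by (simp add: dist_norm)
        also have "\<dots> \<le> (C * K + 1) * \<bar>r - s\<bar>" using C K by (intro mult_right_mono) auto
        also have "\<dots> < e" using that(3) C K by (simp add: dist_real_def pos_less_divide_eq mult.commute
          add_nonneg_pos)
        finally show ?thesis .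
      qed
      moreover have "e / (C * K + 1) > 0" using e C K by (simp add: add_nonneg_pos)
      ultimately show "\<exists>d>0. \<forall>x\<in>{0..<t}. \<forall>x'\<in>{0..<t}. dist x' x < d \<longrightarrow> dist (\<omega> x') (\<omega> x) < e" by blast
    qed
    then obtain G where G: "uniformly_continuous_on (closure {0..<t}) G" "\<And>s. s \<in> {0..<t} \<Longrightarrow> \<omega> s = G s"
      using uniformly_continuous_on_extension_on_closure by metis
    have cl: "closure {0..<t} = {0..t}" using left(1) by simp
    have cG: "continuous_on {0..t} G" using uniformly_continuous_imp_continuous[OF G(1)] by (simp add: cl)
    have "isl t G" unfolding isl_def
    proof (intro conjI ballI cG)
      show "G 0 = u0" using F[of 0] G(2)[of 0] left(1) by (simp add: isl_def \<omega>_def)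
      fix s assume s: "s \<in> {0..t}"
      show "ex x (G s) = \<sigma> s"
      proof (cases "s < t")
        case True
        then show ?thesis using lift[of s] G(2)[of s] s by simp
      next
        case False
        then have "s = t" using s by simp
        have nb: "at t within {0..<t} \<noteq> bot"
          using left(1) by (simp add: at_within_eq_bot_iff closure_greaterThanLessThan islimpt_in_closure)
        have t01: "t \<in> {0..1}" using left by auto
        have "continuous_on {0..t} (\<lambda>s. ex x (G s))"
          by (rule continuous_on_compose2[OF continuous_on_ex[of UNIV] cG]) simp
        then have "((\<lambda>s. ex x (G s)) \<longlongrightarrow> ex x (G t)) (at t within {0..t})"
          using left(1) by (simp add: continuous_on_def)
        then have "((\<lambda>s. ex x (G s)) \<longlongrightarrow> ex x (G t)) (at t within {0..<t})"
          by (rule tendsto_within_subset) auto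
        then have "(\<sigma> \<longlongrightarrow> ex x (G t)) (at t within {0..<t})"
          by (rule Lim_transform_eventually) (use lift G(2) in \<open>auto simp: eventually_at_filter\<close>)
        moreover have "(\<sigma> \<longlongrightarrow> \<sigma> t) (at t within {0..1})"
          using c\<sigma> t01 by (simp add: continuous_on_def)
        then have "(\<sigma> \<longlongrightarrow> \<sigma> t) (at t within {0..<t})"
          by (rule tendsto_within_subset) (use left(2) in auto)
        ultimately show ?thesis using tendsto_unique[OF nb] \<open>s = t\<close> by blast
      qed
    qed
    then show ?case by blast
  next
    case (right t)
    obtain \<omega> where \<omega>: "isl t \<omega>" using right(3)[of t] right(1) by auto
    \<comment> \<open>Beyond \<open>t\<close> the lift is continued by a local inverse at its
      present value.\<close>
    obtain \<epsilon> \<psi> where \<epsilon>: "\<epsilon> > 0" "open (ex x ` ball (\<omega> t) \<epsilon>)" "continuous_on (ex x ` ball (\<omega> t) \<epsilon>) \<psi>" "\<And>v. v \<in>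
      ball (\<omega> t) \<epsilon> \<Longrightarrow> \<psi> (ex x v) = v"
      using ex_local_inverse by metis
    have t01: "t \<in> {0..1}" using right by auto
    have \<sigma>t: "\<sigma> t = ex x (\<omega> t)" using \<omega> right(1) by (simp add: isl_def)
    then have "\<sigma> t \<in> ex x ` ball (\<omega> t) \<epsilon>" using \<epsilon>(1) by simp
    moreover have "(\<sigma> \<longlongrightarrow> \<sigma> t) (at t within {0..1})" using c\<sigma> t01 by (simp add: continuous_on_def)
    ultimately have "\<forall>\<^sub>F s in at t within {0..1}. \<sigma> s \<in> ex x ` ball (\<omega> t) \<epsilon>"
      using topological_tendstoD \<epsilon>(2) by blast
    then obtain d where d: "d > 0" "\<And>s. s \<in> {0..1} \<Longrightarrow> s \<noteq> t \<Longrightarrow> dist s t < d \<Longrightarrow> \<sigma> s \<in> ex x ` ball (\<omega> t) \<epsilon>"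
      unfolding eventually_at by blast
    show ?case
    proof (intro exI[of _ d] conjI allI impI)
      fix s assume s: "t < s \<and> s < t + d \<and> s \<le> 1"
      have sub: "\<sigma> ` {t..s} \<subseteq> ex x ` ball (\<omega> t) \<epsilon>"
      proof safe
        fix r assume r: "r \<in> {t..s}"
        then show "\<sigma> r \<in> ex x ` ball (\<omega> t) \<epsilon>"
          using d(2)[of r] s right(1) \<open>\<sigma> t \<in> _\<close> by (cases "r = t") (auto simp: dist_real_def)
      qed
      define v where "v = (\<lambda>r. if r \<le> t then \<omega> r else \<psi> (\<sigma> r))"
      have "continuous_on {0..s} v" unfolding v_def
      proof (rule continuous_on_cases_le[where h = "\<lambda>r. r"])
        have "{x \<in> {0..s}. x \<le> t} = {0..t}" using s by auto
        then show "continuous_on {x \<in> {0..s}. x \<le> t} \<omega>" using \<omega> by (simp add: isl_def)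
        have ts: "{x \<in> {0..s}. t \<le> x} = {t..s}" using right(1) by auto
        have "continuous_on {t..s} \<sigma>" using c\<sigma> s right(1) by (auto intro: continuous_on_subset)
        then show "continuous_on {x \<in> {0..s}. t \<le> x} (\<lambda>r. \<psi> (\<sigma> r))"
          unfolding ts by (rule continuous_on_compose2[OF \<epsilon>(3) _ sub])
      qed (use \<epsilon>(1,4) \<sigma>t in auto)
      moreover have "ex x (v r) = \<sigma> r" if r: "r \<in> {0..s}" for r
      proof (cases "r \<le> t")
        case True
        then show ?thesis using \<omega> r by (simp add: v_def isl_def)
      next
        case False
        then have "\<sigma> r \<in> ex x ` ball (\<omega> t) \<epsilon>" using sub r by auto
        then obtain w where "w \<in> ball (\<omega> t) \<epsilon>" "\<sigma> r = ex x w" by blast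
        then show ?thesis using False \<epsilon>(4) by (simp add: v_def)
      qed
      moreover have "v 0 = u0" using \<omega> right(1) by (simp add: v_def isl_def)
      ultimately show "\<exists>\<omega>. isl s \<omega>" by (auto simp: isl_def)
    qed (rule d(1))
  qed
  then show ?thesis by (simp add: isl_def)
qed

lemma lift_geodesic:
  assumes "geodesic_on M UNIV \<gamma>" "ex x u0 = \<gamma> 0"
  shows "\<exists>\<omega>. continuous_on {0..1} \<omega> \<and> \<omega> 0 = u0 \<and> (\<forall>s\<in>{0..1}. ex x (\<omega> s) = \<gamma> s)"
  by (rule lift_exists[OF speed_le_geodesic[OF assms(1)] _ assms(2)]) simp

text \<open>The constant loops at two points are freely homotopic, and the image of the homotopy is
  a connected set containing both points.\<close>

lemma connected_UNIV: "connected (UNIV :: 'm set)"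
proof (rule connectedI_const)
  fix P :: "'m \<Rightarrow> bool" assume P: "continuous_on UNIV P"
  have "P a = P b" for a b
  proof -
    have sc: "simply_connected (UNIV :: 'm set)" using hadamard by (simp add: hadamard_manifold_def)
    have "homotopic_loops UNIV (\<lambda>_::real. a) (\<lambda>_. b)"
      using sc[unfolded simply_connected_def] by (simp add: path_def pathfinish_def pathstart_def)
    then obtain h where h: "continuous_on ({0..1::real} \<times> {0..1::real}) h" "\<forall>x\<in>{0..1}. h (0, x) =
      a" "\<forall>x\<in>{0..1}. h (1, x) = b"
      unfolding homotopic_loops by blast
    have "connected (h ` ({0..1} \<times> {0..1}))"
      by (intro connected_continuous_image h(1) convex_connected convex_Times) auto
    moreover have "a \<in> h ` ({0..1} \<times> {0..1})" "b \<in> h ` ({0..1} \<times> {0..1})"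
      using h(2,3) by (force simp: image_iff)+
    ultimately show "P a = P b"
      using connectedD_const[of "h ` ({0..1} \<times> {0..1})" P] P continuous_on_subset by (metis subset_UNIV)
  qed
  then show "\<exists>c. \<forall>s\<in>UNIV. P s = c" by blast
qed

lemma ex_reverse_geo:
  obtains w where "ex (ex x u) w = x" "\<And>s. geo (ex x u) w s = geo x u (1 - s)"
proof
  show "ex (ex x u) (- velocity M UNIV (geo x u) 1) = x" by (rule ex_reverse)
  show "geo (ex x u) (- velocity M UNIV (geo x u) 1) s = geo x u (1 - s)" for s
    using geo_shift[of x u 1 "-1" s] by (simp add: ex_geo)
qed

text \<open>The image is open, and so is its complement: if exponentials from \<open>p\<close> and
  from \<open>x\<close> meet, the geodesic back from the common point to \<open>p\<close> lifts, so
  \<open>p\<close> lies in the image as well.\<close>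

lemma surj_ex: "surj (ex x)"
proof -
  have op: "open (range (ex x))" by (rule open_map_ex) simp
  have "open (- range (ex x))"
  proof (subst open_subopen, intro ballI)
    fix p assume p: "p \<in> - range (ex x)"
    have "range (ex p) \<subseteq> - range (ex x)"
    proof safe
      fix w u assume "ex p w = ex x u"
      obtain w' where w': "ex (ex p w) w' = p" using ex_reverse_geo by metis
      obtain \<omega> where \<omega>: "\<forall>s\<in>{0..1}. ex x (\<omega> s) = geo (ex p w) w' s"
        using lift_geodesic[OF geo(1), of x u "ex p w" w'] \<open>ex p w = ex x u\<close> by (auto simp: geo)
      then have "ex x (\<omega> 1) = p" using w' by (simp add: ex_geo)
      then show False using p by auto
    qed
    moreover have "p \<in> range (ex p)" using ex_0 by (metis rangeI)
    moreover have "open (range (ex p))" by (rule open_map_ex) simp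
    ultimately show "\<exists>T. open T \<and> p \<in> T \<and> T \<subseteq> - range (ex x)" by blast
  qed
  then have "closedin (top_of_set UNIV) (range (ex x))" by (simp add: closed_def)
  moreover have "openin (top_of_set UNIV) (range (ex x))" using op by simp
  ultimately have "range (ex x) = {} \<or> range (ex x) = UNIV"
    using connected_UNIV unfolding connected_clopen by blast
  then show ?thesis by auto
qed

text \<open>The common speed bound gives all lifts the same Lipschitz constant. Hence there is a
  time step, independent of the index, during which they remain where one local inverse of
  \<open>ex x\<close> determines them.\<close>

lemma lift_convergence:
  assumes \<sigma>: "\<And>n. speed_le (\<sigma> n) K" and K: "0 \<le> K"
    and lim: "\<And>s. s \<in> {0..1} \<Longrightarrow> (\<lambda>n. \<sigma> n s) \<longlonglongrightarrow> \<sigma>0 s"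
    and l: "\<And>n. continuous_on {0..1} (l n)" "\<And>n s. s \<in> {0..1} \<Longrightarrow> ex x (l n s) = \<sigma> n s"
    and l0: "continuous_on {0..1} l0" "\<And>s. s \<in> {0..1} \<Longrightarrow> ex x (l0 s) = \<sigma>0 s"
    and init: "(\<lambda>n. l n 0) \<longlonglongrightarrow> l0 0" and t: "t \<in> {0..1}"
  shows "(\<lambda>n. l n t) \<longlonglongrightarrow> l0 t"
proof -
  obtain C where C: "C > 0" "\<And>v. norm v \<le> C * nrm x v" using nrm_equiv[of x] by blast
  show ?thesis
  proof (rule interval_propagate[where P = "\<lambda>t. (\<lambda>n. l n t) \<longlonglongrightarrow> l0 t", OF t init])
    fix t :: real assume t: "t \<in> {0..1}"
    obtain \<epsilon> \<psi> where \<epsilon>: "\<epsilon> > 0" "open (ex x ` ball (l0 t) \<epsilon>)" "continuous_on (ex x ` ball (l0 t) \<epsilon>) \<psi>" "\<And>v. v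
      \<in> ball (l0 t) \<epsilon> \<Longrightarrow> \<psi> (ex x v) = v"
      using ex_local_inverse by metis
    obtain d1 where d1: "d1 > 0" "\<And>s. s \<in> {0..1} \<Longrightarrow> dist s t < d1 \<Longrightarrow> dist (l0 s) (l0 t) < \<epsilon> / 3"
      using l0(1) t \<epsilon>(1) unfolding continuous_on_iff by (metis divide_pos_pos zero_less_numeral)
    \<comment> \<open>Two times within \<open>d\<close> of \<open>t\<close> are less than
      \<open>2 * d\<close> apart, so a lift moves by at most a third of \<epsilon> between them. The
      other two thirds go to the convergence at time \<open>s\<close> and to the oscillation of the
      limit lift.\<close>
    define d where "d = min d1 (\<epsilon> / (6 * (C * K + 1)))"
    have CK: "C * K + 1 > 0" using C K by (simp add: add_nonneg_pos)
    have d: "d > 0" "d \<le> d1" "2 * d * (C * K + 1) \<le> \<epsilon> / 3"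
    proof -
      show "d > 0" "d \<le> d1" using d1 \<epsilon> CK by (auto simp: d_def)
      have "d \<le> \<epsilon> / (6 * (C * K + 1))" by (simp add: d_def)
      then show "2 * d * (C * K + 1) \<le> \<epsilon> / 3" using CK by (simp add: field_simps)
    qed
    show "\<exists>\<epsilon>>0. \<forall>s r. s \<in> {0..1} \<and> r \<in> {0..1} \<and> s \<le> r \<and> t - \<epsilon> < s \<and> r < t + \<epsilon> \<and> (\<lambda>n. l n s) \<longlonglongrightarrow> l0 s \<longrightarrow>
      (\<lambda>n. l n r) \<longlonglongrightarrow> l0 r"
    proof (intro exI[of _ d] conjI allI impI)
      fix s r assume h: "s \<in> {0..1} \<and> r \<in> {0..1} \<and> s \<le> r \<and> t - d < s \<and> r < t + d \<and> (\<lambda>n. l n s) \<longlonglongrightarrow> l0 s"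
      then have near: "dist s t < d1" "dist r t < d1" "\<bar>r - s\<bar> \<le> 2 * d" using d by (auto simp: dist_real_def)
      have r0: "l0 r \<in> ball (l0 t) \<epsilon>" using d1(2)[of r] h near \<epsilon>(1) by (simp add: dist_commute)
      have "\<forall>\<^sub>F n in sequentially. dist (l n s) (l0 s) < \<epsilon> / 3" using h \<epsilon>(1) by (intro tendstoD) auto
      then have ev: "\<forall>\<^sub>F n in sequentially. l n r \<in> ball (l0 t) \<epsilon>"
      proof eventually_elim
        case (elim n)
        have "norm (l n r - l n s) \<le> C * K * \<bar>r - s\<bar>"
          by (rule lift_norm_Lipschitz[OF \<sigma> K order_refl l(1) l(2) C(2,1)]) (use h in auto)
        also have "\<dots> \<le> (C * K + 1) * (2 * d)" using near C K by (intro mult_mono) auto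
        also have "\<dots> = 2 * d * (C * K + 1)" by simp
        also note d(3)
        finally have "dist (l n r) (l n s) \<le> \<epsilon> / 3" by (simp add: dist_norm)
        moreover have "dist (l0 s) (l0 t) < \<epsilon> / 3" using d1(2) h near by auto
        ultimately show ?case using elim dist_triangle[of "l n r" "l0 t" "l n s"] dist_triangle[of "l n s"
          "l0 t" "l0 s"]
          by (simp add: dist_commute)
      qed
      have "isCont \<psi> (ex x (l0 r))" using \<epsilon>(2,3) r0 by (simp add: continuous_on_eq_continuous_at)
      moreover have "(\<lambda>n. \<sigma> n r) \<longlonglongrightarrow> ex x (l0 r)" using lim[of r] l0(2)[of r] h by simp
      ultimately have "(\<lambda>n. \<psi> (\<sigma> n r)) \<longlonglongrightarrow> \<psi> (ex x (l0 r))" by (rule isCont_tendsto_compose)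
      then have "(\<lambda>n. \<psi> (\<sigma> n r)) \<longlonglongrightarrow> l0 r" using \<epsilon>(4)[OF r0] by simp
      then show "(\<lambda>n. l n r) \<longlonglongrightarrow> l0 r"
      proof (rule Lim_transform_eventually)
        show "\<forall>\<^sub>F n in sequentially. \<psi> (\<sigma> n r) = l n r"
          using ev by eventually_elim (use \<epsilon>(4) l(2) h in metis)
      qed
    qed (rule d(1))
  qed
qed

section \<open>The exponential map is a covering, and injective\<close>

text \<open>The neighbourhood is the image of a ball of the tangent space at \<open>p\<close>. A
  vector belongs to the sheet over \<open>u\<close> if the lift of the radial geodesic running back
  to \<open>p\<close> ends at \<open>u\<close>.\<close>

lemma evenly_covered:
  "\<exists>N. open N \<and> p \<in> N \<and> (\<exists>S. (\<Union>u\<in>ex x -` {p}. S u) = ex x -` N \<and> (\<forall>u\<in>ex x -` {p}. open (S u)) \<and>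
    (\<forall>u\<in>ex x -` {p}. \<forall>u'\<in>ex x -` {p}. u \<noteq> u' \<longrightarrow> S u \<inter> S u' = {}) \<and>
    (\<forall>u\<in>ex x -` {p}. \<exists>\<theta>. homeomorphism (S u) N (ex x) \<theta>))"
proof -
  obtain r \<psi> where r: "r > 0" "open (ex p ` ball 0 r)" "continuous_on (ex p ` ball 0 r) \<psi>" "\<And>v. v \<in> ball 0 r
    \<Longrightarrow> \<psi> (ex p v) = v"
    using ex_local_inverse by metis
  define N where "N = ex p ` ball 0 r"
  have N: "open N" "p \<in> N" using r(1,2) ex_0[of p] unfolding N_def by (metis, metis centre_in_ball imageI)
  have \<psi>: "ex p (\<psi> q) = q" "\<psi> q \<in> ball 0 r" if "q \<in> N" for q using that r(4) by (auto simp: N_def)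
  obtain Cp where Cp: "Cp > 0" "\<And>v. nrm p v \<le> Cp * norm v" using nrm_equiv[of p] by blast
  \<comment> \<open>The radial geodesic of the neighbourhood, run backwards from
    \<open>ex x v\<close> at time 0 to \<open>p\<close> at time 1.\<close>
  define rev where "rev = (\<lambda>v s. geo p (\<psi> (ex x v)) (- 1 * s + 1))"
  have grev: "geodesic_on M UNIV (rev v)" for v unfolding rev_def by (rule geodesic_affine(1)[OF geo(1)])
  have rev0: "rev v 0 = ex x v" if "ex x v \<in> N" for v using \<psi>(1)[OF that] by (simp add: rev_def ex_geo)
  have rev1: "rev v 1 = p" for v by (simp add: rev_def geo)
  define L where "L = (\<lambda>v. SOME \<omega>. continuous_on {0..1} \<omega> \<and> \<omega> 0 = v \<and> (\<forall>s\<in>{0..1}. ex x (\<omega> s) = rev v s))"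
  have L: "continuous_on {0..1} (L v)" "L v 0 = v" "\<And>s. s \<in> {0..1} \<Longrightarrow> ex x (L v s) = rev v s"
    if "ex x v \<in> N" for v
  proof -
    have "\<exists>\<omega>. continuous_on {0..1} \<omega> \<and> \<omega> 0 = v \<and> (\<forall>s\<in>{0..1}. ex x (\<omega> s) = rev v s)"
      by (rule lift_geodesic[OF grev]) (simp add: rev0 that)
    from someI_ex[OF this] show "continuous_on {0..1} (L v)" "L v 0 = v" "\<And>s. s \<in> {0..1} \<Longrightarrow> ex x (L v s) =
      rev v s"
      by (auto simp: L_def)
  qed
  define S where "S = (\<lambda>u. {v. ex x v \<in> N \<and> L v 1 = u})"
  have Lp: "ex x (L v 1) = p" if "ex x v \<in> N" for v using L(3)[OF that, of 1] by (simp add: rev1)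
  have speed: "speed_le (rev v) (Cp * r)" if "ex x v \<in> N" for v
  proof -
    have v: "velocity M UNIV (rev v) 1 = - velocity M UNIV (geo p (\<psi> (ex x v))) 0"
      unfolding rev_def using velocity_affine[OF geo(1), of p "\<psi> (ex x v)" "-1" 1 1] by simp
    have "(nrm (rev v 0) (velocity M UNIV (rev v) 0))\<^sup>2 = (nrm (rev v 1) (velocity M UNIV (rev v) 1))\<^sup>2"
      unfolding nrm_power2 by (rule geodesic_speed_constant[OF grev, symmetric])
    then have "nrm (rev v 0) (velocity M UNIV (rev v) 0) = nrm p (\<psi> (ex x v))"
      by (simp add: v rev1 nrm_minus geo)
    also have "\<dots> \<le> Cp * norm (\<psi> (ex x v))" by (rule Cp(2))
    also have "\<dots> \<le> Cp * r" using \<psi>(2)[OF that] Cp(1) by (intro mult_left_mono) auto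
    finally have "(nrm (rev v 0) (velocity M UNIV (rev v) 0))\<^sup>2 \<le> (Cp * r)\<^sup>2" by (rule power_mono) simp
    with speed_le_geodesic[OF grev[of v]] show ?thesis by (rule speed_le_mono)
  qed
  \<comment> \<open>Vectors outside the sheet that tend to one inside would have lifts ending at
    points of the fibre over \<open>p\<close> that tend to \<open>u\<close>. The fibre is discrete,
    so these end points eventually equal \<open>u\<close>.\<close>
  have opS: "open (S u)" if u: "ex x u = p" for u
  proof (rule ccontr)
    assume "\<not> open (S u)"
    then obtain v0 where v0: "v0 \<in> S u" "\<And>e. e > 0 \<Longrightarrow> \<not> ball v0 e \<subseteq> S u" by (auto simp: open_contains_ball)
    then have v0N: "ex x v0 \<in> N" "L v0 1 = u" by (auto simp: S_def)
    have "open (ex x -` N)" using N(1) continuous_on_ex[of UNIV x] by (simp add: continuous_on_open_vimage)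
    then obtain e0 where e0: "e0 > 0" "ball v0 e0 \<subseteq> ex x -` N" using v0N(1) by (meson openE vimageI)
    have "\<exists>v. v \<in> ball v0 (e0 / (real n + 1)) \<and> v \<notin> S u" for n
      using v0(2)[of "e0 / (real n + 1)"] e0(1) by auto
    then obtain v where v: "\<And>n. v n \<in> ball v0 (e0 / (real n + 1))" "\<And>n. v n \<notin> S u" by metis
    have lim0: "(\<lambda>n. e0 / (real n + 1)) \<longlonglongrightarrow> 0"
      using tendsto_mult_right_zero[OF LIMSEQ_inverse_real_of_nat, of e0]
          by (simp add: divide_inverse add.commute)
    have "dist (v n) v0 \<le> dist (e0 / (real n + 1)) 0" for n
      using v(1)[of n] e0(1) by (simp add: dist_commute less_imp_le)
    then have vlim: "v \<longlonglongrightarrow> v0" by (auto intro!: metric_tendsto_imp_tendsto[OF lim0] always_eventually)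
    have vN: "ex x (v n) \<in> N" for n
    proof -
      have "ball v0 (e0 / (real n + 1)) \<subseteq> ball v0 e0" using e0(1)
        by (intro subset_ball) (simp add: field_simps)
      then show ?thesis using v(1)[of n] e0(2) by blast
    qed
    have "isCont \<psi> (ex x v0)" using r(3) v0N(1) unfolding continuous_on_eq_continuous_at[OF r(2)] N_def
      by blast
    then have \<psi>lim: "(\<lambda>n. \<psi> (ex x (v n))) \<longlonglongrightarrow> \<psi> (ex x v0)"
      by (rule isCont_tendsto_compose) (rule ex_tendsto[OF vlim])
    have "(\<lambda>n. L (v n) 1) \<longlonglongrightarrow> L v0 1"
    proof (rule lift_convergence[where \<sigma> = "\<lambda>n. rev (v n)" and K = "Cp * r" and x = x and ?\<sigma>0.0 = "rev v0"])
      show "speed_le (rev (v n)) (Cp * r)" for n by (rule speed[OF vN])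
      show "(\<lambda>n. rev (v n) s) \<longlonglongrightarrow> rev v0 s" if "s \<in> {0..1}" for s
        unfolding rev_def using that
        by (intro conv_imp_tendsto[where \<sigma> = "\<lambda>n. geo p (\<psi> (ex x (v n)))"] conv_geo_fixed \<psi>lim) auto
      show "(\<lambda>n. L (v n) 0) \<longlonglongrightarrow> L v0 0" using vlim by (simp add: L(2)[OF vN] L(2)[OF v0N(1)])
    qed (use Cp(1) r(1) L vN v0N in auto)
    then have lim: "(\<lambda>n. L (v n) 1) \<longlonglongrightarrow> u" by (simp add: v0N)
    obtain \<epsilon> where \<epsilon>: "\<epsilon> > 0" "inj_on (ex x) (ball u \<epsilon>)" "\<And>U. U \<subseteq> ball u \<epsilon> \<Longrightarrow> open U \<Longrightarrow> open (ex x ` U)"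
      using ex_local_homeomorphism by metis
    have "\<forall>\<^sub>F n in sequentially. dist (L (v n) 1) u < \<epsilon>" using lim \<epsilon>(1) by (rule tendstoD)
    then obtain n where "dist (L (v n) 1) u < \<epsilon>" by (auto simp: eventually_sequentially)
    then have "L (v n) 1 = u" using inj_onD[OF \<epsilon>(2), of "L (v n) 1" u] Lp[OF vN] u \<epsilon>(1)
      by (simp add: dist_commute)
    then show False using v(2)[of n] vN[of n] by (simp add: S_def)
  qed
  have bij: "\<exists>\<theta>. homeomorphism (S u) N (ex x) \<theta>" if u: "ex x u = p" for u
  proof -
    have img: "ex x ` S u = N"
    proof (intro equalityI subsetI)
      fix q assume q: "q \<in> N"
      have "ex x u = geo p (\<psi> q) 0" by (simp add: geo u)
      from lift_geodesic[OF geo(1) this] obtain \<mu> where "continuous_on {0..1} \<mu>" "\<mu> 0 = u"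
        and m: "\<forall>s\<in>{0..1}. ex x (\<mu> s) = geo p (\<psi> q) s"
        by (elim exE conjE) (rule that)
      note \<mu> = \<open>continuous_on {0..1} \<mu>\<close> \<open>\<mu> 0 = u\<close> m[rule_format]
      have 1: "ex x (\<mu> 1) = q" using \<mu>(3)[of 1] \<psi>(1)[OF q] by (simp add: ex_geo)
      \<comment> \<open>By uniqueness of lifts, lifting the reversed geodesic from the end of \<mu>
        retraces \<mu> back to its start \<open>u\<close>.\<close>
      have "L (\<mu> 1) 1 = \<mu> (1 - 1)"
      proof (rule lift_unique[of "{0..1::real}" "L (\<mu> 1)" "\<lambda>s. \<mu> (1 - s)" x 0])
        show "continuous_on {0..1} (\<lambda>s. \<mu> (1 - s))"
          by (rule continuous_on_compose2[OF \<mu>(1)]) (auto intro: continuous_intros)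
        show "ex x (L (\<mu> 1) s) = ex x (\<mu> (1 - s))" if "s \<in> {0..1}" for s
          using L(3)[of "\<mu> 1" s] 1 q that \<mu>(3)[of "1 - s"] by (simp add: rev_def)
      qed (use L[of "\<mu> 1"] 1 q in auto)
      then show "q \<in> ex x ` S u" using 1 q \<mu>(2) by (auto simp: S_def image_iff intro!: exI[of _ "\<mu> 1"])
    qed (auto simp: S_def)
    have inj: "inj_on (ex x) (S u)"
    proof (rule inj_onI)
      fix v v' assume v: "v \<in> S u" "v' \<in> S u" and eq: "ex x v = ex x v'"
      have "L v 0 = L v' 0"
        by (rule lift_unique[of "{0..1::real}" "L v" "L v'" x 1]) (use L[of v] L[of v'] v eq in \<open>auto simp:
            S_def rev_def\<close>)
      then show "v = v'" using L(2)[of v] L(2)[of v'] v by (simp add: S_def)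
    qed
    obtain \<theta> where "homeomorphism (S u) N (ex x) \<theta>"
    proof (rule homeomorphism_injective_open_map[OF continuous_on_ex img inj])
      fix U assume "openin (top_of_set (S u)) U"
      then have "open U" "U \<subseteq> S u" using opS[OF u] by (auto simp: openin_open_eq)
      then show "openin (top_of_set N) (ex x ` U)" using open_map_ex[of U x] img N(1)
        by (auto simp: openin_open_eq)
    qed
    then show ?thesis by blast
  qed
  show ?thesis
  proof (rule exI[of _ N], intro conjI N, rule exI[of _ S], intro conjI)
    show "(\<Union>u\<in>ex x -` {p}. S u) = ex x -` N" using Lp by (auto simp: S_def)
  qed (use opS bij in \<open>auto simp: S_def\<close>)
qed

text \<open>The library's lifting theorems are for maps between normed spaces; they are applied to the
  pull-back of the exponential map along a homotopy.\<close>

lemma homotopy_lift: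
  fixes H :: "real \<times> real \<Rightarrow> 'm"
  assumes H: "continuous_on ({0..1} \<times> {0..1}) H" and u0: "ex x u0 = H (0, 0)"
  shows "\<exists>k. continuous_on ({0..1} \<times> {0..1}) k \<and> (\<forall>z\<in>{0..1} \<times> {0..1}. ex x (k z) = H z) \<and> k (0, 0) = u0"
proof -
  define Z where "Z = {0..1::real} \<times> {0..1::real}"
  define C where "C = {zv. fst zv \<in> Z \<and> H (fst zv) = ex x (snd zv)}"
  have cov: "covering_space C fst Z"
  proof
    show "continuous_on C fst" by (intro continuous_intros)
    show "fst ` C = Z"
    proof (intro equalityI subsetI)
      fix z assume z: "z \<in> Z"
      obtain v where "H z = ex x v" using surj_ex by (metis surjD)
      then show "z \<in> fst ` C" using z by (intro image_eqI[of _ _ "(z, v)"]) (auto simp: C_def)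
    qed (auto simp: C_def)
    fix z assume z: "z \<in> Z"
    obtain N S where N0: "open N" "H z \<in> N" "(\<Union>u\<in>ex x -` {H z}. S u) = ex x -` N"
      "\<forall>u\<in>ex x -` {H z}. open (S u)"
      "\<forall>u\<in>ex x -` {H z}. \<forall>u'\<in>ex x -` {H z}. u \<noteq> u' \<longrightarrow> S u \<inter> S u' = {}"
      "\<forall>u\<in>ex x -` {H z}. \<exists>\<theta>. homeomorphism (S u) N (ex x) \<theta>"
      using evenly_covered[of "H z" x] by (elim exE conjE) (rule that)
    note N = N0(1-3) N0(4)[rule_format] N0(5)[rule_format] N0(6)[rule_format]
    define T where "T = Z \<inter> H -` N"
    define S' where "S' = (\<lambda>u. C \<inter> (UNIV \<times> S u))"
    have SN: "S u \<subseteq> ex x -` N" if "u \<in> ex x -` {H z}" for u using N(3) that by blast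
    show "\<exists>T. z \<in> T \<and> openin (top_of_set Z) T \<and> (\<exists>v. \<Union> v = C \<inter> fst -` T \<and> (\<forall>u\<in>v. openin (top_of_set C) u) \<and>
        pairwise disjnt v \<and> (\<forall>u\<in>v. \<exists>q. homeomorphism u T fst q))"
    proof (rule exI[of _ T], intro conjI, goal_cases)
      case 1
      show ?case using z N(2) by (simp add: T_def)
    next
      case 2
      show ?case unfolding T_def by (intro continuous_openin_preimage_gen N(1)) (use H Z_def in simp)
    next
      case 3
      show ?case
      proof (rule exI[of _ "S' ` (ex x -` {H z})"], intro conjI)
        show "\<Union> (S' ` (ex x -` {H z})) = C \<inter> fst -` T"
        proof (intro equalityI subsetI)
          fix zv assume "zv \<in> \<Union> (S' ` (ex x -` {H z}))"
          then obtain u where u: "u \<in> ex x -` {H z}" "zv \<in> C" "snd zv \<in> S u" by (auto simp: S'_def)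
          then have "ex x (snd zv) \<in> N" using SN by blast
          then show "zv \<in> C \<inter> fst -` T" using u(2) by (simp add: C_def T_def)
        next
          fix zv assume zv: "zv \<in> C \<inter> fst -` T"
          then have "snd zv \<in> ex x -` N" by (auto simp: C_def T_def)
          then obtain u where "u \<in> ex x -` {H z}" "snd zv \<in> S u" using N(3) by blast
          then show "zv \<in> \<Union> (S' ` (ex x -` {H z}))" using zv by (auto simp: S'_def mem_Times_iff)
        qed
        show "\<forall>u\<in>S' ` (ex x -` {H z}). openin (top_of_set C) u"
          unfolding S'_def using N(4) by (auto intro!: openin_open_Int open_Times)
        show "pairwise disjnt (S' ` (ex x -` {H z}))"
          unfolding pairwise_def disjnt_def S'_def using N(5) by blast
        show "\<forall>u\<in>S' ` (ex x -` {H z}). \<exists>q. homeomorphism u T fst q"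
        proof
          fix W assume "W \<in> S' ` (ex x -` {H z})"
          then obtain u where u': "u \<in> ex x -` {H z}" and W: "W = S' u" by blast
          obtain \<theta> where \<theta>: "homeomorphism (S u) N (ex x) \<theta>" using N(6)[OF u'] by blast
          have "homeomorphism (S' u) T fst (\<lambda>z. (z, \<theta> (H z)))"
          proof (rule homeomorphismI)
            show "continuous_on (S' u) fst" by (intro continuous_intros)
            have cH: "continuous_on T H" using H by (rule continuous_on_subset) (auto simp: T_def Z_def)
            have HN: "H ` T \<subseteq> N" by (auto simp: T_def)
            have c\<theta>: "continuous_on N \<theta>" using \<theta> by (simp add: homeomorphism_def)
            show "continuous_on T (\<lambda>z. (z, \<theta> (H z)))"
              by (rule continuous_on_Pair[OF continuous_on_id continuous_on_compose2[OF c\<theta> cH HN]])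
            show "fst ` S' u \<subseteq> T" using SN[OF u'] by (auto simp: S'_def C_def T_def)
            have \<theta>N: "\<theta> y \<in> S u" "ex x (\<theta> y) = y" if "y \<in> N" for y using \<theta> that
              by (auto simp: homeomorphism_def)
            show "(\<lambda>z. (z, \<theta> (H z))) ` T \<subseteq> S' u" using \<theta>N by (auto simp: S'_def C_def T_def)
            show "(fst zv, \<theta> (H (fst zv))) = zv" if "zv \<in> S' u" for zv
            proof -
              have "H (fst zv) = ex x (snd zv)" "snd zv \<in> S u" using that by (auto simp: S'_def C_def)
              then have "\<theta> (H (fst zv)) = snd zv" using \<theta> by (simp add: homeomorphism_def)
              then show ?thesis by simp
            qed
          qed simp
          then show "\<exists>q. homeomorphism W T fst q" unfolding W by blast
        qed
      qed
    qed
  qed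
  have convZ: "convex Z" unfolding Z_def by (intro convex_Times) auto
  have "(0, 0) \<in> Z" "((0, 0), u0) \<in> C" using u0 by (auto simp: Z_def C_def)
  \<comment> \<open>Lifting the identity of the square produces a section of the pulled-back
    covering; its second component is the lift of \<open>H\<close>.\<close>
  then obtain k where k: "continuous_on Z k" "k \<in> Z \<rightarrow> C" "k (0, 0) = ((0, 0), u0)" "\<And>y. y \<in> Z \<Longrightarrow> fst (k y) = y"
    using covering_space_lift_strong[OF cov, of "((0, 0), u0)" "(0, 0)" Z "\<lambda>z. z"]
        convex_imp_simply_connected[OF convZ] convex_imp_locally_path_connected[OF convZ]
    by (auto simp: continuous_on_id)
  show ?thesis
  proof (intro exI[of _ "\<lambda>z. snd (k z)"] conjI ballI)
    show "continuous_on ({0..1} \<times> {0..1}) (\<lambda>z. snd (k z))" using k(1)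
      by (auto simp: Z_def intro: continuous_intros)
    fix z assume "z \<in> {0..1::real} \<times> {0..1::real}"
    then have z: "z \<in> Z" by (simp add: Z_def)
    then have "k z \<in> C" using k(2) by blast
    then show "ex x (snd (k z)) = H z" using k(4)[OF z] by (simp add: C_def)
  qed (simp add: k(3))
qed

text \<open>The segment from \<open>u0\<close> to \<open>u1\<close> is mapped to a loop. A
  contraction of this loop is lifted to \<open>k\<close>, whose edge at time 0 is the segment. The
  edge over the constant loop is constant, so the two remaining edges agree at time 1; the homotopy
  is free, hence both lift the same track of the base point, and they agree at time 0 too.\<close>

lemma inj_ex: "inj (ex x)"
proof (rule injI)
  fix u0 u1 assume eq: "ex x u0 = ex x u1"
  define l where "l = (\<lambda>t::real. ex x ((1 - t) *\<^sub>R u0 + t *\<^sub>R u1))"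
  define y where "y = ex x u0"
  have sc: "simply_connected (UNIV :: 'm set)" using hadamard by (simp add: hadamard_manifold_def)
  have "path l" unfolding path_def l_def
    by (rule continuous_on_compose2[OF continuous_on_ex[of UNIV]]) (auto intro!: continuous_intros)
  then have "homotopic_loops UNIV l (\<lambda>_. y)"
    using sc[unfolded simply_connected_def] eq by (simp add: path_def pathfinish_def pathstart_def l_def)
  then obtain h where h: "continuous_on ({0..1::real} \<times> {0..1::real}) h" "\<And>s. s \<in> {0..1} \<Longrightarrow> h (0, s) =
    l s" "\<And>s. s \<in> {0..1} \<Longrightarrow> h (1, s) = y"
    "\<And>t. t \<in> {0..1} \<Longrightarrow> h (t, 1) = h (t, 0)"
    unfolding homotopic_loops by (auto simp: pathfinish_def pathstart_def)
  obtain k where k: "continuous_on ({0..1} \<times> {0..1}) k" "\<And>z. z \<in> {0..1} \<times> {0..1} \<Longrightarrow> ex x (k z) =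
    h z" "k (0, 0) = u0"
    using homotopy_lift[OF h(1), of x u0] h(2)[of 0] by (auto simp: l_def)
  have cont: "continuous_on {0..1} (\<lambda>t. k (a t, b t))"
    if "continuous_on {0..1} a" "continuous_on {0..1} b" "a ` {0..1} \<subseteq> {0..1}" "b ` {0..1} \<subseteq> {0..1}"
      for a b :: "real \<Rightarrow> real"
    by (rule continuous_on_compose2[OF k(1)]) (use that in \<open>auto intro!: continuous_intros\<close>)
  have "k (0, 1) = (1 - 1) *\<^sub>R u0 + 1 *\<^sub>R u1"
  proof (rule lift_unique[of "{0..1::real}" "\<lambda>t. k (0, t)" "\<lambda>t. (1 - t) *\<^sub>R u0 + t *\<^sub>R u1" x 0])
    show "continuous_on {0..1} (\<lambda>t. k (0, t))" by (rule cont) auto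
    show "ex x (k (0, t)) = ex x ((1 - t) *\<^sub>R u0 + t *\<^sub>R u1)" if "t \<in> {0..1}" for t
      using k(2)[of "(0, t)"] h(2)[OF that] that by (simp add: l_def)
  qed (auto simp: k intro!: continuous_intros)
  moreover have "k (1, 1) = k (1, 0)"
  proof (rule lift_unique[of "{0..1::real}" "\<lambda>t. k (1, t)" "\<lambda>t. k (1, 0)" x 0])
    show "continuous_on {0..1} (\<lambda>t. k (1, t))" by (rule cont) auto
    show "ex x (k (1, t)) = ex x (k (1, 0))" if "t \<in> {0..1}" for t
      using k(2)[of "(1, t)"] k(2)[of "(1, 0)"] h(3)[of t] h(3)[of 0] that by simp
  qed auto
  moreover have "k (0, 1) = k (0, 0)"
  proof (rule lift_unique[of "{0..1::real}" "\<lambda>t. k (t, 1)" "\<lambda>t. k (t, 0)" x 1])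
    show "continuous_on {0..1} (\<lambda>t. k (t, 1))" "continuous_on {0..1} (\<lambda>t. k (t, 0))" by (rule cont; auto)+
    show "ex x (k (t, 1)) = ex x (k (t, 0))" if "t \<in> {0..1}" for t
      using k(2)[of "(t, 1)"] k(2)[of "(t, 0)"] h(4)[OF that] that by simp
  qed (use \<open>k (1, 1) = k (1, 0)\<close> in auto)
  ultimately show "u0 = u1" using k(3) by simp
qed

end

section \<open>Metric geometry of a Hadamard manifold\<close>

context hadamard_space
begin

section \<open>The inverse exponential map and geodesics between two points\<close>

definition lg :: "'m \<Rightarrow> 'm \<Rightarrow> 'e" where "lg x = inv (ex x)"

lemma ex_lg [simp]: "ex x (lg x y) = y"
  unfolding lg_def by (rule surj_f_inv_f[OF surj_ex])

lemma lg_ex [simp]: "lg x (ex x v) = v"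
  unfolding lg_def by (rule inv_f_f[OF inj_ex])

lemma lg_self [simp]: "lg x x = 0"
  using lg_ex[of x 0] by simp

lemma lg_eqI: "ex x v = y \<Longrightarrow> lg x y = v"
  using lg_ex by blast

lemma continuous_on_lg: "continuous_on UNIV (lg x)"
proof -
  have "open (lg x -` U)" if "open U" for U
  proof -
    have "lg x -` U = ex x ` U" by (auto simp: image_iff intro: exI[of _ "lg x _"]) (metis ex_lg)
    then show ?thesis using open_map_ex[OF that] by simp
  qed
  then show ?thesis by (simp add: continuous_on_open_vimage)
qed

lemma lg_tendsto: "(f \<longlongrightarrow> y) F \<Longrightarrow> ((\<lambda>n. lg x (f n)) \<longlongrightarrow> lg x y) F"
  by (rule continuous_on_tendsto_compose[OF continuous_on_lg]) auto

text \<open>\<open>geod\<close> is cut off outside the unit interval, so it has to be compared with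
  complete geodesics that agree with it only there.\<close>

lemma geodesic_on_cong:
  assumes \<gamma>: "geodesic_on M I \<gamma>" and eq: "\<And>t. t \<in> I \<Longrightarrow> \<gamma> t = \<sigma> t"
  shows "geodesic_on M I \<sigma>"
  unfolding geodesic_on_def
proof (intro conjI ballI)
  show "continuous_on I \<sigma>" using \<gamma> eq by (auto simp: geodesic_on_def intro: continuous_on_eq)
  fix c assume "c \<in> atlas M"
  then obtain s' where s': "\<forall>t\<in>I. \<gamma> t \<in> fst c \<longrightarrow> ((\<lambda>r. snd c (\<gamma> r)) has_vector_derivative s' t) (at t within
    I) \<and>
        (s' has_vector_derivative - christoffel M c (snd c (\<gamma> t)) (s' t) (s' t)) (at t within I)"
    using \<gamma> unfolding geodesic_on_def by blast
  have "((\<lambda>r. snd c (\<sigma> r)) has_vector_derivative s' t) (at t within I)"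
    if "t \<in> I" "((\<lambda>r. snd c (\<gamma> r)) has_vector_derivative s' t) (at t within I)" for t
    by (rule has_vector_derivative_transform[OF that(1) _ that(2)]) (simp add: eq)
  then show "\<exists>s'. \<forall>t\<in>I. \<sigma> t \<in> fst c \<longrightarrow> ((\<lambda>r. snd c (\<sigma> r)) has_vector_derivative s' t) (at t within I) \<and>
        (s' has_vector_derivative - christoffel M c (snd c (\<sigma> t)) (s' t) (s' t)) (at t within I)"
    using s' eq by (intro exI[of _ s']) auto
qed

lemma velocity_cong:
  assumes "\<And>t. t \<in> I \<Longrightarrow> \<gamma> t = \<sigma> t" "t \<in> I"
  shows "velocity M I \<gamma> t = velocity M I \<sigma> t"
proof -
  have "((\<lambda>r. snd c (\<gamma> r)) has_vector_derivative v) (at t within I) \<longleftrightarrow>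
    ((\<lambda>r. snd c (\<sigma> r)) has_vector_derivative v) (at t within I)" for c :: "('m, 'e) chart" and v
    by (metis (no_types, lifting) assms has_vector_derivative_transform)
  then show ?thesis unfolding velocity_def vector_derivative_def by (simp add: assms)
qed

text \<open>A geodesic on the unit interval from \<open>x\<close> is determined by its initial
  velocity, and injectivity of \<open>ex x\<close> determines that velocity from the end
  point.\<close>

lemma geod_eq: "geod M x y = restrict (geo x (lg x y)) {0..1}"
proof -
  let ?\<gamma> = "restrict (geo x (lg x y)) {0..1}"
  show ?thesis unfolding geod_def
  proof (rule the_equality)
    have "geodesic_on M {0..1} (geo x (lg x y))" using geo(1) geodesic_on_subset by blast
    then have "geodesic_on M {0..1} ?\<gamma>" by (rule geodesic_on_cong) simp
    moreover have "geo x (lg x y) 1 = y" by (simp flip: ex_geo)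
    ultimately show "?\<gamma> \<in> extensional {0..1} \<and> geodesic_on M {0..1} ?\<gamma> \<and> ?\<gamma> 0 = x \<and> ?\<gamma> 1 = y"
      by (simp add: geo)
    fix \<gamma> assume \<gamma>: "\<gamma> \<in> extensional {0..1} \<and> geodesic_on M {0..1} \<gamma> \<and> \<gamma> 0 = x \<and> \<gamma> 1 = y"
    define u where "u = velocity M {0..1} \<gamma> 0"
    have gu: "geodesic_on M {0..1} (geo x u)" using geo(1) geodesic_on_subset by blast
    have eq: "\<gamma> t = geo x u t" if "t \<in> {0..1}" for t
      by (rule geodesic_unique_forward[OF _ gu]) (use \<gamma> that in \<open>auto simp: geo velocity_subset[OF geo(1)]
          u_def\<close>)
    then have "ex x u = y" using \<gamma> eq[of 1] by (simp add: ex_geo)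
    then have "lg x y = u" by (rule lg_eqI)
    then show "\<gamma> = ?\<gamma>" using \<gamma> eq by (intro extensionalityI[of _ "{0..1}"]) auto
  qed
qed

lemma geod_geo: "t \<in> {0..1} \<Longrightarrow> geod M x y t = geo x (lg x y) t"
  by (simp add: geod_eq)

lemma geod_velocity_geo: "t \<in> {0..1} \<Longrightarrow> geod_velocity M x y t = velocity M UNIV (geo x (lg x y)) t"
  unfolding geod_velocity_def
  by (subst velocity_cong[of _ _ "geo x (lg x y)"]) (auto simp: geod_geo velocity_subset[OF geo(1)])

lemma geod_velocity_0: "geod_velocity M x y 0 = lg x y"
  by (simp add: geod_velocity_geo geo)

lemma lg_geo: "lg (geo x u s) (geo x u r) = (r - s) *\<^sub>R velocity M UNIV (geo x u) s"
  using geo_shift[of x u s "r - s" 1] by (intro lg_eqI) (simp add: ex_geo)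

lemma lg_reverse: "lg y x = - velocity M UNIV (geo x (lg x y)) 1"
  using lg_geo[of x "lg x y" 1 0] by (simp add: geo flip: ex_geo)

lemma geod_velocity_1: "geod_velocity M x y 1 = - lg y x"
  by (subst lg_reverse[of y x]) (simp add: geod_velocity_geo)

lemma geod_0 [simp]: "geod M x y 0 = x" and geod_1 [simp]: "geod M x y 1 = y"
  by (simp_all add: geod_geo geo flip: ex_geo)

lemma lg_geod_fst: "t \<in> {0..1} \<Longrightarrow> lg x (geod M x y t) = t *\<^sub>R lg x y"
  by (simp add: geod_geo lg_eqI flip: ex_scale)

section \<open>Distance and comparison inequalities\<close>

definition rdist :: "'m \<Rightarrow> 'm \<Rightarrow> real" where "rdist x y = nrm x (lg x y)"

lemma nrm_velocity: "nrm (geo x u t) (velocity M UNIV (geo x u) t) = nrm x u"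
  using geodesic_speed_constant[OF geo(1), of x u t] by (simp add: nrm_def geo)

lemma rdist_sym: "rdist x y = rdist y x"
proof -
  have "geo x (lg x y) 1 = y" by (simp flip: ex_geo)
  then have "rdist y x = nrm (geo x (lg x y) 1) (- velocity M UNIV (geo x (lg x y)) 1)"
    by (simp only: rdist_def lg_reverse[of y x])
  then show ?thesis by (simp only: nrm_minus nrm_velocity rdist_def[of x])
qed

lemma rdist_nonneg [simp]: "0 \<le> rdist x y"
  by (simp add: rdist_def)

lemma rdist_self [simp]: "rdist x x = 0"
  by (simp add: rdist_def)

lemma rdist_eq_0: "rdist x y = 0 \<longleftrightarrow> x = y"
  unfolding rdist_def nrm_eq_0 by (metis ex_0 ex_lg lg_self)

lemma rdist_geo: "rdist (geo x u s) (geo x u r) = \<bar>r - s\<bar> * nrm x u"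
  by (simp add: rdist_def lg_geo nrm_scale nrm_velocity)

lemma rdist_geod: "t \<in> {0..1} \<Longrightarrow> rdist x (geod M x y t) = t * rdist x y"
  by (simp add: rdist_def lg_geod_fst nrm_scale)

text \<open>Composing a curve with \<open>lg x\<close> yields its lift through \<open>ex x\<close>,
  to which \<open>lift_Lipschitz\<close> applies.\<close>

lemma lg_speed:
  assumes "speed_le \<sigma> K" "0 \<le> K"
  shows "nrm x (lg x (\<sigma> 1) - lg x (\<sigma> 0)) \<le> K"
proof -
  have "nrm x (lg x (\<sigma> 1) - lg x (\<sigma> 0)) \<le> K * (1 - 0)"
  proof (rule lift_Lipschitz[OF assms])
    show "continuous_on {0..1} (\<lambda>s. lg x (\<sigma> s))"
      using assms(1) by (intro continuous_on_compose2[OF continuous_on_lg]) (auto simp: speed_le_def)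
  qed auto
  then show ?thesis by simp
qed

text \<open>The global form of the expansion property, obtained by lifting the geodesic from
  \<open>y\<close> to \<open>z\<close>. Both the triangle inequality and the law of cosines are read
  off from it.\<close>

lemma lg_contract: "nrm x (lg x z - lg x y) \<le> rdist y z"
  using lg_speed[OF speed_le_geodesic[OF geo(1)], of y "lg y z" x] by (simp add: geo rdist_def flip: ex_geo)

lemma rdist_triangle: "rdist x z \<le> rdist x y + rdist y z"
  using nrm_triangle[of x "lg x y" "lg x z - lg x y"] lg_contract[of x z y] by (simp add: rdist_def)

lemma cosine_law: "(rdist x y)\<^sup>2 + (rdist x z)\<^sup>2 - 2 * metric M x (lg x y) (lg x z) \<le> (rdist y z)\<^sup>2"
proof -
  note b = metric_bilinear[of x]
  have "(nrm x (lg x z - lg x y))\<^sup>2 \<le> (rdist y z)\<^sup>2"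
    using lg_contract by (rule power_mono) simp
  then show ?thesis
    by (simp add: rdist_def nrm_power2 bilinear_lsub[OF b] bilinear_rsub[OF b] metric_sym[of x "lg x z" "lg x
        y"])
qed

text \<open>The law of cosines is applied at the point \<open>m\<close> of the geodesic to each of
  its ends. The vectors from \<open>m\<close> to the ends are opposite, in the ratio t to 1 - t, so
  with weights 1 - t and t the inner products cancel.\<close>

lemma CN_inequality:
  assumes t: "t \<in> {0..1}"
  shows "(rdist w (geod M x y t))\<^sup>2 + t * (1 - t) * (rdist x y)\<^sup>2 \<le>
      (1 - t) * (rdist w x)\<^sup>2 + t * (rdist w y)\<^sup>2"
proof -
  define m where "m = geod M x y t"
  define V where "V = velocity M UNIV (geo x (lg x y)) t"
  have m: "m = geo x (lg x y) t" using t by (simp add: m_def geod_geo)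
  have lx: "lg m x = (- t) *\<^sub>R V" using lg_geo[of x "lg x y" t 0] by (simp add: m V_def geo)
  have ly: "lg m y = (1 - t) *\<^sub>R V" using lg_geo[of x "lg x y" t 1] by (simp add: m V_def flip: ex_geo)
  have nV: "nrm m V = rdist x y" by (simp add: m V_def nrm_velocity rdist_def)
  have dx: "rdist m x = t * rdist x y" and dy: "rdist m y = (1 - t) * rdist x y"
    unfolding rdist_def[of m] lx ly nrm_scale nV using t by auto
  note b = metric_bilinear[of m]
  have 1: "(rdist m w)\<^sup>2 + (t * rdist x y)\<^sup>2 + 2 * t * metric M m (lg m w) V \<le> (rdist w x)\<^sup>2"
    using cosine_law[of m w x] by (simp add: dx lx bilinear_rneg[OF b] bilinear_rmul[OF b])
  have 2: "(rdist m w)\<^sup>2 + ((1 - t) * rdist x y)\<^sup>2 - 2 * (1 - t) * metric M m (lg m w) V \<le> (rdist w y)\<^sup>2"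
    using cosine_law[of m w y] by (simp only: dy ly bilinear_rmul[OF b] mult.assoc real_scaleR_def)
  have "(1 - t) * ((rdist m w)\<^sup>2 + (t * rdist x y)\<^sup>2 + 2 * t * metric M m (lg m w) V)
      + t * ((rdist m w)\<^sup>2 + ((1 - t) * rdist x y)\<^sup>2 - 2 * (1 - t) * metric M m (lg m w) V)
      \<le> (1 - t) * (rdist w x)\<^sup>2 + t * (rdist w y)\<^sup>2"
    using 1 2 t by (intro add_mono mult_left_mono) auto
  moreover have "(1 - t) * ((rdist m w)\<^sup>2 + (t * rdist x y)\<^sup>2 + 2 * t * metric M m (lg m w) V)
      + t * ((rdist m w)\<^sup>2 + ((1 - t) * rdist x y)\<^sup>2 - 2 * (1 - t) * metric M m (lg m w) V) =
     (rdist m w)\<^sup>2 + t * (1 - t) * (rdist x y)\<^sup>2"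
    by (simp add: power2_eq_square algebra_simps)
  ultimately show ?thesis by (simp add: m_def rdist_sym[of w])
qed

lemma rdist_geod_le_max:
  assumes t: "t \<in> {0..1}" and x: "rdist w x \<le> R" and y: "rdist w y \<le> R"
  shows "rdist w (geod M x y t) \<le> R"
proof -
  have R: "0 \<le> R" using x rdist_nonneg order_trans by blast
  have "(rdist w (geod M x y t))\<^sup>2 + 0 \<le> (rdist w (geod M x y t))\<^sup>2 + t * (1 - t) * (rdist x y)\<^sup>2"
    using t by (intro add_left_mono) auto
  also note CN_inequality[OF t, of w x y]
  also have "(1 - t) * (rdist w x)\<^sup>2 + t * (rdist w y)\<^sup>2 \<le> (1 - t) * R\<^sup>2 + t * R\<^sup>2"
    using t x y by (intro add_mono mult_left_mono power_mono) auto
  also have "\<dots> = R\<^sup>2" by (simp add: algebra_simps)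
  finally have "(rdist w (geod M x y t))\<^sup>2 \<le> R\<^sup>2" by simp
  then show ?thesis using R by (rule power2_le_imp_le)
qed

lemma continuous_on_nrm: "continuous_on S (nrm x)"
  unfolding nrm_def
  by (intro continuous_on_real_sqrt bounded_bilinear.continuous_on[of "metric M x"] continuous_on_id)
    (simp add: metric_bilinear flip: bilinear_conv_bounded_bilinear)

lemma rdist_tendsto1: "(f \<longlongrightarrow> y) F \<Longrightarrow> ((\<lambda>n. rdist x (f n)) \<longlongrightarrow> rdist x y) F"
  unfolding rdist_def
  by (rule continuous_on_tendsto_compose[OF continuous_on_nrm[of UNIV] lg_tendsto]) auto

text \<open>Since \<open>lg x\<close> and \<open>ex x\<close> are continuous, \<open>rdist\<close>
  induces the given topology, and limits on the manifold turn into limits of real sequences.\<close>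

lemma tendsto_rdist_iff: "(f \<longlonglongrightarrow> x) \<longleftrightarrow> (\<lambda>n. rdist x (f n)) \<longlonglongrightarrow> 0"
proof
  assume "f \<longlonglongrightarrow> x"
  then show "(\<lambda>n. rdist x (f n)) \<longlonglongrightarrow> 0" using rdist_tendsto1[of f x sequentially x] by simp
next
  assume lim: "(\<lambda>n. rdist x (f n)) \<longlonglongrightarrow> 0"
  obtain C where C: "C > 0" "\<And>v. norm v \<le> C * nrm x v" using nrm_equiv[of x] by blast
  have "(\<lambda>n. lg x (f n)) \<longlonglongrightarrow> 0"
  proof (rule Lim_null_comparison)
    show "\<forall>\<^sub>F n in sequentially. norm (lg x (f n)) \<le> C * rdist x (f n)" using C(2) by (simp add: rdist_def)
    show "(\<lambda>n. C * rdist x (f n)) \<longlonglongrightarrow> 0" using tendsto_mult_right_zero[OF lim] .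
  qed
  then have "(\<lambda>n. ex x (lg x (f n))) \<longlonglongrightarrow> ex x 0" by (rule ex_tendsto)
  then show "f \<longlonglongrightarrow> x" by simp
qed

lemma rdist_tendsto:
  assumes "a \<longlonglongrightarrow> x" "b \<longlonglongrightarrow> y"
  shows "(\<lambda>n. rdist (a n) (b n)) \<longlonglongrightarrow> rdist x y"
proof -
  have "(\<lambda>n. rdist x (a n) + rdist y (b n)) \<longlonglongrightarrow> 0 + 0"
    using assms by (intro tendsto_add) (simp_all add: tendsto_rdist_iff)
  then have lim: "(\<lambda>n. rdist x (a n) + rdist y (b n)) \<longlonglongrightarrow> 0" by simp
  have "(\<lambda>n. rdist (a n) (b n) - rdist x y) \<longlonglongrightarrow> 0"
  proof (rule Lim_null_comparison[OF _ lim])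
    have "norm (rdist (a n) (b n) - rdist x y) \<le> rdist x (a n) + rdist y (b n)" for n
      using rdist_triangle[of "a n" "b n" x] rdist_triangle[of x "b n" y] rdist_triangle[of x y "a n"]
          rdist_triangle[of "a n" y "b n"]
        rdist_sym[of "a n" x] rdist_sym[of "b n" y] by (simp add: abs_le_iff)
    then show "\<forall>\<^sub>F n in sequentially. norm (rdist (a n) (b n) - rdist x y) \<le> rdist x (a n) + rdist y (b n)"
      by (simp add: always_eventually)
  qed
  then show ?thesis by (simp add: LIM_zero_iff)
qed

lemma compact_rball: "compact {y. rdist x y \<le> R}"
proof -
  obtain C where C: "C > 0" "\<And>v. norm v \<le> C * nrm x v" using nrm_equiv[of x] by blast
  have "closed {v. nrm x v \<le> R}"
    by (intro closed_Collect_le continuous_on_nrm continuous_on_const)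
  moreover have "bounded {v. nrm x v \<le> R}"
  proof (rule boundedI)
    fix v assume "v \<in> {v. nrm x v \<le> R}"
    then show "norm v \<le> C * R" using C(2)[of v] C(1) by (auto intro: order_trans mult_left_mono)
  qed
  ultimately have "compact {v. nrm x v \<le> R}" by (simp add: compact_eq_bounded_closed)
  then have "compact (ex x ` {v. nrm x v \<le> R})" by (intro compact_continuous_image continuous_on_ex)
  moreover have "ex x ` {v. nrm x v \<le> R} = {y. rdist x y \<le> R}"
  proof (intro equalityI subsetI)
    fix y assume "y \<in> {y. rdist x y \<le> R}"
    then show "y \<in> ex x ` {v. nrm x v \<le> R}" by (intro image_eqI[of _ _ "lg x y"]) (simp_all add: rdist_def)
  qed (auto simp: rdist_def)
  ultimately show ?thesis by simp
qed

lemma open_rball: "open {y. rdist x y < R}"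
proof -
  have "continuous_on UNIV (rdist x)"
    unfolding rdist_def by (rule continuous_on_compose2[OF continuous_on_nrm[of UNIV] continuous_on_lg]) auto
  then show ?thesis by (intro open_Collect_less continuous_on_const)
qed

lemma rball_subset_open:
  assumes "open U" "x \<in> U"
  shows "\<exists>\<rho>>0. {y. rdist x y < \<rho>} \<subseteq> U"
proof (rule ccontr)
  assume neg: "\<not> ?thesis"
  have "\<exists>y. rdist x y < inverse (real (Suc n)) \<and> y \<notin> U" for n
    using neg[simplified, rule_format, of "inverse (real (Suc n))"] by auto
  then obtain f where f: "\<And>n. rdist x (f n) < inverse (real (Suc n))" "\<And>n. f n \<notin> U" by metis
  have "(\<lambda>n. rdist x (f n)) \<longlonglongrightarrow> 0"
    by (rule Lim_null_comparison[OF _ LIMSEQ_inverse_real_of_nat]) (use f(1) in \<open>simp add: less_imp_le\<close>)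
  then have "f \<longlonglongrightarrow> x" by (simp add: tendsto_rdist_iff)
  then have "\<forall>\<^sub>F n in sequentially. f n \<in> U" using assms by (rule topological_tendstoD)
  then show False using f(2) by simp
qed

text \<open>The CN inequality is an equality when the third point lies on the geodesic with the same
  parameter. Tested at the expected limit \<open>w\<close>, it bounds the squared distance to
  \<open>w\<close> by an expression that tends to 0.\<close>

lemma geod_tendsto:
  assumes p: "p \<longlonglongrightarrow> p0" and q: "q \<longlonglongrightarrow> q0" and s: "s \<longlonglongrightarrow> s0" and sr: "\<And>n. s n \<in> {0..1}" "s0 \<in> {0..1}"
  shows "(\<lambda>n. geod M (p n) (q n) (s n)) \<longlonglongrightarrow> geod M p0 q0 s0"
proof -
  define w where "w = geod M p0 q0 s0"
  have dp: "rdist w p0 = s0 * rdist p0 q0" using rdist_geod[OF sr(2), of p0 q0] rdist_sym[of w]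
    by (simp add: w_def)
  have dq: "rdist w q0 = (1 - s0) * rdist p0 q0"
    using rdist_geo[of p0 "lg p0 q0" s0 1] sr(2) by (simp add: w_def geod_geo rdist_def[of p0] flip: ex_geo)
  have "(\<lambda>n. (1 - s n) * (rdist w (p n))\<^sup>2 + s n * (rdist w (q n))\<^sup>2 - s n * (1 - s n) * (rdist (p n) (q
    n))\<^sup>2) \<longlonglongrightarrow>
    (1 - s0) * (rdist w p0)\<^sup>2 + s0 * (rdist w q0)\<^sup>2 - s0 * (1 - s0) * (rdist p0 q0)\<^sup>2"
    by (intro tendsto_intros s rdist_tendsto1 p q rdist_tendsto)
  also have "(1 - s0) * (rdist w p0)\<^sup>2 + s0 * (rdist w q0)\<^sup>2 - s0 * (1 - s0) * (rdist p0 q0)\<^sup>2 = 0"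
    unfolding dp dq by (simp add: power2_eq_square algebra_simps)
  finally have lim: "(\<lambda>n. (1 - s n) * (rdist w (p n))\<^sup>2 + s n * (rdist w (q n))\<^sup>2 - s n * (1 - s n) * (rdist
    (p n) (q n))\<^sup>2) \<longlonglongrightarrow> 0" .
  have "(\<lambda>n. (rdist w (geod M (p n) (q n) (s n)))\<^sup>2) \<longlonglongrightarrow> 0"
  proof (rule Lim_null_comparison[OF _ lim])
    show "\<forall>\<^sub>F n in sequentially. norm ((rdist w (geod M (p n) (q n) (s n)))\<^sup>2) \<le>
      (1 - s n) * (rdist w (p n))\<^sup>2 + s n * (rdist w (q n))\<^sup>2 - s n * (1 - s n) * (rdist (p n) (q n))\<^sup>2"
    proof (rule always_eventually, rule allI)
      fix n
      show "norm ((rdist w (geod M (p n) (q n) (s n)))\<^sup>2) \<le>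
        (1 - s n) * (rdist w (p n))\<^sup>2 + s n * (rdist w (q n))\<^sup>2 - s n * (1 - s n) * (rdist (p n) (q n))\<^sup>2"
        using CN_inequality[OF sr(1)[of n], of w "p n" "q n"] by simp
    qed
  qed
  then have "(\<lambda>n. sqrt ((rdist w (geod M (p n) (q n) (s n)))\<^sup>2)) \<longlonglongrightarrow> sqrt 0" by (rule tendsto_real_sqrt)
  then show ?thesis by (simp add: tendsto_rdist_iff w_def)
qed

lemma geod_convex_Int: "geod_convex M A \<Longrightarrow> geod_convex M B \<Longrightarrow> geod_convex M (A \<inter> B)"
  unfolding geod_convex_def by blast

lemma geod_convex_rball: "geod_convex M {y. rdist x y \<le> R}"
  unfolding geod_convex_def using rdist_geod_le_max by (auto simp del: atLeastAtMost_iff)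

section \<open>Continuity of the metric and first variation\<close>

text \<open>The vector at \<open>y\<close> pointing to \<open>z\<close> is the negative end velocity
  of the geodesic from \<open>z\<close> to \<open>y\<close>. With \<open>z\<close> fixed, only an
  initial velocity varies, which \<open>conv_geo_fixed\<close> covers.\<close>

lemma lg_field_tendsto:
  assumes y: "y \<longlonglongrightarrow> x" and c: "c \<in> atlas M" "x \<in> fst c"
  shows "(\<lambda>n. to_chart M c (y n) (lg (y n) z)) \<longlonglongrightarrow> to_chart M c x (lg x z)"
proof -
  have cv: "conv (\<lambda>n. geo z (lg z (y n))) (geo z (lg z x)) 1"
    by (intro conv_geo_fixed lg_tendsto y) simp
  have x1: "geo z (lg z x) 1 = x" for x by (simp flip: ex_geo)
  have eq: "to_chart M c x (lg x z) = - snd (ph c UNIV (geo z (lg z x)) 1)" if "x \<in> fst c" for x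
  proof -
    have "linear (to_chart M c x)" unfolding to_chart_trd by (intro linear_trd chart_at c(1) that)
    then show ?thesis using ph_velocity[OF geo(1) c(1) UNIV_I, of z "lg z x" 1] that
      by (simp add: x1 lg_reverse[of x z] linear_neg)
  qed
  have "(\<lambda>n. - snd (ph c UNIV (geo z (lg z (y n))) 1)) \<longlonglongrightarrow> - snd (ph c UNIV (geo z (lg z x)) 1)"
    using cv c by (intro tendsto_intros) (auto simp: conv_def x1)
  moreover have "\<forall>\<^sub>F n in sequentially. y n \<in> fst c"
    by (rule topological_tendstoD[OF y open_chart[OF c(1)] c(2)])
  then have "\<forall>\<^sub>F n in sequentially. - snd (ph c UNIV (geo z (lg z (y n))) 1) =
    to_chart M c (y n) (lg (y n) z)"
    by eventually_elim (simp add: eq)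
  ultimately show ?thesis unfolding eq[OF c(2)] by (rule Lim_transform_eventually)
qed

lemma metric_tendsto:
  assumes y: "y \<longlonglongrightarrow> x" and c: "c \<in> atlas M" "x \<in> fst c"
    and u: "(\<lambda>n. to_chart M c (y n) (u n)) \<longlonglongrightarrow> to_chart M c x u0"
    and v: "(\<lambda>n. to_chart M c (y n) (v n)) \<longlonglongrightarrow> to_chart M c x v0"
  shows "(\<lambda>n. metric M (y n) (u n) (v n)) \<longlonglongrightarrow> metric M x u0 v0"
proof -
  let ?S = "((snd c ` fst c) \<times> UNIV) \<times> (UNIV :: 'e set)"
  have op: "open ?S" by (simp add: open_Times open_chart_image[OF c(1)])
  have "((snd c x, to_chart M c x v0), to_chart M c x u0) \<in> ?S" using c(2) by simp
  then have "isCont (\<lambda>z. g c (fst (fst z)) (snd z) (snd (fst z))) ((snd c x, to_chart M c x v0), to_chart M c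
    x u0)"
    using C1f_continuous_on[OF C1f_g3[OF c(1)]] unfolding continuous_on_eq_continuous_at[OF op] by blast
  moreover have "isCont (snd c) x"
    using continuous_on_chart[OF c(1)] open_chart[OF c(1)] c(2) by (auto simp: continuous_on_eq_continuous_at)
  then have "(\<lambda>n. ((snd c (y n), to_chart M c (y n) (v n)), to_chart M c (y n) (u n))) \<longlonglongrightarrow>
    ((snd c x, to_chart M c x v0), to_chart M c x u0)"
    using y u v by (intro tendsto_Pair) (auto intro: isCont_tendsto_compose)
  ultimately have "(\<lambda>n. g c (snd c (y n)) (to_chart M c (y n) (u n)) (to_chart M c (y n) (v n))) \<longlonglongrightarrow>
    g c (snd c x) (to_chart M c x u0) (to_chart M c x v0)"
    using isCont_tendsto_compose by fastforce
  then have "(\<lambda>n. g c (snd c (y n)) (to_chart M c (y n) (u n)) (to_chart M c (y n) (v n))) \<longlonglongrightarrow> metric M x u0 v0"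
    by (simp add: metric_to_chart[OF c])
  moreover have "\<forall>\<^sub>F n in sequentially. y n \<in> fst c"
    by (rule topological_tendstoD[OF y open_chart[OF c(1)] c(2)])
  then have "\<forall>\<^sub>F n in sequentially. g c (snd c (y n)) (to_chart M c (y n) (u n)) (to_chart M c (y n) (v n)) =
    metric M (y n) (u n) (v n)"
    by eventually_elim (simp add: metric_to_chart[OF c(1)])
  ultimately show ?thesis by (rule Lim_transform_eventually)
qed

text \<open>The law of cosines is used at the moved point, so the inner product sits there and not
  at \<open>x\<close>. At \<open>x\<close> it would bound the difference from below, the wrong side
  for testing a minimizer.\<close>

lemma first_variation:
  assumes t: "t \<in> {0..1}"
  shows "(rdist (geod M x y t) z)\<^sup>2 - (rdist x z)\<^sup>2 \<le> - 2 * t * metric M (geod M x y t) (geod_velocity M x y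
      t) (lg (geod M x y t) z)"
proof -
  define m where "m = geod M x y t"
  have lx: "lg m x = (- t) *\<^sub>R geod_velocity M x y t"
    using lg_geo[of x "lg x y" t 0] t by (simp add: m_def geod_geo geod_velocity_geo geo)
  have "(rdist m x)\<^sup>2 + (rdist m z)\<^sup>2 - 2 * (- t * metric M m (geod_velocity M x y t) (lg m z)) \<le>
    (rdist x z)\<^sup>2"
    using cosine_law[of m x z] by (simp only: lx bilinear_lmul[OF metric_bilinear] real_scaleR_def)
  then have "(rdist m z)\<^sup>2 - (rdist x z)\<^sup>2 \<le> - 2 * t * metric M m (geod_velocity M x y t) (lg m z)"
    using zero_le_power2[of "rdist m x"] unfolding mult.assoc by linarith
  then show ?thesis by (simp only: m_def)
qed

text \<open>Brings the inner products of \<open>first_variation\<close> back to \<open>x\<close>: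
  velocity and logarithm both converge in a fixed chart, and the metric is continuous there.\<close>

lemma first_variation_limit:
  "(\<lambda>n. metric M (geod M x y (1 / real (Suc n))) (geod_velocity M x y (1 / real (Suc n))) (lg (geod M x y (1
    / real (Suc n))) z))
    \<longlonglongrightarrow> metric M x (lg x y) (lg x z)"
proof -
  define s where "s = (\<lambda>n. 1 / real (Suc n))"
  have s: "s \<longlonglongrightarrow> 0" "\<And>n. s n \<in> {0..1}"
    using LIMSEQ_inverse_real_of_nat by (auto simp: s_def inverse_eq_divide)
  define c where "c = chart_at M x"
  have c: "c \<in> atlas M" "x \<in> fst c" by (simp_all add: c_def chart_at)
  have y: "(\<lambda>n. geod M x y (s n)) \<longlonglongrightarrow> x"
    using geod_tendsto[OF tendsto_const tendsto_const s(1,2), of x y] by simp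
  have g0: "geo x (lg x y) 0 \<in> fst c" by (simp add: geo c)
  have "isCont (\<lambda>r. snd (ph c UNIV (geo x (lg x y)) r)) 0"
    using has_vector_derivative_continuous[OF has_vector_derivative_chart(2)[OF geo(1) c(1) UNIV_I g0]]
        by simp
  then have "(\<lambda>n. snd (ph c UNIV (geo x (lg x y)) (s n))) \<longlonglongrightarrow> snd (ph c UNIV (geo x (lg x y)) 0)"
    by (rule isCont_tendsto_compose) (rule s)
  then have "(\<lambda>n. snd (ph c UNIV (geo x (lg x y)) (s n))) \<longlonglongrightarrow> to_chart M c x (lg x y)"
    by (simp add: ph_geo_0[OF c])
  moreover have "\<forall>\<^sub>F n in sequentially. geod M x y (s n) \<in> fst c"
    by (rule topological_tendstoD[OF y open_chart[OF c(1)] c(2)])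
  then have "\<forall>\<^sub>F n in sequentially. snd (ph c UNIV (geo x (lg x y)) (s n)) =
    to_chart M c (geod M x y (s n)) (geod_velocity M x y (s n))"
    by eventually_elim (use ph_velocity[OF geo(1) c(1) UNIV_I] s(2) in \<open>simp add: geod_geo geod_velocity_geo
        del: atLeastAtMost_iff\<close>)
  ultimately have "(\<lambda>n. to_chart M c (geod M x y (s n)) (geod_velocity M x y (s n))) \<longlonglongrightarrow>
    to_chart M c x (lg x y)"
    by (rule Lim_transform_eventually)
  from metric_tendsto[OF y c this lg_field_tendsto[OF y c]] show ?thesis by (simp add: s_def)
qed

section \<open>Comparison of the distance with a chart\<close>

text \<open>All three estimates are homogeneous of degree two in \<open>v\<close>, so it suffices to
  bound continuous functions on the compact product of a coordinate ball with the unit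
  sphere.\<close>

lemma chart_bounds:
  assumes c: "c \<in> atlas M" and x: "x \<in> fst c"
  shows "\<exists>r>0. \<exists>C>0. cball (snd c x) r \<subseteq> snd c ` fst c \<and>
    (\<forall>p\<in>cball (snd c x) r. \<forall>v. g c p v v \<le> C\<^sup>2 * (norm v)\<^sup>2 \<and> (norm v)\<^sup>2 \<le> C\<^sup>2 * g c p v v \<and>
      norm (\<Gamma> c p v v) \<le> C * (norm v)\<^sup>2)"
proof -
  obtain r where r: "r > 0" "cball (snd c x) r \<subseteq> snd c ` fst c"
    using open_chart_image[OF c] x open_contains_cball by (metis imageI)
  let ?K = "cball (snd c x) r \<times> sphere (0::'e) 1"
  have K: "compact ?K" by (intro compact_Times compact_cball compact_sphere)
  have ne: "?K \<noteq> {}"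
  proof -
    obtain v :: 'e where "norm v = 1" using vector_choose_size[of 1] by auto
    then have "(snd c x, v) \<in> ?K" using r(1) by simp
    then show ?thesis by blast
  qed
  have cg: "continuous_on ?K (\<lambda>z. g c (fst z) (snd z) (snd z))"
  proof -
    have "continuous_on ?K (\<lambda>z. ((fst z, snd z), snd z))" by (intro continuous_intros)
    from continuous_on_compose2[OF C1f_continuous_on[OF C1f_g3[OF c]] this] show ?thesis using r(2) by auto
  qed
  have cG: "continuous_on ?K (\<lambda>z. norm (\<Gamma> c (fst z) (snd z) (snd z)))"
  proof -
    have "continuous_on ?K (\<lambda>z. ((fst z, snd z), snd z))" by (intro continuous_intros)
    from continuous_on_compose2[OF C1f_continuous_on[OF C1f_christoffel3[OF c]] this] show ?thesis
      using r(2) by (intro continuous_on_norm) auto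
  qed
  obtain a where a: "a \<in> ?K" "\<And>z. z \<in> ?K \<Longrightarrow> g c (fst a) (snd a) (snd a) \<le> g c (fst z) (snd z) (snd z)"
    using continuous_attains_inf[OF K ne cg] by blast
  obtain b where b: "b \<in> ?K" "\<And>z. z \<in> ?K \<Longrightarrow> g c (fst z) (snd z) (snd z) \<le> g c (fst b) (snd b) (snd b)"
    using continuous_attains_sup[OF K ne cg] by blast
  obtain d where d: "\<And>z. z \<in> ?K \<Longrightarrow> norm (\<Gamma> c (fst z) (snd z) (snd z)) \<le> norm (\<Gamma> c (fst d) (snd d) (snd d))"
    using continuous_attains_sup[OF K ne cG] by blast
  define A where "A = g c (fst a) (snd a) (snd a)"
  define B where "B = g c (fst b) (snd b) (snd b)"
  define D where "D = norm (\<Gamma> c (fst d) (snd d) (snd d))"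
  have "snd a \<noteq> 0" "fst a \<in> snd c ` fst c" using a(1) r(2) by auto
  then have A: "A > 0" unfolding A_def using g_pos[OF c] by blast
  define C where "C = 1 + sqrt B + 1 / sqrt A + D"
  have B: "B \<ge> 0" using b(1) g_nonneg[OF c] r(2) by (auto simp: B_def)
  have C: "C > 0" "B \<le> C\<^sup>2" "1 \<le> C\<^sup>2 * A" "D \<le> C"
  proof -
    have pos: "sqrt B \<ge> 0" "1 / sqrt A \<ge> 0" "D \<ge> 0" using B A by (auto simp: D_def)
    then show "C > 0" "D \<le> C" unfolding C_def by linarith+
    have "sqrt B \<le> C" using pos by (simp add: C_def)
    then have "(sqrt B)\<^sup>2 \<le> C\<^sup>2" using pos by (intro power_mono) auto
    then show "B \<le> C\<^sup>2" using B by simp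
    have "1 / sqrt A \<le> C" using pos by (simp add: C_def)
    then have "(1 / sqrt A)\<^sup>2 \<le> C\<^sup>2" using pos by (intro power_mono) auto
    then have "1 / A \<le> C\<^sup>2" using A by (simp add: power_divide)
    then show "1 \<le> C\<^sup>2 * A" using A by (simp add: pos_divide_le_eq)
  qed
  show ?thesis
  proof (rule exI[of _ r], intro conjI r(1), rule exI[of _ C], intro conjI C(1) r(2) ballI allI)
    fix p v :: 'e assume p: "p \<in> cball (snd c x) r"
    have pS: "p \<in> snd c ` fst c" using p r(2) by blast
    note bl = g_bilinear[OF c pS] and l = christoffel_linear[OF c pS]
    define w where "w = v /\<^sub>R norm v"
    have vw: "v = norm v *\<^sub>R w" by (cases "v = 0") (simp_all add: w_def)
    have gv: "g c p v v = (norm v)\<^sup>2 * g c p w w"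
      by (subst vw, subst (2) vw) (simp add: bilinear_lmul[OF bl] bilinear_rmul[OF bl] power2_eq_square)
    have Gv: "\<Gamma> c p v v = (norm v)\<^sup>2 *\<^sub>R \<Gamma> c p w w"
      by (subst vw, subst (2) vw) (simp add: linear_scale[OF l(1)] linear_scale[OF l(2)] power2_eq_square)
    show "g c p v v \<le> C\<^sup>2 * (norm v)\<^sup>2"
    proof (cases "v = 0")
      case False
      have "(p, w) \<in> ?K" using False p by (simp add: w_def)
      then have "g c p w w \<le> C\<^sup>2" using b(2)[of "(p, w)"] C(2) by (simp add: B_def)
      then show ?thesis unfolding gv by (subst mult.commute) (rule mult_right_mono, auto)
    qed (simp add: bilinear_lzero[OF bl])
    show "(norm v)\<^sup>2 \<le> C\<^sup>2 * g c p v v"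
    proof (cases "v = 0")
      case False
      have "(p, w) \<in> ?K" using False p by (simp add: w_def)
      then have "A \<le> g c p w w" using a(2)[of "(p, w)"] by (simp add: A_def)
      then have "C\<^sup>2 * A \<le> C\<^sup>2 * g c p w w" by (rule mult_left_mono) simp
      then have "1 \<le> C\<^sup>2 * g c p w w" using C(3) by linarith
      then have "(norm v)\<^sup>2 * 1 \<le> (norm v)\<^sup>2 * (C\<^sup>2 * g c p w w)" by (rule mult_left_mono) simp
      then show ?thesis unfolding gv by (simp add: mult_ac)
    qed (simp add: bilinear_lzero[OF bl])
    show "norm (\<Gamma> c p v v) \<le> C * (norm v)\<^sup>2"
    proof (cases "v = 0")
      case False
      have "(p, w) \<in> ?K" using False p by (simp add: w_def)
      then have "norm (\<Gamma> c p w w) \<le> C" using d[of "(p, w)"] C(4) by (simp add: D_def)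
      then show ?thesis unfolding Gv by (simp add: mult.commute[of C] mult_left_mono)
    qed (simp add: linear_0[OF l(1)])
  qed
qed

text \<open>Both f s and f 1 are compared with the tangent line at 0; the chord differs from that
  line by the second of the two errors. Each error contributes \<open>B\<close>.\<close>

lemma small_acceleration:
  fixes f f' f'' :: "real \<Rightarrow> 'a::real_normed_vector"
  assumes f: "\<And>t. t \<in> {0..1} \<Longrightarrow> (f has_vector_derivative f' t) (at t within {0..1})"
    and f': "\<And>t. t \<in> {0..1} \<Longrightarrow> (f' has_vector_derivative f'' t) (at t within {0..1})"
    and B: "\<And>t. t \<in> {0..1} \<Longrightarrow> norm (f'' t) \<le> B" and s: "s \<in> {0..1}"
  shows "norm (f s - ((1 - s) *\<^sub>R f 0 + s *\<^sub>R f 1)) \<le> 2 * B"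
proof -
  have B0: "0 \<le> B" using B[of 0] norm_ge_zero[of "f'' 0"] by (simp del: norm_ge_zero)
  have 1: "norm (f' t - f' 0) \<le> B" if t: "t \<in> {0..1}" for t
  proof -
    have "norm (f' t - f' 0) \<le> B * norm (t - 0)"
    proof (rule differentiable_bound[where S = "{0..1}" and f' = "\<lambda>t h. h *\<^sub>R f'' t"])
      fix r :: real assume r: "r \<in> {0..1}"
      show "(f' has_derivative (\<lambda>h. h *\<^sub>R f'' r)) (at r within {0..1})"
        using f'[OF r] by (simp add: has_vector_derivative_def)
      show "onorm (\<lambda>h. h *\<^sub>R f'' r) \<le> B"
        by (rule onorm_bound) (use B[OF r] B0 in \<open>auto simp: mult.commute[of _ "norm (f'' r)"] intro:
            mult_right_mono\<close>)
    qed (use t in auto)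
    also have "\<dots> \<le> B * 1" using t B0 by (intro mult_left_mono) auto
    finally show ?thesis by simp
  qed
  have 2: "norm (f t - f 0 - t *\<^sub>R f' 0) \<le> t * B" if t: "t \<in> {0..1}" for t
  proof -
    have "norm (f t - f 0 - (t - 0) *\<^sub>R f' 0) \<le> norm (t - 0) * B"
      by (rule vector_differentiable_bound_linearization[where S = "{0..1}"])
        (use f 1 t in \<open>auto simp: closed_segment_eq_real_ivl\<close>)
    then show ?thesis using t by simp
  qed
  have "f s - ((1 - s) *\<^sub>R f 0 + s *\<^sub>R f 1) = (f s - f 0 - s *\<^sub>R f' 0) - s *\<^sub>R (f 1 - f 0 - 1 *\<^sub>R f' 0)"
    by (simp add: algebra_simps)
  also have "norm \<dots> \<le> norm (f s - f 0 - s *\<^sub>R f' 0) + norm (s *\<^sub>R (f 1 - f 0 - 1 *\<^sub>R f' 0))"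
    by (rule norm_triangle_ineq4)
  also have "\<dots> \<le> 1 * B + 1 * (1 * B)"
  proof (rule add_mono)
    show "norm (f s - f 0 - s *\<^sub>R f' 0) \<le> 1 * B" using 2[OF s] s B0
      by (meson atLeastAtMost_iff mult_right_mono order_trans)
    show "norm (s *\<^sub>R (f 1 - f 0 - 1 *\<^sub>R f' 0)) \<le> 1 * (1 * B)"
      unfolding norm_scaleR using 2[of 1] s by (intro mult_mono) auto
  qed
  finally show ?thesis by simp
qed

text \<open>The last estimate is the essential one: a geodesic leaves its coordinate chord only by
  the square of the chord length, since the geodesic equation is quadratic in the velocity.\<close>

lemma local_chart:
  assumes c: "c \<in> atlas M" and x: "x \<in> fst c"
  shows "\<exists>\<rho>>0. \<exists>C>0. \<forall>p q. rdist x p < \<rho> \<longrightarrow> rdist x q < \<rho> \<longrightarrow> p \<in> fst c \<and>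
    rdist p q \<le> C * norm (snd c p - snd c q) \<and> norm (snd c p - snd c q) \<le> C * rdist p q \<and>
    (\<forall>s\<in>{0..1}. norm (snd c (geod M p q s) - ((1 - s) *\<^sub>R snd c p + s *\<^sub>R snd c q)) \<le>
      C * (norm (snd c p - snd c q))\<^sup>2)"
proof -
  obtain r C where r: "r > 0" "C > 0" "cball (snd c x) r \<subseteq> snd c ` fst c"
    "\<And>p v. p \<in> cball (snd c x) r \<Longrightarrow> g c p v v \<le> C\<^sup>2 * (norm v)\<^sup>2 \<and> (norm v)\<^sup>2 \<le> C\<^sup>2 * g c p v v \<and>
      norm (\<Gamma> c p v v) \<le> C * (norm v)\<^sup>2"
    using chart_bounds[OF c x] by blast
  define U where "U = fst c \<inter> snd c -` ball (snd c x) r"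
  have "open U" unfolding U_def by (intro continuous_open_preimage continuous_on_chart open_chart c open_ball)
  moreover have "x \<in> U" using x r(1) by (simp add: U_def)
  ultimately obtain \<rho> where \<rho>: "\<rho> > 0" "{y. rdist x y < \<rho>} \<subseteq> U" using rball_subset_open by blast
  \<comment> \<open>Covers both distance comparisons and, once \<open>rdist p q\<close> is replaced
    by the coordinate distance, twice the bound of the acceleration.\<close>
  define C' where "C' = C + 2 * C * (C * C)\<^sup>2"
  have C': "C' > 0" "C \<le> C'" "2 * C * (C * C)\<^sup>2 \<le> C'" using r(2) by (auto simp: C'_def intro!: add_pos_nonneg)
  show ?thesis
  proof (rule exI[of _ \<rho>], intro conjI \<rho>(1), rule exI[of _ C'], intro conjI C'(1) allI impI)
    fix p q assume p: "rdist x p < \<rho>" and q: "rdist x q < \<rho>"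
    have pU: "p \<in> U" and qU: "q \<in> U" using p q \<rho>(2) by auto
    then show "p \<in> fst c" by (simp add: U_def)
    let ?\<Delta> = "snd c q - snd c p"
    have 1: "rdist p q \<le> C * norm ?\<Delta>"
    proof -
      \<comment> \<open>The coordinate segment is a curve of bounded speed, so
        \<open>lg_speed\<close> bounds \<open>rdist\<close> by its length.\<close>
      define \<sigma> where "\<sigma> = (\<lambda>s. chart_inv c ((1 - s) *\<^sub>R snd c p + s *\<^sub>R snd c q))"
      have seg: "(1 - s) *\<^sub>R snd c p + s *\<^sub>R snd c q \<in> cball (snd c x) r" if "s \<in> {0..1}" for s
        using pU qU that convexD_alt[OF convex_cball[of "snd c x" r], of "snd c p" "snd c q" s]
            by (auto simp: U_def)
      have cs: "snd c (\<sigma> s) = (1 - s) *\<^sub>R snd c p + s *\<^sub>R snd c q" "\<sigma> s \<in> fst c" if "s \<in> {0..1}" for s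
        using seg[OF that] r(3) c chart_inv_in[OF c] by (auto simp: \<sigma>_def)
      have "speed_le \<sigma> (C * norm ?\<Delta>)"
        unfolding speed_le_def
      proof (intro conjI ballI)
        show "continuous_on {0..1} \<sigma>" unfolding \<sigma>_def
          by (rule continuous_on_compose2[OF continuous_on_chart_inv[OF c]]) (use seg r(3) in \<open>auto intro!:
              continuous_intros\<close>)
        fix s :: real assume s: "s \<in> {0..1}"
        have bl: "bilinear (g c (snd c (\<sigma> s)))" by (rule g_bilinear[OF c]) (use cs(2)[OF s] in blast)
        have "g c (snd c (\<sigma> s)) (snd c (\<sigma> r2) - snd c (\<sigma> r1)) (snd c (\<sigma> r2) - snd c (\<sigma> r1)) \<le>
          ((C * norm ?\<Delta>)\<^sup>2 + e) * (r2 - r1)\<^sup>2"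
          if "r1 \<in> {0..1}" "r2 \<in> {0..1}" "e > 0" for r1 r2 e
        proof -
          have "snd c (\<sigma> r2) - snd c (\<sigma> r1) = (r2 - r1) *\<^sub>R ?\<Delta>" using cs(1)[OF that(1)] cs(1)[OF that(2)]
            by (simp add: algebra_simps)
          then have "g c (snd c (\<sigma> s)) (snd c (\<sigma> r2) - snd c (\<sigma> r1)) (snd c (\<sigma> r2) - snd c (\<sigma> r1)) =
            (r2 - r1)\<^sup>2 * g c (snd c (\<sigma> s)) ?\<Delta> ?\<Delta>"
            by (simp add: bilinear_lmul[OF bl] bilinear_rmul[OF bl] power2_eq_square)
          also have "\<dots> \<le> (r2 - r1)\<^sup>2 * ((C * norm ?\<Delta>)\<^sup>2 + e)"
          proof (rule mult_left_mono)
            show "g c (snd c (\<sigma> s)) ?\<Delta> ?\<Delta> \<le> (C * norm ?\<Delta>)\<^sup>2 + e"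
              using r(4)[of "snd c (\<sigma> s)" ?\<Delta>] cs(1)[OF s] seg[OF s] that(3) by (simp add: power_mult_distrib)
          qed simp
          finally show ?thesis by (simp add: mult.commute)
        qed
        then show "\<exists>c\<in>atlas M. \<sigma> s \<in> fst c \<and> (\<forall>e>0. \<exists>\<epsilon>>0. \<forall>r1\<in>{0..1}. \<forall>r2\<in>{0..1}. \<bar>r1 - s\<bar> < \<epsilon> \<longrightarrow> \<bar>r2 - s\<bar> <
          \<epsilon> \<longrightarrow>
          g c (snd c (\<sigma> s)) (snd c (\<sigma> r2) - snd c (\<sigma> r1)) (snd c (\<sigma> r2) - snd c (\<sigma> r1)) \<le>
            ((C * norm ?\<Delta>)\<^sup>2 + e) * (r2 - r1)\<^sup>2)"
          using cs(2)[OF s] c zero_less_one by blast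
      qed
      from lg_speed[OF this, of p] show ?thesis using r(2) pU qU c by (simp add: \<sigma>_def U_def rdist_def)
    qed
    then have le1: "rdist p q \<le> C * norm (snd c p - snd c q)" by (simp add: norm_minus_commute)
    also have "\<dots> \<le> C' * norm (snd c p - snd c q)" using C'(2) by (rule mult_right_mono) simp
    finally show "rdist p q \<le> C' * norm (snd c p - snd c q)" .
    \<comment> \<open>For the converse estimate the geodesic is followed. Distance balls are convex,
      so it stays where the bounds of the chart hold, and its speed is constant.\<close>
    define \<gamma> where "\<gamma> = geo p (lg p q)"
    have \<gamma>: "geodesic_on M UNIV \<gamma>" by (simp add: \<gamma>_def geo)
    have \<gamma>01: "\<gamma> 0 = p" "\<gamma> 1 = q" by (simp_all add: \<gamma>_def geo flip: ex_geo)
    have \<gamma>U: "\<gamma> t \<in> U" if t: "t \<in> {0..1}" for t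
    proof -
      have "rdist x (geod M p q t) \<le> max (rdist x p) (rdist x q)" by (rule rdist_geod_le_max[OF t]) auto
      then show ?thesis using p q \<rho>(2) t by (auto simp: \<gamma>_def geod_geo simp del: atLeastAtMost_iff)
    qed
    have \<gamma>c: "\<gamma> t \<in> fst c" "snd c (\<gamma> t) \<in> cball (snd c x) r" if "t \<in> {0..1}" for t using \<gamma>U[OF that]
      by (auto simp: U_def)
    have d1: "((\<lambda>t. snd c (\<gamma> t)) has_vector_derivative snd (ph c UNIV \<gamma> t)) (at t within {0..1})"
      and d2: "((\<lambda>t. snd (ph c UNIV \<gamma> t)) has_vector_derivative - \<Gamma> c (snd c (\<gamma> t)) (snd (ph c UNIV \<gamma> t))
          (snd (ph c UNIV \<gamma> t))) (at t within {0..1})"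
      if "t \<in> {0..1}" for t
      using has_vector_derivative_chart[OF \<gamma> c UNIV_I \<gamma>c(1)[OF that]]
          by (auto intro: has_vector_derivative_at_within)
    have sp: "norm (snd (ph c UNIV \<gamma> t)) \<le> C * rdist p q" if t: "t \<in> {0..1}" for t
    proof -
      have "g c (snd c (\<gamma> t)) (snd (ph c UNIV \<gamma> t)) (snd (ph c UNIV \<gamma> t)) =
        (nrm (\<gamma> t) (velocity M UNIV \<gamma> t))\<^sup>2"
        using ph_velocity[OF \<gamma> c UNIV_I \<gamma>c(1)[OF t]] metric_to_chart[OF c \<gamma>c(1)[OF t]]
            by (simp add: nrm_power2)
      also have "nrm (\<gamma> t) (velocity M UNIV \<gamma> t) = rdist p q" by (simp add: \<gamma>_def nrm_velocity rdist_def)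
      finally have "(norm (snd (ph c UNIV \<gamma> t)))\<^sup>2 \<le> (C * rdist p q)\<^sup>2"
        using r(4)[OF \<gamma>c(2)[OF t], of "snd (ph c UNIV \<gamma> t)"] by (simp add: power_mult_distrib)
      then show ?thesis by (rule power2_le_imp_le) (use r(2) in simp)
    qed
    have "norm (snd c (\<gamma> 1) - snd c (\<gamma> 0)) \<le> C * rdist p q * norm (1 - 0 :: real)"
    proof (rule differentiable_bound[where S = "{0..1}" and f' = "\<lambda>t h. h *\<^sub>R snd (ph c UNIV \<gamma> t)"])
      fix t :: real assume t: "t \<in> {0..1}"
      show "((\<lambda>t. snd c (\<gamma> t)) has_derivative (\<lambda>h. h *\<^sub>R snd (ph c UNIV \<gamma> t))) (at t within {0..1})"
        using d1[OF t] by (simp add: has_vector_derivative_def)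
      show "onorm (\<lambda>h. h *\<^sub>R snd (ph c UNIV \<gamma> t)) \<le> C * rdist p q"
        by (rule onorm_bound) (use sp[OF t] r(2) in \<open>auto simp: mult.commute[of _ "norm (snd _)"] intro:
            mult_right_mono\<close>)
    qed auto
    then have "norm (snd c p - snd c q) \<le> C * rdist p q" by (simp add: \<gamma>01 norm_minus_commute)
    also have "\<dots> \<le> C' * rdist p q" using C'(2) by (rule mult_right_mono) simp
    finally show "norm (snd c p - snd c q) \<le> C' * rdist p q" .
    show "\<forall>s\<in>{0..1}. norm (snd c (geod M p q s) - ((1 - s) *\<^sub>R snd c p + s *\<^sub>R snd c q)) \<le>
      C' * (norm (snd c p - snd c q))\<^sup>2"
    proof
      fix s :: real assume s: "s \<in> {0..1}"
      have "norm (snd c (\<gamma> s) - ((1 - s) *\<^sub>R snd c (\<gamma> 0) + s *\<^sub>R snd c (\<gamma> 1))) \<le> 2 * (C * (C * rdist p q)\<^sup>2)"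
      proof (rule small_acceleration[OF d1 d2 _ s])
        fix t :: real assume t: "t \<in> {0..1}"
        have "norm (\<Gamma> c (snd c (\<gamma> t)) (snd (ph c UNIV \<gamma> t)) (snd (ph c UNIV \<gamma> t))) \<le>
          C * (norm (snd (ph c UNIV \<gamma> t)))\<^sup>2"
          using r(4)[OF \<gamma>c(2)[OF t]] by blast
        also have "\<dots> \<le> C * (C * rdist p q)\<^sup>2" using sp[OF t] r(2) by (intro mult_left_mono power_mono) auto
        finally show "norm (- \<Gamma> c (snd c (\<gamma> t)) (snd (ph c UNIV \<gamma> t)) (snd (ph c UNIV \<gamma> t))) \<le>
          C * (C * rdist p q)\<^sup>2" by simp
      qed auto
      also have "\<dots> \<le> 2 * (C * (C * (C * norm (snd c p - snd c q)))\<^sup>2)"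
        using le1 r(2) by (intro mult_left_mono power_mono) auto
      also have "\<dots> = 2 * C * (C * C)\<^sup>2 * (norm (snd c p - snd c q))\<^sup>2" by (simp add: power_mult_distrib)
      also have "\<dots> \<le> C' * (norm (snd c p - snd c q))\<^sup>2" using C'(3) by (rule mult_right_mono) simp
      finally show "norm (snd c (geod M p q s) - ((1 - s) *\<^sub>R snd c p + s *\<^sub>R snd c q)) \<le>
        C' * (norm (snd c p - snd c q))\<^sup>2"
        using s unfolding \<gamma>01 by (simp add: \<gamma>_def geod_geo)
    qed
  qed
qed

section \<open>Proximal maps and fixed points\<close>

text \<open>At the midpoint of two minimizers the CN inequality puts the squared distance to
  \<open>z\<close> below the mean by a quarter of their squared distance.\<close>

lemma proximal_unique:
  assumes Q: "geod_convex M Q" and \<phi>: "\<And>x y t. x \<in> Q \<Longrightarrow> y \<in> Q \<Longrightarrow> t \<in> {0<..<1} \<Longrightarrow> \<phi> (geod M x y t) \<le>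
      (1 - t) * \<phi> x + t * \<phi> y"
    and y: "y \<in> Q" "\<And>w. w \<in> Q \<Longrightarrow> \<phi> y + (rdist y z)\<^sup>2 / 2 \<le> \<phi> w + (rdist w z)\<^sup>2 / 2"
    and y': "y' \<in> Q" "\<And>w. w \<in> Q \<Longrightarrow> \<phi> y' + (rdist y' z)\<^sup>2 / 2 \<le> \<phi> w + (rdist w z)\<^sup>2 / 2"
  shows "y = y'"
proof -
  define m where "m = geod M y y' (1/2)"
  have mQ: "m \<in> Q" using Q y(1) y'(1) unfolding geod_convex_def m_def by (auto simp: image_subset_iff)
  have "\<phi> m \<le> (1 - 1/2) * \<phi> y + 1/2 * \<phi> y'" unfolding m_def by (rule \<phi>[OF y(1) y'(1)]) simp
  moreover have "(rdist m z)\<^sup>2 + 1/2 * (1 - 1/2) * (rdist y y')\<^sup>2 \<le>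
    (1 - 1/2) * (rdist y z)\<^sup>2 + 1/2 * (rdist y' z)\<^sup>2"
    using CN_inequality[of "1/2" z y y'] by (simp add: m_def rdist_sym[of z])
  ultimately have "(rdist y y')\<^sup>2 \<le> 0" using y(2)[OF mQ] y'(2)[OF mQ] by argo
  then show ?thesis by (simp add: rdist_eq_0)
qed

text \<open>Continuity comes from uniqueness: by compactness minimizers for a convergent sequence
  have cluster points, and each of these minimizes the limit problem.\<close>

lemma proximal_map:
  assumes Q: "geod_convex M Q" "compact Q" "Q \<noteq> {}"
    and \<phi>: "\<And>x y t. x \<in> Q \<Longrightarrow> y \<in> Q \<Longrightarrow> t \<in> {0<..<1} \<Longrightarrow> \<phi> (geod M x y t) \<le> (1 - t) * \<phi> x + t * \<phi> y"
    and c\<phi>: "continuous_on Q \<phi>"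
  shows "\<exists>T. (\<forall>z. T z \<in> Q \<and> (\<forall>w\<in>Q. \<phi> (T z) + (rdist (T z) z)\<^sup>2 / 2 \<le> \<phi> w + (rdist w z)\<^sup>2 / 2)) \<and>
      continuous_on UNIV T"
proof -
  have cd: "continuous_on S (\<lambda>w. rdist w z)" for S z
    by (rule continuous_on_sequentiallyI) (simp add: rdist_tendsto)
  have "\<exists>y. y \<in> Q \<and> (\<forall>w\<in>Q. \<phi> y + (rdist y z)\<^sup>2 / 2 \<le> \<phi> w + (rdist w z)\<^sup>2 / 2)" for z
  proof -
    have "continuous_on Q (\<lambda>w. \<phi> w + (rdist w z)\<^sup>2 / 2)" by (intro continuous_intros c\<phi> cd) simp
    from continuous_attains_inf[OF Q(2,3) this] show ?thesis by blast
  qed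
  then obtain T where T: "\<And>z. T z \<in> Q" "\<And>z w. w \<in> Q \<Longrightarrow> \<phi> (T z) + (rdist (T z) z)\<^sup>2 / 2 \<le>
    \<phi> w + (rdist w z)\<^sup>2 / 2"
    by metis
  have "continuous_on UNIV T"
  proof (rule continuous_on_sequentiallyI, rule ccontr)
    fix u a assume u: "u \<longlonglongrightarrow> a" and neg: "\<not> (\<lambda>n. T (u n)) \<longlonglongrightarrow> T a"
    then obtain S where S: "open S" "T a \<in> S" "\<not> (\<forall>\<^sub>F n in sequentially. T (u n) \<in> S)"
      unfolding tendsto_def by blast
    from not_eventually_sequentiallyD[OF S(3)] obtain r :: "nat \<Rightarrow> nat"
      where r: "strict_mono r" "\<And>n. T (u (r n)) \<notin> S" by blast
    have "seq_compact Q" using Q(2) by (rule compact_imp_seq_compact)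
    then obtain l k where l: "l \<in> Q" "strict_mono k" "((\<lambda>n. T (u (r n))) \<circ> k) \<longlonglongrightarrow> l"
      using T(1) unfolding seq_compact_def by (metis (no_types, lifting))
    have lim: "(\<lambda>n. T (u (r (k n)))) \<longlonglongrightarrow> l" using l(3) by (simp add: o_def)
    have ur: "(\<lambda>n. u (r (k n))) \<longlonglongrightarrow> a"
      using LIMSEQ_subseq_LIMSEQ[OF u strict_mono_o[OF r(1) l(2)]] by (simp add: o_def)
    have min: "\<phi> l + (rdist l a)\<^sup>2 / 2 \<le> \<phi> w + (rdist w a)\<^sup>2 / 2" if w: "w \<in> Q" for w
    proof (rule tendsto_le[OF sequentially_bot])
      have "(\<lambda>n. \<phi> (T (u (r (k n))))) \<longlonglongrightarrow> \<phi> l"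
        by (rule continuous_on_tendsto_compose[OF c\<phi> lim l(1)]) (simp add: T(1))
      then show "(\<lambda>n. \<phi> (T (u (r (k n)))) + (rdist (T (u (r (k n)))) (u (r (k n))))\<^sup>2 / 2) \<longlonglongrightarrow>
        \<phi> l + (rdist l a)\<^sup>2 / 2"
        by (intro tendsto_intros rdist_tendsto lim ur) auto
      show "(\<lambda>n. \<phi> w + (rdist w (u (r (k n))))\<^sup>2 / 2) \<longlonglongrightarrow> \<phi> w + (rdist w a)\<^sup>2 / 2"
        by (intro tendsto_intros rdist_tendsto1 ur) auto
    qed (use T(2)[OF w] in simp)
    have "l = T a"
      by (rule proximal_unique[where \<phi> = \<phi> and z = a, OF Q(1)]) (use \<phi> l(1) min T in blast)+
    then have "\<forall>\<^sub>F n in sequentially. T (u (r (k n))) \<in> S" using lim S(1,2) topological_tendstoD by blast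
    then show False using r(2) by simp
  qed
  then show ?thesis using T by blast
qed

text \<open>The image of \<open>Q\<close> under \<open>lg o'\<close> need not be convex. So
  Brouwer's theorem is used on a ball containing it, after extending \<open>S\<close> by the nearest
  point map, which is \<open>proximal_map\<close> for the zero function.\<close>

lemma fixed_point:
  assumes Q: "geod_convex M Q" "compact Q" "Q \<noteq> {}" and S: "continuous_on Q S" "S ` Q \<subseteq> Q"
  shows "\<exists>w\<in>Q. S w = w"
proof -
  obtain P where P: "\<And>z. P z \<in> Q" "\<And>z w. w \<in> Q \<Longrightarrow> (0::real) + (rdist (P z) z)\<^sup>2 / 2 \<le>
    0 + (rdist w z)\<^sup>2 / 2" "continuous_on UNIV P"
    using proximal_map[OF Q, of "\<lambda>_. 0::real"] by (auto intro: continuous_on_const)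
  have PQ: "P z = z" if "z \<in> Q" for z
    using P(2)[OF that, of z] by (simp add: rdist_eq_0)
  obtain o' where "o' \<in> Q" using Q(3) by blast
  have "compact (lg o' ` Q)"
    using Q(2) by (intro compact_continuous_image continuous_on_subset[OF continuous_on_lg]) auto
  then obtain R where R: "R > 0" "\<And>v. v \<in> lg o' ` Q \<Longrightarrow> norm v \<le> R"
    using compact_imp_bounded bounded_pos by metis
  define F where "F = (\<lambda>v. lg o' (S (P (ex o' v))))"
  have "continuous_on (cball 0 R) F"
    unfolding F_def
    by (rule continuous_on_compose2[OF continuous_on_lg continuous_on_compose2[OF S(1)
        continuous_on_compose2[OF P(3) continuous_on_ex]]])
      (use P(1) in auto)
  moreover have "F v \<in> cball 0 R" for v using R(2) P(1) S(2) unfolding F_def by force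
  ultimately obtain v where v: "F v = v"
    using brouwer[of "cball (0::'e) R" F] R(1) by (auto simp: Pi_def)
  define w where "w = ex o' v"
  have "w = S (P w)" using v by (metis F_def ex_lg w_def)
  moreover have "w \<in> Q" using calculation P(1) S(2) by (metis image_subset_iff)
  ultimately show ?thesis using PQ by (metis)
qed

end

section \<open>Convex functions\<close>

text \<open>Separates the strict epigraph of \<open>p\<close> from the product of \<open>K\<close>
  with the nonpositive half line. With a directional derivative for \<open>p\<close> and a tangent
  cone for \<open>K\<close>, the linear functional in between encodes a subgradient.\<close>

lemma convex_cone_sandwich:
  fixes p :: "'a::euclidean_space \<Rightarrow> real"
  assumes p: "\<And>u v s. s \<in> {0..1} \<Longrightarrow> p ((1 - s) *\<^sub>R u + s *\<^sub>R v) \<le> (1 - s) * p u + s * p v" and p0: "p 0 = 0"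
    and K: "convex K" "0 \<in> K" "\<And>u. u \<in> K \<Longrightarrow> 0 \<le> p u"
  shows "\<exists>l. linear l \<and> (\<forall>u. l u \<le> p u) \<and> (\<forall>u\<in>K. (0::real) \<le> l u)"
proof -
  define A where "A = {z::'a \<times> real. p (fst z) < snd z}"
  define B where "B = K \<times> {..0::real}"
  have cA: "convex A"
    unfolding convex_alt
  proof (intro ballI allI impI)
    fix y z s assume y: "y \<in> A" and z: "z \<in> A" and s: "0 \<le> s \<and> s \<le> (1::real)"
    have "p ((1 - s) *\<^sub>R fst y + s *\<^sub>R fst z) \<le> (1 - s) * p (fst y) + s * p (fst z)" using s by (intro p) auto
    also have "\<dots> < (1 - s) * snd y + s * snd z"
    proof (cases "s = 0")
      case False
      then have "s * p (fst z) < s * snd z" using z s by (simp add: A_def)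
      moreover have "(1 - s) * p (fst y) \<le> (1 - s) * snd y" using y s
        by (intro mult_left_mono) (auto simp: A_def)
      ultimately show ?thesis by simp
    qed (use y in \<open>simp add: A_def\<close>)
    finally show "(1 - s) *\<^sub>R y + s *\<^sub>R z \<in> A" by (simp add: A_def)
  qed
  have cB: "convex B" unfolding B_def by (intro convex_Times K convex_real_interval)
  have "(0, p 0 + 1) \<in> A" by (simp add: A_def)
  then have neA: "A \<noteq> {}" by blast
  have neB: "B \<noteq> {}" using K(2) by (auto simp: B_def)
  have disj: "B \<inter> A = {}" using K(3) by (fastforce simp: A_def B_def)
  obtain a b where ab: "a \<noteq> 0" "\<forall>z\<in>B. a \<bullet> z \<le> b" "\<forall>z\<in>A. b \<le> a \<bullet> z"
    using separating_hyperplane_sets[OF cB cA neB neA disj] by blast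
  obtain a1 a2 where a: "a = (a1, a2)" by (cases a)
  have B: "a1 \<bullet> u + a2 * r \<le> b" if "u \<in> K" "r \<le> 0" for u r
    using ab(2)[rule_format, of "(u, r)"] that by (simp add: a B_def)
  have A: "b \<le> a1 \<bullet> u + a2 * r" if "p u < r" for u r
    using ab(3)[rule_format, of "(u, r)"] that by (simp add: a A_def)
  have b0: "0 \<le> b" using B[OF K(2), of 0] by simp
  \<comment> \<open>The hyperplane is not vertical: \<open>B\<close> is unbounded downwards, which
    excludes a negative \<open>a2\<close>, and for \<open>a2 = 0\<close> finiteness of
    \<open>p\<close> everywhere would force \<open>a1 = 0\<close>.\<close>
  have a2: "0 < a2"
  proof (rule ccontr)
    assume "\<not> 0 < a2"
    then have n: "a2 \<le> 0" by simp
    have "a2 = 0"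
    proof (rule ccontr)
      assume "a2 \<noteq> 0"
      then have "a2 < 0" using n by simp
      have "(b + 1) / a2 \<le> 0" using b0 \<open>a2 < 0\<close> by (intro divide_nonneg_neg) auto
      from B[OF K(2) this] show False using \<open>a2 < 0\<close> by simp
    qed
    have "b \<le> a1 \<bullet> (- a1)" using A[of "- a1" "p (- a1) + 1"] \<open>a2 = 0\<close> by simp
    then have "a1 \<bullet> a1 \<le> 0" using b0 by simp
    then have "a1 = 0" by (metis inner_eq_zero_iff inner_ge_zero antisym)
    then show False using ab(1) \<open>a2 = 0\<close> a by (simp add: zero_prod_def)
  qed
  have b: "b = 0"
  proof (rule antisym[OF _ b0])
    show "b \<le> 0"
    proof (rule field_le_epsilon)
      fix e :: real assume "e > 0"
      then show "b \<le> 0 + e" using A[of 0 "e / a2"] p0 a2 by simp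
    qed
  qed
  show ?thesis
  proof (intro exI[of _ "\<lambda>u. - (a1 \<bullet> u) / a2"] conjI allI ballI)
    show "linear (\<lambda>u. - (a1 \<bullet> u) / a2)"
      by (rule linearI) (simp_all add: inner_right_distrib diff_divide_distrib)
    fix u
    show "- (a1 \<bullet> u) / a2 \<le> p u"
    proof (rule field_le_epsilon)
      fix e :: real assume "e > 0"
      then have "- (a1 \<bullet> u) \<le> a2 * (p u + e)" using A[of u "p u + e"] b by simp
      then show "- (a1 \<bullet> u) / a2 \<le> p u + e" using a2 by (simp only: pos_divide_le_eq mult.commute)
    qed
  next
    fix u assume "u \<in> K"
    then have "a1 \<bullet> u \<le> 0" using B[of u 0] b by simp
    then show "0 \<le> - (a1 \<bullet> u) / a2" using a2 by (intro divide_nonneg_pos) auto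
  qed
qed

context hadamard_space
begin

section \<open>Local Lipschitz continuity of convex functions\<close>

lemma geod_geo_geo:
  assumes "t \<in> {0..1}"
  shows "geod M (geo x u a) (geo x u b) t = geo x u (a + t * (b - a))"
  using geo_shift[of x u a "b - a" t] assms
  by (simp add: geod_geo lg_geo mult.commute)

text \<open>Multi-geodesic interpolation of the vertices of a small cube: the result is close to the
  multi-affine interpolation in the chart, so by Brouwer's theorem it covers a neighbourhood.\<close>

primrec cub :: "('m, 'e) chart \<Rightarrow> real \<Rightarrow> 'e list \<Rightarrow> 'e \<Rightarrow> 'e \<Rightarrow> 'm" where
  "cub c h [] v q = chart_inv c q"
| "cub c h (b # bs) v q = geod M (cub c h bs v (q - h *\<^sub>R b)) (cub c h bs v (q + h *\<^sub>R b)) ((1 + v \<bullet> b) / 2)"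

lemma cub_tendsto:
  assumes "v \<longlonglongrightarrow> v0" "\<And>n b. b \<in> set bs \<Longrightarrow> \<bar>v n \<bullet> b\<bar> \<le> 1" "\<And>b. b \<in> set bs \<Longrightarrow> \<bar>v0 \<bullet> b\<bar> \<le> 1"
  shows "(\<lambda>n. cub c h bs (v n) q) \<longlonglongrightarrow> cub c h bs v0 q"
  using assms(2,3)
proof (induction bs arbitrary: q)
  case (Cons b bs)
  have r: "(1 + x) / 2 \<in> {0..1}" if "\<bar>x\<bar> \<le> 1" for x :: real using that by (auto simp: abs_le_iff)
  show ?case unfolding cub.simps
    by (intro geod_tendsto Cons.IH r tendsto_intros assms(1)) (use Cons.prems in auto)
qed simp

context
  fixes c :: "('m, 'e) chart" and x :: 'm and \<rho> C \<delta> :: real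
  assumes c: "c \<in> atlas M" and C: "C > 0"
    and chart: "\<And>p q. rdist x p < \<rho> \<Longrightarrow> rdist x q < \<rho> \<Longrightarrow> p \<in> fst c \<and>
      (\<forall>s\<in>{0..1}. norm (snd c (geod M p q s) - ((1 - s) *\<^sub>R snd c p + s *\<^sub>R snd c q)) \<le>
        C * (norm (snd c p - snd c q))\<^sup>2)"
    and \<delta>: "\<And>q. norm (q - snd c x) \<le> \<delta> \<Longrightarrow> q \<in> snd c ` fst c \<and> rdist x (chart_inv c q) < \<rho>"
begin

text \<open>Every direction in the list shifts \<open>q\<close> by at most \<open>h\<close>, which
  the sum bounded by \<delta> accounts for. Interpolation stays in the ball by convexity of distance
  balls.\<close>

lemma cub_in_rball:
  assumes "norm (q - snd c x) + real (length bs) * h \<le> \<delta>" "\<And>b. b \<in> set bs \<Longrightarrow> norm b = 1 \<and> \<bar>v \<bullet> b\<bar> \<le> 1" "h \<ge> 0"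
  shows "rdist x (cub c h bs v q) < \<rho>"
  using assms(1,2)
proof (induction bs arbitrary: q)
  case Nil
  then show ?case using \<delta> by simp
next
  case (Cons b bs)
  have nb: "norm b = 1" "\<bar>v \<bullet> b\<bar> \<le> 1" using Cons.prems(2)[of b] by auto
  have "norm (q - h *\<^sub>R b - snd c x) \<le> norm (q - snd c x) + h" "norm (q + h *\<^sub>R b - snd c x) \<le>
    norm (q - snd c x) + h"
    using norm_triangle_ineq4[of "q - snd c x" "h *\<^sub>R b"] norm_triangle_ineq[of "q - snd c x" "h *\<^sub>R b"] nb
        assms(3)
    by (simp_all add: algebra_simps)
  then have "rdist x (cub c h bs v (q - h *\<^sub>R b)) < \<rho>" "rdist x (cub c h bs v (q + h *\<^sub>R b)) < \<rho>"
    using Cons.prems by (auto intro!: Cons.IH simp: algebra_simps)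
  moreover have "rdist x (cub c h (b # bs) v q) \<le> max (rdist x (cub c h bs v (q - h *\<^sub>R b))) (rdist x (cub c
    h bs v (q + h *\<^sub>R b)))"
    unfolding cub.simps using nb by (intro rdist_geod_le_max) (auto simp: abs_le_iff)
  ultimately show ?case by simp
qed

text \<open>Each interpolation differs from the affine one by \<open>C\<close> times the square of a
  chord of order \<open>h\<close>. The total error is thus quadratic in \<open>h\<close>, whereas
  the cube itself has size \<open>h\<close>.\<close>

lemma cub_approx:
  "\<exists>K\<ge>0. \<forall>h q v. 0 < h \<longrightarrow> h \<le> 1 \<longrightarrow> norm (q - snd c x) + real (length bs) * h \<le> \<delta> \<longrightarrow> (\<forall>b\<in>set bs. norm b = 1 \<and>
    \<bar>v \<bullet> b\<bar> \<le> 1) \<longrightarrow>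
    norm (snd c (cub c h bs v q) - (q + h *\<^sub>R (\<Sum>b\<leftarrow>bs. (v \<bullet> b) *\<^sub>R b))) \<le> K * h\<^sup>2"
proof (induction bs)
  case Nil
  show ?case using \<delta> c by (intro exI[of _ 0]) auto
next
  case (Cons b bs)
  then obtain K where K: "K \<ge> 0" "\<And>h q v. 0 < h \<Longrightarrow> h \<le> 1 \<Longrightarrow> norm (q - snd c x) + real (length bs) * h \<le> \<delta> \<Longrightarrow>
    (\<forall>b\<in>set bs. norm b = 1 \<and> \<bar>v \<bullet> b\<bar> \<le> 1) \<Longrightarrow>
    norm (snd c (cub c h bs v q) - (q + h *\<^sub>R (\<Sum>b\<leftarrow>bs. (v \<bullet> b) *\<^sub>R b))) \<le> K * h\<^sup>2" by blast
  \<comment> \<open>The two interpolated ends are at coordinate distance at most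
    \<open>(2 + 2 * K) * h\<close>: 2 * h between the centres and \<open>K * h\<^sup>2\<close> of
    error at each end, where \<open>h \<le> 1\<close>. The new term is \<open>C\<close> times the
    square of this.\<close>
  define K' where "K' = K + C * (2 + 2 * K)\<^sup>2"
  show ?case
  proof (rule exI[of _ K'], intro conjI allI impI)
    show "K' \<ge> 0" using K(1) C by (simp add: K'_def)
    fix h q v
    assume h: "0 < h" "h \<le> (1::real)" and q: "norm (q - snd c x) + real (length (b # bs)) * h \<le> \<delta>"
      and bs: "\<forall>b\<in>set (b # bs). norm b = 1 \<and> \<bar>v \<bullet> b\<bar> \<le> 1"
    have nb: "norm b = 1" "\<bar>v \<bullet> b\<bar> \<le> 1" using bs by auto
    define S where "S = (\<Sum>b\<leftarrow>bs. (v \<bullet> b) *\<^sub>R b)"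
    \<comment> \<open>With this parameter the affine interpolation between q - h b and q + h b is q
      + h (v \<bullet> b) b.\<close>
    define s where "s = (1 + v \<bullet> b) / 2"
    have s: "s \<in> {0..1}" using nb by (auto simp: s_def abs_le_iff)
    have q': "norm (q - h *\<^sub>R b - snd c x) + real (length bs) * h \<le>
      \<delta>" "norm (q + h *\<^sub>R b - snd c x) + real (length bs) * h \<le> \<delta>"
      using norm_triangle_ineq4[of "q - snd c x" "h *\<^sub>R b"] norm_triangle_ineq[of "q - snd c x" "h *\<^sub>R b"] nb
          h q
      by (simp_all add: algebra_simps)
    define p1 where "p1 = cub c h bs v (q - h *\<^sub>R b)"
    define p2 where "p2 = cub c h bs v (q + h *\<^sub>R b)"
    define e1 where "e1 = snd c p1 - (q - h *\<^sub>R b + h *\<^sub>R S)"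
    define e2 where "e2 = snd c p2 - (q + h *\<^sub>R b + h *\<^sub>R S)"
    have e: "norm e1 \<le> K * h\<^sup>2" "norm e2 \<le> K * h\<^sup>2"
      using K(2)[OF h q'(1), of v] K(2)[OF h q'(2), of v] bs
          by (simp_all add: e1_def e2_def p1_def p2_def S_def)
    have r: "rdist x p1 < \<rho>" "rdist x p2 < \<rho>"
      unfolding p1_def p2_def using q' bs h by (auto intro!: cub_in_rball)
    have hh: "h\<^sup>2 \<le> h" using h by (simp add: power2_eq_square mult_left_le)
    have d: "norm (snd c p1 - snd c p2) \<le> (2 + 2 * K) * h"
    proof -
      have "snd c p1 - snd c p2 = e1 - e2 - (2 * h) *\<^sub>R b"
        by (simp add: e1_def e2_def scaleR_2 algebra_simps flip: scaleR_scaleR)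
      also have "norm \<dots> \<le> norm (e1 - e2) + norm ((2 * h) *\<^sub>R b)" by (rule norm_triangle_ineq4)
      also have "norm (e1 - e2) \<le> norm e1 + norm e2" by (rule norm_triangle_ineq4)
      also have "norm ((2 * h) *\<^sub>R b) = 2 * h" using nb h by simp
      also have "norm e1 + norm e2 + 2 * h \<le> K * h + K * h + 2 * h"
        using e mult_left_mono[OF hh K(1)] by linarith
      finally show ?thesis by (simp add: algebra_simps)
    qed
    have "norm (snd c (geod M p1 p2 s) - ((1 - s) *\<^sub>R snd c p1 + s *\<^sub>R snd c p2)) \<le>
      C * (norm (snd c p1 - snd c p2))\<^sup>2"
      using chart[OF r] s by blast
    also have "\<dots> \<le> C * ((2 + 2 * K) * h)\<^sup>2" using d C by (intro mult_left_mono power_mono) auto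
    finally have 1: "norm (snd c (geod M p1 p2 s) - ((1 - s) *\<^sub>R snd c p1 + s *\<^sub>R snd c p2)) \<le>
      C * (2 + 2 * K)\<^sup>2 * h\<^sup>2"
      by (simp add: power_mult_distrib)
    have 2: "norm ((1 - s) *\<^sub>R e1 + s *\<^sub>R e2) \<le> K * h\<^sup>2"
    proof -
      have "norm ((1 - s) *\<^sub>R e1 + s *\<^sub>R e2) \<le> (1 - s) * norm e1 + s * norm e2"
        using norm_triangle_ineq[of "(1 - s) *\<^sub>R e1" "s *\<^sub>R e2"] s by simp
      also have "\<dots> \<le> (1 - s) * (K * h\<^sup>2) + s * (K * h\<^sup>2)" using e s by (intro add_mono mult_left_mono) auto
      finally show ?thesis by (simp add: algebra_simps)
    qed
    have "v \<bullet> b = s + s - 1" by (simp add: s_def field_simps)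
    then have vb: "(v \<bullet> b) *\<^sub>R b = s *\<^sub>R b + s *\<^sub>R b - b"
      by (simp only: scaleR_left_distrib scaleR_left_diff_distrib scaleR_one)
    have "snd c (geod M p1 p2 s) - (q + h *\<^sub>R ((v \<bullet> b) *\<^sub>R b + S)) =
      (snd c (geod M p1 p2 s) - ((1 - s) *\<^sub>R snd c p1 + s *\<^sub>R snd c p2)) + ((1 - s) *\<^sub>R e1 + s *\<^sub>R e2)"
      unfolding vb by (simp add: e1_def e2_def algebra_simps)
    then have "norm (snd c (geod M p1 p2 s) - (q + h *\<^sub>R ((v \<bullet> b) *\<^sub>R b + S))) \<le>
      C * (2 + 2 * K)\<^sup>2 * h\<^sup>2 + K * h\<^sup>2"
      using norm_triangle_ineq[of "snd c (geod M p1 p2 s) - ((1 - s) *\<^sub>R snd c p1 + s *\<^sub>R snd c p2)" "(1 - s)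
          *\<^sub>R e1 + s *\<^sub>R e2"] 1 2
      by (elim ssubst) linarith
    also have "\<dots> = K' * h\<^sup>2" by (simp add: K'_def algebra_simps)
    finally show "norm (snd c (cub c h (b # bs) v q) - (q + h *\<^sub>R (\<Sum>b\<leftarrow>b # bs. (v \<bullet> b) *\<^sub>R b))) \<le> K' * h\<^sup>2"
      by (simp add: p1_def p2_def s_def S_def)
  qed
qed

text \<open>Convexity along each geodesic of the construction bounds the value by the larger of the
  two ends, and finally by the values at the vertices of the cube.\<close>

lemma cub_bounded:
  assumes F: "\<And>p q s. rdist x p < \<rho> \<Longrightarrow> rdist x q < \<rho> \<Longrightarrow> s \<in> {0..1} \<Longrightarrow> F (geod M p q s) \<le>
      (1 - s) * F p + s * (F q :: real)" and h: "0 \<le> h"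
  shows "norm (q - snd c x) + real (length bs) * h \<le> \<delta> \<Longrightarrow> (\<And>b. b \<in> set bs \<Longrightarrow> norm b = 1) \<Longrightarrow>
    \<exists>B. \<forall>v. (\<forall>b\<in>set bs. \<bar>v \<bullet> b\<bar> \<le> 1) \<longrightarrow> F (cub c h bs v q) \<le> B"
proof (induction bs arbitrary: q)
  case Nil
  show ?case by auto
next
  case (Cons b bs)
  have nb: "norm b = 1" using Cons.prems(2)[of b] by auto
  have q': "norm (q - h *\<^sub>R b - snd c x) + real (length bs) * h \<le>
    \<delta>" "norm (q + h *\<^sub>R b - snd c x) + real (length bs) * h \<le> \<delta>"
    using norm_triangle_ineq4[of "q - snd c x" "h *\<^sub>R b"] norm_triangle_ineq[of "q - snd c x" "h *\<^sub>R b"] nb h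
        Cons.prems(1)
    by (simp_all add: algebra_simps)
  obtain B1 where B1: "\<And>v. (\<forall>b\<in>set bs. \<bar>v \<bullet> b\<bar> \<le> 1) \<Longrightarrow> F (cub c h bs v (q - h *\<^sub>R b)) \<le> B1"
    using Cons.IH[OF q'(1)] Cons.prems(2) by auto
  obtain B2 where B2: "\<And>v. (\<forall>b\<in>set bs. \<bar>v \<bullet> b\<bar> \<le> 1) \<Longrightarrow> F (cub c h bs v (q + h *\<^sub>R b)) \<le> B2"
    using Cons.IH[OF q'(2)] Cons.prems(2) by auto
  show ?case
  proof (rule exI[of _ "max B1 B2"], intro allI impI)
    fix v assume v: "\<forall>b'\<in>set (b # bs). \<bar>v \<bullet> b'\<bar> \<le> 1"
    define s where "s = (1 + v \<bullet> b) / 2"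
    have s: "s \<in> {0..1}" using v by (auto simp: s_def abs_le_iff)
    have "F (cub c h (b # bs) v q) \<le> (1 - s) * F (cub c h bs v (q - h *\<^sub>R b)) + s * F (cub c h bs v (q + h
      *\<^sub>R b))"
      unfolding cub.simps s_def[symmetric]
      using q' v h Cons.prems(2) by (intro F s cub_in_rball) auto
    also have "\<dots> \<le> (1 - s) * max B1 B2 + s * max B1 B2"
      using s B1[of v] B2[of v] v by (intro add_mono mult_left_mono) auto
    finally show "F (cub c h (b # bs) v q) \<le> max B1 B2" by (simp add: algebra_simps)
  qed
qed

end

text \<open>In a vector space a convex function is bounded on the hull of finitely many points and
  this hull is a neighbourhood. A geodesic hull has no such explicit shape, so it must be proved
  that the interpolated points fill a ball.\<close>

lemma convex_bounded_above:
  fixes F :: "'m \<Rightarrow> real"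
  assumes U: "open U" "x \<in> U"
    and F: "\<And>p q s. p \<in> U \<Longrightarrow> q \<in> U \<Longrightarrow> geod M p q ` {0..1} \<subseteq> U \<Longrightarrow> s \<in> {0..1} \<Longrightarrow> F (geod M p q s) \<le>
        (1 - s) * F p + s * F q"
  shows "\<exists>\<rho>>0. \<exists>B. \<forall>y. rdist x y < \<rho> \<longrightarrow> y \<in> U \<and> F y \<le> B"
proof -
  define c where "c = chart_at M x"
  have c: "c \<in> atlas M" "x \<in> fst c" by (simp_all add: c_def chart_at)
  obtain \<rho>0 C where \<rho>0: "\<rho>0 > 0" "C > 0" "\<And>p q. rdist x p < \<rho>0 \<Longrightarrow> rdist x q < \<rho>0 \<Longrightarrow> p \<in> fst c \<and>
    rdist p q \<le> C * norm (snd c p - snd c q) \<and> norm (snd c p - snd c q) \<le> C * rdist p q \<and>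
    (\<forall>s\<in>{0..1}. norm (snd c (geod M p q s) - ((1 - s) *\<^sub>R snd c p + s *\<^sub>R snd c q)) \<le>
      C * (norm (snd c p - snd c q))\<^sup>2)"
    using local_chart[OF c] by blast
  obtain \<rho>1 where \<rho>1: "\<rho>1 > 0" "{y. rdist x y < \<rho>1} \<subseteq> U" using rball_subset_open[OF U] by blast
  define \<rho> where "\<rho> = min \<rho>0 \<rho>1"
  have \<rho>: "\<rho> > 0" using \<rho>0 \<rho>1 by (simp add: \<rho>_def)
  have chart: "p \<in> fst c \<and>
      (\<forall>s\<in>{0..1}. norm (snd c (geod M p q s) - ((1 - s) *\<^sub>R snd c p + s *\<^sub>R snd c q)) \<le>
        C * (norm (snd c p - snd c q))\<^sup>2)"
    if "rdist x p < \<rho>" "rdist x q < \<rho>" for p q using \<rho>0(3)[of p q] that by (auto simp: \<rho>_def)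
  have "open (snd c ` (fst c \<inter> {y. rdist x y < \<rho>}))" by (intro open_chart_subset c open_rball)
  moreover have "snd c x \<in> snd c ` (fst c \<inter> {y. rdist x y < \<rho>})" using c \<rho> by simp
  ultimately obtain \<delta> where \<delta>: "\<delta> > 0" "cball (snd c x) \<delta> \<subseteq> snd c ` (fst c \<inter> {y. rdist x y < \<rho>})"
    using open_contains_cball by blast
  have \<delta>': "q \<in> snd c ` fst c \<and> rdist x (chart_inv c q) < \<rho>" if "norm (q - snd c x) \<le> \<delta>" for q
  proof -
    have "q \<in> cball (snd c x) \<delta>" using that by (simp add: dist_norm norm_minus_commute)
    then show ?thesis using \<delta>(2) c(1) by auto
  qed
  obtain bs :: "'e list" where bs: "set bs = Basis" "distinct bs"
    using finite_distinct_list[OF finite_Basis] by blast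
  have sum: "(\<Sum>b\<leftarrow>bs. (v \<bullet> b) *\<^sub>R b) = v" for v
    using bs by (simp add: sum_list_distinct_conv_sum_set euclidean_representation)
  have nb: "norm b = 1" if "b \<in> set bs" for b using that bs by simp
  have vb: "\<bar>v \<bullet> b\<bar> \<le> 1" if "norm v \<le> 1" "b \<in> set bs" for v b
    using Basis_le_norm[of b v] that bs by auto
  obtain K where K: "K \<ge> 0" "\<And>h q v. 0 < h \<Longrightarrow> h \<le> 1 \<Longrightarrow> norm (q - snd c x) + real (length bs) * h \<le> \<delta> \<Longrightarrow>
    (\<forall>b\<in>set bs. norm b = 1 \<and> \<bar>v \<bullet> b\<bar> \<le> 1) \<Longrightarrow>
    norm (snd c (cub c h bs v q) - (q + h *\<^sub>R (\<Sum>b\<leftarrow>bs. (v \<bullet> b) *\<^sub>R b))) \<le> K * h\<^sup>2"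
    using cub_approx[where bs = bs, OF c(1) \<rho>0(2) chart \<delta>'] by blast
  \<comment> \<open>Small enough for \<open>cub_approx\<close>, for all vertices to stay within
    \<delta>, and for the relative error \<open>K * h\<close> to be at most 1/2.\<close>
  define h where "h = min (min 1 (\<delta> / (real (length bs) + 1))) (1 / (2 * (K + 1)))"
  have h: "0 < h" "h \<le> 1" "real (length bs) * h \<le> \<delta>" "K * h \<le> 1 / 2"
  proof -
    show "0 < h" "h \<le> 1" using \<delta> K(1) by (auto simp: h_def)
    have "h \<le> \<delta> / (real (length bs) + 1)" by (simp add: h_def)
    then have "(real (length bs) + 1) * h \<le> \<delta>" by (simp add: pos_le_divide_eq mult.commute)
    then show "real (length bs) * h \<le> \<delta>" using \<open>0 < h\<close> by (simp add: algebra_simps)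
    have "h \<le> 1 / (2 * (K + 1))" by (simp add: h_def)
    then have "(K + 1) * h \<le> 1 / 2" using K(1) by (simp add: field_simps)
    then show "K * h \<le> 1 / 2" using \<open>0 < h\<close> by (simp add: algebra_simps)
  qed
  have q0: "norm (snd c x - snd c x) + real (length bs) * h \<le> \<delta>" using h by simp
  have inU: "{y. rdist x y < \<rho>} \<subseteq> U" using \<rho>1 by (auto simp: \<rho>_def)
  have Fconv: "F (geod M p q s) \<le> (1 - s) * F p + s * F q"
    if "rdist x p < \<rho>" "rdist x q < \<rho>" "s \<in> {0..1}" for p q s
  proof (rule F)
    show "geod M p q ` {0..1} \<subseteq> U"
    proof safe
      fix t :: real assume t: "t \<in> {0..1}"
      have "rdist x (geod M p q t) \<le> max (rdist x p) (rdist x q)" by (rule rdist_geod_le_max[OF t]) auto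
      then have "rdist x (geod M p q t) < \<rho>" using that by simp
      then show "geod M p q t \<in> U" using inU by blast
    qed
  qed (use that inU in auto)
  obtain B where B: "\<And>v. \<forall>b\<in>set bs. \<bar>v \<bullet> b\<bar> \<le> 1 \<Longrightarrow> F (cub c h bs v (snd c x)) \<le> B"
    using cub_bounded[OF c(1) \<rho>0(2) chart \<delta>' Fconv less_imp_le[OF h(1)] q0 nb] by blast
  have cover: "\<exists>v. norm v \<le> 1 \<and> snd c (cub c h bs v (snd c x)) = snd c x + h *\<^sub>R w"
    if w: "norm w \<le> 1 / 2" for w
  proof -
    \<comment> \<open>A fixed point \<open>v\<close> is a parameter whose interpolated point has
      coordinates \<open>snd c x + h w\<close>. The error is at most 1/2 relative to
      \<open>h\<close> and so is \<open>w\<close>, hence the unit ball is mapped into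
      itself.\<close>
    define \<Psi> where "\<Psi> = (\<lambda>v. w + v - (snd c (cub c h bs v (snd c x)) - snd c x) /\<^sub>R h)"
    have inb: "rdist x (cub c h bs v (snd c x)) < \<rho>" if "norm v \<le> 1" for v
      by (rule cub_in_rball[OF c(1) \<rho>0(2) chart \<delta>' q0]) (use nb vb that h in auto)
    have "continuous_on (cball 0 1) (\<lambda>v. snd c (cub c h bs v (snd c x)))"
    proof (rule continuous_on_compose2[OF continuous_on_chart[OF c(1)]])
      show "continuous_on (cball 0 1) (\<lambda>v. cub c h bs v (snd c x))"
        by (rule continuous_on_sequentiallyI, rule cub_tendsto) (use vb in auto)
      show "(\<lambda>v. cub c h bs v (snd c x)) ` cball 0 1 \<subseteq> fst c" using chart[OF inb inb] by auto
    qed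
    then have "continuous_on (cball 0 1) \<Psi>" unfolding \<Psi>_def by (intro continuous_intros)
    moreover have "\<Psi> v \<in> cball 0 1" if "v \<in> cball 0 1" for v
    proof -
      have v: "norm v \<le> 1" using that by simp
      have "norm (snd c (cub c h bs v (snd c x)) - (snd c x + h *\<^sub>R v)) \<le> K * h\<^sup>2"
        using K(2)[OF h(1,2) q0, of v] nb vb[OF v] by (simp add: sum)
      then have "norm (snd c (cub c h bs v (snd c x)) - (snd c x + h *\<^sub>R v)) / h \<le> K * h\<^sup>2 / h"
        using h(1) by (intro divide_right_mono) auto
      moreover have "v - (snd c (cub c h bs v (snd c x)) - snd c x) /\<^sub>R h =
        - ((snd c (cub c h bs v (snd c x)) - (snd c x + h *\<^sub>R v)) /\<^sub>R h)"
        using h(1) by (simp add: algebra_simps)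
      ultimately have "norm (v - (snd c (cub c h bs v (snd c x)) - snd c x) /\<^sub>R h) \<le> K * h"
        using h(1) by (simp only: norm_minus_cancel norm_scaleR_inverse) (simp add: power2_eq_square)
      then have "norm (v - (snd c (cub c h bs v (snd c x)) - snd c x) /\<^sub>R h) \<le> 1 / 2" using h(4) by linarith
      then have "norm (\<Psi> v) \<le> 1 / 2 + 1 / 2"
        unfolding \<Psi>_def using norm_triangle_le[of w "v - (snd c (cub c h bs v (snd c x)) - snd c x) /\<^sub>R h" 1]
            w
        by (simp add: add_diff_eq)
      then show ?thesis by simp
    qed
    ultimately obtain v where v: "v \<in> cball 0 1" "\<Psi> v = v"
      using brouwer[of "cball (0::'e) 1" \<Psi>] by (auto simp: Pi_def)
    then have "(snd c (cub c h bs v (snd c x)) - snd c x) /\<^sub>R h = w" by (simp add: \<Psi>_def algebra_simps)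
    then have "snd c (cub c h bs v (snd c x)) - snd c x = h *\<^sub>R w" using h(1)
      by (metis divideR_right less_irrefl)
    then show ?thesis using v(1) by (intro exI[of _ v]) (simp add: algebra_simps)
  qed
  define r where "r = min \<rho> (h / (2 * C))"
  show ?thesis
  proof (rule exI[of _ r], intro conjI, goal_cases)
    case 1
    show ?case using \<rho> h \<rho>0 by (simp add: r_def)
  next
    case 2
    show ?case
    proof (rule exI[of _ B], intro allI impI)
      fix y assume y: "rdist x y < r"
      then have y\<rho>: "rdist x y < \<rho>" by (simp add: r_def)
      then have yc: "y \<in> fst c" using chart[of y y] by blast
      have "norm (snd c y - snd c x) \<le> C * rdist y x" using \<rho>0(3)[of y x] y\<rho> \<rho>0(1) by (auto simp: \<rho>_def)
      also have "\<dots> \<le> C * (h / (2 * C))" using y \<rho>0(2)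
        by (intro mult_left_mono) (auto simp: r_def rdist_sym[of y])
      also have "\<dots> = h / 2" using \<rho>0(2) by simp
      finally have "norm ((snd c y - snd c x) /\<^sub>R h) \<le> 1 / 2" using h(1)
        by (simp add: norm_scaleR_inverse pos_divide_le_eq del: norm_scaleR)
      then obtain v where v: "norm v \<le> 1" "snd c (cub c h bs v (snd c x)) =
        snd c x + h *\<^sub>R ((snd c y - snd c x) /\<^sub>R h)"
        using cover by blast
      then have "snd c (cub c h bs v (snd c x)) = snd c y" using h(1) by simp
      moreover have "rdist x (cub c h bs v (snd c x)) < \<rho>"
        by (rule cub_in_rball[OF c(1) \<rho>0(2) chart \<delta>' q0]) (use nb vb v h in auto)
      then have "cub c h bs v (snd c x) \<in> fst c" using chart by blast
      ultimately have "y = cub c h bs v (snd c x)" using yc c(1) by (metis chart_inv_chart)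
      then show "y \<in> U \<and> F y \<le> B" using B[of v] vb[OF v(1)] inU y\<rho> by auto
    qed
  qed
qed

lemma convex_locally_Lipschitz:
  fixes F :: "'m \<Rightarrow> real"
  assumes U: "open U" "x \<in> U"
    and F: "\<And>p q s. p \<in> U \<Longrightarrow> q \<in> U \<Longrightarrow> geod M p q ` {0..1} \<subseteq> U \<Longrightarrow> s \<in> {0..1} \<Longrightarrow> F (geod M p q s) \<le>
        (1 - s) * F p + s * F q"
  shows "\<exists>\<rho>>0. \<exists>L\<ge>0. \<forall>y z. rdist x y < \<rho> \<longrightarrow> rdist x z < \<rho> \<longrightarrow> y \<in> U \<and> \<bar>F y - F z\<bar> \<le> L * rdist y z"
proof -
  obtain \<rho> B where \<rho>: "\<rho> > 0" "\<And>y. rdist x y < \<rho> \<Longrightarrow> y \<in> U \<and> F y \<le> B" using convex_bounded_above[OF assms]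
    by blast
  have Fconv: "F (geod M p q s) \<le> (1 - s) * F p + s * F q"
    if "rdist x p < \<rho>" "rdist x q < \<rho>" "s \<in> {0..1}" for p q s
  proof (rule F)
    show "geod M p q ` {0..1} \<subseteq> U"
    proof safe
      fix t :: real assume t: "t \<in> {0..1}"
      have "rdist x (geod M p q t) \<le> max (rdist x p) (rdist x q)" by (rule rdist_geod_le_max[OF t]) auto
      then have "rdist x (geod M p q t) < \<rho>" using that by simp
      then show "geod M p q t \<in> U" using \<rho>(2) by blast
    qed
  qed (use that \<rho> in auto)
  \<comment> \<open>\<open>y'\<close> is the reflection of \<open>y\<close> in \<open>x\<close>, so
    \<open>x\<close> is the midpoint and the upper bound at \<open>y'\<close> turns into a lower
    bound at \<open>y\<close>.\<close>
  have low: "2 * F x - B \<le> F y" if y: "rdist x y < \<rho>" for y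
  proof -
    define y' where "y' = geo x (lg x y) (- 1)"
    have g1: "geo x (lg x y) 1 = y" by (simp flip: ex_geo)
    have y': "rdist x y' < \<rho>" using rdist_geo[of x "lg x y" 0 "-1"] y by (simp add: y'_def geo rdist_def)
    have "geod M y y' (1/2) = x" using geod_geo_geo[of "1/2" x "lg x y" 1 "-1"] by (simp add: g1 y'_def geo)
    then have "F x \<le> (1 - 1/2) * F y + 1/2 * F y'" using Fconv[OF y y', of "1/2"] by simp
    then show ?thesis using \<rho>(2)[OF y'] by simp
  qed
  define r where "r = \<rho> / 2"
  \<comment> \<open>The values differ by at most \<open>2 * (B - F x)\<close> on the ball, and
    convexity compares this with the additional length \<open>r\<close> by which a geodesic is
    prolonged.\<close>
  define L where "L = 2 * (B - F x) / r"
  have r: "r > 0" using \<rho> by (simp add: r_def)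
  have BF: "F x \<le> B" using \<rho>(1) \<rho>(2)[of x] by simp
  have L0: "L \<ge> 0" using r BF by (simp add: L_def)
  have half: "F z - F y \<le> L * rdist y z" if y: "rdist x y < \<rho> / 4" and z: "rdist x z < \<rho> / 4" for y z
  proof (cases "y = z")
    case False
    define d where "d = rdist y z"
    have d: "d > 0" using False rdist_eq_0[of y z] rdist_nonneg[of y z] by (simp add: d_def del: rdist_nonneg)
    \<comment> \<open>The geodesic from \<open>y\<close> is prolonged beyond \<open>z\<close> by
      length \<open>r\<close>, so that \<open>z\<close> divides it at the fraction
      \<open>d / (d + r)\<close>.\<close>
    define z' where "z' = geo y (lg y z) (1 + r / d)"
    have g1: "geo y (lg y z) 1 = z" by (simp flip: ex_geo)
    have "rdist z z' = r"
      using rdist_geo[of y "lg y z" 1 "1 + r / d"] r d by (simp add: g1 z'_def d_def rdist_def[of y])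
    then have z': "rdist x z' < \<rho>" using rdist_triangle[of x z' z] z \<rho>(1) by (simp add: r_def)
    define l where "l = d / (d + r)"
    have l: "l \<in> {0..1}" "l \<le> d / r" using d r by (auto simp: l_def intro!: divide_left_mono)
    have "geod M y z' l = geo y (lg y z) (0 + l * ((1 + r / d) - 0))"
      using geod_geo_geo[OF l(1), of y "lg y z" 0 "1 + r / d"] by (simp add: geo z'_def)
    also have "1 + r / d = (d + r) / d" using d by (simp add: add_divide_distrib)
    also have "0 + l * ((d + r) / d - 0) = 1" using d r by (simp add: l_def)
    finally have gz: "geod M y z' l = z" by (simp add: g1)
    have y\<rho>: "rdist x y < \<rho>" using y \<rho>(1) by simp
    have "F z \<le> (1 - l) * F y + l * F z'" using Fconv[OF y\<rho> z' l(1)] by (simp add: gz)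
    then have "F z - F y \<le> l * (F z' - F y)" by (simp add: algebra_simps)
    also have "\<dots> \<le> l * (2 * (B - F x))"
      using \<rho>(2)[OF z'] low[OF y\<rho>] l(1) by (intro mult_left_mono) auto
    also have "\<dots> \<le> d / r * (2 * (B - F x))" using l(2) BF by (intro mult_right_mono) auto
    also have "\<dots> = L * d" by (simp add: L_def)
    finally show ?thesis by (simp add: d_def)
  qed (use L0 in simp)
  show ?thesis
  proof (rule exI[of _ "\<rho> / 4"], intro conjI, goal_cases)
    case 1
    show ?case using \<rho>(1) by simp
  next
    case 2
    show ?case
    proof (rule exI[of _ L], intro conjI L0 allI impI)
      fix y z assume y: "rdist x y < \<rho> / 4" and z: "rdist x z < \<rho> / 4"
      show "y \<in> U" using \<rho>(1) \<rho>(2)[of y] y by simp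
      show "\<bar>F y - F z\<bar> \<le> L * rdist y z" using half[OF y z] half[OF z y]
        by (simp add: rdist_sym[of z] abs_le_iff)
    qed
  qed
qed

text \<open>Sequences of points whose chart coordinates have a first order expansion with rate
  \<^term>\<open>1 / (n + 1)\<close>.\<close>

definition tang :: "'m \<Rightarrow> (nat \<Rightarrow> 'm) \<Rightarrow> 'e \<Rightarrow> bool" where
  "tang x y u \<longleftrightarrow> y \<longlonglongrightarrow> x \<and> (\<lambda>n. real (Suc n) *\<^sub>R (snd (chart_at M x) (y n) - snd (chart_at M x) x)) \<longlonglongrightarrow> u"

lemma tang_ex: "tang x (\<lambda>n. ex x ((1 / real (Suc n)) *\<^sub>R u)) u"
  unfolding tang_def
proof
  have s: "(\<lambda>n. 1 / real (Suc n)) \<longlonglongrightarrow> 0"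
    using LIMSEQ_inverse_real_of_nat by (simp add: inverse_eq_divide)
  have "(\<lambda>n. (1 / real (Suc n)) *\<^sub>R u) \<longlonglongrightarrow> 0 *\<^sub>R u" by (intro tendsto_intros s)
  then show "(\<lambda>n. ex x ((1 / real (Suc n)) *\<^sub>R u)) \<longlonglongrightarrow> x" using ex_tendsto by fastforce
  define c where "c = chart_at M x"
  have c: "c \<in> atlas M" "x \<in> fst c" by (simp_all add: c_def chart_at)
  have g0: "geo x u 0 \<in> fst c" by (simp add: geo c)
  have "((\<lambda>r. snd c (geo x u r)) has_vector_derivative u) (at 0)"
    using has_vector_derivative_chart(1)[OF geo(1) c(1) UNIV_I g0]
        by (simp add: ph_geo_0[OF c], simp add: c_def)
  then have "((\<lambda>t. ((snd c (geo x u t) - snd c (geo x u 0)) - (t - 0) *\<^sub>R u) /\<^sub>R norm (t - 0)) \<longlongrightarrow> 0) (at 0)"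
    by (simp add: has_vector_derivative_def has_derivative_def netlimit_at)
  then have "((\<lambda>t. norm (((snd c (geo x u t) - snd c (geo x u 0)) - (t - 0) *\<^sub>R u) /\<^sub>R norm (t - 0))) \<longlongrightarrow> 0)
    (at 0)"
    by (rule tendsto_norm_zero)
  then have "((\<lambda>t. norm ((snd c (geo x u t) - snd c (geo x u 0)) /\<^sub>R t - u)) \<longlongrightarrow> 0) (at 0)"
  proof (rule Lim_transform_eventually)
    show "\<forall>\<^sub>F t in at 0. norm (((snd c (geo x u t) - snd c (geo x u 0)) - (t - 0) *\<^sub>R u) /\<^sub>R norm (t - 0)) =
      norm ((snd c (geo x u t) - snd c (geo x u 0)) /\<^sub>R t - u)"
      unfolding eventually_at_filter
    proof (intro always_eventually allI impI)
      fix t :: real assume "t \<noteq> 0"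
      then have "(snd c (geo x u t) - snd c (geo x u 0)) - (t - 0) *\<^sub>R u =
        t *\<^sub>R ((snd c (geo x u t) - snd c (geo x u 0)) /\<^sub>R t - u)"
        by (simp add: scaleR_diff_right)
      then show "norm (((snd c (geo x u t) - snd c (geo x u 0)) - (t - 0) *\<^sub>R u) /\<^sub>R norm (t - 0)) =
        norm ((snd c (geo x u t) - snd c (geo x u 0)) /\<^sub>R t - u)"
        using \<open>t \<noteq> 0\<close> by (simp only: norm_scaleR) simp
    qed
  qed
  then have "((\<lambda>t. (snd c (geo x u t) - snd c (geo x u 0)) /\<^sub>R t) \<longlongrightarrow> u) (at 0)"
    by (simp only: tendsto_norm_zero_iff LIM_zero_iff)
  moreover have "filterlim (\<lambda>n. 1 / real (Suc n)) (at 0) sequentially" using s by (simp add: filterlim_at)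
  ultimately have "(\<lambda>n. (snd c (geo x u (1 / real (Suc n))) - snd c (geo x u 0)) /\<^sub>R (1 / real (Suc n))) \<longlonglongrightarrow> u"
    by (rule filterlim_compose)
  then show "(\<lambda>n. real (Suc n) *\<^sub>R (snd (chart_at M x) (ex x ((1 / real (Suc n)) *\<^sub>R u)) - snd (chart_at M x)
    x)) \<longlonglongrightarrow> u"
    by (simp add: ex_scale c_def geo)
qed

end

section \<open>Mixed variational inequalities\<close>

context hadamard_space
begin

text \<open>Sequences with the same tangent vector differ by o(1/n). Difference quotients of a
  locally Lipschitz function with step 1/(n + 1) do not distinguish them.\<close>

lemma tang_rdist:
  assumes y: "tang x y u" and z: "tang x z u"
  shows "(\<lambda>n. real (Suc n) * rdist (y n) (z n)) \<longlonglongrightarrow> 0"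
proof -
  let ?c = "chart_at M x"
  obtain \<rho> C where \<rho>: "\<rho> > 0" "C > 0" "\<And>p q. rdist x p < \<rho> \<Longrightarrow> rdist x q < \<rho> \<Longrightarrow> rdist p q \<le>
    C * norm (snd ?c p - snd ?c q)"
    using local_chart[OF chart_at, of x] by blast
  have "(\<lambda>n. real (Suc n) *\<^sub>R (snd ?c (y n) - snd ?c x) - real (Suc n) *\<^sub>R (snd ?c (z n) - snd ?c x)) \<longlonglongrightarrow> u - u"
    using y z by (intro tendsto_diff) (auto simp: tang_def)
  then have "(\<lambda>n. real (Suc n) *\<^sub>R (snd ?c (y n) - snd ?c (z n))) \<longlonglongrightarrow> 0"
    by (simp only: scaleR_diff_right[symmetric]) simp
  then have lim: "(\<lambda>n. C * norm (real (Suc n) *\<^sub>R (snd ?c (y n) - snd ?c (z n)))) \<longlonglongrightarrow> 0"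
    by (intro tendsto_mult_right_zero tendsto_norm_zero)
  have "(\<lambda>n. rdist x (y n)) \<longlonglongrightarrow> 0" "(\<lambda>n. rdist x (z n)) \<longlonglongrightarrow> 0"
    using y z by (simp_all add: tang_def flip: tendsto_rdist_iff)
  then have "\<forall>\<^sub>F n in sequentially. rdist x (y n) < \<rho> \<and> rdist x (z n) < \<rho>"
    using \<rho>(1) by (intro eventually_conj order_tendstoD(2)) auto
  then have "\<forall>\<^sub>F n in sequentially. norm (real (Suc n) * rdist (y n) (z n)) \<le>
    C * norm (real (Suc n) *\<^sub>R (snd ?c (y n) - snd ?c (z n)))"
  proof eventually_elim
    case (elim n)
    have "real (Suc n) * rdist (y n) (z n) \<le> real (Suc n) * (C * norm (snd ?c (y n) - snd ?c (z n)))"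
      using \<rho>(3)[of "y n" "z n"] elim by (intro mult_left_mono) auto
    then show ?case by (simp add: mult_ac)
  qed
  then show ?thesis by (rule Lim_null_comparison[OF _ lim])
qed

text \<open>The points are O(1/n) apart, so by \<open>local_chart\<close> the geodesic misses the
  coordinate chord only by O(1/n^2). Interpolating points therefore interpolates their tangent
  vectors, which makes tangent cones and directional derivatives convex.\<close>

lemma tang_geod:
  assumes y: "tang x y u" and z: "tang x z v" and s: "s \<in> {0..1}"
  shows "tang x (\<lambda>n. geod M (y n) (z n) s) ((1 - s) *\<^sub>R u + s *\<^sub>R v)"
  unfolding tang_def
proof
  let ?c = "chart_at M x"
  obtain \<rho> C where \<rho>: "\<rho> > 0" "C > 0" "\<And>p q. rdist x p < \<rho> \<Longrightarrow> rdist x q < \<rho> \<Longrightarrow>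
      norm (snd ?c (geod M p q s) - ((1 - s) *\<^sub>R snd ?c p + s *\<^sub>R snd ?c q)) \<le>
        C * (norm (snd ?c p - snd ?c q))\<^sup>2"
    using local_chart[OF chart_at, of x] s by blast
  have lim: "y \<longlonglongrightarrow> x" "z \<longlonglongrightarrow> x" using y z by (auto simp: tang_def)
  have "(\<lambda>n. geod M (y n) (z n) s) \<longlonglongrightarrow> geod M x x s"
    by (rule geod_tendsto[OF lim tendsto_const s s])
  moreover have "geod M x x s = x" using rdist_geod[OF s, of x x] by (simp add: rdist_eq_0)
  ultimately show "(\<lambda>n. geod M (y n) (z n) s) \<longlonglongrightarrow> x" by simp
  define a where "a = (\<lambda>n. real (Suc n) *\<^sub>R (snd ?c (y n) - snd ?c x))"
  define b where "b = (\<lambda>n. real (Suc n) *\<^sub>R (snd ?c (z n) - snd ?c x))"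
  have ab: "a \<longlonglongrightarrow> u" "b \<longlonglongrightarrow> v" using y z by (auto simp: tang_def a_def b_def)
  have "isCont (snd ?c) x"
    using continuous_on_chart[OF chart_at(1)] open_chart[OF chart_at(1)] chart_at(2)[of x]
    by (auto simp: continuous_on_eq_continuous_at)
  then have "(\<lambda>n. snd ?c (y n)) \<longlonglongrightarrow> snd ?c x" "(\<lambda>n. snd ?c (z n)) \<longlonglongrightarrow> snd ?c x"
    using lim isCont_tendsto_compose by blast+
  then have "(\<lambda>n. C * norm (a n - b n) * norm (snd ?c (y n) - snd ?c (z n))) \<longlonglongrightarrow>
    C * norm (u - v) * norm (snd ?c x - snd ?c x)"
    by (intro tendsto_intros ab)
  then have lim0: "(\<lambda>n. C * norm (a n - b n) * norm (snd ?c (y n) - snd ?c (z n))) \<longlonglongrightarrow> 0" by simp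
  define e where "e = (\<lambda>n. real (Suc n) *\<^sub>R (snd ?c (geod M (y n) (z n) s) - ((1 - s) *\<^sub>R snd ?c (y n) + s
    *\<^sub>R snd ?c (z n))))"
  have "(\<lambda>n. rdist x (y n)) \<longlonglongrightarrow> 0" "(\<lambda>n. rdist x (z n)) \<longlonglongrightarrow> 0"
    using lim by (simp_all flip: tendsto_rdist_iff)
  then have "\<forall>\<^sub>F n in sequentially. rdist x (y n) < \<rho> \<and> rdist x (z n) < \<rho>"
    using \<rho>(1) by (intro eventually_conj order_tendstoD(2)) auto
  then have "\<forall>\<^sub>F n in sequentially. norm (e n) \<le> C * norm (a n - b n) * norm (snd ?c (y n) - snd ?c (z n))"
  proof eventually_elim
    case (elim n)
    have "norm (e n) \<le> real (Suc n) * (C * (norm (snd ?c (y n) - snd ?c (z n)))\<^sup>2)"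
      unfolding e_def norm_scaleR using \<rho>(3)[of "y n" "z n"] elim
          by (simp add: mult_left_mono del: of_nat_Suc)
    moreover have "a n - b n = real (Suc n) *\<^sub>R (snd ?c (y n) - snd ?c (z n))"
      by (simp add: a_def b_def algebra_simps)
    then have "norm (a n - b n) = real (Suc n) * norm (snd ?c (y n) - snd ?c (z n))" by simp
    ultimately show ?case by (simp add: power2_eq_square mult_ac)
  qed
  then have "e \<longlonglongrightarrow> 0" by (rule Lim_null_comparison[OF _ lim0])
  then have "(\<lambda>n. e n + ((1 - s) *\<^sub>R a n + s *\<^sub>R b n)) \<longlonglongrightarrow> 0 + ((1 - s) *\<^sub>R u + s *\<^sub>R v)"
    by (intro tendsto_intros ab)
  moreover have "e n + ((1 - s) *\<^sub>R a n + s *\<^sub>R b n) = real (Suc n) *\<^sub>R (snd ?c (geod M (y n) (z n) s) - snd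
    ?c x)" for n
    unfolding e_def a_def b_def by (simp add: algebra_simps del: of_nat_Suc)
  ultimately show "(\<lambda>n. real (Suc n) *\<^sub>R (snd ?c (geod M (y n) (z n) s) - snd ?c x)) \<longlonglongrightarrow>
    (1 - s) *\<^sub>R u + s *\<^sub>R v" by simp
qed

text \<open>Links the expansion in a chart with logarithms: comparison with the ray of velocity
  \<open>u\<close> leaves an error that \<open>lg_contract\<close> and \<open>tang_rdist\<close>
  control.\<close>

lemma tang_lg:
  assumes y: "tang x y u"
  shows "(\<lambda>n. real (Suc n) *\<^sub>R lg x (y n)) \<longlonglongrightarrow> u"
proof -
  obtain C where C: "C > 0" "\<And>v. norm v \<le> C * nrm x v" using nrm_equiv[of x] by blast
  let ?z = "\<lambda>n. ex x ((1 / real (Suc n)) *\<^sub>R u)"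
  have lim: "(\<lambda>n. C * (real (Suc n) * rdist (?z n) (y n))) \<longlonglongrightarrow> 0"
    by (intro tendsto_mult_right_zero tang_rdist[OF tang_ex y])
  have "(\<lambda>n. real (Suc n) *\<^sub>R lg x (y n) - u) \<longlonglongrightarrow> 0"
  proof (rule Lim_null_comparison[OF _ lim], intro always_eventually allI)
    fix n
    have "real (Suc n) *\<^sub>R lg x (y n) - u = real (Suc n) *\<^sub>R (lg x (y n) - lg x (?z n))"
      by (simp add: scaleR_diff_right del: of_nat_Suc)
    then have "norm (real (Suc n) *\<^sub>R lg x (y n) - u) = real (Suc n) * norm (lg x (y n) - lg x (?z n))"
      by (simp only: norm_scaleR abs_of_nat)
    also have "norm (lg x (y n) - lg x (?z n)) \<le> C * rdist (?z n) (y n)"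
      by (rule order_trans[OF C(2) mult_left_mono[OF lg_contract]]) (use C(1) in simp)
    finally show "norm (real (Suc n) *\<^sub>R lg x (y n) - u) \<le> C * (real (Suc n) * rdist (?z n) (y n))"
      by (simp add: mult_ac)
  qed
  then show ?thesis by (simp only: LIM_zero_iff)
qed

lemma tang_geod_initial: "tang x (\<lambda>n. geod M x y (1 / real (Suc n))) (lg x y)"
proof -
  have "geod M x y (1 / real (Suc n)) = ex x ((1 / real (Suc n)) *\<^sub>R lg x y)" for n
    by (simp add: geod_geo ex_scale)
  then show ?thesis using tang_ex[of x "lg x y"] by simp
qed

end

locale hadamard_convex = hadamard_space M for M :: "('m::{t2_space,second_countable_topology},
  'e::euclidean_space) riemannian" +
  fixes f :: "'m \<Rightarrow> ereal"
  assumes convex_fun: "geod_convex_fun M f"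
begin

section \<open>Directional derivatives and subgradients\<close>

definition F :: "'m \<Rightarrow> real" where "F x = real_of_ereal (f x)"

lemma f_eq: "x \<in> eff_dom f \<Longrightarrow> f x = ereal (F x)"
  using convex_fun unfolding geod_convex_fun_def eff_dom_def F_def by (cases "f x") auto

lemma F_convex:
  assumes p: "p \<in> eff_dom f" "q \<in> eff_dom f" and s: "s \<in> {0..1}"
  shows "geod M p q s \<in> eff_dom f" "F (geod M p q s) \<le> (1 - s) * F p + s * F q"
proof -
  show m: "geod M p q s \<in> eff_dom f"
    using convex_fun p s unfolding geod_convex_fun_def geod_convex_def by blast
  consider "s = 0" | "s = 1" | "s \<in> {0<..<1}" using s by fastforce
  then show "F (geod M p q s) \<le> (1 - s) * F p + s * F q"
  proof cases
    case 3
    then have "f (geod M p q s) \<le> ereal (1 - s) * f p + ereal s * f q"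
      using convex_fun p unfolding geod_convex_fun_def by blast
    then show ?thesis by (simp add: f_eq p m)
  qed simp_all
qed

lemma F_locally_Lipschitz:
  assumes "x \<in> interior (eff_dom f)"
  shows "\<exists>\<rho>>0. \<exists>L\<ge>0. \<forall>y z. rdist x y < \<rho> \<longrightarrow> rdist x z < \<rho> \<longrightarrow> y \<in> eff_dom f \<and> \<bar>F y - F z\<bar> \<le> L * rdist y z"
proof -
  have "\<exists>\<rho>>0. \<exists>L\<ge>0. \<forall>y z. rdist x y < \<rho> \<longrightarrow> rdist x z < \<rho> \<longrightarrow> y \<in> interior (eff_dom f) \<and> \<bar>F y - F z\<bar> \<le>
    L * rdist y z"
    by (rule convex_locally_Lipschitz[OF open_interior assms])
      (intro F_convex(2) subsetD[OF interior_subset[of "eff_dom f"]])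
  then show ?thesis using interior_subset[of "eff_dom f"] by (meson subsetD)
qed

lemma F_tendsto:
  assumes "x \<in> interior (eff_dom f)" "y \<longlonglongrightarrow> x"
  shows "(\<lambda>n. F (y n)) \<longlonglongrightarrow> F x"
proof -
  obtain \<rho> L where \<rho>: "\<rho> > 0" "\<And>y z. rdist x y < \<rho> \<Longrightarrow> rdist x z < \<rho> \<Longrightarrow> \<bar>F y - F z\<bar> \<le> L * rdist y z"
    using F_locally_Lipschitz[OF assms(1)] by blast
  have lim: "(\<lambda>n. rdist x (y n)) \<longlonglongrightarrow> 0" using assms(2) by (simp add: tendsto_rdist_iff)
  have "(\<lambda>n. F (y n) - F x) \<longlonglongrightarrow> 0"
  proof (rule Lim_null_comparison)
    show "\<forall>\<^sub>F n in sequentially. norm (F (y n) - F x) \<le> L * rdist x (y n)"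
      using order_tendstoD(2)[OF lim \<rho>(1)]
    proof eventually_elim
      case (elim n)
      then show ?case using \<rho>(2)[of "y n" x] \<rho>(1) by (simp add: rdist_sym[of _ x])
    qed
    show "(\<lambda>n. L * rdist x (y n)) \<longlonglongrightarrow> 0" by (intro tendsto_mult_right_zero lim)
  qed
  then show ?thesis by (simp only: LIM_zero_iff)
qed

text \<open>Along a ray the difference quotients are monotone by convexity and bounded below by the
  Lipschitz constant, so the limit exists and is finite. The Lipschitz property then transfers it to
  every sequence with tangent vector \<open>u\<close>.\<close>

lemma dir_deriv_real:
  assumes x: "x \<in> interior (eff_dom f)"
  shows "\<exists>l. dir_deriv M f x u = ereal l \<and> (\<forall>y. tang x y u \<longrightarrow> (\<lambda>n. real (Suc n) * (F (y n) - F x)) \<longlonglongrightarrow> l)"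
proof -
  obtain \<rho> L where \<rho>: "\<rho> > 0" "L \<ge> 0" "\<And>y z. rdist x y < \<rho> \<Longrightarrow> rdist x z < \<rho> \<Longrightarrow> y \<in> eff_dom f \<and> \<bar>F y - F z\<bar> \<le>
    L * rdist y z"
    using F_locally_Lipschitz[OF x] by blast
  have xd: "x \<in> eff_dom f" using x interior_subset by blast
  define \<phi> where "\<phi> = (\<lambda>t. (F (ex x (t *\<^sub>R u)) - F x) / t)"
  \<comment> \<open>Up to this time the ray stays in the ball where \<open>F\<close> is Lipschitz;
    the added 1 covers \<open>u = 0\<close>.\<close>
  define \<tau> where "\<tau> = \<rho> / (nrm x u + 1)"
  have \<tau>: "\<tau> > 0" using \<rho>(1) by (simp add: \<tau>_def add_nonneg_pos)
  have near: "rdist x (ex x (t *\<^sub>R u)) < \<rho>" "rdist x (ex x (t *\<^sub>R u)) = t * nrm x u" if "0 < t" "t < \<tau>" for t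
  proof -
    show eq: "rdist x (ex x (t *\<^sub>R u)) = t * nrm x u" using that by (simp add: rdist_def nrm_scale)
    have "t * nrm x u \<le> t * (nrm x u + 1)" using that by (intro mult_left_mono) auto
    also have "\<dots> < \<rho>" using that by (simp add: \<tau>_def pos_less_divide_eq add_nonneg_pos)
    finally show "rdist x (ex x (t *\<^sub>R u)) < \<rho>" by (simp add: eq)
  qed
  have mono: "\<phi> s \<le> \<phi> t" if st: "0 < s" "s \<le> t" "t < \<tau>" for s t
  proof -
    have sub: "geod M x (ex x (t *\<^sub>R u)) (s / t) = ex x (s *\<^sub>R u)"
      using st by (simp add: geod_geo ex_scale[symmetric])
    have "F (ex x (s *\<^sub>R u)) \<le> (1 - s / t) * F x + s / t * F (ex x (t *\<^sub>R u))"
      using F_convex(2)[OF xd, of "ex x (t *\<^sub>R u)" "s / t"] \<rho>(3)[OF near(1)[of t] near(1)[of t]] st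
          by (simp add: sub)
    then have "F (ex x (s *\<^sub>R u)) - F x \<le> s * \<phi> t" by (simp add: \<phi>_def algebra_simps diff_divide_distrib)
    then show ?thesis using st by (simp add: \<phi>_def pos_divide_le_eq mult.commute)
  qed
  have bd: "- (L * nrm x u) \<le> \<phi> t" if t: "0 < t" "t < \<tau>" for t
  proof -
    have "\<bar>F (ex x (t *\<^sub>R u)) - F x\<bar> \<le> L * rdist (ex x (t *\<^sub>R u)) x"
      using \<rho> near(1)[OF t] by simp
    then have "- (L * nrm x u) * t \<le> F (ex x (t *\<^sub>R u)) - F x"
      using near(2)[OF t] by (simp add: rdist_sym[of _ x] abs_le_iff algebra_simps)
    then show ?thesis using t by (simp add: \<phi>_def pos_le_divide_eq)
  qed
  define l where "l = Inf (\<phi> ` {0<..<\<tau>})"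
  have bdd: "bdd_below (\<phi> ` {0<..<\<tau>})" using bd by (intro bdd_belowI[of _ "- (L * nrm x u)"]) auto
  have ne: "\<phi> ` {0<..<\<tau>} \<noteq> {}" using \<tau> by simp
  have lim: "(\<phi> \<longlongrightarrow> l) (at_right 0)"
  proof (rule order_tendstoI)
    fix a assume "a < l"
    then show "\<forall>\<^sub>F t in at_right 0. a < \<phi> t"
      unfolding eventually_at_right_field using \<tau> cInf_lower[OF _ bdd]
          by (intro exI[of _ \<tau>]) (force simp: l_def)
  next
    fix a assume "l < a"
    then obtain t where t: "0 < t" "t < \<tau>" "\<phi> t < a" using cInf_less_iff[OF ne bdd] by (auto simp: l_def)
    then show "\<forall>\<^sub>F t in at_right 0. \<phi> t < a"
      unfolding eventually_at_right_field using mono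
          by (intro exI[of _ t]) (meson less_imp_le order_le_less_trans)
  qed
  have "((\<lambda>t. ereal (\<phi> t)) \<longlongrightarrow> ereal l) (at_right 0)" using lim by simp
  then have "((\<lambda>t. (f (ex x (t *\<^sub>R u)) - f x) / ereal t) \<longlongrightarrow> ereal l) (at_right 0)"
  proof (rule Lim_transform_eventually)
    have "ereal (\<phi> t) = (f (ex x (t *\<^sub>R u)) - f x) / ereal t" if t: "0 < t" "t < \<tau>" for t
      using \<rho>(3)[OF near(1)[OF t] near(1)[OF t]] t by (simp add: f_eq xd \<phi>_def)
    then show "\<forall>\<^sub>F t in at_right 0. ereal (\<phi> t) = (f (ex x (t *\<^sub>R u)) - f x) / ereal t"
      unfolding eventually_at_right_field using \<tau> by blast
  qed
  then have dd: "dir_deriv M f x u = ereal l"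
    unfolding dir_deriv_def by (intro tendsto_Lim) simp_all
  have "(\<lambda>n. real (Suc n) * (F (y n) - F x)) \<longlonglongrightarrow> l" if y: "tang x y u" for y
  proof -
    let ?z = "\<lambda>n. ex x ((1 / real (Suc n)) *\<^sub>R u)"
    have "filterlim (\<lambda>n. 1 / real (Suc n)) (at_right 0) sequentially"
      using LIMSEQ_inverse_real_of_nat by (auto simp: filterlim_at inverse_eq_divide)
    from filterlim_compose[OF lim this] have 1: "(\<lambda>n. \<phi> (1 / real (Suc n))) \<longlonglongrightarrow> l" .
    have lim0: "(\<lambda>n. L * (real (Suc n) * rdist (y n) (?z n))) \<longlonglongrightarrow> 0"
      by (intro tendsto_mult_right_zero tang_rdist[OF y tang_ex])
    have "(\<lambda>n. rdist x (y n)) \<longlonglongrightarrow> 0" "(\<lambda>n. rdist x (?z n)) \<longlonglongrightarrow> 0"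
      using y tang_ex[of x u] by (simp_all add: tang_def flip: tendsto_rdist_iff)
    then have "\<forall>\<^sub>F n in sequentially. rdist x (y n) < \<rho> \<and> rdist x (?z n) < \<rho>"
      using \<rho>(1) by (intro eventually_conj order_tendstoD(2)) auto
    then have "\<forall>\<^sub>F n in sequentially. norm (real (Suc n) * (F (y n) - F (?z n))) \<le>
      L * (real (Suc n) * rdist (y n) (?z n))"
    proof eventually_elim
      case (elim n)
      have "real (Suc n) * \<bar>F (y n) - F (?z n)\<bar> \<le> real (Suc n) * (L * rdist (y n) (?z n))"
        using \<rho>(3)[of "y n" "?z n"] elim by (intro mult_left_mono) auto
      then show ?case by (simp add: abs_mult mult_ac)
    qed
    then have "(\<lambda>n. real (Suc n) * (F (y n) - F (?z n))) \<longlonglongrightarrow> 0" by (rule Lim_null_comparison[OF _ lim0])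
    from tendsto_add[OF this 1] show ?thesis by (simp add: \<phi>_def algebra_simps)
  qed
  then show ?thesis using dd by blast
qed

definition dd :: "'m \<Rightarrow> 'e \<Rightarrow> real" where "dd x u = real_of_ereal (dir_deriv M f x u)"

lemma dd:
  assumes "x \<in> interior (eff_dom f)"
  shows "dir_deriv M f x u = ereal (dd x u)"
    and "tang x y u \<Longrightarrow> (\<lambda>n. real (Suc n) * (F (y n) - F x)) \<longlonglongrightarrow> dd x u"
  using dir_deriv_real[OF assms, of u] by (auto simp: dd_def)

text \<open>Points on the two rays are joined by geodesics, along which \<open>F\<close> is convex.
  By \<open>tang_geod\<close> the intermediate points have the interpolated tangent vector, and the
  inequality passes to the limit.\<close>

lemma dd_convex:
  assumes x: "x \<in> interior (eff_dom f)" and s: "s \<in> {0..1}"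
  shows "dd x ((1 - s) *\<^sub>R u + s *\<^sub>R v) \<le> (1 - s) * dd x u + s * dd x v"
proof -
  let ?y = "\<lambda>n. ex x ((1 / real (Suc n)) *\<^sub>R u)" and ?z = "\<lambda>n. ex x ((1 / real (Suc n)) *\<^sub>R v)"
  have ty: "?y \<longlonglongrightarrow> x" and tz: "?z \<longlonglongrightarrow> x" using tang_ex[of x] by (auto simp: tang_def)
  show ?thesis
  proof (rule tendsto_le[OF sequentially_bot])
    show "(\<lambda>n. (1 - s) * (real (Suc n) * (F (?y n) - F x)) + s * (real (Suc n) * (F (?z n) - F x))) \<longlonglongrightarrow>
      (1 - s) * dd x u + s * dd x v"
      by (intro tendsto_intros dd(2)[OF x] tang_ex)
    show "(\<lambda>n. real (Suc n) * (F (geod M (?y n) (?z n) s) - F x)) \<longlonglongrightarrow> dd x ((1 - s) *\<^sub>R u + s *\<^sub>R v)"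
      by (intro dd(2)[OF x] tang_geod tang_ex s)
    have "\<forall>\<^sub>F n in sequentially. ?y n \<in> interior (eff_dom f) \<and> ?z n \<in> interior (eff_dom f)"
      by (intro eventually_conj topological_tendstoD[OF ty] topological_tendstoD[OF tz] x open_interior)
    then show "\<forall>\<^sub>F n in sequentially. real (Suc n) * (F (geod M (?y n) (?z n) s) - F x)
      \<le> (1 - s) * (real (Suc n) * (F (?y n) - F x)) + s * (real (Suc n) * (F (?z n) - F x))"
    proof eventually_elim
      case (elim n)
      then have "F (geod M (?y n) (?z n) s) \<le> (1 - s) * F (?y n) + s * F (?z n)"
        using interior_subset s by (intro F_convex(2)) blast+
      then have "F (geod M (?y n) (?z n) s) - F x \<le> (1 - s) * (F (?y n) - F x) + s * (F (?z n) - F x)"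
        by (simp add: algebra_simps)
      then have "real (Suc n) * (F (geod M (?y n) (?z n) s) - F x) \<le>
        real (Suc n) * ((1 - s) * (F (?y n) - F x) + s * (F (?z n) - F x))"
        by (intro mult_left_mono) auto
      also have "\<dots> = (1 - s) * (real (Suc n) * (F (?y n) - F x)) + s * (real (Suc n) * (F (?z n) - F x))"
        by (simp only: ring_distribs mult_ac)
      finally show ?case .
    qed
  qed
qed

text \<open>The inequality with the difference of values is replaced by one with a single
  subgradient valid for all \<open>y\<close> at once. Passing to the limit, the field term plus the
  directional derivative is nonnegative on the tangent cone of \<open>Q\<close>, and the sandwich
  functional represents \<open>W + v\<close>.\<close>

lemma subgradient_exists:
  assumes x: "x \<in> interior (eff_dom f)" "x \<in> Q" and Q: "geod_convex M Q"
    and VI: "\<And>y. y \<in> Q \<Longrightarrow> 0 \<le> metric M x W (lg x y) + F y - F x"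
  shows "\<exists>v\<in>subdiff M f x. \<forall>y\<in>Q. 0 \<le> metric M x (W + v) (lg x y)"
proof -
  note b = metric_bilinear[of x]
  define p where "p = (\<lambda>u. metric M x W u + dd x u)"
  \<comment> \<open>Tangent directions of \<open>Q\<close> at \<open>x\<close>, given by sequences
    inside \<open>Q\<close>. Initial velocities of geodesics into \<open>Q\<close> are among them;
    allowing all sequences makes the set visibly convex.\<close>
  define K where "K = {u. \<exists>y. (\<forall>n. y n \<in> Q) \<and> tang x y u}"
  have tx: "tang x (\<lambda>_. x) 0" using tang_ex[of x 0] by simp
  have "(\<lambda>n. real (Suc n) * (F x - F x)) \<longlonglongrightarrow> dd x 0" by (rule dd(2)[OF x(1) tx])
  then have d0: "dd x 0 = 0" using LIMSEQ_unique by (simp add: LIMSEQ_const_iff)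
  have "\<exists>l. linear l \<and> (\<forall>u. l u \<le> p u) \<and> (\<forall>u\<in>K. 0 \<le> l u)"
  proof (rule convex_cone_sandwich)
    show "p ((1 - s) *\<^sub>R u + s *\<^sub>R v) \<le> (1 - s) * p u + s * p v" if "s \<in> {0..1}" for u v s
      using dd_convex[OF x(1) that, of u v]
      by (simp add: p_def bilinear_radd[OF b] bilinear_rmul[OF b] ring_distribs)
    show "p 0 = 0" by (simp add: p_def d0 bilinear_rzero[OF b])
    show "convex K" unfolding convex_alt
    proof (intro ballI allI impI)
      fix u v s assume u: "u \<in> K" "v \<in> K" and s: "0 \<le> s \<and> s \<le> (1::real)"
      then obtain y z where yz: "\<forall>n. y n \<in> Q" "tang x y u" "\<forall>n. z n \<in> Q" "tang x z v" unfolding K_def by blast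
      have m: "geod M (y n) (z n) s \<in> Q" for n using Q yz s unfolding geod_convex_def
        by (auto simp: image_subset_iff)
      have "tang x (\<lambda>n. geod M (y n) (z n) s) ((1 - s) *\<^sub>R u + s *\<^sub>R v)" using yz s by (intro tang_geod) auto
      then show "(1 - s) *\<^sub>R u + s *\<^sub>R v \<in> K" unfolding K_def
        using m by (intro CollectI exI[of _ "\<lambda>n. geod M (y n) (z n) s"] conjI allI)
    qed
    show "0 \<in> K" using tx x(2) unfolding K_def by (intro CollectI exI[of _ "\<lambda>_. x"]) simp
    show "0 \<le> p u" if uK: "u \<in> K" for u
    proof -
      obtain y where y: "\<forall>n. y n \<in> Q" "tang x y u" using uK unfolding K_def by blast
      have "(\<lambda>n. metric M x W (real (Suc n) *\<^sub>R lg x (y n)) + real (Suc n) * (F (y n) - F x)) \<longlonglongrightarrow> p u"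
        unfolding p_def by (intro tendsto_add tendsto_bilinear[OF b] tendsto_const tang_lg[OF y(2)] dd(2)[OF
            x(1) y(2)])
      moreover have "0 \<le> metric M x W (real (Suc n) *\<^sub>R lg x (y n)) + real (Suc n) * (F (y n) - F x)" for n
      proof -
        have "0 \<le> real (Suc n) * (metric M x W (lg x (y n)) + F (y n) - F x)"
          using VI y(1) by (intro mult_nonneg_nonneg) auto
        then show ?thesis by (simp add: bilinear_rmul[OF b] algebra_simps del: of_nat_Suc)
      qed
      ultimately show ?thesis by (intro LIMSEQ_le_const) auto
    qed
  qed
  then obtain l where l: "linear l" "\<And>u. l u \<le> p u" "\<And>u. u \<in> K \<Longrightarrow> 0 \<le> l u" by blast
  obtain w where w: "\<And>u. metric M x w u = l u"
    using posdef_bilinear_riesz[OF b metric_pos l(1)] by blast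
  have "w - W \<in> subdiff M f x"
    unfolding subdiff_def
  proof (intro CollectI allI)
    fix u
    have "metric M x (w - W) u \<le> dd x u" using l(2)[of u] by (simp add: p_def bilinear_lsub[OF b] w)
    then show "ereal (metric M x (w - W) u) \<le> dir_deriv M f x u" by (simp add: dd(1)[OF x(1)])
  qed
  moreover have "0 \<le> metric M x (W + (w - W)) (lg x y)" if y: "y \<in> Q" for y
  proof -
    have "geod M x y (1 / real (Suc n)) \<in> Q" for n
      using Q x(2) y unfolding geod_convex_def by (auto simp: image_subset_iff)
    then have "lg x y \<in> K" using tang_geod_initial[of x y] unfolding K_def
      by (intro CollectI exI[of _ "\<lambda>n. geod M x y (1 / real (Suc n))"]) simp
    then show ?thesis using l(3) by (simp add: w)
  qed
  ultimately show ?thesis by blast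
qed

section \<open>Existence and convexity of solutions\<close>

text \<open>The vector \<open>- lg w z\<close> is the gradient at \<open>w\<close> of half the
  squared distance to \<open>z\<close>, so the regularization joins \<open>F\<close> in the convex
  function \<phi> while \<open>V\<close> enters through the moving target. Part (i) takes
  \<open>k = 0\<close>, part (ii) takes \<open>k = 1\<close>.\<close>

lemma VI_exists:
  assumes Q: "compact Q" "geod_convex M Q" "Q \<noteq> {}" "Q \<subseteq> interior (eff_dom f)"
    and V: "continuous_vector_field_on M Q V" and k: "0 \<le> k"
  shows "\<exists>w\<in>Q. \<forall>y\<in>Q. 0 \<le> metric M w (V w - k *\<^sub>R lg w z) (lg w y) + F y - F w"
proof -
  define \<phi> where "\<phi> = (\<lambda>y. F y + k / 2 * (rdist y z)\<^sup>2)"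
  have Qd: "Q \<subseteq> eff_dom f" using Q(4) interior_subset by blast
  have conv: "\<phi> (geod M p q t) \<le> (1 - t) * \<phi> p + t * \<phi> q" if "p \<in> Q" "q \<in> Q" "t \<in> {0<..<1}" for p q t
  proof -
    have t: "t \<in> {0..1}" using that by auto
    have "(rdist (geod M p q t) z)\<^sup>2 + 0 \<le> (rdist (geod M p q t) z)\<^sup>2 + t * (1 - t) * (rdist p q)\<^sup>2"
      using t by (intro add_left_mono) auto
    also have "\<dots> \<le> (1 - t) * (rdist p z)\<^sup>2 + t * (rdist q z)\<^sup>2"
      using CN_inequality[OF t, of z p q] by (simp add: rdist_sym[of z])
    finally have "k / 2 * (rdist (geod M p q t) z)\<^sup>2 \<le> k / 2 * ((1 - t) * (rdist p z)\<^sup>2 + t * (rdist q z)\<^sup>2)"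
      using k by (intro mult_left_mono) auto
    moreover have "F (geod M p q t) \<le> (1 - t) * F p + t * F q"
      using F_convex(2)[OF _ _ t] that Qd by blast
    ultimately show ?thesis unfolding \<phi>_def ring_distribs by (simp add: mult_ac)
  qed
  have cF: "continuous_on Q \<phi>"
    unfolding \<phi>_def
  proof (rule continuous_on_sequentiallyI)
    fix u a assume "\<forall>n. u n \<in> Q" "a \<in> Q" "u \<longlonglongrightarrow> a"
    then show "(\<lambda>n. F (u n) + k / 2 * (rdist (u n) z)\<^sup>2) \<longlonglongrightarrow> F a + k / 2 * (rdist a z)\<^sup>2"
      using Q(4) by (intro tendsto_intros F_tendsto rdist_tendsto) auto
  qed
  obtain T where T: "\<And>z. T z \<in> Q" "\<And>z w. w \<in> Q \<Longrightarrow> \<phi> (T z) + (rdist (T z) z)\<^sup>2 / 2 \<le>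
    \<phi> w + (rdist w z)\<^sup>2 / 2" "continuous_on UNIV T"
    using proximal_map[OF Q(2,1,3) conv cF] by blast
  have "continuous_on Q (\<lambda>w. ex w (- V w))"
  proof (rule continuous_on_sequentiallyI)
    fix u a assume u: "\<forall>n. u n \<in> Q" and a: "a \<in> Q" and lim: "u \<longlonglongrightarrow> a"
    define c where "c = chart_at M a"
    have c: "c \<in> atlas M" "a \<in> fst c" by (simp_all add: c_def chart_at)
    have ev: "\<forall>\<^sub>F n in sequentially. u n \<in> fst c"
      using topological_tendstoD[OF lim open_chart[OF c(1)] c(2)] .
    have "continuous_on (Q \<inter> fst c) (\<lambda>x. to_chart M c x (V x))" using V c(1)
      by (simp add: continuous_vector_field_on_def)
    then have "(\<lambda>n. to_chart M c (u n) (V (u n))) \<longlonglongrightarrow> to_chart M c a (V a)"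
      by (rule continuous_on_tendsto_compose[OF _ lim]) (use a c u ev in \<open>auto elim: eventually_mono\<close>)
    then have "(\<lambda>n. - to_chart M c (u n) (V (u n))) \<longlonglongrightarrow> - to_chart M c a (V a)" by (rule tendsto_minus)
    then have "(\<lambda>n. - to_chart M c (u n) (V (u n))) \<longlonglongrightarrow> to_chart M c a (- V a)"
      using linear_neg[OF linear_trd[OF chart_at(1) c(1) chart_at(2) c(2)]] by (simp add: to_chart_trd)
    then have "(\<lambda>n. to_chart M c (u n) (- V (u n))) \<longlonglongrightarrow> to_chart M c a (- V a)"
    proof (rule Lim_transform_eventually)
      show "\<forall>\<^sub>F n in sequentially. - to_chart M c (u n) (V (u n)) = to_chart M c (u n) (- V (u n))"
        using ev by eventually_elim (simp add: to_chart_trd linear_neg[OF linear_trd[OF chart_at(1) c(1)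
            chart_at(2)]])
    qed
    from conv_imp_tendsto[OF conv_geo[OF c lim this, of 1]]
    show "(\<lambda>n. ex (u n) (- V (u n))) \<longlonglongrightarrow> ex a (- V a)" by (simp add: ex_geo)
  qed
  then have "continuous_on Q (\<lambda>w. T (ex w (- V w)))"
    by (rule continuous_on_compose2[OF T(3)]) simp
  then obtain w where w: "w \<in> Q" "T (ex w (- V w)) = w"
    using fixed_point[OF Q(2,1,3), of "\<lambda>w. T (ex w (- V w))"] T(1) by blast
  \<comment> \<open>At the fixed point, \<open>w\<close> minimizes \<phi> plus half the squared
    distance to \<open>a\<close>; the gradient of the latter at \<open>w\<close> is
    \<open>- lg w a\<close>, that is \<open>V w\<close>.\<close>
  define a where "a = ex w (- V w)"
  have la: "lg w a = - V w" by (simp add: a_def)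
  have min: "\<phi> w + (rdist w a)\<^sup>2 / 2 \<le> \<phi> y + (rdist y a)\<^sup>2 / 2" if "y \<in> Q" for y
    using T(2)[OF that, of a] w(2) by (simp add: a_def)
  have "0 \<le> metric M w (V w - k *\<^sub>R lg w z) (lg w y) + F y - F w" if y: "y \<in> Q" for y
  proof -
    let ?s = "\<lambda>n. 1 / real (Suc n)"
    let ?m = "\<lambda>n. geod M w y (?s n)"
    let ?A = "\<lambda>n. metric M (?m n) (geod_velocity M w y (?s n)) (lg (?m n) z)"
    let ?B = "\<lambda>n. metric M (?m n) (geod_velocity M w y (?s n)) (lg (?m n) a)"
    \<comment> \<open>Minimality of \<open>w\<close> is tested at points near \<open>w\<close> on
      the geodesic to \<open>y\<close> and divided by the step. The inner products stand at those
      points until the limit is taken.\<close>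
    have "(\<lambda>n. F y - F w - k * ?A n - ?B n) \<longlonglongrightarrow> F y - F w - k * metric M w (lg w y) (lg w z) - metric M w (lg w
      y) (lg w a)"
      by (intro tendsto_intros first_variation_limit)
    moreover have "0 \<le> F y - F w - k * ?A n - ?B n" for n
    proof -
      have s: "?s n \<in> {0..1}" "?s n > 0" by auto
      have mQ: "?m n \<in> Q" using Q(2) w(1) y s unfolding geod_convex_def by (auto simp: image_subset_iff)
      have 1: "F (?m n) - F w \<le> ?s n * (F y - F w)"
        using F_convex(2)[of w y "?s n"] w(1) y Qd s by (auto simp: algebra_simps)
      have 2: "k / 2 * ((rdist (?m n) z)\<^sup>2 - (rdist w z)\<^sup>2) \<le> k / 2 * (- 2 * ?s n * ?A n)"
        using first_variation[OF s(1)] k by (intro mult_left_mono) auto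
      have 3: "((rdist (?m n) a)\<^sup>2 - (rdist w a)\<^sup>2) / 2 \<le> (- 2 * ?s n * ?B n) / 2"
        using first_variation[OF s(1)] by (intro divide_right_mono) auto
      have "0 \<le> F (?m n) - F w + k / 2 * ((rdist (?m n) z)\<^sup>2 - (rdist w z)\<^sup>2) + ((rdist (?m n) a)\<^sup>2 - (rdist
        w a)\<^sup>2) / 2"
        using min[OF mQ] by (simp add: \<phi>_def algebra_simps diff_divide_distrib)
      also have "\<dots> \<le> ?s n * (F y - F w) + k / 2 * (- 2 * ?s n * ?A n) + (- 2 * ?s n * ?B n) / 2"
        using 1 2 3 by linarith
      also have "\<dots> = ?s n * (F y - F w - k * ?A n - ?B n)" by (simp add: algebra_simps del: of_nat_Suc)
      finally show ?thesis using s(2) by (meson mult_pos_neg not_le)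
    qed
    ultimately have "0 \<le> F y - F w - k * metric M w (lg w y) (lg w z) - metric M w (lg w y) (lg w a)"
      by (intro LIMSEQ_le_const) auto
    then show ?thesis
      by (simp add: la bilinear_lsub[OF metric_bilinear] bilinear_lmul[OF metric_bilinear] bilinear_rneg[OF
          metric_bilinear]
         metric_sym[of w "lg w y"])
  qed
  then show ?thesis using w(1) by blast
qed

lemma MVIP_iff:
  assumes "Q \<subseteq> eff_dom f"
  shows "x \<in> MVIP M V f Q \<longleftrightarrow> x \<in> Q \<and> (\<forall>y\<in>Q. 0 \<le> metric M x (V x) (lg x y) + F y - F x)"
proof -
  have "(0 \<le> ereal (metric M x (V x) (geod_velocity M x y 0)) + f y - f x) \<longleftrightarrow> 0 \<le>
    metric M x (V x) (lg x y) + F y - F x"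
    if "x \<in> Q" "y \<in> Q" for y
    using that assms by (simp add: f_eq subsetD geod_velocity_0 zero_ereal_def del: ereal_less_eq(5))
  then show ?thesis by (auto simp: MVIP_def)
qed

text \<open>Along the geodesic from \<open>x\<close> to \<open>y\<close> the field term is linear
  and \<open>F\<close> is convex, so the inequality at a nearby point of the geodesic, still in the
  ball, implies the one at \<open>y\<close>.\<close>

lemma local_VI_imp_VI:
  assumes Q: "geod_convex M Q" "Q \<subseteq> eff_dom f" and x: "x \<in> Q" "rdist o' x < R"
    and VI: "\<And>y. y \<in> Q \<Longrightarrow> rdist o' y \<le> R \<Longrightarrow> 0 \<le> metric M x W (lg x y) + F y - F x" and y: "y \<in> Q"
  shows "0 \<le> metric M x W (lg x y) + F y - F x"
proof -
  \<comment> \<open>By the triangle inequality this keeps the point within distance \<open>R\<close>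
    of the centre; the added 1 avoids division by 0 when \<open>x = y\<close>.\<close>
  define t where "t = min 1 ((R - rdist o' x) / (rdist x y + 1))"
  have t: "0 < t" "t \<in> {0..1}" "t * rdist x y \<le> R - rdist o' x"
  proof -
    have pos: "rdist x y + 1 > 0" by (simp add: add_nonneg_pos)
    show "0 < t" "t \<in> {0..1}" using x(2) pos by (auto simp: t_def)
    have "t * rdist x y \<le> t * (rdist x y + 1)" using \<open>0 < t\<close> by simp
    also have "\<dots> \<le> R - rdist o' x" using pos by (simp add: t_def pos_le_divide_eq[symmetric])
    finally show "t * rdist x y \<le> R - rdist o' x" .
  qed
  define m where "m = geod M x y t"
  have mQ: "m \<in> Q" using Q(1) x(1) y t(2) unfolding geod_convex_def m_def by blast
  have "rdist o' m \<le> R" using rdist_triangle[of o' m x] rdist_geod[OF t(2), of x y] t(3) by (simp add: m_def)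
  then have "0 \<le> metric M x W (lg x m) + F m - F x" by (rule VI[OF mQ])
  moreover have "F m \<le> (1 - t) * F x + t * F y" unfolding m_def using F_convex(2)[OF _ _ t(2)] Q(2) x(1) y
    by blast
  moreover have "metric M x W (lg x m) = t * metric M x W (lg x y)"
    unfolding m_def lg_geod_fst[OF t(2)] by (simp add: bilinear_rmul[OF metric_bilinear])
  ultimately have "0 \<le> t * (metric M x W (lg x y) + F y - F x)" by (simp add: algebra_simps)
  then show ?thesis using t(1) by (simp add: zero_le_mult_iff)
qed

context
  fixes Q :: "'m set" and V :: "'m \<Rightarrow> 'e"
  assumes Qint: "Q \<subseteq> interior (eff_dom f)" and Qne: "Q \<noteq> {}" and Qcl: "closed Q" and Qconv: "geod_convex M Q"
    and Vcont: "continuous_vector_field_on M Q V"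
begin

lemma Q_dom: "Q \<subseteq> eff_dom f"
  using Qint interior_subset by blast

lemma VI_exists_rball:
  assumes "x \<in> Q" "rdist o' x \<le> R" "0 \<le> k"
  shows "\<exists>w\<in>Q. rdist o' w \<le> R \<and> (\<forall>y\<in>Q. rdist o' y \<le> R \<longrightarrow> 0 \<le>
      metric M w (V w - k *\<^sub>R lg w z) (lg w y) + F y - F w)"
proof -
  let ?Q = "Q \<inter> {y. rdist o' y \<le> R}"
  have "compact ?Q" by (rule closed_Int_compact[OF Qcl compact_rball])
  moreover have "continuous_vector_field_on M ?Q V"
    using Vcont unfolding continuous_vector_field_on_def
        by (meson Int_lower1 Int_mono continuous_on_subset order_refl)
  moreover have "geod_convex M ?Q" by (rule geod_convex_Int[OF Qconv geod_convex_rball])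
  ultimately have "\<exists>w\<in>?Q. \<forall>y\<in>?Q. 0 \<le> metric M w (V w - k *\<^sub>R lg w z) (lg w y) + F y - F w"
    using assms Qint by (intro VI_exists) auto
  then show ?thesis by auto
qed

lemma MVIP_nonempty:
  assumes "compact Q \<or> (\<exists>L. compact L \<and> (\<forall>x\<in>Q - L. \<forall>v\<in>subdiff M f x. \<exists>y\<in>Q \<inter> L.
                 metric M x (V x + v) (geod_velocity M x y 0) < 0))"
  shows "MVIP M V f Q \<noteq> {}"
proof -
  obtain q where q: "q \<in> Q" using Qne by blast
  from assms show ?thesis
  proof
    assume "compact Q"
    then obtain w where "w \<in> Q" "\<forall>y\<in>Q. 0 \<le> metric M w (V w - 0 *\<^sub>R lg w q) (lg w y) + F y - F w"
      using VI_exists[OF _ Qconv Qne Qint Vcont order_refl] by blast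
    then have "w \<in> MVIP M V f Q" unfolding MVIP_iff[OF Q_dom] by simp
    then show ?thesis by blast
  next
    assume "\<exists>L. compact L \<and> (\<forall>x\<in>Q - L. \<forall>v\<in>subdiff M f x. \<exists>y\<in>Q \<inter> L. metric M x (V x + v) (geod_velocity M x y
      0) < 0)"
    then obtain L where L: "compact L" "\<And>x v. x \<in> Q - L \<Longrightarrow> v \<in> subdiff M f x \<Longrightarrow>
      \<exists>y\<in>Q \<inter> L. metric M x (V x + v) (lg x y) < 0"
      unfolding geod_velocity_0 by blast
    have "continuous_on L (rdist q)"
      by (rule continuous_on_sequentiallyI) (rule rdist_tendsto1)
    then have "bounded (rdist q ` L)" using L(1) compact_continuous_image compact_imp_bounded by blast
    then obtain R where R: "R > 0" "\<And>y. y \<in> L \<Longrightarrow> rdist q y \<le> R" by (force simp: bounded_pos)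
    \<comment> \<open>\<open>L\<close> lies within distance \<open>R\<close>, the ball has radius
      \<open>R + 1\<close>. So a solution in \<open>L\<close> is interior to the ball, and all
      points of \<open>Q \<inter> L\<close> supplied by coercivity are admissible for
      comparison.\<close>
    obtain w where w: "w \<in> Q" "rdist q w \<le> R + 1" "\<And>y. y \<in> Q \<Longrightarrow> rdist q y \<le> R + 1 \<Longrightarrow> 0 \<le>
      metric M w (V w - 0 *\<^sub>R lg w q) (lg w y) + F y - F w"
      using VI_exists_rball[OF q, of q "R + 1" 0 q] R(1) by auto
    have "w \<in> L"
    proof (rule ccontr)
      assume wL: "w \<notin> L"
      let ?Q = "Q \<inter> {y. rdist q y \<le> R + 1}"
      have "w \<in> interior (eff_dom f)" using w(1) Qint by blast
      then have "\<exists>v\<in>subdiff M f w. \<forall>y\<in>?Q. 0 \<le> metric M w (V w + v) (lg w y)"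
        by (rule subgradient_exists[OF _ _ geod_convex_Int[OF Qconv geod_convex_rball]]) (use w in auto)
      then obtain v where v: "v \<in> subdiff M f w" "\<And>y. y \<in> ?Q \<Longrightarrow> 0 \<le> metric M w (V w + v) (lg w y)" by blast
      obtain y where y: "y \<in> Q \<inter> L" "metric M w (V w + v) (lg w y) < 0" using L(2)[of w v] w(1) wL v(1)
        by blast
      then have "y \<in> ?Q" using R(2)[of y] by auto
      then show False using v(2) y(2) by fastforce
    qed
    then have "rdist q w < R + 1" using R(2) by fastforce
    then have "0 \<le> metric M w (V w) (lg w y) + F y - F w" if "y \<in> Q" for y
      by (rule local_VI_imp_VI[OF Qconv Q_dom w(1) _ _ that]) (use w(3) in auto)
    then have "w \<in> MVIP M V f Q" unfolding MVIP_iff[OF Q_dom] using w(1) by blast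
    then show ?thesis by blast
  qed
qed

lemma MVIP_convex:
  assumes mono: "monotone_field_on M Q (\<lambda>x. {V x + v | v. v \<in> subdiff M f x})"
  shows "geod_convex M (MVIP M V f Q)"
  unfolding geod_convex_def
proof (intro ballI subsetI)
  fix x1 x2 z assume x1: "x1 \<in> MVIP M V f Q" and x2: "x2 \<in> MVIP M V f Q" and z: "z \<in> geod M x1 x2 ` {0..1}"
  obtain t where t: "t \<in> {0..1}" "z = geod M x1 x2 t" using z by blast
  have xQ: "x1 \<in> Q" "x2 \<in> Q" using x1 x2 by (auto simp: MVIP_def)
  have zQ: "z \<in> Q" using Qconv xQ t unfolding geod_convex_def by blast
  \<comment> \<open>The ball about \<open>z\<close> contains both solutions, so they can be inserted
    for \<open>y\<close>. Its radius is positive, so \<open>z\<close> itself lies strictly inside,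
    as the last step requires.\<close>
  define R where "R = rdist z x1 + rdist z x2 + 1"
  have R: "0 < R" "rdist z x1 \<le> R" "rdist z x2 \<le> R"
    using rdist_nonneg[of z x1] rdist_nonneg[of z x2] by (simp_all add: R_def del: rdist_nonneg)
  obtain w where w: "w \<in> Q" "rdist z w \<le> R" "\<And>y. y \<in> Q \<Longrightarrow> rdist z y \<le> R \<Longrightarrow> 0 \<le>
    metric M w (V w - 1 *\<^sub>R lg w z) (lg w y) + F y - F w"
    using VI_exists_rball[OF zQ, of z R 1 z] R(1) by auto
  let ?Q = "Q \<inter> {y. rdist z y \<le> R}"
  have "w \<in> interior (eff_dom f)" using w(1) Qint by blast
  then have "\<exists>v\<in>subdiff M f w. \<forall>y\<in>?Q. 0 \<le> metric M w (V w - 1 *\<^sub>R lg w z + v) (lg w y)"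
    by (rule subgradient_exists[OF _ _ geod_convex_Int[OF Qconv geod_convex_rball]]) (use w in auto)
  then obtain v where v: "v \<in> subdiff M f w" "\<And>y. y \<in> ?Q \<Longrightarrow> 0 \<le> metric M w (V w - 1 *\<^sub>R lg w z + v) (lg w y)"
    by blast
  have obtuse: "(rdist w z)\<^sup>2 + (rdist w x)\<^sup>2 \<le> (rdist z x)\<^sup>2" if x: "x \<in> MVIP M V f Q" "rdist z x \<le> R" for x
  proof -
    have xQ: "x \<in> Q" using x by (simp add: MVIP_def)
    obtain v' where v': "v' \<in> subdiff M f x" "0 \<le> metric M x (V x + v') (lg x w)"
      using subgradient_exists[of x Q "V x", OF _ xQ Qconv] x(1) xQ w(1) Qint unfolding MVIP_iff[OF Q_dom]
          by blast
    \<comment> \<open>At \<open>x\<close> the sign is known because \<open>x\<close> is a solution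
      with subgradient \<open>v'\<close>; monotonicity passes it on to the other end, where the
      velocity is \<open>- lg w x\<close>.\<close>
    have "metric M x (V x + v') (geod_velocity M x w 0) - metric M w (V w + v) (geod_velocity M x w 1) \<le> 0"
      using mono xQ w(1) v(1) v'(1) unfolding monotone_field_on_def by blast
    then have "metric M w (V w + v) (lg w x) \<le> 0"
      using v'(2) by (simp add: geod_velocity_0 geod_velocity_1 bilinear_rneg[OF metric_bilinear])
    moreover have "0 \<le> metric M w (V w - 1 *\<^sub>R lg w z + v) (lg w x)" using v(2) xQ x(2) by blast
    ultimately have "metric M w (lg w z) (lg w x) \<le> 0"
      by (simp add: bilinear_ladd[OF metric_bilinear] bilinear_lsub[OF metric_bilinear])
    then show ?thesis using cosine_law[of w z x] by linarith
  qed
  \<comment> \<open>After inserting the two obtuse angle inequalities with weights 1 - t and t, the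
    same multiple of \<open>(rdist x1 x2)\<^sup>2\<close> stands on both sides, and
    \<open>2 * (rdist w z)\<^sup>2 \<le> 0\<close> remains.\<close>
  have "(rdist w z)\<^sup>2 + t * (1 - t) * (rdist x1 x2)\<^sup>2 \<le> (1 - t) * (rdist w x1)\<^sup>2 + t * (rdist w x2)\<^sup>2"
    unfolding t(2) by (rule CN_inequality[OF t(1)])
  also have "\<dots> \<le> (1 - t) * ((rdist z x1)\<^sup>2 - (rdist w z)\<^sup>2) + t * ((rdist z x2)\<^sup>2 - (rdist w z)\<^sup>2)"
    using obtuse[OF x1 R(2)] obtuse[OF x2 R(3)] t(1) by (intro add_mono mult_left_mono) auto
  also have "rdist z x1 = t * rdist x1 x2" using rdist_geod[OF t(1), of x1 x2]
    by (simp add: t(2) rdist_sym[of _ x1])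
  also have "rdist z x2 = (1 - t) * rdist x1 x2"
    using rdist_geo[of x1 "lg x1 x2" t 1] t by (simp add: geod_geo rdist_def[of x1] flip: ex_geo)
  also have "(1 - t) * ((t * rdist x1 x2)\<^sup>2 - (rdist w z)\<^sup>2) + t * (((1 - t) * rdist x1 x2)\<^sup>2 - (rdist w
    z)\<^sup>2) =
    t * (1 - t) * (rdist x1 x2)\<^sup>2 - (rdist w z)\<^sup>2" by (simp add: power2_eq_square algebra_simps)
  finally have "(rdist w z)\<^sup>2 \<le> 0" by simp
  then have "w = z" by (simp add: rdist_eq_0)
  \<comment> \<open>For \<open>w = z\<close> the regularizing term is \<open>lg z z = 0\<close>, so
    the inequality for \<open>w\<close> is the original one at \<open>z\<close>, first on the ball
    and then on all of \<open>Q\<close>.\<close>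
  then have "0 \<le> metric M z (V z) (lg z y) + F y - F z" if "y \<in> Q" for y
    by (intro local_VI_imp_VI[OF Qconv Q_dom zQ _ _ that, of z R]) (use w(3) R(1) in auto)
  then show "z \<in> MVIP M V f Q" unfolding MVIP_iff[OF Q_dom] using zQ by blast
qed

end

end

theorem corollary5p5:
  fixes M :: "('m::{t2_space,second_countable_topology}, 'e::euclidean_space) riemannian"
    and f :: "'m \<Rightarrow> ereal" and Q :: "'m set" and V :: "'m \<Rightarrow> 'e"
  assumes "hadamard_manifold M"
    and "geod_convex_fun M f"
    and "Q \<subseteq> interior (eff_dom f)" and "Q \<noteq> {}" and "closed Q" and "geod_convex M Q"
    and "continuous_vector_field_on M Q V"
  shows "(compact Q \<or>
           (\<exists>L. compact L \<and>
              (\<forall>x\<in>Q - L. \<forall>v\<in>subdiff M f x. \<exists>y\<in>Q \<inter> L.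
                 metric M x (V x + v) (geod_velocity M x y 0) < 0))
          \<longrightarrow> MVIP M V f Q \<noteq> {})
       \<and> (monotone_field_on M Q (\<lambda>x. {V x + v | v. v \<in> subdiff M f x}) \<and> MVIP M V f Q \<noteq> {}
          \<longrightarrow> geod_convex M (MVIP M V f Q))"
proof -
  interpret hadamard_convex M f
    by unfold_locales (fact assms)+
  show ?thesis
    using MVIP_nonempty[OF assms(3-7)] MVIP_convex[OF assms(3-7)] by blast
qed

end
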